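(* Let $\mathcal{A}=\{\sum_{i=0}^n b_id_i: b_i\in\mathbb{Z}_{\geq 0}\}$ be the $\mathbb{Z}_{\geq0}$-span of all the $d_i$. Suppose that $\lambda\in(\mathbb{K}\setminus\mathbb{Z})\cup\mathcal{A}$ and $\gcd(d_0,\dots,d_n)=1$. Then the global sections functor $\Gamma_\lambda:\mathcal{D}^\lambda_{[X]}\text{-Qcoh}\to(D^\lambda_{[X]})_0\text{-Mod}$ is an equivalence of categories.
   Context: $\mathbb{K}$ is an algebraically closed field of characteristic zero; $n\geq1$ and $0<d_0\leq d_1\leq\dots\leq d_n$ are integers. $[X]=[\mathbb{P}(V)]=[(V\setminus\{0\})/\mathbb{G}_m]$ is the weighted projective stack, where $V=\mathbb{K}^{n+1}$ and $\mathbb{G}_m$ acts on the $i$-th coordinate vector with weight $d_i$. $\mathbb{A}=\mathbb{K}[x_0,\dots,x_n]$ is graded by $\deg x_i=d_i$, and $\mathbb{D}=\mathbb{K}\langle x_0,\dots,x_n,\partial_0,\dots,\partial_n\rangle$ is the Weyl algebra graded by $\deg x_i=d_i$, $\deg\partial_i=-d_i$, with Euler field $\mathbf{E}=\sum_id_ix_i\partial_i\in\mathbb{D}_0$. For a left $\mathbb{D}$-module $M$ and $\mu\in\mathbb{K}$ let $M^\mu=\{m\in M:\mathbf{E}m=\mu m\}$. $M$ is $\lambda$-Euler if $M=\bigoplus_{k\in\mathbb{Z}}M^{\lambda+k}$; it is then $\mathbb{Z}$-graded by $M_k=M^{\lambda+k}$. A graded $\mathbb{A}$-module $M$ is torsion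 if for every $m\in M$ there is $N$ with $\mathbb{A}_km=0$ for all $k>N$. $\mathbb{D}\text{-Grmod}^\lambda$ is the category of $\lambda$-Euler $\mathbb{D}$-modules and $\mathbb{D}\text{-Tors}^\lambda$ its full subcategory of modules that are torsion over $\mathbb{A}$. The category of twisted D-modules on $[X]$ is by definition $\mathcal{D}^\lambda_{[X]}\text{-Qcoh}=\mathbb{D}\text{-Grmod}^\lambda/\mathbb{D}\text{-Tors}^\lambda$. The quotient functor $\pi^\lambda_{\mathbb{D}}:\mathbb{D}\text{-Grmod}^\lambda\to\mathcal{D}^\lambda_{[X]}\text{-Qcoh}$ has a right adjoint $\omega^\lambda_{\mathbb{D}}$. Put $D^\lambda_{[X]}=\mathbb{D}/\mathbb{D}(\mathbf{E}-\lambda)$. Since $\mathbf{E}$ is central in $\mathbb{D}_0$, its degree zero part $(D^\lambda_{[X]})_0=\mathbb{D}_0/\mathbb{D}_0(\mathbf{E}-\lambda)$ is an algebra. The global sections functor is $\Gamma_\lambda(\mathcal{M})=\omega^\lambda_{\mathbb{D}}(\mathcal{M})_0=\omega^\lambda_{\mathbb{D}}(\mathcal{M})^\lambda$. *)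

theory Defs
  imports
    "HOL-Algebra.Module"
    "HOL-Algebra.QuotRing"
    "HOL-Computational_Algebra.Polynomial"
    "HOL-Library.Poly_Mapping"
    "HOL-Library.FuncSet"
begin

section \<open>Categories, functors, adjunctions, equivalences\<close>

text \<open>Hom-sets are indexed by their end points and need not be disjoint, so composition takes
  the three objects as arguments: \<open>Comp C X Y Z g f\<close> is the composite of \<open>f : X \<rightarrow> Y\<close> and
  \<open>g : Y \<rightarrow> Z\<close>.\<close>

record ('o, 'a) cat =
  Obj :: "'o set"
  Hom :: "'o \<Rightarrow> 'o \<Rightarrow> 'a set"
  Id :: "'o \<Rightarrow> 'a"
  Comp :: "'o \<Rightarrow> 'o \<Rightarrow> 'o \<Rightarrow> 'a \<Rightarrow> 'a \<Rightarrow> 'a"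

definition category :: "('o, 'a) cat \<Rightarrow> bool" where
  "category C \<longleftrightarrow>
     (\<forall>X\<in>Obj C. Id C X \<in> Hom C X X) \<and>
     (\<forall>X\<in>Obj C. \<forall>Y\<in>Obj C. \<forall>Z\<in>Obj C. \<forall>f\<in>Hom C X Y. \<forall>g\<in>Hom C Y Z.
        Comp C X Y Z g f \<in> Hom C X Z) \<and>
     (\<forall>X\<in>Obj C. \<forall>Y\<in>Obj C. \<forall>f\<in>Hom C X Y.
        Comp C X X Y f (Id C X) = f \<and> Comp C X Y Y (Id C Y) f = f) \<and>
     (\<forall>W\<in>Obj C. \<forall>X\<in>Obj C. \<forall>Y\<in>Obj C. \<forall>Z\<in>Obj C.
        \<forall>f\<in>Hom C W X. \<forall>g\<in>Hom C X Y. \<forall>h\<in>Hom C Y Z.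
        Comp C W Y Z h (Comp C W X Y g f) = Comp C W X Z (Comp C X Y Z h g) f)"

record ('o1, 'a1, 'o2, 'a2) func =
  fobj :: "'o1 \<Rightarrow> 'o2"
  farr :: "'o1 \<Rightarrow> 'o1 \<Rightarrow> 'a1 \<Rightarrow> 'a2"

definition is_functor :: "('o1, 'a1) cat \<Rightarrow> ('o2, 'a2) cat \<Rightarrow> ('o1, 'a1, 'o2, 'a2) func \<Rightarrow> bool"
  where
  "is_functor C D F \<longleftrightarrow>
     category C \<and> category D \<and>
     (\<forall>X\<in>Obj C. fobj F X \<in> Obj D) \<and>
     (\<forall>X\<in>Obj C. \<forall>Y\<in>Obj C. \<forall>f\<in>Hom C X Y. farr F X Y f \<in> Hom D (fobj F X) (fobj F Y)) \<and>
     (\<forall>X\<in>Obj C. farr F X X (Id C X) = Id D (fobj F X)) \<and>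
     (\<forall>X\<in>Obj C. \<forall>Y\<in>Obj C. \<forall>Z\<in>Obj C. \<forall>f\<in>Hom C X Y. \<forall>g\<in>Hom C Y Z.
        farr F X Z (Comp C X Y Z g f) =
        Comp D (fobj F X) (fobj F Y) (fobj F Z) (farr F Y Z g) (farr F X Y f))"

definition id_func :: "('o, 'a, 'o, 'a) func" where
  "id_func = \<lparr>fobj = (\<lambda>X. X), farr = (\<lambda>X Y f. f)\<rparr>"

definition comp_func ::
  "('o2, 'a2, 'o3, 'a3) func \<Rightarrow> ('o1, 'a1, 'o2, 'a2) func \<Rightarrow> ('o1, 'a1, 'o3, 'a3) func" where
  "comp_func G F =
     \<lparr>fobj = (\<lambda>X. fobj G (fobj F X)),
      farr = (\<lambda>X Y f. farr G (fobj F X) (fobj F Y) (farr F X Y f))\<rparr>"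

definition is_iso :: "('o, 'a) cat \<Rightarrow> 'o \<Rightarrow> 'o \<Rightarrow> 'a \<Rightarrow> bool" where
  "is_iso C X Y f \<longleftrightarrow> f \<in> Hom C X Y \<and>
     (\<exists>g\<in>Hom C Y X. Comp C X Y X g f = Id C X \<and> Comp C Y X Y f g = Id C Y)"

definition naturally_isomorphic ::
  "('o1, 'a1) cat \<Rightarrow> ('o2, 'a2) cat \<Rightarrow> ('o1, 'a1, 'o2, 'a2) func \<Rightarrow> ('o1, 'a1, 'o2, 'a2) func \<Rightarrow> bool"
  where
  "naturally_isomorphic C D F G \<longleftrightarrow>
     (\<exists>\<eta>. (\<forall>X\<in>Obj C. is_iso D (fobj F X) (fobj G X) (\<eta> X)) \<and>
          (\<forall>X\<in>Obj C. \<forall>Y\<in>Obj C. \<forall>f\<in>Hom C X Y.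
             Comp D (fobj F X) (fobj F Y) (fobj G Y) (\<eta> Y) (farr F X Y f) =
             Comp D (fobj F X) (fobj G X) (fobj G Y) (farr G X Y f) (\<eta> X)))"

definition is_equivalence ::
  "('o1, 'a1) cat \<Rightarrow> ('o2, 'a2) cat \<Rightarrow> ('o1, 'a1, 'o2, 'a2) func \<Rightarrow> bool" where
  "is_equivalence C D F \<longleftrightarrow>
     is_functor C D F \<and>
     (\<exists>G. is_functor D C G \<and>
          naturally_isomorphic C C id_func (comp_func G F) \<and>
          naturally_isomorphic D D (comp_func F G) id_func)"

text \<open>\<open>G\<close> is right adjoint to \<open>F : C \<rightarrow> D\<close>: there are bijections
  \<open>Hom D (F X) Y \<rightarrow> Hom C X (G Y)\<close>, natural in \<open>X\<close> and in \<open>Y\<close>.\<close>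

definition right_adjoint ::
  "('o1, 'a1) cat \<Rightarrow> ('o2, 'a2) cat \<Rightarrow> ('o1, 'a1, 'o2, 'a2) func \<Rightarrow> ('o2, 'a2, 'o1, 'a1) func \<Rightarrow> bool"
  where
  "right_adjoint C D F G \<longleftrightarrow>
     is_functor C D F \<and> is_functor D C G \<and>
     (\<exists>\<phi>. (\<forall>X\<in>Obj C. \<forall>Y\<in>Obj D.
             bij_betw (\<phi> X Y) (Hom D (fobj F X) Y) (Hom C X (fobj G Y))) \<and>
          (\<forall>X'\<in>Obj C. \<forall>X\<in>Obj C. \<forall>Y\<in>Obj D. \<forall>u\<in>Hom C X' X. \<forall>f\<in>Hom D (fobj F X) Y.
             \<phi> X' Y (Comp D (fobj F X') (fobj F X) Y f (farr F X' X u)) =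
             Comp C X' X (fobj G Y) (\<phi> X Y f) u) \<and>
          (\<forall>X\<in>Obj C. \<forall>Y\<in>Obj D. \<forall>Y'\<in>Obj D. \<forall>v\<in>Hom D Y Y'. \<forall>f\<in>Hom D (fobj F X) Y.
             \<phi> X Y' (Comp D (fobj F X) Y Y' v f) =
             Comp C X (fobj G Y) (fobj G Y') (farr G Y Y' v) (\<phi> X Y f)))"


section \<open>Left modules over a not necessarily commutative ring\<close>

text \<open>The library's locale \<open>module\<close> demands a commutative ring of scalars. The record type
  \<open>module\<close> is reused; its fields \<open>mult\<close> and \<open>one\<close> play no role.\<close>

locale left_module = R?: ring R + M?: abelian_group M for R and M (structure) +
  assumes smult_closed:
      "\<lbrakk>a \<in> carrier R; x \<in> carrier M\<rbrakk> \<Longrightarrow> a \<odot>\<^bsub>M\<^esub> x \<in> carrier M"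
    and smult_l_distr:
      "\<lbrakk>a \<in> carrier R; b \<in> carrier R; x \<in> carrier M\<rbrakk> \<Longrightarrow>
       (a \<oplus>\<^bsub>R\<^esub> b) \<odot>\<^bsub>M\<^esub> x = a \<odot>\<^bsub>M\<^esub> x \<oplus>\<^bsub>M\<^esub> b \<odot>\<^bsub>M\<^esub> x"
    and smult_r_distr:
      "\<lbrakk>a \<in> carrier R; x \<in> carrier M; y \<in> carrier M\<rbrakk> \<Longrightarrow>
       a \<odot>\<^bsub>M\<^esub> (x \<oplus>\<^bsub>M\<^esub> y) = a \<odot>\<^bsub>M\<^esub> x \<oplus>\<^bsub>M\<^esub> a \<odot>\<^bsub>M\<^esub> y"
    and smult_assoc:
      "\<lbrakk>a \<in> carrier R; b \<in> carrier R; x \<in> carrier M\<rbrakk> \<Longrightarrow>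
       (a \<otimes>\<^bsub>R\<^esub> b) \<odot>\<^bsub>M\<^esub> x = a \<odot>\<^bsub>M\<^esub> (b \<odot>\<^bsub>M\<^esub> x)"
    and smult_one:
      "x \<in> carrier M \<Longrightarrow> \<one>\<^bsub>R\<^esub> \<odot>\<^bsub>M\<^esub> x = x"

definition lin_maps ::
  "'r ring \<Rightarrow> ('r, 'm) module \<Rightarrow> ('r, 'p) module \<Rightarrow> ('m \<Rightarrow> 'p) set" where
  "lin_maps R M N =
     {f \<in> carrier M \<rightarrow>\<^sub>E carrier N.
        (\<forall>x\<in>carrier M. \<forall>y\<in>carrier M. f (x \<oplus>\<^bsub>M\<^esub> y) = f x \<oplus>\<^bsub>N\<^esub> f y) \<and>
        (\<forall>a\<in>carrier R. \<forall>x\<in>carrier M. f (a \<odot>\<^bsub>M\<^esub> x) = a \<odot>\<^bsub>N\<^esub> f x)}"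

definition sub_mod :: "('r, 'm) module \<Rightarrow> 'm set \<Rightarrow> ('r, 'm) module" where
  "sub_mod M L = M\<lparr>carrier := L\<rparr>"

text \<open>The quotient \<open>M/L\<close>; its elements are the cosets of \<open>L\<close>, and \<open>a (L + x) = L + a x\<close>.\<close>

definition quot_mod :: "('r, 'm) module \<Rightarrow> 'm set \<Rightarrow> ('r, 'm set) module" where
  "quot_mod M L =
     \<lparr>carrier = a_rcosets\<^bsub>M\<^esub> L, monoid.mult = (\<lambda>_ _. undefined), one = undefined,
      zero = L, add = set_add M, module.smult = (\<lambda>a X. \<Union>x\<in>X. L +>\<^bsub>M\<^esub> (a \<odot>\<^bsub>M\<^esub> x))\<rparr>"

text \<open>The full subcategory of \<open>R\<close>-modules on a given class of objects. Arrows are extensional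
  functions, so that equality of arrows is equality on the carrier.\<close>

definition mod_cat ::
  "'r ring \<Rightarrow> ('r, 'm) module set \<Rightarrow> (('r, 'm) module, 'm \<Rightarrow> 'm) cat" where
  "mod_cat R S =
     \<lparr>Obj = S, Hom = lin_maps R, Id = (\<lambda>M. restrict (\<lambda>x. x) (carrier M)),
      Comp = (\<lambda>M N P g f. compose (carrier M) g f)\<rparr>"

text \<open>All left \<open>R\<close>-modules with carrier inside the type \<open>'m\<close>.\<close>

definition Left_Mod :: "'r ring \<Rightarrow> (('r, 'm) module, 'm \<Rightarrow> 'm) cat" where
  "Left_Mod R = mod_cat R {M. left_module R M}"


section \<open>The Weyl algebra\<close>

type_synonym 'k pol = "(nat \<Rightarrow>\<^sub>0 nat) \<Rightarrow>\<^sub>0 'k"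
type_synonym 'k oper = "'k pol \<Rightarrow> 'k pol"

text \<open>Over a field of characteristic zero the Weyl algebra is the algebra of operators on
  polynomials generated by the scalars, the multiplications by the variables and the partial
  derivatives. Operators act on polynomials in the variables \<open>x\<^sub>0, x\<^sub>1, x\<^sub>2, \<dots>\<close>, but only
  those with index \<open>\<le> n\<close> enter the generators; the others are inert constants, and the
  resulting algebra is (by restriction) the algebra of operators on \<open>K[x\<^sub>0, \<dots>, x\<^sub>n]\<close>.\<close>

definition mulop :: "'k::field pol \<Rightarrow> 'k oper" where
  "mulop p = (\<lambda>q. p * q)"

definition scal :: "'k::field \<Rightarrow> 'k oper" where
  "scal c = mulop (Poly_Mapping.single 0 c)"

definition xop :: "nat \<Rightarrow> 'k::field oper" where
  "xop i = mulop (Poly_Mapping.single (Poly_Mapping.single i 1) 1)"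

definition pdop :: "nat \<Rightarrow> 'k::field oper" where
  "pdop i p = (\<Sum>m\<in>Poly_Mapping.keys p.
     Poly_Mapping.single (m - Poly_Mapping.single i 1)
       (of_nat (Poly_Mapping.lookup m i) * Poly_Mapping.lookup p m))"

inductive_set weyl_carrier :: "nat \<Rightarrow> 'k::field oper set" for n :: nat where
  scal: "scal c \<in> weyl_carrier n"
| xop: "i \<le> n \<Longrightarrow> xop i \<in> weyl_carrier n"
| pdop: "i \<le> n \<Longrightarrow> pdop i \<in> weyl_carrier n"
| add: "P \<in> weyl_carrier n \<Longrightarrow> Q \<in> weyl_carrier n \<Longrightarrow> (\<lambda>p. P p + Q p) \<in> weyl_carrier n"
| comp: "P \<in> weyl_carrier n \<Longrightarrow> Q \<in> weyl_carrier n \<Longrightarrow> P \<circ> Q \<in> weyl_carrier n"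

definition op_ring :: "'k::field oper set \<Rightarrow> 'k oper ring" where
  "op_ring S = \<lparr>carrier = S, monoid.mult = (\<circ>), one = (\<lambda>p. p), zero = (\<lambda>p. 0),
                add = (\<lambda>P Q p. P p + Q p)\<rparr>"

definition weyl :: "nat \<Rightarrow> 'k::field oper ring" where
  "weyl n = op_ring (weyl_carrier n)"

text \<open>The grading with \<open>x\<^sub>i\<close> in degree \<open>d\<^sub>i\<close> and \<open>\<partial>\<^sub>i\<close> in degree \<open>- d\<^sub>i\<close>: the piece of
  degree \<open>k\<close> is spanned by the words of degree \<open>k\<close> in the generators.\<close>

inductive weyl_homog :: "nat \<Rightarrow> (nat \<Rightarrow> nat) \<Rightarrow> int \<Rightarrow> 'k::field oper \<Rightarrow> bool"
  for n :: nat and d :: "nat \<Rightarrow> nat" where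
  zero: "weyl_homog n d k (\<lambda>p. 0)"
| scal: "weyl_homog n d 0 (scal c)"
| xop: "i \<le> n \<Longrightarrow> weyl_homog n d (int (d i)) (xop i)"
| pdop: "i \<le> n \<Longrightarrow> weyl_homog n d (- int (d i)) (pdop i)"
| add: "weyl_homog n d k P \<Longrightarrow> weyl_homog n d k Q \<Longrightarrow> weyl_homog n d k (\<lambda>p. P p + Q p)"
| comp: "weyl_homog n d k P \<Longrightarrow> weyl_homog n d l Q \<Longrightarrow> weyl_homog n d (k + l) (P \<circ> Q)"

definition weyl0 :: "nat \<Rightarrow> (nat \<Rightarrow> nat) \<Rightarrow> 'k::field oper ring" where
  "weyl0 n d = op_ring {P. weyl_homog n d 0 P}"

definition euler :: "nat \<Rightarrow> (nat \<Rightarrow> nat) \<Rightarrow> 'k::field oper" where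
  "euler n d = (\<lambda>p. \<Sum>i\<le>n. scal (of_nat (d i)) (xop i (pdop i p)))"

text \<open>The algebra \<open>D\<^sub>0 / D\<^sub>0 (E - lam)\<close>.\<close>

definition twisted0 :: "nat \<Rightarrow> (nat \<Rightarrow> nat) \<Rightarrow> 'k::field \<Rightarrow> 'k oper set ring" where
  "twisted0 n d lam =
     weyl0 n d Quot {P \<circ> (\<lambda>p. euler n d p - scal lam p) | P. weyl_homog n d 0 P}"


section \<open>Euler modules, torsion modules and the quotient category\<close>

definition eigen ::
  "nat \<Rightarrow> (nat \<Rightarrow> nat) \<Rightarrow> ('k::field oper, 'm) module \<Rightarrow> 'k \<Rightarrow> 'm set" where
  "eigen n d M \<mu> = {m \<in> carrier M. euler n d \<odot>\<^bsub>M\<^esub> m = scal \<mu> \<odot>\<^bsub>M\<^esub> m}"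

text \<open>The second condition says that \<open>M\<close> is the internal direct sum of the eigenspaces
  for the eigenvalues \<open>lam + k\<close>.\<close>

definition euler_module ::
  "nat \<Rightarrow> (nat \<Rightarrow> nat) \<Rightarrow> 'k::field \<Rightarrow> ('k oper, 'm) module \<Rightarrow> bool" where
  "euler_module n d lam M \<longleftrightarrow>
     left_module (weyl n) M \<and>
     (\<forall>m\<in>carrier M. \<exists>!f :: int \<Rightarrow> 'm.
        (\<forall>k. f k \<in> eigen n d M (lam + of_int k)) \<and>
        finite {k. f k \<noteq> \<zero>\<^bsub>M\<^esub>} \<and>
        m = finsum M f {k. f k \<noteq> \<zero>\<^bsub>M\<^esub>})"

definition pol_homog :: "nat \<Rightarrow> (nat \<Rightarrow> nat) \<Rightarrow> nat \<Rightarrow> 'k::field pol set" where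
  "pol_homog n d k =
     {p. \<forall>m\<in>Poly_Mapping.keys p.
        Poly_Mapping.keys m \<subseteq> {..n} \<and> (\<Sum>i\<le>n. Poly_Mapping.lookup m i * d i) = k}"

definition torsion :: "nat \<Rightarrow> (nat \<Rightarrow> nat) \<Rightarrow> ('k::field oper, 'm) module \<Rightarrow> bool" where
  "torsion n d M \<longleftrightarrow>
     (\<forall>m\<in>carrier M. \<exists>N. \<forall>k>N. \<forall>p\<in>pol_homog n d k. mulop p \<odot>\<^bsub>M\<^esub> m = \<zero>\<^bsub>M\<^esub>)"

definition Grmod ::
  "nat \<Rightarrow> (nat \<Rightarrow> nat) \<Rightarrow> 'k::field \<Rightarrow> (('k oper, 'm) module, 'm \<Rightarrow> 'm) cat" where
  "Grmod n d lam = mod_cat (weyl n) {M. euler_module n d lam M}"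

text \<open>Membership in the Serre subcategory of torsion Euler modules. The carrier type is
  arbitrary because the predicate is also applied to quotient modules.\<close>

definition in_Tors ::
  "nat \<Rightarrow> (nat \<Rightarrow> nat) \<Rightarrow> 'k::field \<Rightarrow> ('k oper, 'm) module \<Rightarrow> bool" where
  "in_Tors n d lam M \<longleftrightarrow> euler_module n d lam M \<and> torsion n d M"

text \<open>Gabriel's quotient category: an arrow \<open>M \<rightarrow> N\<close> is an element of the filtered colimit of
  \<open>Hom (M', N/N')\<close> over the submodules \<open>M'\<close> of \<open>M\<close> and \<open>N'\<close> of \<open>N\<close> with \<open>M/M'\<close> and \<open>N'\<close>
  torsion. A representative is a triple \<open>(M', N', f)\<close>.\<close>

type_synonym 'm frac = "'m set \<times> 'm set \<times> ('m \<Rightarrow> 'm set)"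

definition fracs ::
  "nat \<Rightarrow> (nat \<Rightarrow> nat) \<Rightarrow> 'k::field \<Rightarrow> ('k oper, 'm) module \<Rightarrow> ('k oper, 'm) module \<Rightarrow> 'm frac set"
  where
  "fracs n d lam M N =
     {(M', N', f).
        submodule M' (weyl n) M \<and> in_Tors n d lam (quot_mod M M') \<and>
        submodule N' (weyl n) N \<and> in_Tors n d lam (sub_mod N N') \<and>
        f \<in> lin_maps (weyl n) (sub_mod M M') (quot_mod N N')}"

text \<open>Two representatives are identified if they agree in \<open>Hom (M\<^sub>3, N/N\<^sub>3)\<close> for some admissible
  \<open>M\<^sub>3\<close> and \<open>N\<^sub>3\<close>; the image in \<open>N/N\<^sub>3\<close> of a coset \<open>X\<close> of a smaller submodule is \<open>X + N\<^sub>3\<close>.\<close>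

definition frac_rel ::
  "nat \<Rightarrow> (nat \<Rightarrow> nat) \<Rightarrow> 'k::field \<Rightarrow> ('k oper, 'm) module \<Rightarrow> ('k oper, 'm) module \<Rightarrow>
   ('m frac \<times> 'm frac) set"
  where
  "frac_rel n d lam M N =
     {((M1, N1, f1), (M2, N2, f2)).
        (M1, N1, f1) \<in> fracs n d lam M N \<and> (M2, N2, f2) \<in> fracs n d lam M N \<and>
        (\<exists>M3 N3. M3 \<subseteq> M1 \<inter> M2 \<and> N1 \<union> N2 \<subseteq> N3 \<and>
           submodule M3 (weyl n) M \<and> in_Tors n d lam (quot_mod M M3) \<and>
           submodule N3 (weyl n) N \<and> in_Tors n d lam (sub_mod N N3) \<and>
           (\<forall>m\<in>M3. set_add N (f1 m) N3 = set_add N (f2 m) N3))}"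

text \<open>For \<open>f : M' \<rightarrow> N/N'\<close> and \<open>g : N'' \<rightarrow> P/P'\<close> the composite is defined on
  \<open>M'' = f\<^sup>-\<^sup>1 ((N'' + N')/N')\<close> with values in \<open>P/P''\<close>, where \<open>P''/P' = g (N' \<inter> N'')\<close>. It sends
  \<open>m\<close> to \<open>g y + P''\<close> for any \<open>y\<close> in \<open>f m \<inter> N''\<close>; this coset is the union of all these \<open>g y\<close>.\<close>

definition frac_comp :: "'m frac \<Rightarrow> 'm frac \<Rightarrow> 'm frac" where
  "frac_comp = (\<lambda>(N'', P', g) (M', N', f).
     let M'' = {m \<in> M'. f m \<inter> N'' \<noteq> {}}
     in (M'', \<Union>y\<in>N' \<inter> N''. g y, restrict (\<lambda>m. \<Union>y\<in>f m \<inter> N''. g y) M''))"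

text \<open>A linear map \<open>f : M \<rightarrow> N\<close>, viewed as a map \<open>M \<rightarrow> N/0\<close>.\<close>

definition frac_of ::
  "('r, 'm) module \<Rightarrow> ('r, 'm) module \<Rightarrow> ('m \<Rightarrow> 'm) \<Rightarrow> 'm frac" where
  "frac_of M N f = (carrier M, {\<zero>\<^bsub>N\<^esub>}, restrict (\<lambda>x. {f x}) (carrier M))"

definition Qcoh ::
  "nat \<Rightarrow> (nat \<Rightarrow> nat) \<Rightarrow> 'k::field \<Rightarrow> (('k oper, 'm) module, 'm frac set) cat" where
  "Qcoh n d lam =
     \<lparr>Obj = {M. euler_module n d lam M},
      Hom = (\<lambda>M N. fracs n d lam M N // frac_rel n d lam M N),
      Id = (\<lambda>M. frac_rel n d lam M M `` {frac_of M M (\<lambda>x. x)}),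
      Comp = (\<lambda>M N P \<beta> \<alpha>. \<Union>s\<in>\<alpha>. \<Union>t\<in>\<beta>. frac_rel n d lam M P `` {frac_comp t s})\<rparr>"

definition quot_func ::
  "nat \<Rightarrow> (nat \<Rightarrow> nat) \<Rightarrow> 'k::field \<Rightarrow>
   (('k oper, 'm) module, 'm \<Rightarrow> 'm, ('k oper, 'm) module, 'm frac set) func" where
  "quot_func n d lam =
     \<lparr>fobj = (\<lambda>M. M), farr = (\<lambda>M N f. frac_rel n d lam M N `` {frac_of M N f})\<rparr>"


section \<open>Global sections\<close>

text \<open>The eigenspace for \<open>lam\<close>, that is, the degree zero part of a \<open>lam\<close>-Euler module, as a module
  over \<open>D\<^sub>0 / D\<^sub>0 (E - lam)\<close>. A coset acts through any of its representatives.\<close>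

definition degree0 ::
  "nat \<Rightarrow> (nat \<Rightarrow> nat) \<Rightarrow> 'k::field \<Rightarrow> ('k oper, 'm) module \<Rightarrow> ('k oper set, 'm) module" where
  "degree0 n d lam M =
     \<lparr>carrier = eigen n d M lam, monoid.mult = monoid.mult M, one = one M, zero = zero M, add = add M,
      module.smult = (\<lambda>X m. THE y. \<forall>P\<in>X. P \<odot>\<^bsub>M\<^esub> m = y)\<rparr>"

definition global_sections ::
  "nat \<Rightarrow> (nat \<Rightarrow> nat) \<Rightarrow> 'k::field \<Rightarrow>
   (('k oper, 'm) module, 'm frac set, ('k oper, 'm) module, 'm \<Rightarrow> 'm) func \<Rightarrow>
   (('k oper, 'm) module, 'm frac set, ('k oper set, 'm) module, 'm \<Rightarrow> 'm) func" where
  "global_sections n d lam \<omega> =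
     \<lparr>fobj = (\<lambda>M. degree0 n d lam (fobj \<omega> M)),
      farr = (\<lambda>M N \<alpha>. restrict (farr \<omega> M N \<alpha>) (eigen n d (fobj \<omega> M) lam))\<rparr>"

end

theory Submission
  imports Defs "HOL-Library.Countable"
begin

text \<open>The functor \<open>M \<mapsto> M\<^sub>0 = M\<^sup>\<lambda>\<close> detects torsion: a \<open>\<lambda>\<close>-Euler module \<open>M\<close> is torsion
  if and only if \<open>M\<^sub>0 = 0\<close>. In a torsion module some nonzero multiple \<open>u\<close> of any given nonzero
  \<open>m \<in> M\<^sub>0\<close> is killed by all \<open>x\<^sub>i\<close>, so its eigenvalue is \<open>- \<Sum> d\<^sub>i\<close>, which the assumption on
  \<open>\<lambda>\<close> excludes. Conversely, let \<open>L = \<Prod> d\<^sub>i\<close>. If \<open>x\<^sub>i\<close> is not nilpotent on \<open>m\<close>, then \<open>gcd = 1\<close> allows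
  to move \<open>m\<close> by operators to a nonzero \<open>m'\<close> in a degree \<open>k \<ge> 0\<close> divisible by \<open>L\<close>. Either some \<open>\<partial>\<^sub>j\<close> is not
  nilpotent on \<open>m'\<close> and a power of it moves \<open>m'\<close> to \<open>M\<^sub>0\<close>, or some nonzero multiple \<open>u\<close> of \<open>m'\<close> is killed
  by all \<open>\<partial>\<^sub>j\<close>; then \<open>E u = 0\<close>, so \<open>\<lambda> = \<Sum> b\<^sub>i d\<^sub>i\<close> and \<open>x\<^sup>b u\<close> is nonzero in \<open>M\<^sub>0\<close>.

  Hence a morphism \<open>M \<rightarrow> N\<close> in the quotient category is the same as a \<open>D\<^sub>0\<close>-linear map \<open>M\<^sub>0 \<rightarrow> N\<^sub>0\<close>.
  By adjunction the counit \<open>\<omega> N \<rightarrow> N\<close> induces a bijection \<open>(\<omega> N)\<^sub>0 \<rightarrow> N\<^sub>0\<close>, which makes \<open>\<Gamma>\<close> fully faithful.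
  For a \<open>D\<^sub>0\<close>-module \<open>V\<close>, the submodule generated by \<open>V\<close> in the additive maps \<open>D \<rightarrow> V\<close> is an Euler module
  with degree zero part \<open>V\<close>. It has at most the cardinality of \<open>V\<close>, so it can be realised inside the
  type of \<open>V\<close>.\<close>

section \<open>The Weyl algebra and its grading\<close>

text \<open>Once torsion means vanishing in degree zero, a submodule of \<open>M\<close> is an
  admissible domain of a fraction exactly if it contains \<open>M\<^sub>0\<close>, and a submodule
  of \<open>N\<close> may be divided out exactly if it meets \<open>N\<^sub>0\<close> in zero. This
  is why arrows of the quotient category can be read off in degree zero. Nothing is known about
  \<open>\<omega>\<close> except the adjunction, so it is never computed: the counit is the only
  handle on it. The adjunction also brings along the facts that \<open>Qcoh\<close> is a category
  and that the quotient functor respects composition.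

  The module built from \<open>V\<close> stands in for the tensor product
  \<open>D \<otimes> V\<close> over \<open>D\<^sub>0\<close>. It is its image in the functions on
  \<open>D\<close>, where \<open>P \<otimes> v\<close> becomes
  \<open>Q \<mapsto> (Q P)\<^sub>0 v\<close>; the elements lost are those that no operator moves to
  a nonzero element of degree zero. The size of this module matters because the objects of both
  categories have their carriers in the one type \<open>'m\<close>.\<close>

lemma pol_induct [case_names single add]:
  fixes p :: "('a::zero \<Rightarrow>\<^sub>0 nat) \<Rightarrow>\<^sub>0 'k::comm_monoid_add"
  assumes "\<And>m c. P (Poly_Mapping.single m c)"
    and "\<And>p q. P p \<Longrightarrow> P q \<Longrightarrow> P (p + q)"
  shows "P p"
proof -
  have "P (\<Sum>m\<in>A. Poly_Mapping.single m (Poly_Mapping.lookup p m))" if "finite A" for A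
    using that
  proof (induction A rule: finite_induct)
    case empty
    \<comment> \<open>The zero polynomial is a monomial with coefficient 0, so the rule needs no
      separate case for it.\<close>
    show ?case using assms(1)[of 0 0] by simp
  next
    case (insert x F)
    thus ?case using assms by simp
  qed
  moreover have "(\<Sum>m\<in>Poly_Mapping.keys p. Poly_Mapping.single m (Poly_Mapping.lookup p m)) = p"
    by (rule poly_mapping_eqI)
      (auto simp: lookup_sum lookup_single when_def in_keys_iff sum.delta)
  ultimately show ?thesis by (metis finite_keys)
qed

text \<open>The key sets of \<open>p\<close>, \<open>q\<close> and \<open>p + q\<close> differ as
  soon as terms cancel; \<open>setsum_keys_plus_distrib\<close> copes with this because the summand
  is additive in the coefficient and zero at coefficient 0.\<close>

lemma pdop_add: "pdop i (p + q) = pdop i p + pdop i (q :: 'k::field pol)"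
  unfolding pdop_def
  by (rule setsum_keys_plus_distrib) (simp_all add: distrib_left single_add)

lemma mulop_add: "mulop a (p + q) = mulop a p + mulop a q"
  by (simp add: mulop_def distrib_left)

lemma mulop_comp: "mulop a \<circ> mulop b = mulop (a * b)"
  by (auto simp: mulop_def mult.assoc)

text \<open>At exponent 0 the truncated subtraction returns \<open>m\<close> itself, which does no
  harm: the factor \<open>of_nat (Poly_Mapping.lookup m i)\<close> is then zero.\<close>

lemma pdop_single: "pdop i (Poly_Mapping.single m c) =
   Poly_Mapping.single (m - Poly_Mapping.single i 1) (of_nat (Poly_Mapping.lookup m i) * c)"
  by (simp add: pdop_def)

lemma xop_single: "xop i (Poly_Mapping.single m c) =
   Poly_Mapping.single (m + Poly_Mapping.single i 1) c"
  by (simp add: xop_def mulop_def mult_single add.commute)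

lemma scal_single: "scal a (Poly_Mapping.single m c) = Poly_Mapping.single m (a * c)"
  by (simp add: scal_def mulop_def mult_single)

lemma lookup_scal: "Poly_Mapping.lookup (scal c p) m = c * Poly_Mapping.lookup p m"
proof (induction p rule: pol_induct)
  case (single m' a)
  show ?case by (simp add: scal_single lookup_single when_def)
next
  case (add p q)
  thus ?case by (simp add: scal_def mulop_add lookup_add distrib_left)
qed

lemma weyl_carrier_add:
  assumes "P \<in> weyl_carrier n"
  shows "P (p + q) = P p + P q"
  using assms
proof (induction arbitrary: p q rule: weyl_carrier.induct)
  case (add P Q)
  show ?case by (simp add: add.IH algebra_simps)
qed (simp_all add: scal_def xop_def mulop_add pdop_add)

text \<open>Only additivity is known at this point, hence monomials with an arbitrary coefficient
  \<open>c\<close>. The commutation relations that involve derivatives are all verified through this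
  criterion.\<close>

lemma weyl_carrier_eqI:
  assumes "P \<in> weyl_carrier n" "Q \<in> weyl_carrier n"
    and "\<And>m c. P (Poly_Mapping.single m c) = Q (Poly_Mapping.single m c)"
  shows "P = Q"
proof
  fix p show "P p = Q p"
    by (induction p rule: pol_induct) (simp_all add: assms weyl_carrier_add[OF assms(1)]
      weyl_carrier_add[OF assms(2)])
qed

lemma weyl_carrier_zero: "(\<lambda>p. 0) \<in> weyl_carrier n"
  using weyl_carrier.scal[of 0 n] by (simp add: scal_def mulop_def)

lemma weyl_carrier_id: "(\<lambda>p. p) \<in> weyl_carrier n"
  using weyl_carrier.scal[of 1 n] by (simp add: scal_def mulop_def)

lemma scal_one: "scal 1 = (\<lambda>p. p)"
  by (simp add: scal_def mulop_def)

lemma scal_zero: "scal 0 = (\<lambda>p. 0)"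
  by (simp add: scal_def mulop_def)

lemma scal_minus_one: "scal (- 1) p = - p"
  by (simp add: scal_def mulop_def single_uminus)

lemma scal_comp: "scal a \<circ> scal b = scal (a * b)"
  by (simp add: scal_def mulop_comp mult_single)

lemma scal_plus: "(\<lambda>p. scal a p + scal b p) = scal (a + b)"
  by (simp add: scal_def mulop_def single_add distrib_right)

lemma scal_diff: "(\<lambda>p. scal a p - scal b p) = scal (a - b)"
  by (simp add: scal_def mulop_def single_diff left_diff_distrib)

lemma weyl_carrier_uminus: "P \<in> weyl_carrier n \<Longrightarrow> (\<lambda>p. - P p) \<in> weyl_carrier n"
  using weyl_carrier.comp[OF weyl_carrier.scal[of "-1" n], of P]
  by (simp add: comp_def scal_minus_one)

lemma weyl_carrier_diff:
  "P \<in> weyl_carrier n \<Longrightarrow> Q \<in> weyl_carrier n \<Longrightarrow> (\<lambda>p. P p - Q p) \<in> weyl_carrier n"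
  using weyl_carrier.add[OF _ weyl_carrier_uminus, of P n Q] by simp

lemma weyl_carrier_0: "P \<in> weyl_carrier n \<Longrightarrow> P 0 = 0"
  using weyl_carrier_add[of P n 0 0] by (simp only: add_0 add_cancel_right_right)

lemma weyl_carrier_minus: "P \<in> weyl_carrier n \<Longrightarrow> P (p - q) = P p - P q"
  using weyl_carrier_add[of P n "p - q" q] by simp

text \<open>Linearity over the field, phrased as centrality of the scalars; the generators have it,
  and sums and composites inherit it.\<close>

lemma scal_commute:
  assumes "P \<in> weyl_carrier n"
  shows "P \<circ> scal c = scal c \<circ> P"
  using assms
proof (induction rule: weyl_carrier.induct)
  case (scal a)
  show ?case by (simp add: scal_comp mult.commute)
next
  case (xop i)
  show ?case by (simp add: xop_def scal_def mulop_comp mult.commute)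
next
  case (pdop i)
  show ?case
    by (rule weyl_carrier_eqI[of _ n])
      (use pdop in \<open>blast intro: weyl_carrier.intros\<close>,
       use pdop in \<open>blast intro: weyl_carrier.intros\<close>,
       simp add: pdop_single scal_single mult.left_commute)
next
  case (add P Q)
  have "P (scal c p) = scal c (P p)" "Q (scal c p) = scal c (Q p)" for p
    using add.IH by (simp_all add: fun_eq_iff)
  thus ?case by (auto simp: scal_def mulop_def distrib_left)
next
  case (comp P Q)
  thus ?case by (metis comp_assoc)
qed

lemma weyl_homog_weyl_carrier: "weyl_homog n d k P \<Longrightarrow> P \<in> weyl_carrier n"
  by (induction rule: weyl_homog.induct) (blast intro: weyl_carrier.intros weyl_carrier_zero)+

lemma op_ring_simps [simp]:
  "carrier (op_ring S) = S" "x \<otimes>\<^bsub>op_ring S\<^esub> y = x \<circ> y" "\<one>\<^bsub>op_ring S\<^esub> = (\<lambda>p. p)"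
  "\<zero>\<^bsub>op_ring S\<^esub> = (\<lambda>p. 0)" "x \<oplus>\<^bsub>op_ring S\<^esub> y = (\<lambda>p. x p + y p)"
  by (simp_all add: op_ring_def)

text \<open>Of the ring axioms only the distributive law for \<open>P \<circ> (Q + R)\<close> can
  fail for arbitrary operators. It is additivity of \<open>P\<close>, which is why \<open>S\<close>
  has to lie in \<open>weyl_carrier n\<close>. The lemma serves for the Weyl algebra and for its
  degree zero part.\<close>

lemma ring_op_ring:
  assumes S: "S \<subseteq> weyl_carrier n"
    and z: "(\<lambda>p. 0) \<in> S" and one: "(\<lambda>p. p) \<in> S"
    and a: "\<And>P Q. P \<in> S \<Longrightarrow> Q \<in> S \<Longrightarrow> (\<lambda>p. P p + Q p) \<in> S"
    and m: "\<And>P. P \<in> S \<Longrightarrow> (\<lambda>p. - P p) \<in> S"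
    and c: "\<And>P Q. P \<in> S \<Longrightarrow> Q \<in> S \<Longrightarrow> P \<circ> Q \<in> S"
  shows "ring (op_ring S)"
proof (rule ringI)
  show "abelian_group (op_ring S)"
  proof (rule abelian_groupI)
    fix P assume "P \<in> carrier (op_ring S)"
    thus "\<exists>y\<in>carrier (op_ring S). y \<oplus>\<^bsub>op_ring S\<^esub> P = \<zero>\<^bsub>op_ring S\<^esub>"
      using m by (auto intro!: bexI[of _ "\<lambda>p. - P p"])
  qed (use z a in \<open>auto simp: algebra_simps\<close>)
  show "Group.monoid (op_ring S)"
    by (rule Group.monoid.intro) (use c one in \<open>auto simp: comp_def\<close>)
qed (use S in \<open>auto simp: weyl_carrier_add[of _ n] subset_iff\<close>)

lemma weyl_simps [simp]:
  "carrier (weyl n) = weyl_carrier n" "x \<otimes>\<^bsub>weyl n\<^esub> y = x \<circ> y" "\<one>\<^bsub>weyl n\<^esub> = (\<lambda>p. p)"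
  "\<zero>\<^bsub>weyl n\<^esub> = (\<lambda>p. 0)" "x \<oplus>\<^bsub>weyl n\<^esub> y = (\<lambda>p. x p + y p)"
  by (simp_all add: weyl_def)

lemma ring_weyl: "ring (weyl n)"
  unfolding weyl_def
  by (rule ring_op_ring)
    (auto intro: weyl_carrier.intros weyl_carrier_zero weyl_carrier_id weyl_carrier_uminus)

lemma weyl_homog_id: "weyl_homog n d 0 (\<lambda>p. p)"
  using weyl_homog.scal[of n d 1] by (simp add: scal_one)

lemma weyl_homog_scal_comp: "weyl_homog n d k P \<Longrightarrow> weyl_homog n d k (scal c \<circ> P)"
  using weyl_homog.comp[OF weyl_homog.scal, of n d k P c] by simp

lemma weyl_homog_uminus: "weyl_homog n d k P \<Longrightarrow> weyl_homog n d k (\<lambda>p. - P p)"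
  using weyl_homog_scal_comp[of n d k P "-1"] by (simp add: comp_def scal_minus_one)

lemma weyl_homog_diff:
  "weyl_homog n d k P \<Longrightarrow> weyl_homog n d k Q \<Longrightarrow> weyl_homog n d k (\<lambda>p. P p - Q p)"
  using weyl_homog.add[OF _ weyl_homog_uminus, of n d k P Q] by simp

lemma weyl_homog_comp0:
  "weyl_homog n d 0 P \<Longrightarrow> weyl_homog n d k Q \<Longrightarrow> weyl_homog n d k (P \<circ> Q)"
  "weyl_homog n d k Q \<Longrightarrow> weyl_homog n d 0 P \<Longrightarrow> weyl_homog n d k (Q \<circ> P)"
  using weyl_homog.comp[of n d 0 P k Q] weyl_homog.comp[of n d k Q 0 P] by simp_all

lemma ring_weyl0: "ring (weyl0 n d)"
  unfolding weyl0_def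
  by (rule ring_op_ring[of _ n])
    (auto intro: weyl_homog_weyl_carrier weyl_homog.zero weyl_homog_id weyl_homog.add
      weyl_homog_uminus weyl_homog_comp0)

lemma weyl_homog_funpow: "weyl_homog n d k P \<Longrightarrow> weyl_homog n d (int t * k) (P ^^ t)"
proof (induction t)
  case 0
  thus ?case by (simp add: weyl_homog_id id_def)
next
  case (Suc t)
  hence "weyl_homog n d (k + int t * k) (P \<circ> P ^^ t)"
    by (intro weyl_homog.comp)
  moreover have "k + int t * k = int (Suc t) * k" by (simp add: distrib_right)
  ultimately show ?case unfolding funpow.simps by argo
qed

lemma euler_sum_comp: "euler n d = (\<lambda>p. \<Sum>i\<le>n. (scal (of_nat (d i)) \<circ> (xop i \<circ> pdop i)) p)"
  by (simp add: euler_def)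

lemma weyl_homog_sum:
  "finite A \<Longrightarrow> (\<And>i. i \<in> A \<Longrightarrow> weyl_homog n d k (P i)) \<Longrightarrow> weyl_homog n d k (\<lambda>p. \<Sum>i\<in>A. P i p)"
  by (induction A rule: finite_induct) (auto intro: weyl_homog.zero weyl_homog.add)

lemma weyl_homog_euler: "weyl_homog n d 0 (euler n d)"
proof -
  have "weyl_homog n d 0 (xop i \<circ> pdop i)" if "i \<le> n" for i
    using weyl_homog.comp[OF weyl_homog.xop[OF that, of d] weyl_homog.pdop[OF that, of d]] by simp
  thus ?thesis unfolding euler_sum_comp
    by (intro weyl_homog_sum weyl_homog_scal_comp) auto
qed

lemma euler_weyl_carrier: "euler n d \<in> weyl_carrier n"
  using weyl_homog_euler weyl_homog_weyl_carrier by blast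

section \<open>Commutation relations of the generators\<close>

lemma lookup_exp_simps:
  "Poly_Mapping.lookup (a + b) j = Poly_Mapping.lookup a j + Poly_Mapping.lookup (b::'a \<Rightarrow>\<^sub>0 nat) j"
  "Poly_Mapping.lookup (a - b) j = Poly_Mapping.lookup a j - Poly_Mapping.lookup b j"
  "Poly_Mapping.lookup (Poly_Mapping.single i c) j = (if i = j then (c::nat) else 0)"
  by (simp_all add: lookup_add lookup_minus lookup_single when_def)

lemma pdop_xop_same: "i \<le> n \<Longrightarrow> pdop i \<circ> xop i = (\<lambda>p. (xop i \<circ> pdop i) p + p)"
proof (rule weyl_carrier_eqI[of _ n])
  fix m :: "nat \<Rightarrow>\<^sub>0 nat" and c :: 'a
  define e :: "nat \<Rightarrow>\<^sub>0 nat" where "e = Poly_Mapping.single i 1"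
  \<comment> \<open>Subtraction is truncated, so cancellation needs a positive exponent. At exponent
    0 the derivative vanishes and only the summand 1 of the relation survives.\<close>
  have "m - e + e = m" if "Poly_Mapping.lookup m i \<noteq> 0"
    by (rule poly_mapping_eqI) (use that in \<open>auto simp: lookup_exp_simps e_def\<close>)
  moreover have "m + e - e = m" by simp
  moreover have "xop i 0 = 0" by (simp add: xop_def mulop_def)
  moreover have "Poly_Mapping.single m (c + c * of_nat (Poly_Mapping.lookup m i)) =
     Poly_Mapping.single m (c * of_nat (Poly_Mapping.lookup m i)) + Poly_Mapping.single m c"
    by (simp add: single_add add.commute)
  ultimately show "(pdop i \<circ> xop i) (Poly_Mapping.single m c) =
     (xop i \<circ> pdop i) (Poly_Mapping.single m c) + Poly_Mapping.single m c"
    by (cases "Poly_Mapping.lookup m i = 0")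
      (simp_all add: pdop_single xop_single lookup_exp_simps distrib_left distrib_right
        mult.commute[of _ c] flip: e_def, simp_all add: e_def lookup_exp_simps)
next
  assume i: "i \<le> n"
  show "(\<lambda>p. (xop i \<circ> pdop i) p + p) \<in> weyl_carrier n"
    by (rule weyl_carrier.add[OF weyl_carrier.comp weyl_carrier_id])
      (use i in \<open>blast intro: weyl_carrier.intros\<close>)+
qed (blast intro: weyl_carrier.intros)

lemma pdop_xop_diff: "i \<le> n \<Longrightarrow> j \<le> n \<Longrightarrow> i \<noteq> j \<Longrightarrow> pdop i \<circ> xop j = xop j \<circ> pdop i"
proof (rule weyl_carrier_eqI[of _ n])
  fix m :: "nat \<Rightarrow>\<^sub>0 nat" and c :: 'a assume ij: "i \<noteq> j"
  have "m + Poly_Mapping.single j 1 - Poly_Mapping.single i 1 =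
        m - Poly_Mapping.single i 1 + Poly_Mapping.single j 1"
    by (rule poly_mapping_eqI) (use ij in \<open>auto simp: lookup_exp_simps\<close>)
  thus "(pdop i \<circ> xop j) (Poly_Mapping.single m c) = (xop j \<circ> pdop i) (Poly_Mapping.single m c)"
    using ij by (simp add: pdop_single xop_single lookup_exp_simps)
qed (blast intro: weyl_carrier.intros weyl_carrier_id)+

lemma xop_xop: "xop i \<circ> xop j = xop j \<circ> xop i"
  by (simp add: xop_def mulop_comp mult.commute)

lemma pdop_pdop: "i \<le> n \<Longrightarrow> j \<le> n \<Longrightarrow> pdop i \<circ> pdop j = pdop j \<circ> pdop i"
proof (rule weyl_carrier_eqI[of _ n])
  fix m :: "nat \<Rightarrow>\<^sub>0 nat" and c :: 'a
  have "m - Poly_Mapping.single j 1 - Poly_Mapping.single i 1 =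
        m - Poly_Mapping.single i 1 - Poly_Mapping.single j 1"
    by (rule poly_mapping_eqI) (auto simp: lookup_exp_simps)
  thus "(pdop i \<circ> pdop j) (Poly_Mapping.single m c) = (pdop j \<circ> pdop i) (Poly_Mapping.single m c)"
    by (cases "i = j") (simp_all add: pdop_single lookup_exp_simps algebra_simps)
qed (blast intro: weyl_carrier.intros weyl_carrier_id)+

section \<open>Weighted degrees and the commutator with the Euler field\<close>

definition wdeg :: "nat \<Rightarrow> (nat \<Rightarrow> nat) \<Rightarrow> (nat \<Rightarrow>\<^sub>0 nat) \<Rightarrow> nat" where
  "wdeg n d m = (\<Sum>i\<le>n. d i * Poly_Mapping.lookup m i)"

lemma wdeg_add: "wdeg n d (a + b) = wdeg n d a + wdeg n d b"
  by (simp add: wdeg_def lookup_add distrib_left sum.distrib)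

lemma wdeg_single: "i \<le> n \<Longrightarrow> wdeg n d (Poly_Mapping.single i t) = d i * t"
proof -
  assume "i \<le> n"
  have "d j * Poly_Mapping.lookup (Poly_Mapping.single i t) j = (if i = j then d i * t else 0)" for j
    by (simp add: lookup_exp_simps)
  thus ?thesis using \<open>i \<le> n\<close> by (simp add: wdeg_def)
qed

text \<open>Stated for single coefficients, since terms may cancel: whatever monomial survives in
  \<open>P p\<close> arises from some monomial of \<open>p\<close> by a shift of the weighted
  degree. The commutator with the Euler field and the directness of the grading both rest on this.
  Degrees are compared in \<open>int\<close> because \<open>k\<close> may be negative.\<close>

lemma lookup_weyl_homog:
  assumes "weyl_homog n d k P" "Poly_Mapping.lookup (P p) m' \<noteq> 0"
  shows "\<exists>m\<in>Poly_Mapping.keys p. int (wdeg n d m') = int (wdeg n d m) + k"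
  using assms
proof (induction arbitrary: p m' rule: weyl_homog.induct)
  case (scal c)
  thus ?case by (auto intro!: bexI[of _ m'] simp: in_keys_iff lookup_scal)
next
  case (xop i)
  have *: "\<exists>m\<in>Poly_Mapping.keys p. m' = m + Poly_Mapping.single i 1"
    using xop(2) keys_mult[of "Poly_Mapping.single (Poly_Mapping.single i 1) (1::'a)" p]
    by (auto simp: xop_def mulop_def in_keys_iff[symmetric] add.commute)
  show ?case using * \<open>i \<le> n\<close>
    by (auto simp: wdeg_add wdeg_single)
next
  case (pdop i)
  from pdop(2) obtain m where m: "m \<in> Poly_Mapping.keys p"
    "Poly_Mapping.lookup (Poly_Mapping.single (m - Poly_Mapping.single i 1)
       (of_nat (Poly_Mapping.lookup m i) * Poly_Mapping.lookup p m)) m' \<noteq> 0"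
    unfolding pdop_def lookup_sum by (meson sum.not_neutral_contains_not_neutral)
  hence m': "m' = m - Poly_Mapping.single i 1" "Poly_Mapping.lookup m i \<noteq> 0"
    by (auto simp: lookup_single when_def split: if_splits intro: gr0I)
  \<comment> \<open>The surviving term has a positive exponent at \<open>i\<close>, so the truncated
    subtraction is exact.\<close>
  have "m = m' + Poly_Mapping.single i 1"
    unfolding m' by (rule poly_mapping_eqI) (use m'(2) in \<open>auto simp: lookup_exp_simps\<close>)
  hence "wdeg n d m = wdeg n d m' + d i" using \<open>i \<le> n\<close>
    by (simp add: wdeg_add wdeg_single)
  hence "int (wdeg n d m') = int (wdeg n d m) + - int (d i)" by simp
  thus ?case using m(1) by blast
next
  case (add k P Q)
  hence "Poly_Mapping.lookup (P p) m' \<noteq> 0 \<or> Poly_Mapping.lookup (Q p) m' \<noteq> 0"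
    by (auto simp: lookup_add)
  thus ?case using add.IH by blast
next
  case (comp k P l Q)
  from comp.prems have "Poly_Mapping.lookup (P (Q p)) m' \<noteq> 0" by simp
  from comp.IH(1)[OF this] obtain m1 where m1: "m1 \<in> Poly_Mapping.keys (Q p)"
    "int (wdeg n d m') = int (wdeg n d m1) + k" by blast
  hence "Poly_Mapping.lookup (Q p) m1 \<noteq> 0" by (simp add: in_keys_iff)
  from comp.IH(2)[OF this] m1 show ?case by force
qed simp

text \<open>Euler's identity: \<open>x\<^sub>i \<partial>\<^sub>i\<close> multiplies a monomial by
  its exponent at \<open>i\<close>.\<close>

lemma euler_single:
  "euler n d (Poly_Mapping.single m c) = Poly_Mapping.single m (of_nat (wdeg n d m) * c)"
proof -
  have "m - Poly_Mapping.single i 1 + Poly_Mapping.single i 1 = m"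
    if "Poly_Mapping.lookup m i \<noteq> 0" for i
    by (rule poly_mapping_eqI) (use that in \<open>auto simp: lookup_exp_simps\<close>)
  hence "scal (of_nat (d i)) (xop i (pdop i (Poly_Mapping.single m c))) =
    Poly_Mapping.single m (of_nat (d i * Poly_Mapping.lookup m i) * c)" for i
    by (cases "Poly_Mapping.lookup m i = 0")
      (simp_all add: pdop_single xop_single scal_single mult.assoc, simp add: scal_def xop_def mulop_def)
  hence "euler n d (Poly_Mapping.single m c) =
    (\<Sum>i\<le>n. Poly_Mapping.single m (of_nat (d i * Poly_Mapping.lookup m i) * c))"
    by (simp add: euler_def)
  also have "\<dots> = Poly_Mapping.single m (\<Sum>i\<le>n. of_nat (d i * Poly_Mapping.lookup m i) * c)"
    by (rule poly_mapping_eqI) (simp only: lookup_sum lookup_single when_def, auto)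
  finally show ?thesis
    by (simp add: wdeg_def sum_distrib_right)
qed

lemma lookup_euler:
  "Poly_Mapping.lookup (euler n d p) m = of_nat (wdeg n d m) * Poly_Mapping.lookup p m"
proof (induction p rule: pol_induct)
  case (single m' c)
  show ?case by (simp add: euler_single lookup_single when_def)
next
  case (add p q)
  thus ?case by (simp add: weyl_carrier_add[OF euler_weyl_carrier] lookup_add distrib_left)
qed

text \<open>This is \<open>[E, P] = k P\<close>. On a monomial of weighted degree \<open>w\<close>
  the right-hand side multiplies the image by \<open>w + k\<close>, while \<open>E\<close>
  multiplies each monomial of the image by its own weighted degree, which is \<open>w + k\<close> by
  \<open>lookup_weyl_homog\<close>.\<close>

lemma euler_comp:
  assumes "weyl_homog n d k P"
  shows "euler n d \<circ> P = (\<lambda>p. (P \<circ> euler n d) p + scal (of_int k) (P p))"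
proof (rule weyl_carrier_eqI[of _ n])
  have P: "P \<in> weyl_carrier n" using assms by (rule weyl_homog_weyl_carrier)
  show "euler n d \<circ> P \<in> weyl_carrier n"
    by (intro weyl_carrier.comp euler_weyl_carrier P)
  show "(\<lambda>p. (P \<circ> euler n d) p + scal (of_int k) (P p)) \<in> weyl_carrier n"
    using weyl_carrier.add[OF weyl_carrier.comp[OF P euler_weyl_carrier[of n d]]
      weyl_carrier.comp[OF weyl_carrier.scal[of "of_int k" n] P]] by (simp only: comp_apply)
  fix m :: "nat \<Rightarrow>\<^sub>0 nat" and c :: 'a
  let ?s = "Poly_Mapping.single m c"
  have s: "euler n d ?s = scal (of_nat (wdeg n d m)) ?s"
    by (simp add: euler_single scal_single)
  have s': "P (scal a p) = scal a (P p)" for a p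
    using fun_cong[OF scal_commute[OF P, of a], of p] by simp
  show "(euler n d \<circ> P) ?s = (P \<circ> euler n d) ?s + scal (of_int k) (P ?s)"
  proof (rule poly_mapping_eqI)
    fix m'
    show "Poly_Mapping.lookup ((euler n d \<circ> P) ?s) m' =
       Poly_Mapping.lookup ((P \<circ> euler n d) ?s + scal (of_int k) (P ?s)) m'"
    proof (cases "Poly_Mapping.lookup (P ?s) m' = 0")
      case False
      from lookup_weyl_homog[OF assms False] have "int (wdeg n d m') = int (wdeg n d m) + k"
        by (auto split: if_splits)
      hence "(of_int (int (wdeg n d m')) :: 'a) = of_int (int (wdeg n d m) + k)" by simp
      hence "(of_nat (wdeg n d m') :: 'a) = of_nat (wdeg n d m) + of_int k" by simp
      thus ?thesis by (simp only: comp_apply lookup_euler s s' lookup_add lookup_scal distrib_right)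
    qed (simp only: comp_apply lookup_euler s s' lookup_add lookup_scal mult_zero_right add_0)
  qed
qed


text \<open>The sum of the graded pieces with degree in \<open>K\<close>. What matters in the end is
  the splitting of an operator into its degree zero component and the rest, so a span, taken with
  \<open>K\<close> the complement of 0, replaces families of homogeneous components.\<close>

inductive_set homog_span :: "nat \<Rightarrow> (nat \<Rightarrow> nat) \<Rightarrow> int set \<Rightarrow> 'k::field oper set"
  for n :: nat and d :: "nat \<Rightarrow> nat" and K :: "int set" where
  zero: "(\<lambda>p. 0) \<in> homog_span n d K"
| homog: "k \<in> K \<Longrightarrow> weyl_homog n d k P \<Longrightarrow> P \<in> homog_span n d K"
| add: "P \<in> homog_span n d K \<Longrightarrow> Q \<in> homog_span n d K \<Longrightarrow> (\<lambda>p. P p + Q p) \<in> homog_span n d K"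

lemma homog_span_weyl_carrier: "P \<in> homog_span n d K \<Longrightarrow> P \<in> weyl_carrier n"
  by (induction rule: homog_span.induct)
    (blast intro: weyl_carrier.intros weyl_carrier_zero weyl_homog_weyl_carrier)+

lemma homog_span_comp:
  assumes "P \<in> homog_span n d K" "Q \<in> homog_span n d K'"
    and "\<And>k k'. k \<in> K \<Longrightarrow> k' \<in> K' \<Longrightarrow> k + k' \<in> J"
  shows "P \<circ> Q \<in> homog_span n d J"
  using assms(1)
proof (induction rule: homog_span.induct)
  case zero
  show ?case using homog_span.zero by (simp add: comp_def)
next
  case (add P1 P2)
  thus ?case using homog_span.add[of "P1 \<circ> Q" n d J "P2 \<circ> Q"] by (simp add: comp_def)
next
  case (homog k P)
  have P: "P \<in> weyl_carrier n" using homog by (blast intro: weyl_homog_weyl_carrier)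
  from assms(2) show ?case
  proof (induction rule: homog_span.induct)
    case zero
    show ?case using homog_span.zero weyl_carrier_0[OF P] by (simp add: comp_def)
  next
    case (add P1 P2)
    thus ?case using homog_span.add[of "P \<circ> P1" n d J "P \<circ> P2"]
      by (simp add: comp_def weyl_carrier_add[OF P])
  next
    case (homog k' Q)
    show ?case
      by (rule homog_span.homog[OF assms(3)[OF \<open>k \<in> K\<close> \<open>k' \<in> K'\<close>]])
        (intro weyl_homog.comp \<open>weyl_homog n d k P\<close> homog)
  qed
qed

lemma weyl_carrier_homog_span: "P \<in> weyl_carrier n \<Longrightarrow> P \<in> homog_span n d UNIV"
proof (induction rule: weyl_carrier.induct)
  case (comp P Q)
  show ?case by (rule homog_span_comp[OF comp.IH]) (rule UNIV_I)
qed (blast intro: homog_span.intros weyl_homog.intros)+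

text \<open>Reduces statements that are additive in the operator to homogeneous operators. The
  weights \<open>d\<close> do not occur in the conclusion and are instantiated when the rule is
  applied.\<close>

lemma weyl_carrier_induct_homog [consumes 1, case_names homog add]:
  assumes "P \<in> weyl_carrier n"
    and "\<And>k P. weyl_homog n d k P \<Longrightarrow> T P"
    and "\<And>P Q. P \<in> weyl_carrier n \<Longrightarrow> Q \<in> weyl_carrier n \<Longrightarrow> T P \<Longrightarrow> T Q \<Longrightarrow> T (\<lambda>p. P p + Q p)"
  shows "T P"
  using weyl_carrier_homog_span[OF assms(1), of d]
proof (induction rule: homog_span.induct)
  case zero
  show ?case using assms(2) weyl_homog.zero by blast
next
  case (add P Q)
  thus ?case using assms(3) homog_span_weyl_carrier by blast
qed (use assms(2) in blast)

lemma homog_span_uminus: "P \<in> homog_span n d K \<Longrightarrow> (\<lambda>p. - P p) \<in> homog_span n d K"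
proof (induction rule: homog_span.induct)
  case zero
  show ?case using homog_span.zero by simp
next
  case (homog k P)
  thus ?case by (blast intro: homog_span.homog weyl_homog_uminus)
next
  case (add P Q)
  have "(\<lambda>p. - (P p + Q p)) = (\<lambda>p. - P p + - Q p)" by simp
  thus ?case using homog_span.add[OF add.IH] by simp
qed

lemma homog_span_diff:
  "P \<in> homog_span n d K \<Longrightarrow> Q \<in> homog_span n d K \<Longrightarrow> (\<lambda>p. P p - Q p) \<in> homog_span n d K"
  using homog_span.add[OF _ homog_span_uminus, of P n d K Q] by simp

text \<open>Compare coefficients on a monomial of weighted degree \<open>w\<close>: a sum of
  operators of nonzero degrees produces no monomial of weighted degree \<open>w\<close>, and an
  operator of degree zero produces no other.\<close>

lemma homog_span_direct:
  assumes "weyl_homog n d 0 P" "P \<in> homog_span n d (- {0})"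
  shows "P = (\<lambda>p. 0)"
proof (rule weyl_carrier_eqI[of _ n])
  fix m :: "nat \<Rightarrow>\<^sub>0 nat" and c :: 'a
  have *: "Poly_Mapping.lookup (P (Poly_Mapping.single m c)) m' = 0"
    if "wdeg n d m' = wdeg n d m" for m'
    using assms(2)
  proof (induction rule: homog_span.induct)
    case (homog k P)
    show ?case
    proof (rule ccontr)
      assume "Poly_Mapping.lookup (P (Poly_Mapping.single m c)) m' \<noteq> 0"
      from lookup_weyl_homog[OF homog(2) this] homog(1) that show False
        by (auto split: if_splits)
    qed
  qed (simp_all add: lookup_add)
  show "P (Poly_Mapping.single m c) = 0"
  proof (rule poly_mapping_eqI, rule ccontr)
    fix m' assume "Poly_Mapping.lookup (P (Poly_Mapping.single m c)) m' \<noteq> Poly_Mapping.lookup 0 m'"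
    hence "Poly_Mapping.lookup (P (Poly_Mapping.single m c)) m' \<noteq> 0" by simp
    from lookup_weyl_homog[OF assms(1) this] *[of m'] this show False
      by (auto split: if_splits)
  qed
qed (use assms weyl_homog_weyl_carrier weyl_carrier_zero in blast)+

text \<open>The projection of the Weyl algebra onto \<open>D\<^sub>0\<close> along the other
  degrees. The choice is unique by \<open>homog_span_direct\<close>, which \<open>deg0_eqI\<close>
  turns into a rule for computing it.\<close>

definition deg0 :: "nat \<Rightarrow> (nat \<Rightarrow> nat) \<Rightarrow> 'k::field oper \<Rightarrow> 'k oper" where
  "deg0 n d Q = (SOME R. weyl_homog n d 0 R \<and> (\<lambda>p. Q p - R p) \<in> homog_span n d (- {0}))"

lemma deg0_ex:
  assumes "Q \<in> weyl_carrier n"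
  shows "\<exists>R. weyl_homog n d 0 R \<and> (\<lambda>p. Q p - R p) \<in> homog_span n d (- {0})"
  using weyl_carrier_homog_span[OF assms, of d]
proof (induction rule: homog_span.induct)
  case zero
  show ?case using homog_span.zero by (intro exI[of _ "\<lambda>p. 0"]) (simp add: weyl_homog.zero)
next
  case (homog k P)
  show ?case
  proof (cases "k = 0")
    case True
    thus ?thesis using homog homog_span.zero by (intro exI[of _ P]) simp
  next
    case False
    thus ?thesis using homog homog_span.homog[of k "- {0}"]
      by (intro exI[of _ "\<lambda>p. 0"]) (simp add: weyl_homog.zero)
  qed
next
  case (add P Q)
  then obtain R S where RS: "weyl_homog n d 0 R" "(\<lambda>p. P p - R p) \<in> homog_span n d (- {0})"
    "weyl_homog n d 0 S" "(\<lambda>p. Q p - S p) \<in> homog_span n d (- {0})" by blast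
  have "(\<lambda>p. P p + Q p - (R p + S p)) = (\<lambda>p. (P p - R p) + (Q p - S p))" by (simp add: algebra_simps)
  hence "(\<lambda>p. P p + Q p - (R p + S p)) \<in> homog_span n d (- {0})"
    using homog_span.add[OF RS(2,4)] by simp
  moreover have "weyl_homog n d 0 (\<lambda>p. R p + S p)" using RS by (blast intro: weyl_homog.add)
  ultimately show ?case by blast
qed

lemma deg0:
  assumes "Q \<in> weyl_carrier n"
  shows weyl_homog_deg0: "weyl_homog n d 0 (deg0 n d Q)"
    and homog_span_deg0: "(\<lambda>p. Q p - deg0 n d Q p) \<in> homog_span n d (- {0})"
  using someI_ex[OF deg0_ex[OF assms]] unfolding deg0_def by blast+

lemma deg0_eqI:
  assumes "weyl_homog n d 0 R" "(\<lambda>p. Q p - R p) \<in> homog_span n d (- {0})"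
  shows "deg0 n d Q = R"
proof -
  have "(\<lambda>p. (Q p - R p) + R p) \<in> weyl_carrier n"
    by (rule weyl_carrier.add)
      (use assms homog_span_weyl_carrier weyl_homog_weyl_carrier in blast)+
  hence "Q \<in> weyl_carrier n" by simp
  note D = deg0[OF this, of d]
  have "(\<lambda>p. R p - deg0 n d Q p) = (\<lambda>p. (Q p - deg0 n d Q p) - (Q p - R p))" by simp
  hence "(\<lambda>p. R p - deg0 n d Q p) \<in> homog_span n d (- {0})"
    using homog_span_diff[OF D(2) assms(2)] by simp
  moreover have "weyl_homog n d 0 (\<lambda>p. R p - deg0 n d Q p)"
    by (rule weyl_homog_diff[OF assms(1) D(1)])
  ultimately have "(\<lambda>p. R p - deg0 n d Q p) = (\<lambda>p. 0)" by (intro homog_span_direct)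
  thus ?thesis by (simp add: fun_eq_iff)
qed

lemma deg0_homog:
  assumes "weyl_homog n d k P"
  shows "deg0 n d P = (if k = 0 then P else (\<lambda>p. 0))"
  by (rule deg0_eqI) (use assms in \<open>auto intro: homog_span.intros weyl_homog.zero
      homog_span.homog[of k]\<close>)

lemma deg0_add:
  assumes "P \<in> weyl_carrier n" "Q \<in> weyl_carrier n"
  shows "deg0 n d (\<lambda>p. P p + Q p) = (\<lambda>p. deg0 n d P p + deg0 n d Q p)"
proof (rule deg0_eqI)
  show "weyl_homog n d 0 (\<lambda>p. deg0 n d P p + deg0 n d Q p)"
    by (intro weyl_homog.add weyl_homog_deg0 assms)
  have "(\<lambda>p. (P p - deg0 n d P p) + (Q p - deg0 n d Q p)) \<in> homog_span n d (- {0})"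
    by (intro homog_span.add homog_span_deg0 assms)
  thus "(\<lambda>p. P p + Q p - (deg0 n d P p + deg0 n d Q p)) \<in> homog_span n d (- {0})"
    by (simp add: algebra_simps)
qed

text \<open>Right linearity of the projection over \<open>D\<^sub>0\<close>. It will make
  \<open>(Q P)\<^sub>0 v\<close> compatible with moving operators of degree zero from
  \<open>P\<close> to \<open>v\<close>.\<close>

lemma deg0_comp_right:
  assumes R: "weyl_homog n d 0 R" and Q: "Q \<in> weyl_carrier n"
  shows "deg0 n d (Q \<circ> R) = deg0 n d Q \<circ> R"
proof (rule deg0_eqI)
  show "weyl_homog n d 0 (deg0 n d Q \<circ> R)"
    by (intro weyl_homog_comp0 weyl_homog_deg0 assms)
  have "R \<in> homog_span n d {0}" using R by (blast intro: homog_span.homog)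
  from homog_span_comp[OF homog_span_deg0[OF Q] this, of "- {0}"]
  have "(\<lambda>p. Q p - deg0 n d Q p) \<circ> R \<in> homog_span n d (- {0})" by simp
  thus "(\<lambda>p. (Q \<circ> R) p - (deg0 n d Q \<circ> R) p) \<in> homog_span n d (- {0})"
    by (simp add: comp_def)
qed

text \<open>\<open>True\<close> stands for a variable and \<open>False\<close> for a derivative.
  Words without scalars form a countable type, and the cardinality bound for essential surjectivity
  relies on this.\<close>

definition weyl_word :: "(bool \<times> nat) list \<Rightarrow> 'k::field oper" where
  "weyl_word w = foldr (\<lambda>(b, i) P. (if b then xop i else pdop i) \<circ> P) w (\<lambda>p. p)"

lemma weyl_word_Nil: "weyl_word [] = (\<lambda>p. p)"
  by (simp add: weyl_word_def)

lemma weyl_word_Cons: "weyl_word ((b, i) # w) = (if b then xop i else pdop i) \<circ> weyl_word w"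
  by (simp add: weyl_word_def)

lemma weyl_word_append: "weyl_word (v @ w) = weyl_word v \<circ> weyl_word w"
proof (induction v)
  case Nil
  show ?case by (simp add: weyl_word_Nil comp_def)
next
  case (Cons a v)
  thus ?case by (cases a) (simp add: weyl_word_Cons comp_assoc)
qed

lemma weyl_word_homog:
  "snd ` set w \<subseteq> {..n} \<Longrightarrow> \<exists>k. weyl_homog n d k (weyl_word w :: 'k::field oper)"
proof (induction w)
  case Nil
  show ?case unfolding weyl_word_Nil using weyl_homog_id by blast
next
  case (Cons a w)
  then obtain k where k: "weyl_homog n d k (weyl_word w :: 'k oper)" by auto
  obtain b i where a: "a = (b, i)" by (cases a)
  have "i \<le> n" using Cons a by auto
  hence "\<exists>l. weyl_homog n d l (if b then xop i else pdop i :: 'k oper)"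
    using weyl_homog.xop weyl_homog.pdop by (cases b) force+
  then obtain l where "weyl_homog n d l (if b then xop i else pdop i :: 'k oper)" by blast
  from weyl_homog.comp[OF this k] show ?case unfolding a weyl_word_Cons by (rule exI)
qed

text \<open>Scalars stand on the far right so that they can be absorbed into the vector to which a
  word is applied; this leaves countably many words.\<close>

inductive_set word_span :: "nat \<Rightarrow> 'k::field oper set" for n :: nat where
  word: "snd ` set w \<subseteq> {..n} \<Longrightarrow> weyl_word w \<circ> scal c \<in> word_span n"
| add: "P \<in> word_span n \<Longrightarrow> Q \<in> word_span n \<Longrightarrow> (\<lambda>p. P p + Q p) \<in> word_span n"

lemma weyl_word_weyl_carrier: "snd ` set w \<subseteq> {..n} \<Longrightarrow> weyl_word w \<in> weyl_carrier n"
  using weyl_word_homog[of w n undefined] weyl_homog_weyl_carrier[of n undefined] by metis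

lemma word_span_weyl_carrier: "P \<in> word_span n \<Longrightarrow> P \<in> weyl_carrier n"
  by (induction rule: word_span.induct)
    (blast intro: weyl_carrier.intros weyl_word_weyl_carrier)+

lemma word_span_comp:
  assumes "P \<in> word_span n" "Q \<in> word_span n"
  shows "P \<circ> Q \<in> word_span n"
  using assms(1)
proof (induction rule: word_span.induct)
  case (add P1 P2)
  from word_span.add[OF add.IH] show ?case by (simp add: comp_def)
next
  case (word w c)
  have W: "weyl_word w \<circ> scal c \<in> weyl_carrier n"
    by (intro weyl_carrier.comp weyl_word_weyl_carrier word weyl_carrier.scal)
  from assms(2) show ?case
  proof (induction rule: word_span.induct)
    case (add P1 P2)
    from word_span.add[OF add.IH] show ?case
      using weyl_carrier_add[OF W] by (simp add: comp_def)
  next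
    case (word v b)
    have "weyl_word w \<circ> scal c \<circ> (weyl_word v \<circ> scal b) =
          weyl_word w \<circ> (scal c \<circ> weyl_word v) \<circ> scal b" by (simp only: comp_assoc)
    also have "\<dots> = weyl_word w \<circ> weyl_word v \<circ> (scal c \<circ> scal b)"
      unfolding scal_commute[OF weyl_word_weyl_carrier[OF word], symmetric] by (simp only: comp_assoc)
    also have "\<dots> = weyl_word (w @ v) \<circ> scal (c * b)"
      by (simp only: scal_comp weyl_word_append)
    finally have eq: "weyl_word w \<circ> scal c \<circ> (weyl_word v \<circ> scal b) = weyl_word (w @ v) \<circ> scal (c * b)" .
    have "snd ` set (w @ v) \<subseteq> {..n}"
      using word \<open>snd ` set w \<subseteq> {..n}\<close> by auto
    thus ?case unfolding eq by (rule word_span.word)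
  qed
qed

lemma weyl_carrier_word_span: "P \<in> weyl_carrier n \<Longrightarrow> P \<in> word_span n"
proof (induction rule: weyl_carrier.induct)
  case (scal c)
  show ?case using word_span.word[of "[]" n c] by (simp add: weyl_word_Nil comp_def)
next
  case (xop i)
  thus ?case using word_span.word[of "[(True, i)]" n 1]
    by (simp add: weyl_word_Cons weyl_word_Nil scal_one comp_def)
next
  case (pdop i)
  thus ?case using word_span.word[of "[(False, i)]" n 1]
    by (simp add: weyl_word_Cons weyl_word_Nil scal_one comp_def)
qed (blast intro: word_span.add word_span_comp)+

section \<open>Left modules\<close>

context left_module
begin

text \<open>A second name, since \<open>submodule.smult_closed\<close> hides the first one in \<open>left_module_submodule\<close>.\<close>

lemmas smult_mem = smult_closed

lemma smult_l_null [simp]: "x \<in> carrier M \<Longrightarrow> \<zero>\<^bsub>R\<^esub> \<odot>\<^bsub>M\<^esub> x = \<zero>\<^bsub>M\<^esub>"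
  by (metis R.zero_closed R.add.l_one M.add.r_cancel_one' smult_closed smult_l_distr)

lemma smult_r_null [simp]: "a \<in> carrier R \<Longrightarrow> a \<odot>\<^bsub>M\<^esub> \<zero>\<^bsub>M\<^esub> = \<zero>\<^bsub>M\<^esub>"
  by (metis M.zero_closed M.add.l_one M.add.r_cancel_one' smult_closed smult_r_distr)

lemma smult_l_minus:
  assumes "a \<in> carrier R" "x \<in> carrier M"
  shows "(\<ominus>\<^bsub>R\<^esub> a) \<odot>\<^bsub>M\<^esub> x = \<ominus>\<^bsub>M\<^esub> (a \<odot>\<^bsub>M\<^esub> x)"
proof -
  have "(\<ominus>\<^bsub>R\<^esub> a) \<odot>\<^bsub>M\<^esub> x \<oplus>\<^bsub>M\<^esub> a \<odot>\<^bsub>M\<^esub> x = \<zero>\<^bsub>M\<^esub>"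
    using assms by (simp add: R.l_neg flip: smult_l_distr)
  thus ?thesis using assms by (simp add: M.minus_equality smult_closed)
qed

lemma smult_r_minus:
  assumes "a \<in> carrier R" "x \<in> carrier M"
  shows "a \<odot>\<^bsub>M\<^esub> (\<ominus>\<^bsub>M\<^esub> x) = \<ominus>\<^bsub>M\<^esub> (a \<odot>\<^bsub>M\<^esub> x)"
proof -
  have "a \<odot>\<^bsub>M\<^esub> (\<ominus>\<^bsub>M\<^esub> x) \<oplus>\<^bsub>M\<^esub> a \<odot>\<^bsub>M\<^esub> x = \<zero>\<^bsub>M\<^esub>"
    using assms by (simp add: M.l_neg flip: smult_r_distr)
  thus ?thesis using assms by (simp add: M.minus_equality smult_closed)
qed

lemma smult_diff:
  assumes "a \<in> carrier R" "x \<in> carrier M" "y \<in> carrier M"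
  shows "a \<odot>\<^bsub>M\<^esub> (x \<ominus>\<^bsub>M\<^esub> y) = a \<odot>\<^bsub>M\<^esub> x \<ominus>\<^bsub>M\<^esub> a \<odot>\<^bsub>M\<^esub> y"
  using assms by (simp add: a_minus_def smult_r_distr smult_r_minus)

lemma smult_minus_one: "x \<in> carrier M \<Longrightarrow> (\<ominus>\<^bsub>R\<^esub> \<one>\<^bsub>R\<^esub>) \<odot>\<^bsub>M\<^esub> x = \<ominus>\<^bsub>M\<^esub> x"
  by (simp add: smult_l_minus smult_one)

lemma submoduleI:
  assumes "H \<subseteq> carrier M" "\<zero>\<^bsub>M\<^esub> \<in> H"
    and "\<And>a b. \<lbrakk>a \<in> H; b \<in> H\<rbrakk> \<Longrightarrow> a \<oplus>\<^bsub>M\<^esub> b \<in> H"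
    and smult: "\<And>a x. \<lbrakk>a \<in> carrier R; x \<in> H\<rbrakk> \<Longrightarrow> a \<odot>\<^bsub>M\<^esub> x \<in> H"
  shows "submodule H R M"
proof (intro submodule.intro subgroup.intro)
  fix x assume "x \<in> H"
  thus "inv\<^bsub>add_monoid M\<^esub> x \<in> H"
    using smult[of "\<ominus>\<^bsub>R\<^esub> \<one>\<^bsub>R\<^esub>" x] assms(1) smult_minus_one[of x] by (auto simp: a_inv_def)
qed (use assms in \<open>auto simp: submodule_axioms_def\<close>)

lemma submodule_Int:
  assumes "submodule H R M" "submodule K R M"
  shows "submodule (H \<inter> K) R M"
proof -
  interpret H: submodule H R M by fact
  interpret K: submodule K R M by fact
  show ?thesis
    by (rule submoduleI) (use H.subset H.one_closed K.one_closed H.m_closed K.m_closed in auto)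
qed

end

locale left_module_submodule = left_module R M + submodule H R M
  for R :: "'r ring" and M :: "('r, 'm) module" (structure) and H
begin

lemma H_closed: "x \<in> H \<Longrightarrow> x \<in> carrier M"
  using subset by auto

lemma H_zero: "\<zero>\<^bsub>M\<^esub> \<in> H"
  using one_closed by simp

lemma H_add: "x \<in> H \<Longrightarrow> y \<in> H \<Longrightarrow> x \<oplus>\<^bsub>M\<^esub> y \<in> H"
  using m_closed by simp

lemma H_minus: "x \<in> H \<Longrightarrow> \<ominus>\<^bsub>M\<^esub> x \<in> H"
  using m_inv_closed by (simp add: a_inv_def)

lemma H_diff: "x \<in> H \<Longrightarrow> y \<in> H \<Longrightarrow> x \<ominus>\<^bsub>M\<^esub> y \<in> H"
  by (simp add: a_minus_def H_add H_minus)

lemma H_smult: "a \<in> carrier R \<Longrightarrow> x \<in> H \<Longrightarrow> a \<odot>\<^bsub>M\<^esub> x \<in> H"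
  by (rule submodule.smult_closed[OF submodule_axioms])

lemma sub_mod_simps [simp]:
  "carrier (sub_mod M H) = H" "\<zero>\<^bsub>sub_mod M H\<^esub> = \<zero>\<^bsub>M\<^esub>"
  "x \<oplus>\<^bsub>sub_mod M H\<^esub> y = x \<oplus>\<^bsub>M\<^esub> y" "a \<odot>\<^bsub>sub_mod M H\<^esub> x = a \<odot>\<^bsub>M\<^esub> x"
  by (simp_all add: sub_mod_def)

lemma left_module_sub_mod: "left_module R (sub_mod M H)"
proof (intro left_module.intro left_module_axioms.intro)
  show "abelian_group (sub_mod M H)"
  proof (rule abelian_groupI)
    fix x assume "x \<in> carrier (sub_mod M H)"
    thus "\<exists>y\<in>carrier (sub_mod M H). y \<oplus>\<^bsub>sub_mod M H\<^esub> x = \<zero>\<^bsub>sub_mod M H\<^esub>"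
      by (auto intro!: bexI[of _ "\<ominus>\<^bsub>M\<^esub> x"] H_minus H_closed M.l_neg)
  qed (auto simp: H_closed H_add H_zero M.a_ac)
qed (auto simp: R.ring_axioms H_closed H_smult smult_l_distr smult_r_distr smult_assoc smult_one)

lemma abelian_subgroup: "abelian_subgroup H M"
  by (intro abelian_subgroupI3 additive_subgroup.intro subgroup_axioms M.abelian_group_axioms)

interpretation S: abelian_subgroup H M by (rule abelian_subgroup)

lemma coset_eq_iff:
  assumes "x \<in> carrier M" "y \<in> carrier M"
  shows "H +>\<^bsub>M\<^esub> x = H +>\<^bsub>M\<^esub> y \<longleftrightarrow> x \<ominus>\<^bsub>M\<^esub> y \<in> H"
proof
  assume "H +>\<^bsub>M\<^esub> x = H +>\<^bsub>M\<^esub> y"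
  hence "x \<in> H +>\<^bsub>M\<^esub> y" using S.a_rcos_self[of x] assms by simp
  thus "x \<ominus>\<^bsub>M\<^esub> y \<in> H" using S.a_rcos_module assms by (simp add: a_minus_def)
next
  assume "x \<ominus>\<^bsub>M\<^esub> y \<in> H"
  hence "x \<in> H +>\<^bsub>M\<^esub> y" using assms S.a_rcos_module by (simp add: a_minus_def)
  thus "H +>\<^bsub>M\<^esub> x = H +>\<^bsub>M\<^esub> y" using S.a_repr_independence' assms by simp
qed

lemma mem_coset_iff:
  assumes "y \<in> carrier M"
  shows "x \<in> H +>\<^bsub>M\<^esub> y \<longleftrightarrow> x \<in> carrier M \<and> x \<ominus>\<^bsub>M\<^esub> y \<in> H"
  using assms S.a_rcos_module[OF assms, of x] S.a_elemrcos_carrier[OF assms, of x]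
  by (auto simp: a_minus_def)

lemma coset_self: "x \<in> carrier M \<Longrightarrow> x \<in> H +>\<^bsub>M\<^esub> x"
  by (rule S.a_rcos_self)

lemma coset_subset: "x \<in> carrier M \<Longrightarrow> H +>\<^bsub>M\<^esub> x \<subseteq> carrier M"
  using mem_coset_iff by blast

lemma coset_eq_H_iff: "x \<in> carrier M \<Longrightarrow> H +>\<^bsub>M\<^esub> x = H \<longleftrightarrow> x \<in> H"
  using coset_eq_iff[of x "\<zero>\<^bsub>M\<^esub>"] M.a_coset_add_zero[of H] subset
  by (simp add: a_minus_def a_inv_def M.add.inv_one)

lemma coset_add:
  "x \<in> carrier M \<Longrightarrow> y \<in> carrier M \<Longrightarrow> (H +>\<^bsub>M\<^esub> x) <+>\<^bsub>M\<^esub> (H +>\<^bsub>M\<^esub> y) = H +>\<^bsub>M\<^esub> (x \<oplus>\<^bsub>M\<^esub> y)"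
  by (rule S.a_rcos_sum)

text \<open>\<open>quot_mod\<close> multiplies a coset by taking the union over all its
  representatives. The union collapses to one coset because \<open>a\<close> maps differences in
  \<open>H\<close> to differences in \<open>H\<close>.\<close>

lemma coset_smult:
  assumes "a \<in> carrier R" "x \<in> carrier M"
  shows "(\<Union>y\<in>H +>\<^bsub>M\<^esub> x. H +>\<^bsub>M\<^esub> (a \<odot>\<^bsub>M\<^esub> y)) = H +>\<^bsub>M\<^esub> (a \<odot>\<^bsub>M\<^esub> x)"
proof -
  have "H +>\<^bsub>M\<^esub> (a \<odot>\<^bsub>M\<^esub> y) = H +>\<^bsub>M\<^esub> (a \<odot>\<^bsub>M\<^esub> x)" if "y \<in> H +>\<^bsub>M\<^esub> x" for y
  proof -
    have y: "y \<in> carrier M" "y \<ominus>\<^bsub>M\<^esub> x \<in> H" using that assms mem_coset_iff by auto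
    have "a \<odot>\<^bsub>M\<^esub> y \<ominus>\<^bsub>M\<^esub> a \<odot>\<^bsub>M\<^esub> x \<in> H"
      using H_smult[OF assms(1) y(2)] y assms by (simp add: smult_diff)
    thus ?thesis using y assms by (simp add: coset_eq_iff smult_mem)
  qed
  thus ?thesis using coset_self[OF assms(2)] by blast
qed

lemma quot_mod_simps [simp]:
  "\<zero>\<^bsub>quot_mod M H\<^esub> = H" "X \<oplus>\<^bsub>quot_mod M H\<^esub> Y = X <+>\<^bsub>M\<^esub> Y"
  by (simp_all add: quot_mod_def)

lemma quot_mod_carrier: "carrier (quot_mod M H) = {H +>\<^bsub>M\<^esub> x | x. x \<in> carrier M}"
  by (auto simp: quot_mod_def A_RCOSETS_def')

lemma quot_mod_carrierE:
  assumes "X \<in> carrier (quot_mod M H)"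
  obtains x where "x \<in> carrier M" "X = H +>\<^bsub>M\<^esub> x"
  using assms unfolding quot_mod_carrier by blast

lemma coset_quot_mod: "x \<in> carrier M \<Longrightarrow> H +>\<^bsub>M\<^esub> x \<in> carrier (quot_mod M H)"
  unfolding quot_mod_carrier by blast

lemma quot_mod_smult:
  "a \<in> carrier R \<Longrightarrow> x \<in> carrier M \<Longrightarrow> a \<odot>\<^bsub>quot_mod M H\<^esub> (H +>\<^bsub>M\<^esub> x) = H +>\<^bsub>M\<^esub> (a \<odot>\<^bsub>M\<^esub> x)"
  using coset_smult by (simp add: quot_mod_def)

lemma coset_zero: "H +>\<^bsub>M\<^esub> \<zero>\<^bsub>M\<^esub> = H"
  using coset_eq_H_iff H_zero by simp

lemma left_module_quot_mod: "left_module R (quot_mod M H)"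
proof -
  have group: "abelian_group (quot_mod M H)"
  proof (rule abelian_groupI)
    fix X assume "X \<in> carrier (quot_mod M H)"
    then obtain x where x: "x \<in> carrier M" "X = H +>\<^bsub>M\<^esub> x" by (rule quot_mod_carrierE)
    show "\<exists>Y\<in>carrier (quot_mod M H). Y \<oplus>\<^bsub>quot_mod M H\<^esub> X = \<zero>\<^bsub>quot_mod M H\<^esub>"
      by (rule bexI[of _ "H +>\<^bsub>M\<^esub> (\<ominus>\<^bsub>M\<^esub> x)"])
        (simp_all add: x coset_add M.l_neg coset_zero coset_quot_mod)
    show "\<zero>\<^bsub>quot_mod M H\<^esub> \<oplus>\<^bsub>quot_mod M H\<^esub> X = X"
      using x coset_add[of "\<zero>\<^bsub>M\<^esub>" x] by (simp add: coset_zero)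
    fix Y assume "Y \<in> carrier (quot_mod M H)"
    then obtain y where y: "y \<in> carrier M" "Y = H +>\<^bsub>M\<^esub> y" by (rule quot_mod_carrierE)
    show "X \<oplus>\<^bsub>quot_mod M H\<^esub> Y \<in> carrier (quot_mod M H)"
      by (simp add: x y coset_add coset_quot_mod)
    show "X \<oplus>\<^bsub>quot_mod M H\<^esub> Y = Y \<oplus>\<^bsub>quot_mod M H\<^esub> X"
      by (simp add: x y coset_add M.a_comm)
    fix Z assume "Z \<in> carrier (quot_mod M H)"
    then obtain z where z: "z \<in> carrier M" "Z = H +>\<^bsub>M\<^esub> z" by (rule quot_mod_carrierE)
    show "X \<oplus>\<^bsub>quot_mod M H\<^esub> Y \<oplus>\<^bsub>quot_mod M H\<^esub> Z = X \<oplus>\<^bsub>quot_mod M H\<^esub> (Y \<oplus>\<^bsub>quot_mod M H\<^esub> Z)"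
      by (simp add: x y z coset_add M.a_assoc)
  next
    show "\<zero>\<^bsub>quot_mod M H\<^esub> \<in> carrier (quot_mod M H)"
      using coset_quot_mod[of "\<zero>\<^bsub>M\<^esub>"] by (simp add: coset_zero)
  qed
  have "left_module_axioms R (quot_mod M H)"
  proof (rule left_module_axioms.intro)
    fix X assume "X \<in> carrier (quot_mod M H)"
    then obtain x where x: "x \<in> carrier M" "X = H +>\<^bsub>M\<^esub> x" by (rule quot_mod_carrierE)
    show "\<one>\<^bsub>R\<^esub> \<odot>\<^bsub>quot_mod M H\<^esub> X = X"
      by (simp add: x quot_mod_smult smult_one)
    fix a assume a: "a \<in> carrier R"
    show "a \<odot>\<^bsub>quot_mod M H\<^esub> X \<in> carrier (quot_mod M H)"
      by (simp add: x a quot_mod_smult coset_quot_mod smult_mem)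
    fix b assume b: "b \<in> carrier R"
    show "(a \<oplus>\<^bsub>R\<^esub> b) \<odot>\<^bsub>quot_mod M H\<^esub> X =
       a \<odot>\<^bsub>quot_mod M H\<^esub> X \<oplus>\<^bsub>quot_mod M H\<^esub> b \<odot>\<^bsub>quot_mod M H\<^esub> X"
      by (simp add: x a b quot_mod_smult coset_add smult_mem smult_l_distr)
    show "(a \<otimes>\<^bsub>R\<^esub> b) \<odot>\<^bsub>quot_mod M H\<^esub> X = a \<odot>\<^bsub>quot_mod M H\<^esub> (b \<odot>\<^bsub>quot_mod M H\<^esub> X)"
      by (simp add: x a b quot_mod_smult smult_mem smult_assoc)
  next
    fix a X Y assume a: "a \<in> carrier R" and "X \<in> carrier (quot_mod M H)" "Y \<in> carrier (quot_mod M H)"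
    then obtain x y where xy: "x \<in> carrier M" "X = H +>\<^bsub>M\<^esub> x" "y \<in> carrier M" "Y = H +>\<^bsub>M\<^esub> y"
      by (meson quot_mod_carrierE)
    show "a \<odot>\<^bsub>quot_mod M H\<^esub> (X \<oplus>\<^bsub>quot_mod M H\<^esub> Y) =
       a \<odot>\<^bsub>quot_mod M H\<^esub> X \<oplus>\<^bsub>quot_mod M H\<^esub> a \<odot>\<^bsub>quot_mod M H\<^esub> Y"
      by (simp add: xy a quot_mod_smult coset_add smult_mem smult_r_distr)
  qed
  thus ?thesis by (intro left_module.intro group R.ring_axioms)
qed

end

lemma lin_mapsD:
  assumes "f \<in> lin_maps R M N"
  shows "x \<in> carrier M \<Longrightarrow> f x \<in> carrier N"
    and "x \<in> carrier M \<Longrightarrow> y \<in> carrier M \<Longrightarrow> f (x \<oplus>\<^bsub>M\<^esub> y) = f x \<oplus>\<^bsub>N\<^esub> f y"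
    and "a \<in> carrier R \<Longrightarrow> x \<in> carrier M \<Longrightarrow> f (a \<odot>\<^bsub>M\<^esub> x) = a \<odot>\<^bsub>N\<^esub> f x"
    and "x \<notin> carrier M \<Longrightarrow> f x = undefined"
  using assms by (simp_all add: lin_maps_def PiE_iff extensional_def)

lemma lin_mapsI:
  assumes "\<And>x. x \<in> carrier M \<Longrightarrow> f x \<in> carrier N"
    and "\<And>x y. x \<in> carrier M \<Longrightarrow> y \<in> carrier M \<Longrightarrow> f (x \<oplus>\<^bsub>M\<^esub> y) = f x \<oplus>\<^bsub>N\<^esub> f y"
    and "\<And>a x. a \<in> carrier R \<Longrightarrow> x \<in> carrier M \<Longrightarrow> f (a \<odot>\<^bsub>M\<^esub> x) = a \<odot>\<^bsub>N\<^esub> f x"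
    and "\<And>x. x \<notin> carrier M \<Longrightarrow> f x = undefined"
  shows "f \<in> lin_maps R M N"
  using assms by (simp add: lin_maps_def PiE_iff extensional_def)

lemma lin_maps_eqI:
  assumes "f \<in> lin_maps R M N" "g \<in> lin_maps R M N" "\<And>x. x \<in> carrier M \<Longrightarrow> f x = g x"
  shows "f = g"
proof
  fix x show "f x = g x" using assms lin_mapsD(4)[OF assms(1)] lin_mapsD(4)[OF assms(2)]
    by (cases "x \<in> carrier M") auto
qed

lemma lin_maps_compose:
  assumes "f \<in> lin_maps R M N" "g \<in> lin_maps R N P"
    and "left_module R M"
  shows "compose (carrier M) g f \<in> lin_maps R M P"
proof -
  interpret left_module R M by fact
  show ?thesis
    by (rule lin_mapsI)
      (simp_all add: compose_def lin_mapsD[OF assms(1)] lin_mapsD[OF assms(2)] smult_closed)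
qed

lemma lin_maps_id:
  assumes "left_module R M"
  shows "restrict (\<lambda>x. x) (carrier M) \<in> lin_maps R M M"
proof -
  interpret left_module R M by fact
  show ?thesis by (rule lin_mapsI) (auto simp: smult_closed)
qed

lemma lin_maps_zero:
  assumes "f \<in> lin_maps R M N" "left_module R M" "left_module R N"
  shows "f \<zero>\<^bsub>M\<^esub> = \<zero>\<^bsub>N\<^esub>"
proof -
  interpret M: left_module R M by fact
  interpret N: left_module R N by fact
  show ?thesis
    using lin_mapsD(3)[OF assms(1), of "\<zero>\<^bsub>R\<^esub>" "\<zero>\<^bsub>M\<^esub>"] lin_mapsD(1)[OF assms(1), of "\<zero>\<^bsub>M\<^esub>"]
    by simp
qed

lemma category_mod_cat:
  assumes "\<And>M. M \<in> S \<Longrightarrow> left_module R M"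
  shows "category (mod_cat R S)"
  unfolding category_def mod_cat_def
proof (simp, intro conjI ballI, goal_cases)
  case (1 X)
  thus ?case using assms lin_maps_id by blast
next
  case (2 X Y Z f g)
  thus ?case using assms lin_maps_compose by blast
next
  case (3 X Y f)
  have "compose (carrier X) f (restrict (\<lambda>x. x) (carrier X)) \<in> lin_maps R X Y"
    by (rule lin_maps_compose[OF lin_maps_id]) (use 3 assms in blast)+
  thus ?case by (rule lin_maps_eqI[OF _ 3(3)]) (simp add: compose_def)
next
  case (4 X Y f)
  have "compose (carrier X) (restrict (\<lambda>x. x) (carrier Y)) f \<in> lin_maps R X Y"
    by (rule lin_maps_compose[OF _ lin_maps_id]) (use 4 assms in blast)+
  thus ?case by (rule lin_maps_eqI[OF _ 4(3)]) (simp add: compose_def lin_mapsD(1)[OF 4(3)])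
next
  case (5 W X Y Z f g h)
  have "compose (carrier W) h (compose (carrier W) g f) x = compose (carrier W) (compose (carrier X) h g) f x"
    for x
    by (cases "x \<in> carrier W") (simp_all add: compose_def lin_mapsD(1)[OF 5(5)])
  thus ?case by (rule ext)
qed

section \<open>Euler modules\<close>

context abelian_group
begin

lemma diff_self: "x \<in> carrier G \<Longrightarrow> x \<ominus> x = \<zero>"
  by (simp add: a_minus_def r_neg)

lemma diff_add_cancel: "x \<in> carrier G \<Longrightarrow> y \<in> carrier G \<Longrightarrow> (x \<ominus> y) \<oplus> y = x"
  by (simp add: a_minus_def a_assoc l_neg)

lemma diff_eq_zero_iff: "x \<in> carrier G \<Longrightarrow> y \<in> carrier G \<Longrightarrow> x \<ominus> y = \<zero> \<longleftrightarrow> x = y"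
  by (metis diff_self diff_add_cancel l_zero)

lemma add_eq_self_zero: "x \<oplus> y = y \<Longrightarrow> x \<in> carrier G \<Longrightarrow> y \<in> carrier G \<Longrightarrow> x = \<zero>"
  by (metis add.r_cancel_one')

lemma diff_zero: "x \<in> carrier G \<Longrightarrow> x \<ominus> \<zero> = x"
  using diff_add_cancel[of x \<zero>] by (simp add: minus_closed)

lemma diff_add_diff:
  "x \<in> carrier G \<Longrightarrow> y \<in> carrier G \<Longrightarrow> u \<in> carrier G \<Longrightarrow> v \<in> carrier G \<Longrightarrow>
   (x \<oplus> y) \<ominus> (u \<oplus> v) = (x \<ominus> u) \<oplus> (y \<ominus> v)"
  by (simp add: a_minus_def minus_add a_ac)

lemma diff_diff_cancel:
  "x \<in> carrier G \<Longrightarrow> u \<in> carrier G \<Longrightarrow> v \<in> carrier G \<Longrightarrow> (x \<ominus> u) \<ominus> (x \<ominus> v) = v \<ominus> u"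
proof -
  assume c: "x \<in> carrier G" "u \<in> carrier G" "v \<in> carrier G"
  have "(x \<ominus> u) \<ominus> (x \<ominus> v) = (\<ominus> u \<oplus> x) \<oplus> (\<ominus> x \<oplus> v)"
    using c by (simp add: a_minus_def minus_add a_comm)
  also have "\<dots> = \<ominus> u \<oplus> ((x \<oplus> \<ominus> x) \<oplus> v)" using c by (simp only: a_assoc a_closed a_inv_closed)
  finally show ?thesis using c by (simp add: a_minus_def r_neg a_comm)
qed

end

locale weyl_module = left_module "weyl n" M
  for n :: nat and M :: "('k::field_char_0 oper, 'm) module" (structure) +
  fixes d :: "nat \<Rightarrow> nat" and lam :: 'k
begin

lemma act_closed: "P \<in> weyl_carrier n \<Longrightarrow> x \<in> carrier M \<Longrightarrow> P \<odot> x \<in> carrier M"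
  using smult_closed by simp

lemma act_comp:
  "P \<in> weyl_carrier n \<Longrightarrow> Q \<in> weyl_carrier n \<Longrightarrow> x \<in> carrier M \<Longrightarrow> (P \<circ> Q) \<odot> x = P \<odot> (Q \<odot> x)"
  using smult_assoc[of P Q x] by simp

lemma act_add_op:
  "P \<in> weyl_carrier n \<Longrightarrow> Q \<in> weyl_carrier n \<Longrightarrow> x \<in> carrier M \<Longrightarrow>
   (\<lambda>p. P p + Q p) \<odot> x = P \<odot> x \<oplus> Q \<odot> x"
  using smult_l_distr[of P Q x] by simp

lemma act_add:
  "P \<in> weyl_carrier n \<Longrightarrow> x \<in> carrier M \<Longrightarrow> y \<in> carrier M \<Longrightarrow> P \<odot> (x \<oplus> y) = P \<odot> x \<oplus> P \<odot> y"
  using smult_r_distr[of P x y] by simp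

lemma act_id: "x \<in> carrier M \<Longrightarrow> (\<lambda>p. p) \<odot> x = x"
  using smult_one[of x] by simp

lemma act_zero_op: "x \<in> carrier M \<Longrightarrow> (\<lambda>p. 0) \<odot> x = \<zero>"
  using smult_l_null[of x] by simp

lemma act_zero: "P \<in> weyl_carrier n \<Longrightarrow> P \<odot> \<zero> = \<zero>"
  using smult_r_null[of P] by simp

lemma act_diff:
  "P \<in> weyl_carrier n \<Longrightarrow> x \<in> carrier M \<Longrightarrow> y \<in> carrier M \<Longrightarrow> P \<odot> (x \<ominus> y) = P \<odot> x \<ominus> P \<odot> y"
  using smult_diff[of P x y] by simp

lemma act_diff_op:
  assumes "P \<in> weyl_carrier n" "Q \<in> weyl_carrier n" "x \<in> carrier M"
  shows "(\<lambda>p. P p - Q p) \<odot> x = P \<odot> x \<ominus> Q \<odot> x"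
proof -
  have "(\<lambda>p. (P p - Q p) + Q p) \<odot> x = (\<lambda>p. P p - Q p) \<odot> x \<oplus> Q \<odot> x"
    by (rule act_add_op[OF weyl_carrier_diff[OF assms(1,2)] assms(2,3)])
  hence "P \<odot> x = (\<lambda>p. P p - Q p) \<odot> x \<oplus> Q \<odot> x" by simp
  thus ?thesis using assms act_closed[OF weyl_carrier_diff[OF assms(1,2)] assms(3)]
    act_closed[of Q x] by (simp add: a_minus_def M.a_assoc M.r_neg)
qed

lemma act_scal_scal: "x \<in> carrier M \<Longrightarrow> scal a \<odot> (scal b \<odot> x) = scal (a * b) \<odot> x"
  using act_comp[of "scal a" "scal b" x] by (simp add: weyl_carrier.scal scal_comp)

lemma act_scal_add: "x \<in> carrier M \<Longrightarrow> scal (a + b) \<odot> x = scal a \<odot> x \<oplus> scal b \<odot> x"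
  using act_add_op[of "scal a" "scal b" x] by (simp add: weyl_carrier.scal scal_plus)

lemma act_scal_diff: "x \<in> carrier M \<Longrightarrow> scal (a - b) \<odot> x = scal a \<odot> x \<ominus> scal b \<odot> x"
  using act_diff_op[of "scal a" "scal b" x] by (simp add: weyl_carrier.scal scal_diff)

lemma act_scal_one: "x \<in> carrier M \<Longrightarrow> scal 1 \<odot> x = x"
  by (simp add: scal_one act_id)

lemma act_scal_zero: "x \<in> carrier M \<Longrightarrow> scal 0 \<odot> x = \<zero>"
  by (simp add: scal_zero act_zero_op)

lemma act_scal_comm:
  assumes "P \<in> weyl_carrier n" "x \<in> carrier M"
  shows "P \<odot> (scal c \<odot> x) = scal c \<odot> (P \<odot> x)"
  using act_comp[OF assms(1) weyl_carrier.scal assms(2), of c]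
    act_comp[OF weyl_carrier.scal assms, of c] scal_commute[OF assms(1), of c] by simp

lemma act_scal_cancel: "x \<in> carrier M \<Longrightarrow> c \<noteq> 0 \<Longrightarrow> scal (1 / c) \<odot> (scal c \<odot> x) = x"
  by (simp add: act_scal_scal act_scal_one)

lemma act_scal_eq_zero: "x \<in> carrier M \<Longrightarrow> c \<noteq> 0 \<Longrightarrow> scal c \<odot> x = \<zero> \<Longrightarrow> x = \<zero>"
  using act_scal_cancel[of x c] act_zero[OF weyl_carrier.scal] by simp

lemma eigen_iff: "x \<in> eigen n d M \<mu> \<longleftrightarrow> x \<in> carrier M \<and> euler n d \<odot> x = scal \<mu> \<odot> x"
  by (simp add: eigen_def)

lemma eigen_carrier: "x \<in> eigen n d M \<mu> \<Longrightarrow> x \<in> carrier M"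
  by (simp add: eigen_def)

lemma eigen_zero: "\<zero> \<in> eigen n d M \<mu>"
  by (simp add: eigen_def act_zero weyl_carrier.scal euler_weyl_carrier)

lemma eigen_add: "x \<in> eigen n d M \<mu> \<Longrightarrow> y \<in> eigen n d M \<mu> \<Longrightarrow> x \<oplus> y \<in> eigen n d M \<mu>"
  by (simp add: eigen_def act_add weyl_carrier.scal euler_weyl_carrier)

lemma eigen_homog:
  assumes P: "weyl_homog n d k P" and x: "x \<in> eigen n d M \<mu>"
  shows "P \<odot> x \<in> eigen n d M (\<mu> + of_int k)"
proof -
  have PW: "P \<in> weyl_carrier n" using P by (rule weyl_homog_weyl_carrier)
  have xM: "x \<in> carrier M" using x by (rule eigen_carrier)
  have "euler n d \<odot> (P \<odot> x) = (euler n d \<circ> P) \<odot> x"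
    by (simp add: act_comp euler_weyl_carrier PW xM)
  also have "\<dots> = (\<lambda>p. (P \<circ> euler n d) p + (scal (of_int k) \<circ> P) p) \<odot> x"
    unfolding euler_comp[OF P] by simp
  also have "\<dots> = (P \<circ> euler n d) \<odot> x \<oplus> (scal (of_int k) \<circ> P) \<odot> x"
    by (intro act_add_op weyl_carrier.comp PW xM euler_weyl_carrier weyl_carrier.scal)
  also have "\<dots> = P \<odot> (scal \<mu> \<odot> x) \<oplus> scal (of_int k) \<odot> (P \<odot> x)"
    using x by (simp add: act_comp euler_weyl_carrier PW xM weyl_carrier.scal eigen_iff)
  also have "\<dots> = scal (\<mu> + of_int k) \<odot> (P \<odot> x)"
    by (simp add: act_scal_comm act_scal_add PW xM act_closed)
  finally show ?thesis by (simp add: eigen_iff act_closed PW xM)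
qed

lemma eigen_homog0: "weyl_homog n d 0 P \<Longrightarrow> x \<in> eigen n d M \<mu> \<Longrightarrow> P \<odot> x \<in> eigen n d M \<mu>"
  using eigen_homog[of 0 P x \<mu>] by simp

lemma eigen_scal: "x \<in> eigen n d M \<mu> \<Longrightarrow> scal c \<odot> x \<in> eigen n d M \<mu>"
  by (rule eigen_homog0[OF weyl_homog.scal])

lemma eigen_minus: "x \<in> eigen n d M \<mu> \<Longrightarrow> \<ominus> x \<in> eigen n d M \<mu>"
  using eigen_scal[of x \<mu> "-1"] act_scal_diff[of x 0 1]
  by (simp add: act_scal_zero act_scal_one eigen_carrier a_minus_def)

lemma eigen_diff: "x \<in> eigen n d M \<mu> \<Longrightarrow> y \<in> eigen n d M \<mu> \<Longrightarrow> x \<ominus> y \<in> eigen n d M \<mu>"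
  by (simp add: a_minus_def eigen_add eigen_minus)

lemma finsum_act:
  "finite F \<Longrightarrow> P \<in> weyl_carrier n \<Longrightarrow> f \<in> F \<rightarrow> carrier M \<Longrightarrow>
   P \<odot> finsum M f F = finsum M (\<lambda>k. P \<odot> f k) F"
proof (induction F rule: finite_induct)
  case empty
  thus ?case by (simp add: act_zero)
next
  case (insert k F)
  thus ?case by (simp add: Pi_def act_add act_closed)
qed

lemma finsum_submodule:
  assumes "submodule H (weyl n) M" "finite F" "f \<in> F \<rightarrow> H"
  shows "finsum M f F \<in> H"
proof -
  interpret H: left_module_submodule "weyl n" M H
    by (intro left_module_submodule.intro left_module_axioms assms)
  show ?thesis using assms(2,3)
    by (induction F rule: finite_induct) (auto simp: H.H_zero H.H_add Pi_def H.H_closed)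
qed

text \<open>The usual independence of eigenvectors, relative to a submodule: applying
  \<open>E - (lam + j)\<close> removes one term and multiplies the others by nonzero integers
  \<open>k - j\<close>. With \<open>H\<close> zero it gives uniqueness of the decomposition into
  eigenvectors; with general \<open>H\<close> it shows that a submodule contains the components of
  its elements.\<close>

lemma eigen_independent:
  assumes H: "submodule H (weyl n) M" and "finite F"
    and "\<And>k. k \<in> F \<Longrightarrow> f k \<in> eigen n d M (lam + of_int k)"
    and "finsum M f F \<in> H"
  shows "\<forall>k\<in>F. f k \<in> H"
proof -
  interpret H: left_module_submodule "weyl n" M H
    by (intro left_module_submodule.intro left_module_axioms assms)
  show ?thesis using assms(2-4)
  proof (induction F arbitrary: f rule: finite_induct)
    case (insert j F)
    define T where "T = (\<lambda>p. euler n d p - scal (lam + of_int j) p)"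
    have T: "T \<in> weyl_carrier n"
      unfolding T_def by (intro weyl_carrier_diff euler_weyl_carrier weyl_carrier.scal)
    have fC: "f k \<in> carrier M" if "k \<in> insert j F" for k using insert.prems(1)[OF that] eigen_carrier by blast
    have Tf: "T \<odot> f k = scal (of_int (k - j)) \<odot> f k" if "k \<in> insert j F" for k
    proof -
      have "T \<odot> f k = scal (lam + of_int k) \<odot> f k \<ominus> scal (lam + of_int j) \<odot> f k"
        using insert.prems(1)[OF that] fC[OF that] unfolding T_def
        by (simp add: act_diff_op euler_weyl_carrier weyl_carrier.scal eigen_iff)
      also have "\<dots> = scal (of_int (k - j)) \<odot> f k"
        using fC[OF that] act_scal_diff[of "f k" "lam + of_int k" "lam + of_int j"] by simp
      finally show ?thesis .
    qed
    have s: "finsum M f (insert j F) = f j \<oplus> finsum M f F"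
      using insert fC by (simp add: Pi_def)
    have sC: "finsum M f F \<in> carrier M" using fC by (simp add: Pi_def)
    have "T \<odot> finsum M f (insert j F) = T \<odot> f j \<oplus> finsum M (\<lambda>k. T \<odot> f k) F"
      unfolding s using fC sC T insert(1) by (simp add: act_add finsum_act Pi_def)
    also have "T \<odot> f j = \<zero>" using Tf[of j] fC by (simp add: act_scal_zero)
    also have "finsum M (\<lambda>k. T \<odot> f k) F = finsum M (\<lambda>k. scal (of_int (k - j)) \<odot> f k) F"
      by (rule M.finsum_cong') (use Tf fC in \<open>auto simp: act_closed weyl_carrier.scal\<close>)
    finally have "T \<odot> finsum M f (insert j F) = finsum M (\<lambda>k. scal (of_int (k - j)) \<odot> f k) F"
      using fC by (simp add: Pi_def act_closed weyl_carrier.scal)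
    hence "finsum M (\<lambda>k. scal (of_int (k - j)) \<odot> f k) F \<in> H"
      using H.H_smult[OF _ insert.prems(2), of T] T by (simp only: weyl_simps)
    from insert.IH[OF _ this] have IH: "\<forall>k\<in>F. scal (of_int (k - j)) \<odot> f k \<in> H"
      using insert.prems(1) eigen_scal by blast
    have fH: "f k \<in> H" if "k \<in> F" for k
    proof -
      \<comment> \<open>Characteristic zero keeps distinct integers distinct in the field.\<close>
      have "(of_int (k - j) :: 'k) \<noteq> 0" using that insert(2) by (simp only: of_int_eq_0_iff) auto
      from act_scal_cancel[OF fC this] that
      have "f k = scal (1 / of_int (k - j)) \<odot> (scal (of_int (k - j)) \<odot> f k)" by simp
      moreover have "scal (1 / of_int (k - j)) \<odot> (scal (of_int (k - j)) \<odot> f k) \<in> H"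
        by (rule H.H_smult) (use IH that in \<open>simp_all only: weyl_simps weyl_carrier.scal\<close>)
      ultimately show ?thesis by argo
    qed
    hence "finsum M f F \<in> H" by (intro finsum_submodule H insert(1)) auto
    moreover have "f j = finsum M f (insert j F) \<ominus> finsum M f F"
      unfolding s using fC sC by (simp add: a_minus_def M.a_assoc M.r_neg)
    ultimately have "f j \<in> H" using H.H_diff insert.prems(2) by simp
    thus ?case using fH by blast
  qed simp
qed

lemma submodule_zero: "submodule {\<zero>} (weyl n) M"
  by (rule submoduleI) auto

end

section \<open>Sums of eigenspaces and the projection to degree zero\<close>

lemma euler_module_decomp:
  fixes M :: "('k::field oper, 'm) module"
  assumes "euler_module n d lam M" "m \<in> carrier M"
  shows "\<exists>f :: int \<Rightarrow> 'm. (\<forall>k. f k \<in> eigen n d M (lam + of_int k)) \<and>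
     finite {k. f k \<noteq> \<zero>\<^bsub>M\<^esub>} \<and> m = finsum M f {k. f k \<noteq> \<zero>\<^bsub>M\<^esub>}"
  using assms unfolding euler_module_def
  apply -
  apply (drule conjunct2)
  apply (drule (1) bspec)
  apply (erule ex1_implies_ex)
  done

text \<open>Gives induction over elements where \<open>euler_module\<close> speaks of finitely
  supported families; \<open>eigen_span_finsum\<close> translates back. The index set is
  \<open>UNIV\<close> for the whole module and the complement of 0 for what the projection
  kills.\<close>

inductive_set eigen_span ::
  "nat \<Rightarrow> (nat \<Rightarrow> nat) \<Rightarrow> 'k::field \<Rightarrow> ('k oper, 'm) module \<Rightarrow> int set \<Rightarrow> 'm set"
  for n d lam M K where
  zero: "\<zero>\<^bsub>M\<^esub> \<in> eigen_span n d lam M K"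
| eigen: "k \<in> K \<Longrightarrow> x \<in> eigen n d M (lam + of_int k) \<Longrightarrow> x \<in> eigen_span n d lam M K"
| add: "x \<in> eigen_span n d lam M K \<Longrightarrow> y \<in> eigen_span n d lam M K \<Longrightarrow>
        x \<oplus>\<^bsub>M\<^esub> y \<in> eigen_span n d lam M K"

text \<open>The component of degree zero. On an Euler module it is unique because the eigenspace of
  \<open>lam\<close> and the span of the others meet in zero
  (\<open>eigen_span_direct\<close>).\<close>

definition eproj :: "nat \<Rightarrow> (nat \<Rightarrow> nat) \<Rightarrow> 'k::field \<Rightarrow> ('k oper, 'm) module \<Rightarrow> 'm \<Rightarrow> 'm" where
  "eproj n d lam M x =
     (THE y. y \<in> eigen n d M lam \<and> x \<ominus>\<^bsub>M\<^esub> y \<in> eigen_span n d lam M (- {0}))"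

context weyl_module
begin

lemma eigen_span_carrier: "x \<in> eigen_span n d lam M K \<Longrightarrow> x \<in> carrier M"
  by (induction rule: eigen_span.induct) (auto simp: eigen_carrier)

lemma eigen_span_minus: "x \<in> eigen_span n d lam M K \<Longrightarrow> \<ominus> x \<in> eigen_span n d lam M K"
proof (induction rule: eigen_span.induct)
  case zero
  have "\<ominus> \<zero> = \<zero>" using M.minus_equality[of \<zero> \<zero>] by simp
  thus ?case using eigen_span.zero[of M n d lam K] by (simp only:)
next
  case (eigen k x)
  thus ?case by (intro eigen_span.eigen[of k] eigen_minus)
next
  case (add x y)
  thus ?case using eigen_span_carrier by (simp add: M.minus_add eigen_span.add)
qed

lemma eigen_span_diff:
  "x \<in> eigen_span n d lam M K \<Longrightarrow> y \<in> eigen_span n d lam M K \<Longrightarrow> x \<ominus> y \<in> eigen_span n d lam M K"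
  by (simp add: a_minus_def eigen_span.add eigen_span_minus)

lemma finsum_support:
  assumes "finite F" "{k. f k \<noteq> \<zero>} \<subseteq> F" "\<And>k. f k \<in> carrier M"
  shows "finsum M f {k. f k \<noteq> \<zero>} = finsum M f F"
  by (rule M.add.finprod_mono_neutral_cong_left) (use assms in auto)

lemma eigen_span_finsum:
  assumes "x \<in> eigen_span n d lam M K"
  shows "\<exists>f. (\<forall>k. f k \<in> eigen n d M (lam + of_int k)) \<and> finite {k. f k \<noteq> \<zero>} \<and>
     {k. f k \<noteq> \<zero>} \<subseteq> K \<and> x = finsum M f {k. f k \<noteq> \<zero>}"
  using assms
proof (induction rule: eigen_span.induct)
  case zero
  show ?case by (rule exI[of _ "\<lambda>k. \<zero>"]) (simp add: eigen_zero)
next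
  case (eigen k x)
  define f where "f = (\<lambda>j. if j = k then x else \<zero>)"
  have fC: "f j \<in> carrier M" for j using eigen eigen_carrier by (auto simp: f_def)
  have sup: "{j. f j \<noteq> \<zero>} \<subseteq> {k}" by (auto simp: f_def)
  have "finsum M f {j. f j \<noteq> \<zero>} = finsum M f {k}"
    by (rule finsum_support) (use sup fC in auto)
  also have "\<dots> = x" using fC[of k] by (simp add: f_def)
  finally have "x = finsum M f {j. f j \<noteq> \<zero>}" by simp
  moreover have "finite {j. f j \<noteq> \<zero>}" using sup finite_subset by blast
  moreover have "\<forall>j. f j \<in> eigen n d M (lam + of_int j)" using eigen eigen_zero by (auto simp: f_def)
  moreover have "{j. f j \<noteq> \<zero>} \<subseteq> K" using sup eigen(1) by auto
  ultimately show ?case by blast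
next
  case (add x y)
  from add.IH obtain f where f: "\<forall>k. f k \<in> eigen n d M (lam + of_int k)" "finite {k. f k \<noteq> \<zero>}"
     "{k. f k \<noteq> \<zero>} \<subseteq> K" "x = finsum M f {k. f k \<noteq> \<zero>}" by blast
  from add.IH obtain g where g: "\<forall>k. g k \<in> eigen n d M (lam + of_int k)" "finite {k. g k \<noteq> \<zero>}"
     "{k. g k \<noteq> \<zero>} \<subseteq> K" "y = finsum M g {k. g k \<noteq> \<zero>}" by blast
  define h where "h = (\<lambda>k. f k \<oplus> g k)"
  let ?F = "{k. f k \<noteq> \<zero>} \<union> {k. g k \<noteq> \<zero>}"
  have C: "f k \<in> carrier M" "g k \<in> carrier M" "h k \<in> carrier M" for k
    using f(1) g(1) eigen_carrier unfolding h_def by blast+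
  have F: "finite ?F" using f g by simp
  have hs: "{k. h k \<noteq> \<zero>} \<subseteq> ?F" by (auto simp: h_def)
  have "finsum M h {k. h k \<noteq> \<zero>} = finsum M h ?F" by (rule finsum_support) (use hs F C in auto)
  also have "\<dots> = finsum M f ?F \<oplus> finsum M g ?F"
    unfolding h_def using C by (intro M.finsum_addf) auto
  also have "finsum M f ?F = x" unfolding f(4) by (rule finsum_support[symmetric]) (use F C in auto)
  also have "finsum M g ?F = y" unfolding g(4) by (rule finsum_support[symmetric]) (use F C in auto)
  finally have "x \<oplus> y = finsum M h {k. h k \<noteq> \<zero>}" by simp
  moreover have "finite {k. h k \<noteq> \<zero>}" using hs F finite_subset by blast
  moreover have "\<forall>k. h k \<in> eigen n d M (lam + of_int k)" using f g eigen_add by (simp add: h_def)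
  moreover have "{k. h k \<noteq> \<zero>} \<subseteq> K" using hs f g by blast
  ultimately show ?case by blast
qed

lemma finsum_eigen_span:
  "finite F \<Longrightarrow> (\<And>k. k \<in> F \<Longrightarrow> f k \<in> eigen_span n d lam M K) \<Longrightarrow> finsum M f F \<in> eigen_span n d lam M K"
proof (induction F rule: finite_induct)
  case (insert k F)
  have "finsum M f (insert k F) = f k \<oplus> finsum M f F"
    by (rule M.finsum_insert) (use insert eigen_span_carrier in auto)
  thus ?case using insert by (simp add: eigen_span.add)
qed (simp add: eigen_span.zero)

text \<open>The uniqueness demanded by \<open>euler_module\<close> is automatic, as eigenvectors for
  distinct eigenvalues are independent. From here on only spanning has to be checked.\<close>

lemma euler_module_iff: "euler_module n d lam M \<longleftrightarrow> carrier M \<subseteq> eigen_span n d lam M UNIV"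
proof
  assume e: "euler_module n d lam M"
  show "carrier M \<subseteq> eigen_span n d lam M UNIV"
  proof
    fix m assume m: "m \<in> carrier M"
    obtain f :: "int \<Rightarrow> 'm" where f: "\<forall>k. f k \<in> eigen n d M (lam + of_int k)"
      "finite {k. f k \<noteq> \<zero>}" "m = finsum M f {k. f k \<noteq> \<zero>}"
      using euler_module_decomp[OF e m] by (elim exE conjE) (rule that)
    show "m \<in> eigen_span n d lam M UNIV"
      unfolding f(3) by (rule finsum_eigen_span[OF f(2) eigen_span.eigen[OF UNIV_I spec[OF f(1)]]])
  qed
next
  assume span: "carrier M \<subseteq> eigen_span n d lam M UNIV"
  show "euler_module n d lam M"
    unfolding euler_module_def
  proof (intro conjI ballI)
    fix m assume "m \<in> carrier M"
    hence "m \<in> eigen_span n d lam M UNIV" using span by blast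
    then obtain f where f: "\<forall>k. f k \<in> eigen n d M (lam + of_int k)" "finite {k. f k \<noteq> \<zero>}"
       "m = finsum M f {k. f k \<noteq> \<zero>}" using eigen_span_finsum by blast
    show "\<exists>!f :: int \<Rightarrow> 'm. (\<forall>k. f k \<in> eigen n d M (lam + of_int k)) \<and>
       finite {k. f k \<noteq> \<zero>} \<and> m = finsum M f {k. f k \<noteq> \<zero>}"
    proof (rule ex1I[of _ f])
      show "(\<forall>k. f k \<in> eigen n d M (lam + of_int k)) \<and>
        finite {k. f k \<noteq> \<zero>} \<and> m = finsum M f {k. f k \<noteq> \<zero>}" by (intro conjI f)
      fix g :: "int \<Rightarrow> 'm"
      assume *: "(\<forall>k. g k \<in> eigen n d M (lam + of_int k)) \<and>
        finite {k. g k \<noteq> \<zero>} \<and> m = finsum M g {k. g k \<noteq> \<zero>}"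
      note g = conjunct1[OF *] conjunct1[OF conjunct2[OF *]] conjunct2[OF conjunct2[OF *]]
      let ?F = "{k. f k \<noteq> \<zero>} \<union> {k. g k \<noteq> \<zero>}"
      have C: "f k \<in> carrier M" "g k \<in> carrier M" for k
        using f(1) g(1) eigen_carrier by blast+
      have F: "finite ?F" using f g by simp
      have fF: "finsum M f ?F = m" unfolding f(3) by (rule finsum_support[symmetric]) (use F C in auto)
      have gF: "finsum M g ?F = m" unfolding g(3) by (rule finsum_support[symmetric]) (use F C in auto)
      have m: "m \<in> carrier M" by fact
      \<comment> \<open>The difference of two decompositions of \<open>m\<close> is a decomposition
        of zero.\<close>
      have "finsum M (\<lambda>k. g k \<ominus> f k) ?F \<oplus> finsum M f ?F = finsum M (\<lambda>k. (g k \<ominus> f k) \<oplus> f k) ?F"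
        using C by (intro M.finsum_addf[symmetric]) auto
      also have "\<dots> = finsum M g ?F"
        by (rule M.finsum_cong') (use C in \<open>auto simp: M.diff_add_cancel\<close>)
      finally have "finsum M (\<lambda>k. g k \<ominus> f k) ?F \<oplus> m = m" unfolding fF gF .
      moreover have "finsum M (\<lambda>k. g k \<ominus> f k) ?F \<in> carrier M"
        using C by (intro M.finsum_closed Pi_I M.minus_closed)
      ultimately have "finsum M (\<lambda>k. g k \<ominus> f k) ?F = \<zero>"
        using M.add_eq_self_zero m by blast
      hence z: "finsum M (\<lambda>k. g k \<ominus> f k) ?F \<in> {\<zero>}" by blast
      have "\<forall>k\<in>?F. g k \<ominus> f k \<in> {\<zero>}"
        by (rule eigen_independent[OF submodule_zero F _ z]) (use f(1) g(1) eigen_diff in blast)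
      hence "g k = f k" if "k \<in> ?F" for k using that C[of k] M.diff_eq_zero_iff[of "g k" "f k"] by blast
      moreover have "g k = f k" if "k \<notin> ?F" for k using that by simp
      ultimately show "g = f" by blast
    qed
  qed (rule left_module_axioms)
qed

lemma eigen_span_direct:
  assumes "x \<in> eigen n d M lam" "x \<in> eigen_span n d lam M (- {0})"
  shows "x = \<zero>"
proof -
  obtain f where f: "\<forall>k. f k \<in> eigen n d M (lam + of_int k)" "finite {k. f k \<noteq> \<zero>}"
    "{k. f k \<noteq> \<zero>} \<subseteq> - {0}" "x = finsum M f {k. f k \<noteq> \<zero>}" using eigen_span_finsum[OF assms(2)] by blast
  let ?F = "{k. f k \<noteq> \<zero>}"
  \<comment> \<open>The index 0 does not occur in \<open>f\<close>. Putting
    \<open>\<ominus> x\<close> there turns the decomposition of \<open>x\<close> into a relation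
    between eigenvectors with sum zero.\<close>
  define g where "g = f(0 := \<ominus> x)"
  have xC: "x \<in> carrier M" using assms(1) eigen_carrier by blast
  have fC: "f k \<in> carrier M" for k using f(1) eigen_carrier by blast
  have n0: "0 \<notin> ?F" using f(3) by blast
  have "finsum M g (insert 0 ?F) = g 0 \<oplus> finsum M g ?F"
    by (rule M.finsum_insert) (use f(2) n0 xC fC in \<open>auto simp: g_def\<close>)
  also have "finsum M g ?F = x"
    unfolding f(4) by (rule M.finsum_cong') (use n0 fC in \<open>auto simp: g_def\<close>)
  also have "g 0 = \<ominus> x" by (simp add: g_def)
  also have "\<ominus> x \<oplus> x = \<zero>" using xC by (rule M.l_neg)
  finally have "finsum M g (insert 0 ?F) \<in> {\<zero>}" by blast
  from eigen_independent[OF submodule_zero _ _ this] f(1,2) eigen_minus[OF assms(1)]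
  have "g 0 = \<zero>" by (auto simp: g_def split: if_splits)
  thus ?thesis using xC by (metis M.a_inv_closed M.minus_minus M.r_neg M.r_zero fun_upd_same g_def)
qed

end

locale euler_mod = weyl_module +
  assumes span: "carrier M \<subseteq> eigen_span n d lam M UNIV"
begin

abbreviation "pr \<equiv> eproj n d lam M"

lemma euler_module: "euler_module n d lam M"
  using euler_module_iff span by blast

lemma carrier_induct [consumes 1, case_names eigen add]:
  assumes "x \<in> carrier M"
    and "\<And>k x. x \<in> eigen n d M (lam + of_int k) \<Longrightarrow> T x"
    and "\<And>x y. x \<in> carrier M \<Longrightarrow> y \<in> carrier M \<Longrightarrow> T x \<Longrightarrow> T y \<Longrightarrow> T (x \<oplus> y)"
  shows "T x"
proof -
  have "x \<in> eigen_span n d lam M UNIV" using assms(1) span by blast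
  thus ?thesis
  proof (induction rule: eigen_span.induct)
    case zero
    show ?case by (rule assms(2)[OF eigen_zero])
  next
    case (add x y)
    thus ?case using assms(3) eigen_span_carrier by blast
  qed (use assms(2) in blast)
qed

lemma eproj_ex:
  assumes "x \<in> carrier M"
  shows "\<exists>y. y \<in> eigen n d M lam \<and> x \<ominus> y \<in> eigen_span n d lam M (- {0})"
  using assms
proof (induction rule: carrier_induct)
  case (eigen k x)
  hence x: "x \<in> carrier M" using eigen_carrier by blast
  show ?case
  proof (cases "k = 0")
    case True
    thus ?thesis using eigen x eigen_span.zero[of M n d lam "- {0}"]
      by (intro exI[of _ x]) (simp add: M.diff_self)
  next
    case False
    thus ?thesis using eigen x eigen_span.eigen[of k "- {0}" x n d M lam]
      by (intro exI[of _ \<zero>]) (simp add: M.diff_zero eigen_zero)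
  qed
next
  case (add x y)
  then obtain u v where uv: "u \<in> eigen n d M lam" "x \<ominus> u \<in> eigen_span n d lam M (- {0})"
    "v \<in> eigen n d M lam" "y \<ominus> v \<in> eigen_span n d lam M (- {0})" by blast
  have "x \<oplus> y \<ominus> (u \<oplus> v) \<in> eigen_span n d lam M (- {0})"
    using M.diff_add_diff[of x y u v] add uv eigen_carrier eigen_span.add[OF uv(2,4)] by simp
  thus ?case using eigen_add[OF uv(1,3)] by blast
qed

lemma eproj_unique:
  assumes "x \<in> carrier M"
    "y \<in> eigen n d M lam" "x \<ominus> y \<in> eigen_span n d lam M (- {0})"
    "z \<in> eigen n d M lam" "x \<ominus> z \<in> eigen_span n d lam M (- {0})"
  shows "y = z"
proof -
  have C: "y \<in> carrier M" "z \<in> carrier M" using assms eigen_carrier by blast+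
  have "z \<ominus> y \<in> eigen_span n d lam M (- {0})"
    using eigen_span_diff[OF assms(3,5)] M.diff_diff_cancel[of x y z] assms(1) C by simp
  moreover have "z \<ominus> y \<in> eigen n d M lam" using assms eigen_diff by blast
  ultimately have "z \<ominus> y = \<zero>" by (intro eigen_span_direct)
  thus ?thesis using M.diff_eq_zero_iff C by blast
qed

lemma eproj_eqI:
  assumes "x \<in> carrier M" "y \<in> eigen n d M lam" "x \<ominus> y \<in> eigen_span n d lam M (- {0})"
  shows "pr x = y"
  unfolding eproj_def
  by (rule the_equality) (use assms eproj_unique[OF assms(1)] in blast)+

lemma eproj:
  assumes "x \<in> carrier M"
  shows eproj_eigen: "pr x \<in> eigen n d M lam"
    and eproj_span: "x \<ominus> pr x \<in> eigen_span n d lam M (- {0})"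
  using eproj_ex[OF assms] eproj_eqI[OF assms] by auto

lemma eproj_closed: "x \<in> carrier M \<Longrightarrow> pr x \<in> carrier M"
  using eproj_eigen eigen_carrier by blast

lemma eproj_add:
  assumes "x \<in> carrier M" "y \<in> carrier M"
  shows "pr (x \<oplus> y) = pr x \<oplus> pr y"
proof (rule eproj_eqI)
  show "x \<oplus> y \<ominus> (pr x \<oplus> pr y) \<in> eigen_span n d lam M (- {0})"
    using M.diff_add_diff[of x y "pr x" "pr y"] assms eproj_closed
      eigen_span.add[OF eproj_span eproj_span, of x y] by simp
qed (use assms eproj_eigen eigen_add in auto)

lemma eproj_on_eigen:
  assumes "x \<in> eigen n d M (lam + of_int k)"
  shows "pr x = (if k = 0 then x else \<zero>)"
proof (rule eproj_eqI)
  show x: "x \<in> carrier M" using assms eigen_carrier by blast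
  show "x \<ominus> (if k = 0 then x else \<zero>) \<in> eigen_span n d lam M (- {0})"
    using x assms eigen_span.zero[of M n d lam] eigen_span.eigen[of k "- {0}" x n d M lam]
    by (simp add: M.diff_self M.diff_zero)
qed (use assms eigen_zero in auto)

lemma eproj_eq_self: "x \<in> eigen n d M lam \<Longrightarrow> pr x = x"
  using eproj_on_eigen[of x 0] by simp

lemma eproj_zero: "pr \<zero> = \<zero>"
  by (rule eproj_eq_self[OF eigen_zero])

lemma eproj_diff:
  assumes "x \<in> carrier M" "y \<in> carrier M"
  shows "pr (x \<ominus> y) = pr x \<ominus> pr y"
proof -
  have "pr x = pr ((x \<ominus> y) \<oplus> y)" using assms by (simp add: M.diff_add_cancel)
  also have "\<dots> = pr (x \<ominus> y) \<oplus> pr y" using assms by (intro eproj_add) auto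
  finally show ?thesis
    using assms eproj_closed[of "x \<ominus> y"] eproj_closed[of y]
    by (simp add: a_minus_def M.a_assoc M.r_neg)
qed

text \<open>By \<open>eigen_independent\<close> the components in \<open>M\<close> of an element of
  \<open>H\<close> lie in \<open>H\<close> again, so its decomposition takes place inside
  \<open>H\<close>.\<close>

lemma submodule_eigen_span:
  assumes H: "submodule H (weyl n) M" and x: "x \<in> H"
  shows "x \<in> eigen_span n d lam (sub_mod M H) UNIV"
proof -
  interpret H: left_module_submodule "weyl n" M H
    by (intro left_module_submodule.intro left_module_axioms assms)
  interpret S: weyl_module n "sub_mod M H" d lam
    by (intro weyl_module.intro H.left_module_sub_mod)
  have "x \<in> eigen_span n d lam M UNIV" using span x H.H_closed by blast
  then obtain f where f: "\<forall>k. f k \<in> eigen n d M (lam + of_int k)" "finite {k. f k \<noteq> \<zero>}"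
     "x = finsum M f {k. f k \<noteq> \<zero>}" using eigen_span_finsum by blast
  let ?F = "{k. f k \<noteq> \<zero>}"
  have fH: "\<forall>k\<in>?F. f k \<in> H"
    by (rule eigen_independent[OF H f(2)]) (use f x in auto)
  have "finsum M f F \<in> eigen_span n d lam (sub_mod M H) UNIV" if "finite F" "F \<subseteq> ?F" for F
    using that
  proof (induction F rule: finite_induct)
    case empty
    show ?case using eigen_span.zero[of "sub_mod M H"] by simp
  next
    case (insert k F)
    have "f k \<in> eigen n d (sub_mod M H) (lam + of_int k)"
      using insert fH f(1) by (auto simp: eigen_def)
    hence "f k \<in> eigen_span n d lam (sub_mod M H) UNIV" by (intro eigen_span.eigen) auto
    from eigen_span.add[OF this insert.IH] insert(4)
    have "f k \<oplus> finsum M f F \<in> eigen_span n d lam (sub_mod M H) UNIV" by simp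
    moreover have "finsum M f (insert k F) = f k \<oplus> finsum M f F"
      by (rule M.finsum_insert) (use insert f(1) eigen_carrier in auto)
    ultimately show ?case by simp
  qed
  thus ?thesis using f by blast
qed

lemma euler_mod_sub:
  assumes H: "submodule H (weyl n) M"
  shows "euler_mod n (sub_mod M H) d lam"
proof -
  interpret H: left_module_submodule "weyl n" M H
    by (intro left_module_submodule.intro left_module_axioms assms)
  show ?thesis
    using submodule_eigen_span[OF H]
    by (intro euler_mod.intro weyl_module.intro H.left_module_sub_mod euler_mod_axioms.intro) auto
qed

lemma euler_mod_quot:
  assumes H: "submodule H (weyl n) M"
  shows "euler_mod n (quot_mod M H) d lam"
proof -
  interpret H: left_module_submodule "weyl n" M H
    by (intro left_module_submodule.intro left_module_axioms assms)
  have "H +> x \<in> eigen_span n d lam (quot_mod M H) UNIV" if "x \<in> carrier M" for x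
    using that
  proof (induction rule: carrier_induct)
    case (eigen k x)
    have "x \<in> carrier M" using eigen eigen_carrier by blast
    hence "H +> x \<in> eigen n d (quot_mod M H) (lam + of_int k)"
      using eigen by (simp add: eigen_def H.coset_quot_mod H.quot_mod_smult euler_weyl_carrier
          weyl_carrier.scal)
    thus ?case by (intro eigen_span.eigen) auto
  next
    case (add x y)
    from eigen_span.add[OF add(3,4)] add(1,2) show ?case by (simp add: H.coset_add)
  qed
  thus ?thesis
    by (intro euler_mod.intro weyl_module.intro H.left_module_quot_mod euler_mod_axioms.intro)
      (auto simp: H.quot_mod_carrier)
qed

end

lemma euler_mod_iff: "euler_mod n M d lam \<longleftrightarrow> euler_module n d (lam :: 'k::field_char_0) M"
proof
  assume "euler_mod n M d lam"
  thus "euler_module n d lam M" by (rule euler_mod.euler_module)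
next
  assume e: "euler_module n d lam M"
  hence l: "left_module (weyl n) M" unfolding euler_module_def by blast
  interpret weyl_module n M d lam by (intro weyl_module.intro l)
  show "euler_mod n M d lam"
    by (intro euler_mod.intro weyl_module_axioms euler_mod_axioms.intro)
      (use e euler_module_iff in blast)
qed

text \<open>Linear maps preserve every eigenspace, hence the projections. Applied to inclusions and
  to coset maps, this is the exactness of passing to degree zero.\<close>

lemma eproj_natural:
  assumes "euler_mod n M d lam" "euler_mod n N d lam"
    and f: "f \<in> lin_maps (weyl n) M N" and x: "x \<in> carrier M"
  shows "eproj n d lam N (f x) = f (eproj n d lam M x)"
proof -
  interpret M: euler_mod n M d lam by fact
  interpret N: euler_mod n N d lam by fact
  have e: "f y \<in> eigen n d N \<mu>" if "y \<in> eigen n d M \<mu>" for y \<mu>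
  proof -
    have "y \<in> carrier M" "euler n d \<odot>\<^bsub>M\<^esub> y = scal \<mu> \<odot>\<^bsub>M\<^esub> y" using that by (simp_all add: eigen_def)
    thus ?thesis using lin_mapsD(1)[OF f, of y] lin_mapsD(3)[OF f, of "euler n d" y]
      lin_mapsD(3)[OF f, of "scal \<mu>" y]
      by (simp add: eigen_def euler_weyl_carrier weyl_carrier.scal)
  qed
  have f0: "f \<zero>\<^bsub>M\<^esub> = \<zero>\<^bsub>N\<^esub>"
    by (rule lin_maps_zero[OF f M.left_module_axioms N.left_module_axioms])
  show ?thesis using x
  proof (induction rule: M.carrier_induct)
    case (eigen k x)
    show ?case using M.eproj_on_eigen[OF eigen] N.eproj_on_eigen[OF e[OF eigen]] f0 by simp
  next
    case (add x y)
    thus ?case using lin_mapsD[OF f] by (simp add: M.eproj_add N.eproj_add M.eproj_closed)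
  qed
qed

context euler_mod
begin

lemma eproj_submodule:
  assumes H: "submodule H (weyl n) M" and x: "x \<in> H"
  shows "pr x \<in> H"
proof -
  interpret H: left_module_submodule "weyl n" M H
    by (intro left_module_submodule.intro left_module_axioms assms)
  interpret S: euler_mod n "sub_mod M H" d lam by (rule euler_mod_sub[OF H])
  have "restrict (\<lambda>x. x) H \<in> lin_maps (weyl n) (sub_mod M H) M"
    by (rule lin_mapsI) (auto simp: H.H_closed H.H_add H.H_smult)
  from eproj_natural[OF S.euler_mod_axioms euler_mod_axioms this, of x] x S.eproj_closed[of x]
  show ?thesis by simp
qed

end

section \<open>Torsion modules\<close>

lemma comp_funpow_commute: "P \<circ> Q = Q \<circ> P \<Longrightarrow> P \<circ> (Q ^^ t) = (Q ^^ t) \<circ> P"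
proof (induction t)
  case (Suc t)
  have "P \<circ> (Q ^^ Suc t) = (P \<circ> Q) \<circ> (Q ^^ t)" by (simp only: funpow.simps comp_assoc)
  also have "\<dots> = Q \<circ> (P \<circ> (Q ^^ t))" unfolding Suc.prems by (simp only: comp_assoc)
  also have "\<dots> = (Q ^^ Suc t) \<circ> P" unfolding Suc.IH[OF Suc.prems] by (simp only: funpow.simps comp_assoc)
  finally show ?case .
qed simp

lemma weyl_carrier_funpow: "P \<in> weyl_carrier n \<Longrightarrow> (P ^^ t) \<in> weyl_carrier n"
proof (induction t)
  case 0
  show ?case using weyl_carrier_id by (simp add: id_def)
next
  case (Suc t)
  show ?case unfolding funpow.simps by (intro weyl_carrier.comp Suc)
qed

lemma xop_funpow: "xop i ^^ t = mulop (Poly_Mapping.single (Poly_Mapping.single i t) 1)"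
proof (induction t)
  case 0
  show ?case by (simp add: mulop_def id_def)
next
  case (Suc t)
  have "Poly_Mapping.single i (1::nat) + Poly_Mapping.single i t = Poly_Mapping.single i (Suc t)"
    by (simp flip: single_add)
  thus ?case unfolding funpow.simps Suc unfolding xop_def by (simp only: mulop_comp mult_single mult_1)
qed

text \<open>\<open>torsion\<close> is defined through the operators \<open>mulop p\<close>; here
  those of monomials are recognised as elements of the algebra, being products of powers of the
  variables.\<close>

lemma mulop_single_weyl_carrier:
  fixes c :: "'k::field"
  assumes "Poly_Mapping.keys m \<subseteq> {..n}"
  shows "mulop (Poly_Mapping.single m c) \<in> weyl_carrier n"
proof -
  have "mulop (Poly_Mapping.single (\<Sum>i\<in>A. Poly_Mapping.single i (g i)) (1::'k)) \<in> weyl_carrier n"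
    if "finite A" "A \<subseteq> {..n}" for A and g :: "nat \<Rightarrow> nat"
    using that
  proof (induction A rule: finite_induct)
    case empty
    show ?case using weyl_carrier_id by (simp add: mulop_def)
  next
    case (insert i A)
    hence "(xop i ^^ g i) \<circ> mulop (Poly_Mapping.single (\<Sum>i\<in>A. Poly_Mapping.single i (g i)) (1::'k))
      \<in> weyl_carrier n"
      by (intro weyl_carrier.comp weyl_carrier_funpow weyl_carrier.xop) auto
    thus ?case using insert by (simp add: xop_funpow mulop_comp mult_single)
  qed
  from this[OF finite_keys assms, of "Poly_Mapping.lookup m"]
  have "mulop (Poly_Mapping.single (\<Sum>i\<in>Poly_Mapping.keys m. Poly_Mapping.single i (Poly_Mapping.lookup m i)) (1::'k))
    \<in> weyl_carrier n" .
  also have "(\<Sum>i\<in>Poly_Mapping.keys m. Poly_Mapping.single i (Poly_Mapping.lookup m i)) = m"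
    by (rule poly_mapping_eqI) (simp add: lookup_sum lookup_exp_simps in_keys_iff)
  finally have "scal c \<circ> mulop (Poly_Mapping.single m 1) \<in> weyl_carrier n"
    by (intro weyl_carrier.comp weyl_carrier.scal)
  thus ?thesis by (simp add: scal_def mulop_comp mult_single)
qed

context weyl_module
begin

lemma act_funpow_Suc:
  "P \<in> weyl_carrier n \<Longrightarrow> x \<in> carrier M \<Longrightarrow> (P ^^ Suc t) \<odot> x = P \<odot> ((P ^^ t) \<odot> x)"
  unfolding funpow.simps by (intro act_comp weyl_carrier_funpow)

lemma act_funpow_add:
  assumes "P \<in> weyl_carrier n" "x \<in> carrier M"
  shows "(P ^^ (s + t)) \<odot> x = (P ^^ s) \<odot> ((P ^^ t) \<odot> x)"
  unfolding funpow_add by (intro act_comp weyl_carrier_funpow assms)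

lemma act_funpow_0: "x \<in> carrier M \<Longrightarrow> (P ^^ 0) \<odot> x = x"
  using act_id by (simp add: id_def)

lemma act_commute:
  assumes "P \<in> weyl_carrier n" "Q \<in> weyl_carrier n" "P \<circ> Q = Q \<circ> P" "x \<in> carrier M"
  shows "P \<odot> (Q \<odot> x) = Q \<odot> (P \<odot> x)"
  using act_comp[OF assms(1,2,4)] act_comp[OF assms(2,1,4)] assms(3) by simp

text \<open>Heisenberg relation: applying \<open>P\<close> to the power \<open>t + 1\<close> of
  \<open>Q\<close> on \<open>v\<close> returns \<open>c * (t + 1)\<close> times the power
  \<open>t\<close>, and this factor is nonzero in characteristic zero. Used for a variable and its
  derivative in either order, with \<open>c = 1\<close> and \<open>c = - 1\<close>.\<close>

lemma funpow_act_nonzero: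
  assumes P: "P \<in> weyl_carrier n" and Q: "Q \<in> weyl_carrier n"
    and comm: "P \<circ> Q = (\<lambda>p. (Q \<circ> P) p + scal c p)" and c: "c \<noteq> 0"
    and v: "v \<in> carrier M" "v \<noteq> \<zero>" "P \<odot> v = \<zero>"
  shows "(Q ^^ t) \<odot> v \<noteq> \<zero>"
proof -
  have PQ: "P \<odot> (Q \<odot> x) = Q \<odot> (P \<odot> x) \<oplus> scal c \<odot> x" if "x \<in> carrier M" for x
    using act_comp[OF P Q that] act_comp[OF Q P that] that
      act_add_op[OF weyl_carrier.comp[OF Q P] weyl_carrier.scal that, of c] comm by simp
  have C: "(Q ^^ t) \<odot> v \<in> carrier M" for t by (intro act_closed weyl_carrier_funpow Q v)
  have *: "P \<odot> ((Q ^^ Suc t) \<odot> v) = scal (c * of_nat (Suc t)) \<odot> ((Q ^^ t) \<odot> v)" for t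
  proof (induction t)
    case 0
    have "P \<odot> (Q \<odot> v) = scal c \<odot> v" using PQ[OF v(1)] v Q
      by (simp add: act_zero act_closed weyl_carrier.scal)
    thus ?case unfolding act_funpow_Suc[OF Q v(1), of 0] act_funpow_0[OF v(1)] by simp
  next
    case (Suc t)
    have "P \<odot> ((Q ^^ Suc (Suc t)) \<odot> v) = P \<odot> (Q \<odot> ((Q ^^ Suc t) \<odot> v))"
      using act_funpow_Suc[OF Q v(1), of "Suc t"] by simp
    also have "\<dots> = Q \<odot> (P \<odot> ((Q ^^ Suc t) \<odot> v)) \<oplus> scal c \<odot> ((Q ^^ Suc t) \<odot> v)"
      by (rule PQ[OF C])
    also have "Q \<odot> (P \<odot> ((Q ^^ Suc t) \<odot> v)) = scal (c * of_nat (Suc t)) \<odot> (Q \<odot> ((Q ^^ t) \<odot> v))"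
      unfolding Suc by (rule act_scal_comm[OF Q C])
    also have "Q \<odot> ((Q ^^ t) \<odot> v) = (Q ^^ Suc t) \<odot> v" by (rule act_funpow_Suc[OF Q v(1), symmetric])
    also have "scal (c * of_nat (Suc t)) \<odot> ((Q ^^ Suc t) \<odot> v) \<oplus> scal c \<odot> ((Q ^^ Suc t) \<odot> v) =
      scal (c * of_nat (Suc t) + c) \<odot> ((Q ^^ Suc t) \<odot> v)" by (rule act_scal_add[OF C, symmetric])
    also have "c * of_nat (Suc t) + c = c * of_nat (Suc (Suc t))" by (simp add: algebra_simps)
    finally show ?case .
  qed
  show ?thesis
  proof (induction t)
    case 0
    show ?case unfolding act_funpow_0[OF v(1)] by (rule v(2))
  next
    case (Suc t)
    show ?case
    proof
      assume "(Q ^^ Suc t) \<odot> v = \<zero>"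
      hence "scal (c * of_nat (Suc t)) \<odot> ((Q ^^ t) \<odot> v) = \<zero>" using *[of t] act_zero[OF P] by simp
      moreover have "c * of_nat (Suc t) \<noteq> 0" using c of_nat_neq_0 by (simp del: of_nat_Suc)
      ultimately show False using act_scal_eq_zero[OF C] Suc by blast
    qed
  qed
qed

lemma xop_funpow_nonzero:
  assumes "i \<le> n" "v \<in> carrier M" "v \<noteq> \<zero>" "pdop i \<odot> v = \<zero>"
  shows "(xop i ^^ t) \<odot> v \<noteq> \<zero>"
  by (rule funpow_act_nonzero[of "pdop i" "xop i" 1])
    (use assms pdop_xop_same[of i n] in \<open>auto simp: weyl_carrier.xop weyl_carrier.pdop scal_one\<close>)

lemma pdop_funpow_nonzero:
  assumes "i \<le> n" "v \<in> carrier M" "v \<noteq> \<zero>" "xop i \<odot> v = \<zero>"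
  shows "(pdop i ^^ t) \<odot> v \<noteq> \<zero>"
proof (rule funpow_act_nonzero[of "xop i" "pdop i" "-1"])
  show "xop i \<circ> pdop i = (\<lambda>p. (pdop i \<circ> xop i) p + scal (- 1) p)"
    unfolding pdop_xop_same[OF assms(1)] by (simp add: scal_minus_one comp_def)
qed (use assms in \<open>auto simp: weyl_carrier.xop weyl_carrier.pdop\<close>)

text \<open>The operators are treated one after the other: each is applied as often as possible
  without killing the vector, and commutativity keeps the vector in the kernel of those treated
  before. The exponents \<open>s\<close> are recorded because the degree of \<open>u\<close> will be
  compared with an eigenvalue.\<close>

lemma ex_annihilated:
  assumes "finite I" and P: "\<And>i. i \<in> I \<Longrightarrow> weyl_homog n d (e i) (P i)"
    and comm: "\<And>i j. i \<in> I \<Longrightarrow> j \<in> I \<Longrightarrow> P i \<circ> P j = P j \<circ> P i"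
    and v: "v \<in> eigen n d M (lam + of_int k)" "v \<noteq> \<zero>"
    and nil: "\<And>i. i \<in> I \<Longrightarrow> \<exists>s. (P i ^^ s) \<odot> v = \<zero>"
  shows "\<exists>u s. u \<in> eigen n d M (lam + of_int (k + (\<Sum>i\<in>I. int (s i) * e i))) \<and> u \<noteq> \<zero> \<and>
     (\<forall>i\<in>I. P i \<odot> u = \<zero>)"
proof -
  have PW: "P i \<in> weyl_carrier n" if "i \<in> I" for i using P[OF that] by (rule weyl_homog_weyl_carrier)
  have vC: "v \<in> carrier M" using v(1) by (rule eigen_carrier)
  \<comment> \<open>\<open>u\<close> is kept in the form \<open>Q \<odot> v\<close> with
    \<open>Q\<close> commuting with every \<open>P i\<close>, so that nilpotency on \<open>v\<close>
    carries over to \<open>u\<close>.\<close>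
  have "\<exists>u s Q. u \<in> eigen n d M (lam + of_int (k + (\<Sum>i\<in>J. int (s i) * e i))) \<and> u \<noteq> \<zero> \<and>
     (\<forall>i\<in>J. P i \<odot> u = \<zero>) \<and> Q \<in> weyl_carrier n \<and> (\<forall>i\<in>I. P i \<circ> Q = Q \<circ> P i) \<and> u = Q \<odot> v"
    if "finite J" "J \<subseteq> I" for J
    using that
  proof (induction J rule: finite_induct)
    case empty
    show ?case
      by (rule exI[of _ v], rule exI, rule exI[of _ "\<lambda>p. p"])
        (use v vC weyl_carrier_id in \<open>simp add: act_id comp_def\<close>)
  next
    case (insert j J)
    hence "J \<subseteq> I" by simp
    from insert.IH[OF this] obtain u s Q where u: "u \<in> eigen n d M (lam + of_int (k + (\<Sum>i\<in>J. int (s i) * e i)))"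
      "u \<noteq> \<zero>" "\<forall>i\<in>J. P i \<odot> u = \<zero>" "Q \<in> weyl_carrier n" "\<forall>i\<in>I. P i \<circ> Q = Q \<circ> P i" "u = Q \<odot> v"
      by (elim exE conjE) (rule that)
    have j: "j \<in> I" using insert by simp
    have uC: "u \<in> carrier M" using u(1) by (rule eigen_carrier)
    obtain r where r: "(P j ^^ r) \<odot> v = \<zero>" using nil[OF j] by blast
    have "Q \<circ> P j = P j \<circ> Q" using u(5) j by simp
    hence "Q \<circ> (P j ^^ r) = (P j ^^ r) \<circ> Q" by (rule comp_funpow_commute)
    hence "(P j ^^ r) \<odot> u = Q \<odot> ((P j ^^ r) \<odot> v)"
      unfolding u(6) by (intro act_commute weyl_carrier_funpow PW j u(4) vC) simp
    hence ex: "\<exists>r. (P j ^^ r) \<odot> u = \<zero>" using r act_zero[OF u(4)] by auto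
    \<comment> \<open>The last power of \<open>P j\<close> not killing \<open>u\<close> has exponent
      one less than the least one that does; the latter is positive because \<open>u\<close> is
      nonzero.\<close>
    define r where "r = (LEAST r. (P j ^^ r) \<odot> u = \<zero>)"
    have r0: "(P j ^^ r) \<odot> u = \<zero>" unfolding r_def using ex by (rule LeastI_ex)
    have "r \<noteq> 0" using r0 u(2) act_funpow_0[OF uC, of "P j"] by metis
    then obtain t where t: "r = Suc t" using not0_implies_Suc by blast
    define w where "w = (P j ^^ t) \<odot> u"
    have w0: "w \<noteq> \<zero>" unfolding w_def using not_less_Least[of t "\<lambda>r. (P j ^^ r) \<odot> u = \<zero>"] t r_def by auto
    have "P j \<odot> w = \<zero>" using r0 act_funpow_Suc[OF PW[OF j] uC, of t] unfolding t w_def by simp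
    moreover have "P i \<odot> w = \<zero>" if "i \<in> J" for i
    proof -
      have i: "i \<in> I" using that insert by blast
      have "P i \<odot> w = (P j ^^ t) \<odot> (P i \<odot> u)" unfolding w_def
        by (intro act_commute weyl_carrier_funpow PW i j uC comp_funpow_commute comm)
      thus ?thesis using u(3) that act_zero[OF weyl_carrier_funpow[OF PW[OF j]], of t] by simp
    qed
    moreover have "w \<in> eigen n d M (lam + of_int (k + (\<Sum>i\<in>insert j J. int ((s(j := t)) i) * e i)))"
    proof -
      have "(\<Sum>i\<in>J. int ((s(j := t)) i) * e i) = (\<Sum>i\<in>J. int (s i) * e i)"
        by (rule sum.cong) (use insert in auto)
      moreover have "w \<in> eigen n d M (lam + of_int (k + (\<Sum>i\<in>J. int (s i) * e i)) + of_int (int t * e j))"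
        unfolding w_def by (rule eigen_homog[OF weyl_homog_funpow[OF P[OF j]] u(1)])
      ultimately show ?thesis using insert(1,2) by (simp add: algebra_simps)
    qed
    moreover have "w = ((P j ^^ t) \<circ> Q) \<odot> v"
      unfolding w_def u(6) by (intro act_comp[symmetric] weyl_carrier_funpow PW j u(4) vC)
    moreover have "\<forall>i\<in>I. P i \<circ> ((P j ^^ t) \<circ> Q) = ((P j ^^ t) \<circ> Q) \<circ> P i"
    proof
      fix i assume i: "i \<in> I"
      have 1: "P i \<circ> (P j ^^ t) = (P j ^^ t) \<circ> P i" by (intro comp_funpow_commute comm i j)
      have "P i \<circ> ((P j ^^ t) \<circ> Q) = (P i \<circ> (P j ^^ t)) \<circ> Q" by (simp only: comp_assoc)
      also have "\<dots> = (P j ^^ t) \<circ> (P i \<circ> Q)" unfolding 1 by (simp only: comp_assoc)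
      also have "P i \<circ> Q = Q \<circ> P i" using u(5) i by simp
      finally show "P i \<circ> ((P j ^^ t) \<circ> Q) = ((P j ^^ t) \<circ> Q) \<circ> P i" by (simp only: comp_assoc)
    qed
    moreover have "(P j ^^ t) \<circ> Q \<in> weyl_carrier n"
      by (intro weyl_carrier.comp weyl_carrier_funpow PW j u(4))
    ultimately show ?case using w0 by (intro exI[of _ w] exI[of _ "s(j := t)"] exI[of _ "(P j ^^ t) \<circ> Q"]) blast
  qed
  from this[OF assms(1) subset_refl] show ?thesis by blast
qed

lemma euler_act:
  assumes "x \<in> carrier M"
  shows "euler n d \<odot> x = finsum M (\<lambda>i. scal (of_nat (d i)) \<odot> (xop i \<odot> (pdop i \<odot> x))) {..n}"
proof -
  let ?T = "\<lambda>i. scal (of_nat (d i)) \<circ> (xop i \<circ> pdop i) :: 'k oper"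
  have "(\<lambda>p. \<Sum>i\<in>A. ?T i p) \<in> weyl_carrier n \<and>
    (\<lambda>p. \<Sum>i\<in>A. ?T i p) \<odot> x =
    finsum M (\<lambda>i. scal (of_nat (d i)) \<odot> (xop i \<odot> (pdop i \<odot> x))) A"
    if "finite A" "A \<subseteq> {..n}" for A
    using that
  proof (induction A rule: finite_induct)
    case empty
    show ?case using weyl_carrier_zero act_zero_op assms by simp
  next
    case (insert i A)
    let ?S = "\<lambda>p. \<Sum>i\<in>A. ?T i p"
    have i: "i \<le> n" using insert by simp
    have W: "?T i \<in> weyl_carrier n"
      by (intro weyl_carrier.intros i)
    have eq: "(\<lambda>p. \<Sum>i\<in>insert i A. ?T i p) =
      (\<lambda>p. ?T i p + ?S p)"
      by (rule ext) (simp only: sum.insert[OF insert(1,2)])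
    have "A \<subseteq> {..n}" using insert(4) by simp
    note S = conjunct1[OF insert.IH[OF this]] conjunct2[OF insert.IH[OF this]]
    have a: "?T i \<odot> x = scal (of_nat (d i)) \<odot> (xop i \<odot> (pdop i \<odot> x))"
      using act_comp[of "scal (of_nat (d i))" "xop i \<circ> pdop i" x] act_comp[of "xop i" "pdop i" x]
        assms i by (simp add: weyl_carrier.scal weyl_carrier.xop weyl_carrier.pdop weyl_carrier.comp)
    have C: "(\<lambda>i. scal (of_nat (d i)) \<odot> (xop i \<odot> (pdop i \<odot> x))) \<in> insert i A \<rightarrow> carrier M"
      using insert(4) assms
      by (intro Pi_I act_closed weyl_carrier.scal weyl_carrier.xop weyl_carrier.pdop) auto
    have "finsum M (\<lambda>i. scal (of_nat (d i)) \<odot> (xop i \<odot> (pdop i \<odot> x))) (insert i A) =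
      scal (of_nat (d i)) \<odot> (xop i \<odot> (pdop i \<odot> x)) \<oplus> ?S \<odot> x"
      unfolding S(2) by (rule M.finsum_insert) (use insert C in auto)
    thus ?case unfolding eq using act_add_op[OF W S(1) assms] weyl_carrier.add[OF W S(1)] a by simp
  qed
  from this[of "{..n}"] show ?thesis unfolding euler_sum_comp by simp
qed

lemma eigen_annihilated_pdop:
  assumes "x \<in> carrier M" "\<And>i. i \<le> n \<Longrightarrow> pdop i \<odot> x = \<zero>"
  shows "euler n d \<odot> x = \<zero>"
proof -
  have "euler n d \<odot> x = finsum M (\<lambda>i. \<zero>) {..n}"
    unfolding euler_act[OF assms(1)]
    by (rule M.finsum_cong') (use assms in \<open>auto simp: act_zero weyl_carrier.intros\<close>)
  thus ?thesis by simp
qed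

text \<open>On such a vector \<open>x\<^sub>i \<partial>\<^sub>i = \<partial>\<^sub>i x\<^sub>i -
  1\<close> acts as \<open>- 1\<close>, so each summand of the Euler field contributes
  \<open>- d\<^sub>i\<close>.\<close>

lemma eigen_annihilated_xop:
  assumes "x \<in> carrier M" "\<And>i. i \<le> n \<Longrightarrow> xop i \<odot> x = \<zero>"
  shows "euler n d \<odot> x = scal (- of_nat (\<Sum>i\<le>n. d i)) \<odot> x"
proof -
  have *: "xop i \<odot> (pdop i \<odot> x) = scal (- 1) \<odot> x" if "i \<le> n" for i
  proof -
    have W: "(xop i :: 'k oper) \<in> weyl_carrier n" "(pdop i :: 'k oper) \<in> weyl_carrier n"
      using that by (blast intro: weyl_carrier.intros)+
    have C: "xop i \<odot> (pdop i \<odot> x) \<in> carrier M" by (intro act_closed W assms)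
    have "pdop i \<odot> (xop i \<odot> x) = (\<lambda>p. (xop i \<circ> pdop i) p + p) \<odot> x"
      unfolding pdop_xop_same[OF that, symmetric] by (rule act_comp[OF W(2,1) assms(1), symmetric])
    also have "\<dots> = xop i \<odot> (pdop i \<odot> x) \<oplus> x"
      using act_add_op[OF weyl_carrier.comp[OF W] weyl_carrier_id assms(1)]
        act_comp[OF W assms(1)] act_id[OF assms(1)] by simp
    finally have "xop i \<odot> (pdop i \<odot> x) \<oplus> x = \<zero>" using assms that act_zero W by simp
    hence "\<ominus> x = xop i \<odot> (pdop i \<odot> x)" using M.minus_equality C assms(1) by blast
    moreover have "scal (- 1) \<odot> x = \<ominus> x"
      using act_scal_diff[OF assms(1), of 0 1] assms(1)
      by (simp add: act_scal_zero act_scal_one a_minus_def)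
    ultimately show ?thesis by simp
  qed
  have "finsum M (\<lambda>i. scal (of_nat (d i)) \<odot> (xop i \<odot> (pdop i \<odot> x))) A =
    scal (- of_nat (\<Sum>i\<in>A. d i)) \<odot> x" if "finite A" "A \<subseteq> {..n}" for A
    using that
  proof (induction A rule: finite_induct)
    case empty
    show ?case using act_scal_zero assms by simp
  next
    case (insert i A)
    have e: "scal (of_nat (d j)) \<odot> (xop j \<odot> (pdop j \<odot> x)) = scal (- of_nat (d j)) \<odot> x" if "j \<le> n" for j
      using *[OF that] act_scal_scal[OF assms(1)] by simp
    have C: "scal (of_nat (d j)) \<odot> (xop j \<odot> (pdop j \<odot> x)) \<in> carrier M" if "j \<le> n" for j
      unfolding e[OF that] by (intro act_closed weyl_carrier.scal assms)
    have "finsum M (\<lambda>i. scal (of_nat (d i)) \<odot> (xop i \<odot> (pdop i \<odot> x))) (insert i A) =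
      scal (of_nat (d i)) \<odot> (xop i \<odot> (pdop i \<odot> x)) \<oplus> scal (- of_nat (\<Sum>i\<in>A. d i)) \<odot> x"
      using insert C by (subst M.finsum_insert) (auto simp: Pi_def subset_iff)
    also have "\<dots> = scal (- of_nat (d i) + - of_nat (\<Sum>i\<in>A. d i)) \<odot> x"
      unfolding act_scal_add[OF assms(1)] using e insert by simp
    finally show ?case using insert(1,2) by simp
  qed
  from this[of "{..n}"] show ?thesis unfolding euler_act[OF assms(1)] by simp
qed

text \<open>From right to left a pigeonhole argument: a monomial of weighted degree above
  \<open>\<Sum> N\<^sub>i d\<^sub>i\<close> contains some \<open>x\<^sub>i\<close> at least
  \<open>N\<^sub>i\<close> times. Nilpotency of single variables is the form of torsion to which the
  commutation relations apply.\<close>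

lemma torsion_iff_xop_nilpotent:
  assumes "\<And>i. i \<le> n \<Longrightarrow> 0 < d i"
  shows "torsion n d M \<longleftrightarrow> (\<forall>x\<in>carrier M. \<forall>i\<le>n. \<exists>N. (xop i ^^ N) \<odot> x = \<zero>)"
proof
  assume t: "torsion n d M"
  show "\<forall>x\<in>carrier M. \<forall>i\<le>n. \<exists>N. (xop i ^^ N) \<odot> x = \<zero>"
  proof (intro ballI allI impI)
    fix x i assume x: "x \<in> carrier M" and i: "i \<le> n"
    obtain N where N: "\<And>k p. k > N \<Longrightarrow> p \<in> pol_homog n d k \<Longrightarrow> mulop p \<odot> x = \<zero>"
      using t x unfolding torsion_def by blast
    have "(Poly_Mapping.single (Poly_Mapping.single i (Suc N)) 1 :: 'k pol) \<in> pol_homog n d (Suc N * d i)"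
      using i wdeg_single[OF i, of d "Suc N"] by (simp add: pol_homog_def wdeg_def mult.commute)
    \<comment> \<open>Weights are positive, so the degree of a power of a variable is at least its
      exponent.\<close>
    moreover have "Suc N * d i > N"
      using mult_le_mono2[of 1 "d i" "Suc N"] assms[OF i] by simp
    ultimately have "mulop (Poly_Mapping.single (Poly_Mapping.single i (Suc N)) 1) \<odot> x = \<zero>"
      using N by blast
    thus "\<exists>N. (xop i ^^ N) \<odot> x = \<zero>" unfolding xop_funpow by blast
  qed
next
  assume nil: "\<forall>x\<in>carrier M. \<forall>i\<le>n. \<exists>N. (xop i ^^ N) \<odot> x = \<zero>"
  show "torsion n d M"
    unfolding torsion_def
  proof
    fix x assume x: "x \<in> carrier M"
    obtain N where N: "\<And>i. i \<le> n \<Longrightarrow> (xop i ^^ N i) \<odot> x = \<zero>" using nil x by metis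
    have mono: "mulop (Poly_Mapping.single m c) \<in> weyl_carrier n \<and> mulop (Poly_Mapping.single m c) \<odot> x = \<zero>"
      if m: "Poly_Mapping.keys m \<subseteq> {..n}" "i \<le> n" "N i \<le> Poly_Mapping.lookup m i" for m c i
    proof
      define m' where "m' = m - Poly_Mapping.single i (N i)"
      have mm: "m = m' + Poly_Mapping.single i (N i)"
        unfolding m'_def by (rule poly_mapping_eqI) (use m(3) in \<open>auto simp: lookup_exp_simps\<close>)
      have "Poly_Mapping.keys m' \<subseteq> {..n}"
        using m(1) unfolding m'_def by (auto simp: in_keys_iff lookup_exp_simps subset_iff)
      hence W: "mulop (Poly_Mapping.single m' c) \<in> weyl_carrier n" by (rule mulop_single_weyl_carrier)
      have "mulop (Poly_Mapping.single m c) = mulop (Poly_Mapping.single m' c) \<circ> (xop i ^^ N i)"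
        unfolding xop_funpow mulop_comp mult_single mm by simp
      hence "mulop (Poly_Mapping.single m c) \<odot> x = mulop (Poly_Mapping.single m' c) \<odot> ((xop i ^^ N i) \<odot> x)"
        using act_comp[OF W weyl_carrier_funpow[OF weyl_carrier.xop[OF m(2)]] x] by simp
      thus "mulop (Poly_Mapping.single m c) \<odot> x = \<zero>" using N[OF m(2)] act_zero[OF W] by simp
      show "mulop (Poly_Mapping.single m c) \<in> weyl_carrier n" using m(1) by (rule mulop_single_weyl_carrier)
    qed
    show "\<exists>K. \<forall>k>K. \<forall>p\<in>pol_homog n d k. mulop p \<odot> x = \<zero>"
    proof (rule exI[of _ "\<Sum>i\<le>n. N i * d i"], intro allI impI ballI)
      fix k and p :: "'k pol" assume k: "(\<Sum>i\<le>n. N i * d i) < k" and p: "p \<in> pol_homog n d k"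
      have "mulop (\<Sum>m\<in>A. Poly_Mapping.single m (Poly_Mapping.lookup p m)) \<in> weyl_carrier n \<and>
        mulop (\<Sum>m\<in>A. Poly_Mapping.single m (Poly_Mapping.lookup p m)) \<odot> x = \<zero>"
        if "finite A" "A \<subseteq> Poly_Mapping.keys p" for A
        using that
      proof (induction A rule: finite_induct)
        case empty
        show ?case using weyl_carrier_zero act_zero_op x by (simp add: mulop_def)
      next
        case (insert m A)
        have m: "Poly_Mapping.keys m \<subseteq> {..n}" "(\<Sum>i\<le>n. Poly_Mapping.lookup m i * d i) = k"
          using p insert by (auto simp: pol_homog_def)
        have "\<exists>i\<le>n. N i \<le> Poly_Mapping.lookup m i"
        proof (rule ccontr)
          assume "\<not> ?thesis"
          hence "(\<Sum>i\<le>n. Poly_Mapping.lookup m i * d i) \<le> (\<Sum>i\<le>n. N i * d i)"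
            by (intro sum_mono mult_right_mono) auto
          thus False using m(2) k by simp
        qed
        then obtain i where i: "i \<le> n" "N i \<le> Poly_Mapping.lookup m i" by blast
        note W = mono[OF m(1) i, of "Poly_Mapping.lookup p m"]
        have "A \<subseteq> Poly_Mapping.keys p" using insert(4) by simp
        note S = conjunct1[OF insert.IH[OF this]] conjunct2[OF insert.IH[OF this]]
        have "mulop (\<Sum>m\<in>insert m A. Poly_Mapping.single m (Poly_Mapping.lookup p m)) =
          (\<lambda>q. mulop (Poly_Mapping.single m (Poly_Mapping.lookup p m)) q +
               mulop (\<Sum>m\<in>A. Poly_Mapping.single m (Poly_Mapping.lookup p m)) q)"
          using insert(1,2) by (simp add: mulop_def distrib_right)
        thus ?case
          using act_add_op[OF conjunct1[OF W] S(1) x] weyl_carrier.add[OF conjunct1[OF W] S(1)]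
            W S(2) by simp
      qed
      from this[OF finite_keys subset_refl]
      have "mulop (\<Sum>m\<in>Poly_Mapping.keys p. Poly_Mapping.single m (Poly_Mapping.lookup p m)) \<odot> x = \<zero>"
        by blast
      moreover have "(\<Sum>m\<in>Poly_Mapping.keys p. Poly_Mapping.single m (Poly_Mapping.lookup p m)) = p"
        by (rule poly_mapping_eqI) (auto simp: lookup_sum lookup_single when_def in_keys_iff)
      ultimately show "mulop p \<odot> x = \<zero>" by simp
    qed
  qed
qed

end


section \<open>The torsion criterion in degree zero\<close>

context weyl_module
begin

lemma eigen_unique:
  assumes "x \<in> eigen n d M \<mu>" "euler n d \<odot> x = scal \<nu> \<odot> x" "x \<noteq> \<zero>"
  shows "\<mu> = \<nu>"
proof (rule ccontr)
  assume "\<mu> \<noteq> \<nu>"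
  have x: "x \<in> carrier M" "euler n d \<odot> x = scal \<mu> \<odot> x" using assms(1) by (simp_all add: eigen_iff)
  have "scal (\<mu> - \<nu>) \<odot> x = scal \<mu> \<odot> x \<ominus> scal \<nu> \<odot> x" by (rule act_scal_diff[OF x(1)])
  also have "\<dots> = \<zero>"
    using assms(2) x(2) M.diff_self act_closed[OF weyl_carrier.scal x(1)] by metis
  finally show False using act_scal_eq_zero[OF x(1), of "\<mu> - \<nu>"] \<open>\<mu> \<noteq> \<nu>\<close> assms(3) by simp
qed

end

text \<open>Bezout coefficients for one further weight at each step. \<open>G\<close> will be the
  group of degree shifts that are possible modulo \<open>L\<close>.\<close>

lemma int_subgroup_Gcd:
  fixes G :: "int set" and d :: "nat \<Rightarrow> nat"
  assumes zero: "0 \<in> G" and add: "\<And>x y. x \<in> G \<Longrightarrow> y \<in> G \<Longrightarrow> x + y \<in> G"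
    and neg: "\<And>x. x \<in> G \<Longrightarrow> - x \<in> G"
    and "\<And>i. i \<le> n \<Longrightarrow> int (d i) \<in> G"
  shows "int (Gcd (d ` {..n})) \<in> G"
  using assms(4)
proof (induction n)
  case 0
  thus ?case by simp
next
  case (Suc n)
  have nat: "int t * x \<in> G" if "x \<in> G" for t x
    by (induction t) (use that zero add in \<open>auto simp: distrib_right\<close>)
  have mult: "t * x \<in> G" if "x \<in> G" for t x
    using nat[OF that, of "nat t"] neg[OF nat[OF that, of "nat (- t)"]] by (cases "0 \<le> t") auto
  have IH: "int (Gcd (d ` {..n})) \<in> G" using Suc by simp
  obtain u v where uv: "u * int (Gcd (d ` {..n})) + v * int (d (Suc n)) =
    gcd (int (Gcd (d ` {..n}))) (int (d (Suc n)))" using bezout_int by blast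
  have "Gcd (d ` {..Suc n}) = gcd (Gcd (d ` {..n})) (d (Suc n))"
    by (simp add: atMost_Suc gcd.commute)
  hence "int (Gcd (d ` {..Suc n})) = u * int (Gcd (d ` {..n})) + v * int (d (Suc n))"
    unfolding uv by simp
  thus ?case using add[OF mult[OF IH, of u] mult[OF Suc.prems[of "Suc n"], of v]] by simp
qed

locale affine_weights =
  fixes n :: nat and d :: "nat \<Rightarrow> nat" and lam :: "'k::field_char_0"
  assumes d_pos: "i \<le> n \<Longrightarrow> 0 < d i"
    and lam_cases: "lam \<notin> \<int> \<or> (\<exists>b. lam = of_nat (\<Sum>i\<le>n. b i * d i))"
    and Gcd_d: "Gcd (d ` {..n}) = 1"
begin

text \<open>The hypothesis on \<open>lam\<close> enters the torsion criterion through this lemma, in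
  two ways: an integral \<open>lam\<close> is not negative, and the coefficients \<open>b\<close>
  are the exponents of a monomial of degree \<open>lam\<close>.\<close>

lemma lam_nonneg:
  assumes "lam = of_int k"
  obtains b where "k = int (\<Sum>i\<le>n. b i * d i)"
proof -
  have "lam \<in> \<int>" using assms by simp
  then obtain b where "lam = of_nat (\<Sum>i\<le>n. b i * d i)" using lam_cases by blast
  hence "(of_int k :: 'k) = of_int (int (\<Sum>i\<le>n. b i * d i))" using assms by simp
  hence "k = int (\<Sum>i\<le>n. b i * d i)" by (simp only: of_int_eq_iff)
  thus ?thesis by (rule that)
qed

end

locale affine_module = affine_weights n d lam + euler_mod n M d lam
  for n d and lam :: "'k::field_char_0" and M :: "('k oper, 'm) module" (structure)
begin

lemma torsion_imp_eigen_zero: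
  assumes "torsion n d M" "x \<in> eigen n d M lam"
  shows "x = \<zero>"
proof (rule ccontr)
  assume "x \<noteq> \<zero>"
  have x: "x \<in> carrier M" using assms(2) by (rule eigen_carrier)
  have "\<exists>u s. u \<in> eigen n d M (lam + of_int (0 + (\<Sum>i\<in>{..n}. int (s i) * int (d i)))) \<and> u \<noteq> \<zero> \<and>
     (\<forall>i\<in>{..n}. xop i \<odot> u = \<zero>)"
  proof (rule ex_annihilated)
    show "x \<in> eigen n d M (lam + of_int 0)" using assms(2) by simp
    show "\<exists>s. (xop i ^^ s) \<odot> x = \<zero>" if "i \<in> {..n}" for i
      using assms(1) x that torsion_iff_xop_nilpotent d_pos by auto
  qed (use \<open>x \<noteq> \<zero>\<close> in \<open>simp_all only: xop_xop weyl_homog.xop atMost_iff finite_atMost not_False_eq_True\<close>)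
  then obtain u s where u: "u \<in> eigen n d M (lam + of_int (0 + (\<Sum>i\<in>{..n}. int (s i) * int (d i))))"
    "u \<noteq> \<zero>" "\<forall>i\<in>{..n}. xop i \<odot> u = \<zero>" by blast
  have "euler n d \<odot> u = scal (- of_nat (\<Sum>i\<le>n. d i)) \<odot> u"
    by (rule eigen_annihilated_xop) (use u eigen_carrier in auto)
  \<comment> \<open>The eigenvalue of \<open>u\<close> is
    \<open>lam + \<Sum> s\<^sub>i d\<^sub>i\<close> by its degree and
    \<open>- \<Sum> d\<^sub>i\<close> by annihilation, which makes \<open>lam\<close> a negative
    integer.\<close>
  from eigen_unique[OF u(1) this u(2)]
  have "lam = of_int (- (int (\<Sum>i\<le>n. d i) + (\<Sum>i\<in>{..n}. int (s i) * int (d i))))"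
    by (simp add: algebra_simps eq_neg_iff_add_eq_0)
  then obtain b where b: "- (int (\<Sum>i\<le>n. d i) + (\<Sum>i\<in>{..n}. int (s i) * int (d i))) =
     int (\<Sum>i\<le>n. b i * d i)" by (rule lam_nonneg)
  have "0 \<le> (\<Sum>i\<in>{..n}. int (s i) * int (d i))" by (intro sum_nonneg) auto
  moreover have "0 < (\<Sum>i\<le>n. d i)" using d_pos by (intro sum_pos) auto
  ultimately show False using b by linarith
qed

text \<open>Divisibility of \<open>k\<close> by every weight lets a power of a single derivative
  land exactly in degree zero, whichever derivative fails to be nilpotent.\<close>

lemma eigen_lam_nonzero:
  assumes v: "v \<in> eigen n d M (lam + of_int k)" "v \<noteq> \<zero>" and k: "0 \<le> k"
    and dvd: "\<And>j. j \<le> n \<Longrightarrow> int (d j) dvd k"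
  shows "\<exists>w \<in> eigen n d M lam. w \<noteq> \<zero>"
proof (cases "\<exists>j\<le>n. \<forall>s. (pdop j ^^ s) \<odot> v \<noteq> \<zero>")
  case True
  then obtain j where j: "j \<le> n" "\<And>s. (pdop j ^^ s) \<odot> v \<noteq> \<zero>" by blast
  define s where "s = nat (k div int (d j))"
  have s: "int s * int (d j) = k" unfolding s_def using dvd[OF j(1)] k d_pos[OF j(1)]
    by (simp add: pos_imp_zdiv_nonneg_iff)
  have "(pdop j ^^ s) \<odot> v \<in> eigen n d M (lam + of_int k + of_int (int s * (- int (d j))))"
    by (rule eigen_homog[OF weyl_homog_funpow[OF weyl_homog.pdop[OF j(1)]] v(1)])
  also have "of_int (int s * (- int (d j))) = (- of_int k :: 'k)" using s
    by (metis mult_minus_right of_int_minus)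
  finally show ?thesis using j(2) by (intro bexI[of _ "(pdop j ^^ s) \<odot> v"]) auto
next
  case False
  have "\<exists>u s. u \<in> eigen n d M (lam + of_int (k + (\<Sum>i\<in>{..n}. int (s i) * (- int (d i))))) \<and> u \<noteq> \<zero> \<and>
     (\<forall>i\<in>{..n}. pdop i \<odot> u = \<zero>)"
  proof (rule ex_annihilated[OF _ _ _ v])
    show "pdop i \<circ> pdop j = pdop j \<circ> pdop i" if "i \<in> {..n}" "j \<in> {..n}" for i j
      using pdop_pdop[of i n j] that by simp
    show "\<exists>s. (pdop i ^^ s) \<odot> v = \<zero>" if "i \<in> {..n}" for i using False that by auto
  qed (simp_all add: weyl_homog.pdop)
  then obtain u s where u: "u \<in> eigen n d M (lam + of_int (k + (\<Sum>i\<in>{..n}. int (s i) * (- int (d i)))))"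
    "u \<noteq> \<zero>" "\<forall>i\<in>{..n}. pdop i \<odot> u = \<zero>" by blast
  define l where "l = k + (\<Sum>i\<in>{..n}. int (s i) * (- int (d i)))"
  have uC: "u \<in> carrier M" using u(1) by (rule eigen_carrier)
  have "euler n d \<odot> u = scal 0 \<odot> u"
    using eigen_annihilated_pdop[OF uC] u(3) act_scal_zero[OF uC] by simp
  from eigen_unique[OF u(1) this u(2)] have l0: "lam + of_int l = 0" unfolding l_def .
  hence "lam = of_int (- l)" by (simp add: eq_neg_iff_add_eq_0)
  then obtain b where b: "- l = int (\<Sum>i\<le>n. b i * d i)" by (rule lam_nonneg)
  have u0: "u \<in> eigen n d M 0" using u(1) l0 unfolding l_def by simp
  \<comment> \<open>The powers \<open>xop i ^^ b i\<close> are applied one variable at a time. The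
    derivatives for the variables not yet treated still kill \<open>w\<close>, and by
    \<open>xop_funpow_nonzero\<close> this keeps the next vector nonzero.\<close>
  have "\<exists>w. w \<in> eigen n d M (of_nat (\<Sum>i\<in>A. b i * d i)) \<and> w \<noteq> \<zero> \<and> (\<forall>j\<le>n. j \<notin> A \<longrightarrow> pdop j \<odot> w = \<zero>)"
    if "finite A" "A \<subseteq> {..n}" for A
    using that
  proof (induction A rule: finite_induct)
    case empty
    show ?case using u0 u by (intro exI[of _ u]) auto
  next
    case (insert i A)
    hence "A \<subseteq> {..n}" by simp
    from insert.IH[OF this] obtain w where w: "w \<in> eigen n d M (of_nat (\<Sum>i\<in>A. b i * d i))" "w \<noteq> \<zero>"
      "\<forall>j\<le>n. j \<notin> A \<longrightarrow> pdop j \<odot> w = \<zero>" by blast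
    have i: "i \<le> n" using insert by simp
    have wC: "w \<in> carrier M" using w(1) by (rule eigen_carrier)
    define w' where "w' = (xop i ^^ b i) \<odot> w"
    have "w' \<noteq> \<zero>" unfolding w'_def using w insert i wC by (intro xop_funpow_nonzero) auto
    moreover have "w' \<in> eigen n d M (of_nat (\<Sum>i\<in>A. b i * d i) + of_int (int (b i) * int (d i)))"
      unfolding w'_def by (rule eigen_homog[OF weyl_homog_funpow[OF weyl_homog.xop[OF i]] w(1)])
    moreover have "of_nat (\<Sum>i\<in>A. b i * d i) + of_int (int (b i) * int (d i)) =
      (of_nat (\<Sum>i\<in>insert i A. b i * d i) :: 'k)" using insert by simp
    moreover have "pdop j \<odot> w' = \<zero>" if j: "j \<le> n" "j \<notin> insert i A" for j
    proof -
      have "pdop j \<odot> w' = (xop i ^^ b i) \<odot> (pdop j \<odot> w)" unfolding w'_def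
        by (intro act_commute weyl_carrier_funpow weyl_carrier.intros comp_funpow_commute
            pdop_xop_diff[of _ n] i j wC) (use j in auto)
      thus ?thesis using w(3) j act_zero[OF weyl_carrier_funpow[OF weyl_carrier.xop[OF i]]] by simp
    qed
    ultimately show ?case by (intro exI[of _ w']) (metis (no_types, lifting))
  qed
  from this[of "{..n}"] obtain w where w: "w \<in> eigen n d M (of_nat (\<Sum>i\<le>n. b i * d i))" "w \<noteq> \<zero>"
    by auto
  have "(of_nat (\<Sum>i\<le>n. b i * d i) :: 'k) = of_int (- l)" unfolding b by simp
  thus ?thesis using w l0 by (metis \<open>lam = of_int (- l)\<close>)
qed

text \<open>Shifting degrees modulo \<open>L\<close>: if \<open>x\<^sub>i\<close> is not nilpotent on \<open>u\<close>, then either it is not nilpotent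
  on \<open>x\<^sub>j u\<close>, or a power of \<open>x\<^sub>i\<close> moves \<open>u\<close> into the kernel of \<open>x\<^sub>j\<close>, where all powers of
  \<open>\<partial>\<^sub>j\<close> are injective.\<close>

lemma nonnilpotent_shift:
  assumes i: "i \<le> n" and j: "j \<le> n" and L: "0 < L" "int (d i) dvd L"
    and u: "u \<in> eigen n d M (lam + of_int k)" "\<And>N. (xop i ^^ N) \<odot> u \<noteq> \<zero>"
  shows "\<exists>t. \<exists>u'\<in>eigen n d M (lam + of_int (k + int (d j) + L * t)). \<forall>N. (xop i ^^ N) \<odot> u' \<noteq> \<zero>"
proof (cases "\<forall>N. (xop i ^^ N) \<odot> (xop j \<odot> u) \<noteq> \<zero>")
  case True
  have "xop j \<odot> u \<in> eigen n d M (lam + of_int k + of_int (int (d j)))"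
    by (rule eigen_homog[OF weyl_homog.xop[OF j] u(1)])
  thus ?thesis using True by (intro exI[of _ 0] bexI[of _ "xop j \<odot> u"]) (simp_all add: add.assoc)
next
  case False
  then obtain N where N: "(xop i ^^ N) \<odot> (xop j \<odot> u) = \<zero>" by blast
  have uC: "u \<in> carrier M" using u(1) by (rule eigen_carrier)
  have X: "(xop i :: 'k oper) \<in> weyl_carrier n" "(xop j :: 'k oper) \<in> weyl_carrier n"
    "(pdop j :: 'k oper) \<in> weyl_carrier n" using i j by (blast intro: weyl_carrier.intros)+
  \<comment> \<open>For \<open>i = j\<close> the power \<open>N + 1\<close> of \<open>xop i\<close>
    would kill \<open>u\<close>.\<close>
  have "i \<noteq> j"
  proof
    assume "i = j"
    have "(xop i ^^ 1) = (xop i :: 'k oper)" by (simp add: fun_eq_iff)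
    hence "(xop i ^^ (N + 1)) \<odot> u = \<zero>"
      using N act_funpow_add[OF X(1) uC, of N 1] \<open>i = j\<close> by metis
    thus False using u(2) by blast
  qed
  obtain e where e: "L = int (d i) * e" using L(2) by blast
  have "0 < e" using e L(1) by (simp add: zero_less_mult_iff)
  \<comment> \<open>At least \<open>N\<close>, so that \<open>xop j\<close> kills the new vector,
    and with \<open>N' * d i\<close> a multiple of \<open>L\<close>, so that the degree does not
    change modulo \<open>L\<close>.\<close>
  define N' where "N' = N * nat e"
  have N': "N \<le> N'" "int N' * int (d i) = int N * L"
    unfolding N'_def e using \<open>0 < e\<close> by (auto simp: algebra_simps)
  define w where "w = (xop i ^^ N') \<odot> u"
  have w: "w \<in> eigen n d M (lam + of_int k + of_int (int N' * int (d i)))"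
    unfolding w_def by (rule eigen_homog[OF weyl_homog_funpow[OF weyl_homog.xop[OF i]] u(1)])
  have wC: "w \<in> carrier M" using w by (rule eigen_carrier)
  have wN: "(xop i ^^ K) \<odot> w \<noteq> \<zero>" for K
    unfolding w_def using u(2) act_funpow_add[OF X(1) uC, of K N'] by metis
  have xjw: "xop j \<odot> w = \<zero>"
  proof -
    have "xop j \<odot> w = (xop i ^^ N') \<odot> (xop j \<odot> u)" unfolding w_def
      by (intro act_commute weyl_carrier_funpow X uC comp_funpow_commute xop_xop)
    also have "\<dots> = (xop i ^^ (N' - N)) \<odot> ((xop i ^^ N) \<odot> (xop j \<odot> u))"
      using act_funpow_add[OF X(1) act_closed[OF X(2) uC], of "N' - N" N] N'(1) by simp
    also have "\<dots> = \<zero>" unfolding N by (rule act_zero[OF weyl_carrier_funpow[OF X(1)]])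
    finally show ?thesis .
  qed
  \<comment> \<open>Lowering the degree by \<open>(L - 1) * d j\<close> is the same as raising it by
    \<open>d j\<close> modulo \<open>L\<close>.\<close>
  define r where "r = nat (L - 1)"
  have r: "int r = L - 1" using L(1) by (simp add: r_def)
  define u' where "u' = (pdop j ^^ r) \<odot> w"
  have u': "u' \<in> eigen n d M (lam + of_int k + of_int (int N' * int (d i)) + of_int (int r * (- int (d j))))"
    unfolding u'_def by (rule eigen_homog[OF weyl_homog_funpow[OF weyl_homog.pdop[OF j]] w])
  have "k + int N' * int (d i) + int r * (- int (d j)) = k + int (d j) + L * (int N - int (d j))"
    unfolding N'(2) r by (simp add: algebra_simps)
  hence u'e: "u' \<in> eigen n d M (lam + of_int (k + int (d j) + L * (int N - int (d j))))"
    using u' by (metis (no_types, opaque_lifting) add.assoc of_int_add)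
  \<comment> \<open>\<open>xop i\<close> commutes with \<open>pdop j\<close>, so its power on
    \<open>u'\<close> is a power of \<open>pdop j\<close> on \<open>(xop i ^^ K) \<odot> w\<close>,
    a nonzero vector that \<open>xop j\<close> still kills.\<close>
  have "(xop i ^^ K) \<odot> u' \<noteq> \<zero>" for K
  proof -
    have wK: "(xop i ^^ K) \<odot> w \<in> carrier M" by (intro act_closed weyl_carrier_funpow X wC)
    have c: "pdop j \<circ> xop i = xop i \<circ> (pdop j :: 'k oper)" using pdop_xop_diff[OF j i] \<open>i \<noteq> j\<close> by simp
    have "(xop i ^^ K) \<circ> (pdop j ^^ r) = (pdop j ^^ r) \<circ> (xop i ^^ K :: 'k oper)"
      by (rule comp_funpow_commute, rule sym, rule comp_funpow_commute) (rule c)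
    hence "(xop i ^^ K) \<odot> u' = (pdop j ^^ r) \<odot> ((xop i ^^ K) \<odot> w)"
      unfolding u'_def by (intro act_commute weyl_carrier_funpow X wC)
    moreover have "xop j \<odot> ((xop i ^^ K) \<odot> w) = (xop i ^^ K) \<odot> (xop j \<odot> w)"
      by (intro act_commute weyl_carrier_funpow X wC comp_funpow_commute xop_xop)
    hence "xop j \<odot> ((xop i ^^ K) \<odot> w) = \<zero>"
      unfolding xjw using act_zero[OF weyl_carrier_funpow[OF X(1)]] by simp
    hence "(pdop j ^^ r) \<odot> ((xop i ^^ K) \<odot> w) \<noteq> \<zero>"
      by (intro pdop_funpow_nonzero j wK wN)
    ultimately show ?thesis by simp
  qed
  thus ?thesis using u'e by blast
qed

text \<open>Suppose that \<open>xop i\<close> is not nilpotent on some vector, and let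
  \<open>S\<close> be the set of degrees in which this happens. The shifts that preserve
  \<open>S\<close> up to multiples of \<open>L\<close> form a subgroup \<open>G\<close> of the
  integers, and \<open>nonnilpotent_shift\<close> puts every weight into \<open>G\<close>. With
  greatest common divisor 1 every shift is possible, in particular one to a multiple of
  \<open>L\<close>.\<close>

lemma eigen_zero_imp_torsion:
  assumes zero: "\<And>x. x \<in> eigen n d M lam \<Longrightarrow> x = \<zero>"
  shows "torsion n d M"
proof -
  have nil: "\<exists>N. (xop i ^^ N) \<odot> v = \<zero>" if v: "v \<in> eigen n d M (lam + of_int k)" and i: "i \<le> n" for v k i
  proof (rule ccontr)
    assume nonnil: "\<not> ?thesis"
    define L where "L = (\<Prod>j\<le>n. int (d j))"
    have L: "0 < L" unfolding L_def using d_pos by (intro prod_pos) auto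
    have dL: "int (d j) dvd L" if "j \<le> n" for j unfolding L_def using that by (intro dvd_prodI) auto
    define S where "S = {k. \<exists>u\<in>eigen n d M (lam + of_int k). \<forall>N. (xop i ^^ N) \<odot> u \<noteq> \<zero>}"
    define G where "G = {g. \<forall>k\<in>S. \<exists>t. k + g + L * t \<in> S}"
    have kS: "k \<in> S" using nonnil v unfolding S_def by blast
    have G0: "0 \<in> G" unfolding G_def by (auto intro!: exI[of _ 0])
    have Gadd: "g + h \<in> G" if g: "g \<in> G" and h: "h \<in> G" for g h
      unfolding G_def
    proof (rule CollectI, rule ballI)
      fix k assume "k \<in> S"
      then obtain t where "k + g + L * t \<in> S" using g unfolding G_def by blast
      then obtain t' where "(k + g + L * t) + h + L * t' \<in> S" using h unfolding G_def by blast
      hence "k + (g + h) + L * (t + t') \<in> S" by (simp add: algebra_simps)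
      thus "\<exists>t. k + (g + h) + L * t \<in> S" ..
    qed
    have Gneg: "- g \<in> G" if g: "g \<in> G" for g
      unfolding G_def
    proof (rule CollectI, rule ballI)
      fix k assume k: "k \<in> S"
      \<comment> \<open>Modulo \<open>L\<close> the negative of \<open>g\<close> is
        \<open>(L - 1) * g\<close>, so closure under addition is enough.\<close>
      have "int t * g \<in> G" for t
        by (induction t) (use G0 Gadd g in \<open>auto simp: distrib_right\<close>)
      from this[of "nat (L - 1)"] L have "(L - 1) * g \<in> G" by simp
      then obtain t where "k + (L - 1) * g + L * t \<in> S" using k unfolding G_def by blast
      hence "k + (- g) + L * (t + g) \<in> S" by (simp add: algebra_simps)
      thus "\<exists>t. k + - g + L * t \<in> S" ..
    qed
    have Gd: "int (d j) \<in> G" if "j \<le> n" for j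
      unfolding G_def
    proof (rule CollectI, rule ballI)
      fix k assume "k \<in> S"
      then obtain u where "u \<in> eigen n d M (lam + of_int k)" "\<And>N. (xop i ^^ N) \<odot> u \<noteq> \<zero>"
        unfolding S_def by blast
      from nonnilpotent_shift[OF i that L dL[OF i] this]
      show "\<exists>t. k + int (d j) + L * t \<in> S" unfolding S_def by blast
    qed
    have "int (Gcd (d ` {..n})) \<in> G" by (rule int_subgroup_Gcd) (use G0 Gadd Gneg Gd in blast)+
    hence G1: "1 \<in> G" unfolding Gcd_d by simp
    have Gnat: "int t \<in> G" for t
      by (induction t) (use G0 Gadd[OF G1] in auto)
    have "- k \<in> G" using Gnat[of "nat (- k)"] Gneg[OF Gnat[of "nat k"]] by (cases "k \<le> 0") auto
    then obtain t where t: "k + - k + L * t \<in> S" using kS unfolding G_def by blast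
    then obtain u where u: "u \<in> eigen n d M (lam + of_int (L * t))" "\<And>N. (xop i ^^ N) \<odot> u \<noteq> \<zero>"
      unfolding S_def by auto
    obtain e where e: "L = int (d i) * e" using dL[OF i] by blast
    have "0 < e" using e L by (simp add: zero_less_mult_iff)
    \<comment> \<open>Applying \<open>xop i\<close> this often adds \<open>L * \<bar>t\<bar>\<close>
      to the degree, which becomes nonnegative and remains a multiple of \<open>L\<close>.\<close>
    define N where "N = nat e * nat \<bar>t\<bar>"
    have N: "int N * int (d i) = L * \<bar>t\<bar>" unfolding N_def e using \<open>0 < e\<close> by (simp add: algebra_simps)
    have "(xop i ^^ N) \<odot> u \<in> eigen n d M (lam + of_int (L * t) + of_int (int N * int (d i)))"
      by (rule eigen_homog[OF weyl_homog_funpow[OF weyl_homog.xop[OF i]] u(1)])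
    hence "(xop i ^^ N) \<odot> u \<in> eigen n d M (lam + of_int (L * (t + \<bar>t\<bar>)))"
      unfolding N by (simp add: algebra_simps)
    moreover have "0 \<le> L * (t + \<bar>t\<bar>)" using L by simp
    moreover have "int (d j) dvd L * (t + \<bar>t\<bar>)" if "j \<le> n" for j using dL[OF that] by simp
    ultimately have "\<exists>w \<in> eigen n d M lam. w \<noteq> \<zero>" using u(2) by (intro eigen_lam_nonzero) auto
    thus False using zero by blast
  qed
  have "\<exists>N. (xop i ^^ N) \<odot> x = \<zero>" if "x \<in> carrier M" "i \<le> n" for x i
    using that(1)
  proof (induction rule: carrier_induct)
    case (eigen k x)
    thus ?case using nil that by blast
  next
    case (add x y)
    then obtain N K where NK: "(xop i ^^ N) \<odot> x = \<zero>" "(xop i ^^ K) \<odot> y = \<zero>" by blast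
    have X: "(xop i :: 'k oper) \<in> weyl_carrier n" using that by (intro weyl_carrier.xop)
    have "(xop i ^^ (K + N)) \<odot> x = \<zero>" "(xop i ^^ (N + K)) \<odot> y = \<zero>"
      using act_funpow_add[OF X add(1), of K N] act_funpow_add[OF X add(2), of N K] NK
        act_zero[OF weyl_carrier_funpow[OF X]] by simp_all
    hence "(xop i ^^ (N + K)) \<odot> (x \<oplus> y) = \<zero>"
      using act_add[OF weyl_carrier_funpow[OF X, of "N + K"] add(1,2)] by (simp add: add.commute)
    thus ?case ..
  qed
  thus ?thesis using torsion_iff_xop_nilpotent d_pos by blast
qed

lemma in_Tors_iff: "in_Tors n d lam M \<longleftrightarrow> eigen n d M lam = {\<zero>}"
  using torsion_imp_eigen_zero eigen_zero_imp_torsion euler_module eigen_zero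
  unfolding in_Tors_def by blast

end

section \<open>Twisted differential operators\<close>

definition euler_diff :: "nat \<Rightarrow> (nat \<Rightarrow> nat) \<Rightarrow> 'k::field \<Rightarrow> 'k oper" where
  "euler_diff n d lam = (\<lambda>p. euler n d p - scal lam p)"

definition euler_ideal :: "nat \<Rightarrow> (nat \<Rightarrow> nat) \<Rightarrow> 'k::field \<Rightarrow> 'k oper set" where
  "euler_ideal n d lam = {P \<circ> euler_diff n d lam | P. weyl_homog n d 0 P}"

abbreviation tcoset :: "nat \<Rightarrow> (nat \<Rightarrow> nat) \<Rightarrow> 'k::field \<Rightarrow> 'k oper \<Rightarrow> 'k oper set" where
  "tcoset n d lam P \<equiv> euler_ideal n d lam +>\<^bsub>weyl0 n d\<^esub> P"

lemma weyl0_simps [simp]: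
  "carrier (weyl0 n d) = {P. weyl_homog n d 0 P}" "x \<otimes>\<^bsub>weyl0 n d\<^esub> y = x \<circ> y"
  "\<one>\<^bsub>weyl0 n d\<^esub> = (\<lambda>p. p)" "\<zero>\<^bsub>weyl0 n d\<^esub> = (\<lambda>p. 0)" "x \<oplus>\<^bsub>weyl0 n d\<^esub> y = (\<lambda>p. x p + y p)"
  by (simp_all add: weyl0_def)

lemma twisted0_eq: "twisted0 n d lam = weyl0 n d Quot euler_ideal n d lam"
  by (simp add: twisted0_def euler_ideal_def euler_diff_def)

lemma weyl_homog_euler_diff: "weyl_homog n d 0 (euler_diff n d lam)"
  unfolding euler_diff_def by (intro weyl_homog_diff weyl_homog_euler weyl_homog.scal)

text \<open>The case \<open>k = 0\<close> of the commutator with the Euler field, together with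
  centrality of scalars. It makes the left ideal generated by \<open>E - lam\<close> in
  \<open>D\<^sub>0\<close> two-sided.\<close>

lemma euler_diff_commute:
  assumes "weyl_homog n d 0 P"
  shows "euler_diff n d lam \<circ> P = P \<circ> euler_diff n d lam"
proof
  fix p
  have W: "P \<in> weyl_carrier n" using assms by (rule weyl_homog_weyl_carrier)
  have "euler n d (P p) = P (euler n d p)"
    using fun_cong[OF euler_comp[OF assms], of p] by (simp add: scal_zero)
  moreover have "scal lam (P p) = P (scal lam p)" using fun_cong[OF scal_commute[OF W], of lam p] by simp
  ultimately show "(euler_diff n d lam \<circ> P) p = (P \<circ> euler_diff n d lam) p"
    by (simp add: euler_diff_def weyl_carrier_minus[OF W])
qed

lemma ideal_euler_ideal: "ideal (euler_ideal n d lam) (weyl0 n d)"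
proof (rule idealI)
  show "ring (weyl0 n d)" by (rule ring_weyl0)
  interpret R: ring "weyl0 n d" by (rule ring_weyl0)
  note T = weyl_homog_euler_diff[of n d lam]
  have add: "(\<lambda>p. P p + Q p) \<in> euler_ideal n d lam"
    if PQ: "P \<in> euler_ideal n d lam" "Q \<in> euler_ideal n d lam" for P Q
  proof -
    obtain A B where "P = A \<circ> euler_diff n d lam" "weyl_homog n d 0 A"
      "Q = B \<circ> euler_diff n d lam" "weyl_homog n d 0 B" using PQ unfolding euler_ideal_def by blast
    hence "(\<lambda>p. P p + Q p) = (\<lambda>p. A p + B p) \<circ> euler_diff n d lam" "weyl_homog n d 0 (\<lambda>p. A p + B p)"
      by (auto simp: comp_def intro: weyl_homog.add)
    thus ?thesis unfolding euler_ideal_def by blast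
  qed
  have left: "Q \<circ> P \<in> euler_ideal n d lam" if P: "P \<in> euler_ideal n d lam" and Q: "weyl_homog n d 0 Q" for P Q
  proof -
    obtain A where "P = A \<circ> euler_diff n d lam" "weyl_homog n d 0 A"
      using P unfolding euler_ideal_def by blast
    hence "Q \<circ> P = (Q \<circ> A) \<circ> euler_diff n d lam" "weyl_homog n d 0 (Q \<circ> A)"
      by (simp_all only: comp_assoc weyl_homog_comp0(1)[OF Q])
    thus ?thesis unfolding euler_ideal_def by blast
  qed
  have right: "P \<circ> Q \<in> euler_ideal n d lam" if P: "P \<in> euler_ideal n d lam" and Q: "weyl_homog n d 0 Q" for P Q
  proof -
    obtain A where A: "P = A \<circ> euler_diff n d lam" "weyl_homog n d 0 A"
      using P unfolding euler_ideal_def by blast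
    have "P \<circ> Q = A \<circ> (euler_diff n d lam \<circ> Q)" unfolding A by (simp only: comp_assoc)
    also have "\<dots> = (A \<circ> Q) \<circ> euler_diff n d lam" unfolding euler_diff_commute[OF Q] by (simp only: comp_assoc)
    finally show ?thesis using weyl_homog_comp0(1)[OF A(2) Q] unfolding euler_ideal_def by blast
  qed
  have zero: "(\<lambda>p. 0) \<in> euler_ideal n d lam"
    unfolding euler_ideal_def using weyl_homog.zero[of n d 0]
    by (intro CollectI exI[of _ "\<lambda>p. 0"]) (simp add: comp_def)
  have sub: "euler_ideal n d lam \<subseteq> carrier (weyl0 n d)"
    unfolding euler_ideal_def using weyl_homog_comp0(1)[OF _ T] by auto
  show "subgroup (euler_ideal n d lam) (add_monoid (weyl0 n d))"
  proof (rule R.add.subgroupI)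
    fix P assume P: "P \<in> euler_ideal n d lam"
    hence PW: "weyl_homog n d 0 P" using sub by auto
    have "\<ominus>\<^bsub>weyl0 n d\<^esub> P = (\<lambda>p. - P p)"
      by (rule R.minus_equality) (use PW weyl_homog_uminus in auto)
    moreover have "(\<lambda>p. - P p) \<in> euler_ideal n d lam"
      using left[OF P weyl_homog.scal[of n d "-1"]] by (simp add: comp_def scal_minus_one)
    ultimately show "\<ominus>\<^bsub>weyl0 n d\<^esub> P \<in> euler_ideal n d lam" by simp
  qed (use sub zero add in auto)
  fix P Q :: "'a oper" assume "P \<in> euler_ideal n d lam" "Q \<in> carrier (weyl0 n d)"
  thus "Q \<otimes>\<^bsub>weyl0 n d\<^esub> P \<in> euler_ideal n d lam" "P \<otimes>\<^bsub>weyl0 n d\<^esub> Q \<in> euler_ideal n d lam"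
    using left right by simp_all
qed

lemma ring_twisted0: "ring (twisted0 n d lam)"
  unfolding twisted0_eq by (rule ideal.quotient_is_ring[OF ideal_euler_ideal])

lemma carrier_twisted0: "carrier (twisted0 n d lam) = {tcoset n d lam P | P. weyl_homog n d 0 P}"
  by (auto simp: twisted0_eq FactRing_def A_RCOSETS_def')

lemma tcoset_carrier: "weyl_homog n d 0 P \<Longrightarrow> tcoset n d lam P \<in> carrier (twisted0 n d lam)"
  unfolding carrier_twisted0 by blast

lemma twisted0_carrierE:
  assumes "X \<in> carrier (twisted0 n d lam)"
  obtains P where "weyl_homog n d 0 P" "X = tcoset n d lam P"
  using assms unfolding carrier_twisted0 by blast

lemma tcoset_add:
  assumes "weyl_homog n d 0 P" "weyl_homog n d 0 Q"
  shows "tcoset n d lam P \<oplus>\<^bsub>twisted0 n d lam\<^esub> tcoset n d lam Q = tcoset n d lam (\<lambda>p. P p + Q p)"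
proof -
  interpret I: ideal "euler_ideal n d lam" "weyl0 n d" by (rule ideal_euler_ideal)
  show ?thesis using I.a_rcos_sum[of P Q] assms by (simp add: twisted0_eq FactRing_def)
qed

lemma tcoset_mult:
  assumes "weyl_homog n d 0 P" "weyl_homog n d 0 Q"
  shows "tcoset n d lam P \<otimes>\<^bsub>twisted0 n d lam\<^esub> tcoset n d lam Q = tcoset n d lam (P \<circ> Q)"
proof -
  interpret I: ideal "euler_ideal n d lam" "weyl0 n d" by (rule ideal_euler_ideal)
  show ?thesis using I.rcoset_mult_add[of P Q] assms by (simp add: twisted0_eq FactRing_def)
qed

lemma twisted0_one: "\<one>\<^bsub>twisted0 n d lam\<^esub> = tcoset n d lam (\<lambda>p. p)"
  by (simp add: twisted0_eq FactRing_def)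

lemma mem_tcoset: "Q \<in> tcoset n d lam P \<longleftrightarrow> (\<exists>R. weyl_homog n d 0 R \<and> Q = (\<lambda>p. R (euler_diff n d lam p) + P p))"
  by (auto simp: a_r_coset_def' euler_ideal_def comp_def)

lemma tcoset_self: "P \<in> tcoset n d lam P"
  unfolding mem_tcoset by (rule exI[of _ "\<lambda>p. 0"]) (simp add: weyl_homog.zero)

lemma tcoset_euler: "tcoset n d lam (euler n d) = tcoset n d lam (scal lam)"
proof -
  interpret I: ideal "euler_ideal n d lam" "weyl0 n d" by (rule ideal_euler_ideal)
  have "euler n d \<in> tcoset n d lam (scal lam)"
    unfolding mem_tcoset
    by (rule exI[of _ "\<lambda>p. p"]) (simp add: weyl_homog_id euler_diff_def)
  thus ?thesis
    using I.a_repr_independence'[of "euler n d" "scal lam"] weyl_homog.scal[of n d lam] by simp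
qed

section \<open>The degree zero part as a module over twisted operators\<close>

context weyl_module
begin

lemma degree0_simps [simp]:
  "carrier (degree0 n d lam M) = eigen n d M lam" "\<zero>\<^bsub>degree0 n d lam M\<^esub> = \<zero>"
  "x \<oplus>\<^bsub>degree0 n d lam M\<^esub> y = x \<oplus> y"
  by (simp_all add: degree0_def)

text \<open>Two representatives of a coset differ by a multiple of \<open>E - lam\<close>, which
  kills the eigenspace; hence the definite description in \<open>degree0\<close> has a
  value.\<close>

lemma degree0_smult:
  assumes P: "weyl_homog n d 0 P" and m: "m \<in> eigen n d M lam"
  shows "tcoset n d lam P \<odot>\<^bsub>degree0 n d lam M\<^esub> m = P \<odot> m"
proof -
  have mC: "m \<in> carrier M" using m by (rule eigen_carrier)
  have PW: "P \<in> weyl_carrier n" using P by (rule weyl_homog_weyl_carrier)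
  have "Q \<odot> m = P \<odot> m" if "Q \<in> tcoset n d lam P" for Q
  proof -
    obtain R where R: "weyl_homog n d 0 R" "Q = (\<lambda>p. (R \<circ> euler_diff n d lam) p + P p)"
      using \<open>Q \<in> _\<close> unfolding mem_tcoset by auto
    have RW: "R \<in> weyl_carrier n" using R(1) by (rule weyl_homog_weyl_carrier)
    have TW: "euler_diff n d lam \<in> weyl_carrier n"
      using weyl_homog_euler_diff by (rule weyl_homog_weyl_carrier)
    have "euler_diff n d lam \<odot> m = euler n d \<odot> m \<ominus> scal lam \<odot> m"
      unfolding euler_diff_def by (intro act_diff_op euler_weyl_carrier weyl_carrier.scal mC)
    also have "\<dots> = \<zero>" using m M.diff_self act_closed[OF weyl_carrier.scal mC] by (simp add: eigen_iff)
    finally have "(R \<circ> euler_diff n d lam) \<odot> m = \<zero>"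
      using act_comp[OF RW TW mC] act_zero[OF RW] by simp
    thus ?thesis
      unfolding R(2) using act_add_op[OF weyl_carrier.comp[OF RW TW] PW mC] act_closed[OF PW mC] by simp
  qed
  hence "\<forall>Q\<in>tcoset n d lam P. Q \<odot> m = P \<odot> m" by blast
  hence "(THE y. \<forall>Q\<in>tcoset n d lam P. Q \<odot> m = y) = P \<odot> m"
  proof (rule the_equality)
    fix y assume "\<forall>Q\<in>tcoset n d lam P. Q \<odot> m = y"
    from bspec[OF this tcoset_self] show "y = P \<odot> m" by simp
  qed
  thus ?thesis by (simp add: degree0_def)
qed

lemma left_module_degree0: "left_module (twisted0 n d lam) (degree0 n d lam M)"
proof -
  have W: "P \<in> weyl_carrier n" if "weyl_homog n d 0 P" for P :: "'k oper"
    using that by (rule weyl_homog_weyl_carrier)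
  have "abelian_group (degree0 n d lam M)"
  proof (rule abelian_groupI)
    fix x assume x: "x \<in> carrier (degree0 n d lam M)"
    show "\<exists>y\<in>carrier (degree0 n d lam M). y \<oplus>\<^bsub>degree0 n d lam M\<^esub> x = \<zero>\<^bsub>degree0 n d lam M\<^esub>"
      using x eigen_minus[of x lam] eigen_carrier[of x lam] by (auto intro!: bexI[of _ "\<ominus> x"] M.l_neg)
  qed (use eigen_carrier eigen_zero eigen_add in \<open>simp_all add: M.a_ac\<close>)
  moreover have "left_module_axioms (twisted0 n d lam) (degree0 n d lam M)"
  proof (rule left_module_axioms.intro)
    fix X x assume "X \<in> carrier (twisted0 n d lam)" and "x \<in> carrier (degree0 n d lam M)"
    then obtain P where P: "weyl_homog n d 0 P" "X = tcoset n d lam P" and x: "x \<in> eigen n d M lam"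
      using twisted0_carrierE by (metis degree0_simps(1))
    have xC: "x \<in> carrier M" using x by (rule eigen_carrier)
    show "X \<odot>\<^bsub>degree0 n d lam M\<^esub> x \<in> carrier (degree0 n d lam M)"
      using P x by (simp add: degree0_smult eigen_homog0)
    fix Y assume "Y \<in> carrier (twisted0 n d lam)"
    then obtain Q where Q: "weyl_homog n d 0 Q" "Y = tcoset n d lam Q" by (rule twisted0_carrierE)
    have PQ: "weyl_homog n d 0 (P \<circ> Q)" by (rule weyl_homog_comp0[OF P(1) Q(1)])
    have PaQ: "weyl_homog n d 0 (\<lambda>p. P p + Q p)" by (rule weyl_homog.add[OF P(1) Q(1)])
    show "(X \<oplus>\<^bsub>twisted0 n d lam\<^esub> Y) \<odot>\<^bsub>degree0 n d lam M\<^esub> x =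
      X \<odot>\<^bsub>degree0 n d lam M\<^esub> x \<oplus>\<^bsub>degree0 n d lam M\<^esub> Y \<odot>\<^bsub>degree0 n d lam M\<^esub> x"
      unfolding P(2) Q(2) tcoset_add[OF P(1) Q(1)] degree0_smult[OF P(1) x] degree0_smult[OF Q(1) x]
        degree0_smult[OF PaQ x] using act_add_op[OF W[OF P(1)] W[OF Q(1)] xC] by simp
    show "(X \<otimes>\<^bsub>twisted0 n d lam\<^esub> Y) \<odot>\<^bsub>degree0 n d lam M\<^esub> x =
      X \<odot>\<^bsub>degree0 n d lam M\<^esub> (Y \<odot>\<^bsub>degree0 n d lam M\<^esub> x)"
      unfolding P(2) Q(2) tcoset_mult[OF P(1) Q(1)] degree0_smult[OF Q(1) x]
        degree0_smult[OF P(1) eigen_homog0[OF Q(1) x]]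
        degree0_smult[OF PQ x] by (rule act_comp[OF W[OF P(1)] W[OF Q(1)] xC])
  next
    fix X x y assume "X \<in> carrier (twisted0 n d lam)" and "x \<in> carrier (degree0 n d lam M)"
      "y \<in> carrier (degree0 n d lam M)"
    then obtain P where P: "weyl_homog n d 0 P" "X = tcoset n d lam P"
      and xy: "x \<in> eigen n d M lam" "y \<in> eigen n d M lam"
      using twisted0_carrierE by (metis degree0_simps(1))
    show "X \<odot>\<^bsub>degree0 n d lam M\<^esub> (x \<oplus>\<^bsub>degree0 n d lam M\<^esub> y) =
      X \<odot>\<^bsub>degree0 n d lam M\<^esub> x \<oplus>\<^bsub>degree0 n d lam M\<^esub> X \<odot>\<^bsub>degree0 n d lam M\<^esub> y"
      unfolding P(2) degree0_simps(3) degree0_smult[OF P(1) xy(1)] degree0_smult[OF P(1) xy(2)]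
        degree0_smult[OF P(1) eigen_add[OF xy]]
      using act_add[OF W[OF P(1)]] xy eigen_carrier by blast
  next
    fix x assume "x \<in> carrier (degree0 n d lam M)"
    hence x: "x \<in> eigen n d M lam" by simp
    show "\<one>\<^bsub>twisted0 n d lam\<^esub> \<odot>\<^bsub>degree0 n d lam M\<^esub> x = x"
      unfolding twisted0_one degree0_smult[OF weyl_homog_id x] using x eigen_carrier act_id by blast
  qed
  ultimately show ?thesis by (intro left_module.intro ring_twisted0)
qed

end

text \<open>Scalars of \<open>twisted0\<close> are cosets of degree zero operators and act through
  them, so linearity may be tested on operators. This removes cosets from the arguments about
  arrows.\<close>

lemma lin_maps_degree0_iff:
  assumes "weyl_module n M" "weyl_module n N"
  shows "f \<in> lin_maps (twisted0 n d lam) (degree0 n d lam M) (degree0 n d lam N) \<longleftrightarrow>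
    f \<in> eigen n d M lam \<rightarrow>\<^sub>E eigen n d N lam \<and>
    (\<forall>x\<in>eigen n d M lam. \<forall>y\<in>eigen n d M lam. f (x \<oplus>\<^bsub>M\<^esub> y) = f x \<oplus>\<^bsub>N\<^esub> f y) \<and>
    (\<forall>P. weyl_homog n d 0 P \<longrightarrow> (\<forall>x\<in>eigen n d M lam. f (P \<odot>\<^bsub>M\<^esub> x) = P \<odot>\<^bsub>N\<^esub> f x))"
proof -
  interpret M: weyl_module n M d lam by fact
  interpret N: weyl_module n N d lam by fact
  have "(\<forall>a\<in>carrier (twisted0 n d lam). \<forall>x\<in>eigen n d M lam.
      f (a \<odot>\<^bsub>degree0 n d lam M\<^esub> x) = a \<odot>\<^bsub>degree0 n d lam N\<^esub> f x) \<longleftrightarrow>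
    (\<forall>P. weyl_homog n d 0 P \<longrightarrow> (\<forall>x\<in>eigen n d M lam. f (P \<odot>\<^bsub>M\<^esub> x) = P \<odot>\<^bsub>N\<^esub> f x))"
    if f: "f \<in> eigen n d M lam \<rightarrow>\<^sub>E eigen n d N lam"
  proof -
    have e: "f (tcoset n d lam P \<odot>\<^bsub>degree0 n d lam M\<^esub> x) = tcoset n d lam P \<odot>\<^bsub>degree0 n d lam N\<^esub> f x
      \<longleftrightarrow> f (P \<odot>\<^bsub>M\<^esub> x) = P \<odot>\<^bsub>N\<^esub> f x" if "weyl_homog n d 0 P" "x \<in> eigen n d M lam" for P x
      using M.degree0_smult[OF that] N.degree0_smult[OF that(1), of "f x"] PiE_mem[OF f that(2)] by simp
    show ?thesis unfolding carrier_twisted0 using e by blast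
  qed
  thus ?thesis
    by (cases "f \<in> eigen n d M lam \<rightarrow>\<^sub>E eigen n d N lam") (simp_all add: lin_maps_def)
qed

section \<open>Morphisms in the quotient category\<close>

context affine_module
begin

lemma eigen_sub_mod: "eigen n d (sub_mod M H) \<mu> = H \<inter> eigen n d M \<mu>" if "H \<subseteq> carrier M"
  using that by (auto simp: eigen_def sub_mod_def)

lemma affine_module_sub: "submodule H (weyl n) M \<Longrightarrow> affine_module n d lam (sub_mod M H)"
  by (intro affine_module.intro affine_weights_axioms euler_mod_sub)

lemma affine_module_quot: "submodule H (weyl n) M \<Longrightarrow> affine_module n d lam (quot_mod M H)"
  by (intro affine_module.intro affine_weights_axioms euler_mod_quot)

lemma left_module_submodule: "submodule H (weyl n) M \<Longrightarrow> left_module_submodule (weyl n) M H"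
  by (intro left_module_submodule.intro left_module_axioms)

lemma submodule_subset: "submodule H (weyl n) M \<Longrightarrow> H \<subseteq> carrier M"
  using left_module_submodule.H_closed[OF left_module_submodule] by blast

lemma coset_lin_maps:
  assumes "submodule H (weyl n) M"
  shows "restrict (\<lambda>x. H +> x) (carrier M) \<in> lin_maps (weyl n) M (quot_mod M H)"
proof -
  interpret H: left_module_submodule "weyl n" M H by (rule left_module_submodule[OF assms])
  show ?thesis
    by (rule lin_mapsI) (simp_all add: H.coset_quot_mod H.coset_add H.quot_mod_smult act_closed)
qed

lemma eproj_quot:
  assumes "submodule H (weyl n) M" "x \<in> carrier M"
  shows "eproj n d lam (quot_mod M H) (H +> x) = H +> pr x"
proof -
  interpret Q: affine_module n d lam "quot_mod M H" by (rule affine_module_quot[OF assms(1)])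
  from eproj_natural[OF euler_mod_axioms Q.euler_mod_axioms coset_lin_maps[OF assms(1)] assms(2)]
  show ?thesis using assms(2) eproj_closed by simp
qed

lemma eproj_sub:
  assumes "submodule H (weyl n) M" "x \<in> H"
  shows "eproj n d lam (sub_mod M H) x = pr x"
proof -
  interpret H: left_module_submodule "weyl n" M H by (rule left_module_submodule[OF assms(1)])
  interpret S: affine_module n d lam "sub_mod M H" by (rule affine_module_sub[OF assms(1)])
  have "restrict (\<lambda>x. x) H \<in> lin_maps (weyl n) (sub_mod M H) M"
    by (rule lin_mapsI) (auto simp: H.H_closed H.H_add H.H_smult)
  from eproj_natural[OF S.euler_mod_axioms euler_mod_axioms this, of x] assms(2) S.eproj_closed[of x]
  show ?thesis by simp
qed

text \<open>The projections commute with the coset map, so the degree zero part of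
  \<open>M/H\<close> consists of the cosets of \<open>M\<^sub>0\<close>.\<close>

lemma in_Tors_quot_iff:
  assumes H: "submodule H (weyl n) M"
  shows "in_Tors n d lam (quot_mod M H) \<longleftrightarrow> eigen n d M lam \<subseteq> H"
proof -
  interpret H: left_module_submodule "weyl n" M H by (rule left_module_submodule[OF H])
  interpret Q: affine_module n d lam "quot_mod M H" by (rule affine_module_quot[OF H])
  have *: "H +> pr x \<in> eigen n d (quot_mod M H) lam" if "x \<in> carrier M" for x
    using Q.eproj_eigen[of "H +> x"] eproj_quot[OF H that] H.coset_quot_mod[OF that] by simp
  have **: "X \<in> (\<lambda>x. H +> x) ` eigen n d M lam" if X: "X \<in> eigen n d (quot_mod M H) lam" for X
  proof -
    obtain x where x: "x \<in> carrier M" "X = H +> x"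
      using Q.eigen_carrier[OF X] by (rule H.quot_mod_carrierE)
    have "X = H +> pr x" using Q.eproj_eq_self[OF X] eproj_quot[OF H x(1)] x(2) by simp
    thus ?thesis using eproj_eigen[OF x(1)] by blast
  qed
  have "eigen n d (quot_mod M H) lam = {H} \<longleftrightarrow> eigen n d M lam \<subseteq> H"
  proof
    assume e: "eigen n d (quot_mod M H) lam = {H}"
    show "eigen n d M lam \<subseteq> H"
    proof
      fix x assume x: "x \<in> eigen n d M lam"
      hence xC: "x \<in> carrier M" by (rule eigen_carrier)
      have "H +> x = H" using *[OF xC] e eproj_eq_self[OF x] by simp
      thus "x \<in> H" using H.coset_eq_H_iff[OF xC] by simp
    qed
  next
    assume e: "eigen n d M lam \<subseteq> H"
    have "X = H" if "X \<in> eigen n d (quot_mod M H) lam" for X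
      using **[OF that] e H.coset_eq_H_iff eigen_carrier by blast
    thus "eigen n d (quot_mod M H) lam = {H}" using Q.eigen_zero[of lam] by auto
  qed
  thus ?thesis using Q.in_Tors_iff by simp
qed

lemma in_Tors_sub_iff:
  assumes H: "submodule H (weyl n) M"
  shows "in_Tors n d lam (sub_mod M H) \<longleftrightarrow> H \<inter> eigen n d M lam = {\<zero>}"
proof -
  interpret S: affine_module n d lam "sub_mod M H" by (rule affine_module_sub[OF H])
  show ?thesis
    using S.in_Tors_iff eigen_sub_mod[OF submodule_subset[OF H]] by (simp add: sub_mod_def)
qed

text \<open>The largest submodule whose degree zero part lies in the kernel of
  \<open>\<theta>\<close>. Quantifying over all \<open>Q\<close> makes it stable under the algebra.
  It is applied to the identity, which gives \<open>tors\<close>, and to the counit in degree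
  zero.\<close>

lemma submodule_preimage_kernel:
  assumes "abelian_group A"
    and \<theta>: "\<And>x. x \<in> eigen n d M lam \<Longrightarrow> \<theta> x \<in> carrier A"
      "\<And>x y. x \<in> eigen n d M lam \<Longrightarrow> y \<in> eigen n d M lam \<Longrightarrow> \<theta> (x \<oplus> y) = \<theta> x \<oplus>\<^bsub>A\<^esub> \<theta> y"
  shows "submodule {x \<in> carrier M. \<forall>Q\<in>weyl_carrier n. \<theta> (pr (Q \<odot> x)) = \<zero>\<^bsub>A\<^esub>} (weyl n) M"
proof -
  interpret A: abelian_group A by fact
  have "\<theta> \<zero> \<oplus>\<^bsub>A\<^esub> \<theta> \<zero> = \<theta> \<zero>" using \<theta>(2)[OF eigen_zero eigen_zero] by simp
  hence z: "\<theta> \<zero> = \<zero>\<^bsub>A\<^esub>" using \<theta>(1)[OF eigen_zero] A.add_eq_self_zero by blast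
  show ?thesis
  proof (rule submoduleI)
    show "\<zero> \<in> {x \<in> carrier M. \<forall>Q\<in>weyl_carrier n. \<theta> (pr (Q \<odot> x)) = \<zero>\<^bsub>A\<^esub>}"
      using z act_zero eproj_zero by simp
  next
    fix x y assume "x \<in> {x \<in> carrier M. \<forall>Q\<in>weyl_carrier n. \<theta> (pr (Q \<odot> x)) = \<zero>\<^bsub>A\<^esub>}"
      "y \<in> {x \<in> carrier M. \<forall>Q\<in>weyl_carrier n. \<theta> (pr (Q \<odot> x)) = \<zero>\<^bsub>A\<^esub>}"
    thus "x \<oplus> y \<in> {x \<in> carrier M. \<forall>Q\<in>weyl_carrier n. \<theta> (pr (Q \<odot> x)) = \<zero>\<^bsub>A\<^esub>}"
      by (simp add: act_add eproj_add act_closed \<theta>(2) eproj_eigen)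
  next
    fix P :: "'k oper" and x assume "P \<in> carrier (weyl n)" "x \<in> {x \<in> carrier M. \<forall>Q\<in>weyl_carrier n. \<theta> (pr (Q \<odot> x)) = \<zero>\<^bsub>A\<^esub>}"
    thus "P \<odot> x \<in> {x \<in> carrier M. \<forall>Q\<in>weyl_carrier n. \<theta> (pr (Q \<odot> x)) = \<zero>\<^bsub>A\<^esub>}"
      using act_closed by (simp add: weyl_carrier.comp flip: act_comp)
  qed auto
qed

text \<open>The largest torsion submodule, by \<open>in_Tors_tors\<close> and
  \<open>submodule_subset_tors\<close>. It can serve as the denominator of every fraction into
  \<open>M\<close>.\<close>

definition tors where
  "tors = {x \<in> carrier M. \<forall>Q\<in>weyl_carrier n. pr (Q \<odot> x) = \<zero>}"

lemma submodule_tors: "submodule tors (weyl n) M"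
  using submodule_preimage_kernel[OF M.abelian_group_axioms, of "\<lambda>x. x"] eigen_carrier
  by (simp add: tors_def)

lemma in_Tors_tors: "in_Tors n d lam (sub_mod M tors)"
proof -
  have "x = \<zero>" if "x \<in> tors" "x \<in> eigen n d M lam" for x
  proof -
    have "pr ((\<lambda>p. p) \<odot> x) = \<zero>" using that(1) weyl_carrier_id unfolding tors_def by blast
    thus ?thesis using that act_id eproj_eq_self eigen_carrier by simp
  qed
  thus ?thesis
    using in_Tors_sub_iff[OF submodule_tors] eigen_zero
      left_module_submodule.H_zero[OF left_module_submodule[OF submodule_tors]] by blast
qed

lemma submodule_subset_tors:
  assumes H: "submodule H (weyl n) M" "in_Tors n d lam (sub_mod M H)"
  shows "H \<subseteq> tors"
proof
  interpret H: left_module_submodule "weyl n" M H by (rule left_module_submodule[OF H(1)])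
  fix x assume x: "x \<in> H"
  have "pr (Q \<odot> x) = \<zero>" if "Q \<in> weyl_carrier n" for Q
  proof -
    have Qx: "Q \<odot> x \<in> H" using H.H_smult that x by simp
    hence "pr (Q \<odot> x) \<in> H \<inter> eigen n d M lam"
      using eproj_submodule[OF H(1)] eproj_eigen H.H_closed by blast
    thus ?thesis using H(2) in_Tors_sub_iff[OF H(1)] by blast
  qed
  thus "x \<in> tors" using H.H_closed[OF x] by (simp add: tors_def)
qed

end

section \<open>Fractions and the maps they induce in degree zero\<close>

lemma fracs_iff: "(M', N', f) \<in> fracs n d lam M N \<longleftrightarrow>
   submodule M' (weyl n) M \<and> in_Tors n d lam (quot_mod M M') \<and>
   submodule N' (weyl n) N \<and> in_Tors n d lam (sub_mod N N') \<and>
   f \<in> lin_maps (weyl n) (sub_mod M M') (quot_mod N N')"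
  by (simp add: fracs_def)

text \<open>A value of a fraction is a coset of \<open>N'\<close>, and \<open>N'\<close> meets
  \<open>N\<^sub>0\<close> only in zero. For an argument in \<open>M\<^sub>0\<close> the coset
  therefore contains exactly one element of \<open>N\<^sub>0\<close>.\<close>

definition frac_map ::
  "nat \<Rightarrow> (nat \<Rightarrow> nat) \<Rightarrow> 'k::field \<Rightarrow> ('k oper, 'm) module \<Rightarrow> ('k oper, 'm) module \<Rightarrow> 'm frac \<Rightarrow> 'm \<Rightarrow> 'm"
  where
  "frac_map n d lam M N s =
     restrict (\<lambda>x. THE y. y \<in> eigen n d N lam \<and> y \<in> snd (snd s) x) (eigen n d M lam)"

locale affine_pair = M: affine_module n d lam M + N: affine_module n d lam N
  for n d and lam :: "'k::field_char_0" and M N :: "('k oper, 'm) module"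
begin

lemma frac_eigen_subset: "(M', N', f) \<in> fracs n d lam M N \<Longrightarrow> eigen n d M lam \<subseteq> M'"
  unfolding fracs_iff using M.in_Tors_quot_iff by blast

lemma frac_value:
  assumes s: "(M', N', f) \<in> fracs n d lam M N" and x: "x \<in> M'"
  shows "\<exists>y\<in>carrier N. f x = N' +>\<^bsub>N\<^esub> y"
proof -
  have s': "submodule M' (weyl n) M" "submodule N' (weyl n) N"
    "f \<in> lin_maps (weyl n) (sub_mod M M') (quot_mod N N')" using s unfolding fracs_iff by blast+
  interpret N': left_module_submodule "weyl n" N N' by (rule N.left_module_submodule[OF s'(2)])
  have "f x \<in> carrier (quot_mod N N')" using lin_mapsD(1)[OF s'(3), of x] x by (simp add: sub_mod_def)
  thus ?thesis using N'.quot_mod_carrierE by metis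
qed

lemma frac_mem:
  assumes s: "(M', N', f) \<in> fracs n d lam M N" and x: "x \<in> M'" and y: "y \<in> f x"
  shows "y \<in> carrier N" "f x = N' +>\<^bsub>N\<^esub> y"
proof -
  have s': "submodule N' (weyl n) N" using s unfolding fracs_iff by blast
  interpret N': left_module_submodule "weyl n" N N' by (rule N.left_module_submodule[OF s'])
  obtain z where z: "z \<in> carrier N" "f x = N' +>\<^bsub>N\<^esub> z" using frac_value[OF s x] by blast
  show yC: "y \<in> carrier N" using y z N'.coset_subset by blast
  have "y \<ominus>\<^bsub>N\<^esub> z \<in> N'" using y z N'.mem_coset_iff by blast
  thus "f x = N' +>\<^bsub>N\<^esub> y" using z N'.coset_eq_iff[OF yC z(1)] by simp
qed

lemma frac_mem_act:
  assumes s: "(M', N', f) \<in> fracs n d lam M N" and x: "x \<in> M'" and y: "y \<in> f x"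
    and Q: "Q \<in> weyl_carrier n"
  shows "Q \<odot>\<^bsub>M\<^esub> x \<in> M'" "Q \<odot>\<^bsub>N\<^esub> y \<in> f (Q \<odot>\<^bsub>M\<^esub> x)"
proof -
  have s': "submodule M' (weyl n) M" "submodule N' (weyl n) N"
    "f \<in> lin_maps (weyl n) (sub_mod M M') (quot_mod N N')" using s unfolding fracs_iff by blast+
  interpret M': left_module_submodule "weyl n" M M' by (rule M.left_module_submodule[OF s'(1)])
  interpret N': left_module_submodule "weyl n" N N' by (rule N.left_module_submodule[OF s'(2)])
  note y' = frac_mem[OF s x y]
  show "Q \<odot>\<^bsub>M\<^esub> x \<in> M'" using M'.H_smult Q x by simp
  have "f (Q \<odot>\<^bsub>M\<^esub> x) = N' +>\<^bsub>N\<^esub> (Q \<odot>\<^bsub>N\<^esub> y)"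
    using lin_mapsD(3)[OF s'(3), of Q x] Q x y' by (simp add: N'.quot_mod_smult)
  thus "Q \<odot>\<^bsub>N\<^esub> y \<in> f (Q \<odot>\<^bsub>M\<^esub> x)" using N'.coset_self[OF N.act_closed[OF Q y'(1)]] by simp
qed

text \<open>A fraction is a linear map from a submodule to a quotient, both Euler modules, so it
  commutes with the projections to degree zero.\<close>

lemma frac_mem_eproj:
  assumes s: "(M', N', f) \<in> fracs n d lam M N" and x: "x \<in> M'" and y: "y \<in> f x"
  shows "N.pr y \<in> f (M.pr x)"
proof -
  have s': "submodule M' (weyl n) M" "submodule N' (weyl n) N"
    "f \<in> lin_maps (weyl n) (sub_mod M M') (quot_mod N N')" using s unfolding fracs_iff by blast+
  interpret M': left_module_submodule "weyl n" M M' by (rule M.left_module_submodule[OF s'(1)])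
  interpret N': left_module_submodule "weyl n" N N' by (rule N.left_module_submodule[OF s'(2)])
  interpret S: affine_module n d lam "sub_mod M M'" by (rule M.affine_module_sub[OF s'(1)])
  interpret Q: affine_module n d lam "quot_mod N N'" by (rule N.affine_module_quot[OF s'(2)])
  note y' = frac_mem[OF s x y]
  have "Q.pr (f x) = f (S.pr x)"
    by (rule eproj_natural[OF S.euler_mod_axioms Q.euler_mod_axioms s'(3)]) (use x in simp)
  hence "f (M.pr x) = N' +>\<^bsub>N\<^esub> N.pr y"
    using y' M.eproj_sub[OF s'(1) x] N.eproj_quot[OF s'(2) y'(1)] by simp
  thus ?thesis using N'.coset_self[OF N.eproj_closed[OF y'(1)]] by simp
qed

lemma frac_eigen_unique:
  assumes s: "(M', N', f) \<in> fracs n d lam M N" and x: "x \<in> M'"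
    and y: "y \<in> f x" "y \<in> eigen n d N lam" and z: "z \<in> f x" "z \<in> eigen n d N lam"
  shows "y = z"
proof -
  have s': "submodule N' (weyl n) N" "in_Tors n d lam (sub_mod N N')" using s unfolding fracs_iff by blast+
  interpret N': left_module_submodule "weyl n" N N' by (rule N.left_module_submodule[OF s'(1)])
  have C: "y \<in> carrier N" "z \<in> carrier N" using y z N.eigen_carrier by blast+
  have "N' +>\<^bsub>N\<^esub> y = N' +>\<^bsub>N\<^esub> z" using frac_mem(2)[OF s x] y z by metis
  hence "y \<ominus>\<^bsub>N\<^esub> z \<in> N'" using N'.coset_eq_iff C by simp
  moreover have "y \<ominus>\<^bsub>N\<^esub> z \<in> eigen n d N lam" using y z N.eigen_diff by blast
  ultimately have "y \<ominus>\<^bsub>N\<^esub> z = \<zero>\<^bsub>N\<^esub>" using s'(2) N.in_Tors_sub_iff[OF s'(1)] by blast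
  thus ?thesis using N.diff_eq_zero_iff C by blast
qed

lemma frac_map_eqI:
  assumes s: "(M', N', f) \<in> fracs n d lam M N" and x: "x \<in> eigen n d M lam"
    and y: "y \<in> f x" "y \<in> eigen n d N lam"
  shows "frac_map n d lam M N (M', N', f) x = y"
proof -
  have "x \<in> M'" using frac_eigen_subset[OF s] x by blast
  hence "(THE y. y \<in> eigen n d N lam \<and> y \<in> f x) = y"
    using frac_eigen_unique[OF s] y by (intro the_equality) blast+
  thus ?thesis using x by (simp add: frac_map_def)
qed

text \<open>The induced map controls the whole fraction up to torsion: it prescribes the degree zero
  part of every multiple of a value \<open>y\<close>.\<close>

lemma frac_map_eproj_act:
  assumes s: "(M', N', f) \<in> fracs n d lam M N" and x: "x \<in> M'" and y: "y \<in> f x"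
    and Q: "Q \<in> weyl_carrier n"
  shows "frac_map n d lam M N (M', N', f) (M.pr (Q \<odot>\<^bsub>M\<^esub> x)) = N.pr (Q \<odot>\<^bsub>N\<^esub> y)"
proof (rule frac_map_eqI[OF s])
  have M': "submodule M' (weyl n) M" using s unfolding fracs_iff by blast
  note Qm = frac_mem_act[OF s x y Q]
  show "M.pr (Q \<odot>\<^bsub>M\<^esub> x) \<in> eigen n d M lam"
    using M.eproj_eigen Qm(1) M.submodule_subset[OF M'] by blast
  show "N.pr (Q \<odot>\<^bsub>N\<^esub> y) \<in> f (M.pr (Q \<odot>\<^bsub>M\<^esub> x))" by (rule frac_mem_eproj[OF s Qm])
  show "N.pr (Q \<odot>\<^bsub>N\<^esub> y) \<in> eigen n d N lam"
    using N.eproj_eigen frac_mem(1)[OF s Qm] by blast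
qed

lemma frac_map_mem:
  assumes s: "(M', N', f) \<in> fracs n d lam M N" and x: "x \<in> eigen n d M lam"
  shows "frac_map n d lam M N (M', N', f) x \<in> eigen n d N lam"
    "frac_map n d lam M N (M', N', f) x \<in> f x"
proof -
  have N': "submodule N' (weyl n) N" using s unfolding fracs_iff by blast
  interpret N': left_module_submodule "weyl n" N N' by (rule N.left_module_submodule[OF N'])
  have xM: "x \<in> M'" using frac_eigen_subset[OF s] x by blast
  obtain y where y: "y \<in> carrier N" "f x = N' +>\<^bsub>N\<^esub> y" using frac_value[OF s xM] by blast
  have "y \<in> f x" using y N'.coset_self by simp
  from frac_mem_eproj[OF s xM this] have "N.pr y \<in> f x" using M.eproj_eq_self[OF x] by simp
  moreover have "N.pr y \<in> eigen n d N lam" using N.eproj_eigen y by blast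
  ultimately show "frac_map n d lam M N (M', N', f) x \<in> eigen n d N lam"
    "frac_map n d lam M N (M', N', f) x \<in> f x" using frac_map_eqI[OF s x] by simp_all
qed

lemma frac_map_lin_maps:
  assumes s: "(M', N', f) \<in> fracs n d lam M N"
  shows "frac_map n d lam M N (M', N', f) \<in>
    lin_maps (twisted0 n d lam) (degree0 n d lam M) (degree0 n d lam N)"
proof -
  have s': "submodule M' (weyl n) M" "submodule N' (weyl n) N"
    "f \<in> lin_maps (weyl n) (sub_mod M M') (quot_mod N N')" using s unfolding fracs_iff by blast+
  interpret M': left_module_submodule "weyl n" M M' by (rule M.left_module_submodule[OF s'(1)])
  interpret N': left_module_submodule "weyl n" N N' by (rule N.left_module_submodule[OF s'(2)])
  let ?i = "frac_map n d lam M N (M', N', f)"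
  note sub = subsetD[OF frac_eigen_subset[OF s]]
  have "?i (x \<oplus>\<^bsub>M\<^esub> y) = ?i x \<oplus>\<^bsub>N\<^esub> ?i y" if x: "x \<in> eigen n d M lam" and y: "y \<in> eigen n d M lam" for x y
  proof (rule frac_map_eqI[OF s M.eigen_add[OF x y]])
    note fx = frac_map_mem[OF s x] and fy = frac_map_mem[OF s y]
    note cx = frac_mem[OF s sub[OF x] fx(2)] and cy = frac_mem[OF s sub[OF y] fy(2)]
    have "f (x \<oplus>\<^bsub>M\<^esub> y) = f x <+>\<^bsub>N\<^esub> f y"
      using lin_mapsD(2)[OF s'(3), of x y] sub x y by simp
    also have "\<dots> = N' +>\<^bsub>N\<^esub> (?i x \<oplus>\<^bsub>N\<^esub> ?i y)" unfolding cx(2) cy(2) by (rule N'.coset_add[OF cx(1) cy(1)])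
    finally show "?i x \<oplus>\<^bsub>N\<^esub> ?i y \<in> f (x \<oplus>\<^bsub>M\<^esub> y)" using N'.coset_self cx(1) cy(1) by simp
    show "?i x \<oplus>\<^bsub>N\<^esub> ?i y \<in> eigen n d N lam" by (rule N.eigen_add[OF fx(1) fy(1)])
  qed
  moreover have "?i (P \<odot>\<^bsub>M\<^esub> x) = P \<odot>\<^bsub>N\<^esub> ?i x" if P: "weyl_homog n d 0 P" and x: "x \<in> eigen n d M lam" for P x
  proof (rule frac_map_eqI[OF s M.eigen_homog0[OF P x]])
    note fx = frac_map_mem[OF s x]
    show "P \<odot>\<^bsub>N\<^esub> ?i x \<in> f (P \<odot>\<^bsub>M\<^esub> x)"
      by (rule frac_mem_act(2)[OF s sub[OF x] fx(2) weyl_homog_weyl_carrier[OF P]])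
    show "P \<odot>\<^bsub>N\<^esub> ?i x \<in> eigen n d N lam" by (rule N.eigen_homog0[OF P fx(1)])
  qed
  moreover have "?i \<in> eigen n d M lam \<rightarrow>\<^sub>E eigen n d N lam"
    using frac_map_mem(1)[OF s] by (auto simp: PiE_iff frac_map_def)
  ultimately show ?thesis
    unfolding lin_maps_degree0_iff[OF M.weyl_module_axioms N.weyl_module_axioms] by blast
qed

text \<open>Every admissible \<open>M3\<close> contains \<open>M\<^sub>0\<close> and every
  admissible \<open>N3\<close> meets \<open>N\<^sub>0\<close> in zero, so equivalent fractions agree
  in degree zero. Conversely, if they agree there, all multiples of a difference of their values
  have degree zero part zero, and the difference lies in \<open>N.tors\<close>.\<close>

lemma frac_rel_iff:
  "(s, t) \<in> frac_rel n d lam M N \<longleftrightarrow> s \<in> fracs n d lam M N \<and> t \<in> fracs n d lam M N \<and>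
     frac_map n d lam M N s = frac_map n d lam M N t"
proof -
  obtain M1 N1 f1 where s: "s = (M1, N1, f1)" by (cases s)
  obtain M2 N2 f2 where t: "t = (M2, N2, f2)" by (cases t)
  have fwd: "frac_map n d lam M N s = frac_map n d lam M N t" if rel: "(s, t) \<in> frac_rel n d lam M N"
  proof -
    have st: "(M1, N1, f1) \<in> fracs n d lam M N" "(M2, N2, f2) \<in> fracs n d lam M N"
      using rel unfolding frac_rel_def s t by blast+
    obtain M3 N3 where 3: "M3 \<subseteq> M1 \<inter> M2" "N1 \<union> N2 \<subseteq> N3"
      "submodule M3 (weyl n) M" "in_Tors n d lam (quot_mod M M3)"
      "submodule N3 (weyl n) N" "in_Tors n d lam (sub_mod N N3)"
      "\<forall>m\<in>M3. set_add N (f1 m) N3 = set_add N (f2 m) N3"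
      using rel unfolding frac_rel_def s t by blast
    interpret N3: left_module_submodule "weyl n" N N3 by (rule N.left_module_submodule[OF 3(5)])
    \<comment> \<open>Enlarging the submodule turns a coset of \<open>N'\<close> into the coset of
      \<open>N3\<close> through the same point.\<close>
    have add: "set_add N (N' +>\<^bsub>N\<^esub> y) N3 = N3 +>\<^bsub>N\<^esub> y" if N': "submodule N' (weyl n) N" "N' \<subseteq> N3" "y \<in> carrier N" for N' y
    proof -
      interpret N': left_module_submodule "weyl n" N N' by (rule N.left_module_submodule[OF N'(1)])
      show ?thesis
      proof (intro equalityI subsetI)
        fix z assume "z \<in> set_add N (N' +>\<^bsub>N\<^esub> y) N3"
        then obtain a b where ab: "a \<in> N' +>\<^bsub>N\<^esub> y" "b \<in> N3" "z = a \<oplus>\<^bsub>N\<^esub> b" by (auto simp: set_add_def')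
        have a: "a \<in> carrier N" "a \<ominus>\<^bsub>N\<^esub> y \<in> N'" using ab(1) N'.mem_coset_iff[OF N'(3)] by blast+
        have bC: "b \<in> carrier N" using ab(2) by (rule N3.H_closed)
        have "z \<ominus>\<^bsub>N\<^esub> y = (a \<ominus>\<^bsub>N\<^esub> y) \<oplus>\<^bsub>N\<^esub> b"
          unfolding ab(3) a_minus_def using a bC N'(3) by (simp add: N.a_ac)
        hence "z \<ominus>\<^bsub>N\<^esub> y \<in> N3" using N3.H_add a(2) N'(2) ab(2) by auto
        thus "z \<in> N3 +>\<^bsub>N\<^esub> y" using N3.mem_coset_iff[OF N'(3)] ab a bC by simp
      next
        fix z assume "z \<in> N3 +>\<^bsub>N\<^esub> y"
        hence z: "z \<in> carrier N" "z \<ominus>\<^bsub>N\<^esub> y \<in> N3" using N3.mem_coset_iff[OF N'(3)] by blast+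
        have "z = y \<oplus>\<^bsub>N\<^esub> (z \<ominus>\<^bsub>N\<^esub> y)" using N.diff_add_cancel[OF z(1) N'(3)] z N'(3)
          by (simp add: N.a_comm)
        thus "z \<in> set_add N (N' +>\<^bsub>N\<^esub> y) N3" using N'.coset_self[OF N'(3)] z(2)
          unfolding set_add_def' by blast
      qed
    qed
    have "frac_map n d lam M N s x = frac_map n d lam M N t x" if x: "x \<in> eigen n d M lam" for x
    proof -
      have x3: "x \<in> M3" using M.in_Tors_quot_iff[OF 3(3)] 3(4) x by blast
      have x12: "x \<in> M1" "x \<in> M2" using x3 3(1) by blast+
      have sub: "submodule N1 (weyl n) N" "submodule N2 (weyl n) N"
        using st unfolding fracs_iff by blast+
      note m1 = frac_map_mem[OF st(1) x] and m2 = frac_map_mem[OF st(2) x]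
      note c1 = frac_mem[OF st(1) x12(1) m1(2)] and c2 = frac_mem[OF st(2) x12(2) m2(2)]
      have "N3 +>\<^bsub>N\<^esub> frac_map n d lam M N s x = N3 +>\<^bsub>N\<^esub> frac_map n d lam M N t x"
        using 3(7) x3 add[OF sub(1) _ c1(1)] add[OF sub(2) _ c2(1)] 3(2) c1(2) c2(2) unfolding s t by auto
      hence "frac_map n d lam M N s x \<ominus>\<^bsub>N\<^esub> frac_map n d lam M N t x \<in> N3"
        using N3.coset_eq_iff c1(1) c2(1) unfolding s t by blast
      moreover have "frac_map n d lam M N s x \<ominus>\<^bsub>N\<^esub> frac_map n d lam M N t x \<in> eigen n d N lam"
        using m1(1) m2(1) N.eigen_diff unfolding s t by blast
      ultimately have "frac_map n d lam M N s x \<ominus>\<^bsub>N\<^esub> frac_map n d lam M N t x = \<zero>\<^bsub>N\<^esub>"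
        using N.in_Tors_sub_iff[OF 3(5)] 3(6) by blast
      thus ?thesis using N.diff_eq_zero_iff c1(1) c2(1) unfolding s t by blast
    qed
    thus ?thesis by (auto simp: frac_map_def)
  qed
  have bwd: "(s, t) \<in> frac_rel n d lam M N"
    if st: "s \<in> fracs n d lam M N" "t \<in> fracs n d lam M N"
      and eq: "frac_map n d lam M N s = frac_map n d lam M N t"
  proof -
    note st = st[unfolded s t]
    have sub: "submodule M1 (weyl n) M" "submodule M2 (weyl n) M" "submodule N1 (weyl n) N"
      "submodule N2 (weyl n) N" "in_Tors n d lam (sub_mod N N1)" "in_Tors n d lam (sub_mod N N2)"
      using st unfolding fracs_iff by blast+
    \<comment> \<open>Witnesses for the equivalence: the common domain on the side of
      \<open>M\<close>, the largest torsion submodule on the side of \<open>N\<close>.\<close>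
    have M3: "submodule (M1 \<inter> M2) (weyl n) M" by (rule M.submodule_Int[OF sub(1,2)])
    have MT: "in_Tors n d lam (quot_mod M (M1 \<inter> M2))"
      using M.in_Tors_quot_iff[OF M3] frac_eigen_subset[OF st(1)] frac_eigen_subset[OF st(2)] by blast
    have NT: "N1 \<subseteq> N.tors" "N2 \<subseteq> N.tors" using N.submodule_subset_tors sub by blast+
    have eqT: "set_add N (f1 x) N.tors = set_add N (f2 x) N.tors" if x: "x \<in> M1 \<inter> M2" for x
    proof -
      interpret T: left_module_submodule "weyl n" N N.tors by (rule N.left_module_submodule[OF N.submodule_tors])
      interpret N1: left_module_submodule "weyl n" N N1 by (rule N.left_module_submodule[OF sub(3)])
      interpret N2: left_module_submodule "weyl n" N N2 by (rule N.left_module_submodule[OF sub(4)])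
      have x1: "x \<in> M1" and x2: "x \<in> M2" using x by blast+
      have diff: "y \<ominus>\<^bsub>N\<^esub> z \<in> N.tors" if y: "y \<in> f1 x" and z: "z \<in> f2 x" for y z
      proof -
        note yC = frac_mem(1)[OF st(1) x1 y] and zC = frac_mem(1)[OF st(2) x2 z]
        have "N.pr (Q \<odot>\<^bsub>N\<^esub> (y \<ominus>\<^bsub>N\<^esub> z)) = \<zero>\<^bsub>N\<^esub>" if Q: "Q \<in> weyl_carrier n" for Q
        proof -
          have "N.pr (Q \<odot>\<^bsub>N\<^esub> y) = N.pr (Q \<odot>\<^bsub>N\<^esub> z)"
            using frac_map_eproj_act[OF st(1) x1 y Q] frac_map_eproj_act[OF st(2) x2 z Q]
              eq[unfolded s t] by simp
          thus ?thesis
            using N.act_diff[OF Q yC zC] N.eproj_diff[OF N.act_closed[OF Q yC] N.act_closed[OF Q zC]]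
              N.diff_self[OF N.eproj_closed[OF N.act_closed[OF Q zC]]] by simp
        qed
        thus ?thesis using yC zC by (simp add: N.tors_def)
      qed
      \<comment> \<open>Formulated for arbitrary \<open>g\<close> and \<open>h\<close> because the
        inclusion is needed in both directions.\<close>
      have incl: "set_add N (g x) N.tors \<subseteq> set_add N (h x) N.tors"
        if g: "\<And>y. y \<in> g x \<Longrightarrow> y \<in> carrier N" and h: "\<And>y. y \<in> h x \<Longrightarrow> y \<in> carrier N"
          and d: "\<And>y z. y \<in> g x \<Longrightarrow> z \<in> h x \<Longrightarrow> y \<ominus>\<^bsub>N\<^esub> z \<in> N.tors" and ne: "h x \<noteq> {}" for g h :: "'m \<Rightarrow> 'm set"
      proof
        fix w assume "w \<in> set_add N (g x) N.tors"
        then obtain y a where ya: "y \<in> g x" "a \<in> N.tors" "w = y \<oplus>\<^bsub>N\<^esub> a" by (auto simp: set_add_def')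
        obtain z where z: "z \<in> h x" using ne by blast
        have C: "y \<in> carrier N" "z \<in> carrier N" "a \<in> carrier N" using ya z g h T.H_closed by blast+
        have "z \<oplus>\<^bsub>N\<^esub> ((y \<ominus>\<^bsub>N\<^esub> z) \<oplus>\<^bsub>N\<^esub> a) = ((y \<ominus>\<^bsub>N\<^esub> z) \<oplus>\<^bsub>N\<^esub> z) \<oplus>\<^bsub>N\<^esub> a"
          using C by (simp add: N.a_ac)
        hence "w = z \<oplus>\<^bsub>N\<^esub> ((y \<ominus>\<^bsub>N\<^esub> z) \<oplus>\<^bsub>N\<^esub> a)" unfolding ya(3) using C by (simp add: N.diff_add_cancel)
        thus "w \<in> set_add N (h x) N.tors"
          using z T.H_add[OF d[OF ya(1) z] ya(2)] unfolding set_add_def' by blast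
      qed
      have ne: "f1 x \<noteq> {}" "f2 x \<noteq> {}"
        using frac_value[OF st(1) x1] frac_value[OF st(2) x2] N1.coset_self N2.coset_self by blast+
      have diff': "z \<ominus>\<^bsub>N\<^esub> y \<in> N.tors" if y: "y \<in> f1 x" and z: "z \<in> f2 x" for y z
      proof -
        note yC = frac_mem(1)[OF st(1) x1 y] and zC = frac_mem(1)[OF st(2) x2 z]
        have "z \<ominus>\<^bsub>N\<^esub> y = \<ominus>\<^bsub>N\<^esub> (y \<ominus>\<^bsub>N\<^esub> z)" using yC zC
          by (simp add: a_minus_def N.minus_add N.a_comm)
        thus ?thesis using T.H_minus[OF diff[OF y z]] by simp
      qed
      show ?thesis
        by (intro equalityI incl) (use frac_mem(1)[OF st(1) x1] frac_mem(1)[OF st(2) x2] diff diff' ne in blast)+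
    qed
    show ?thesis
      unfolding frac_rel_def s t mem_Collect_eq prod.case
      by (intro conjI exI[of _ "M1 \<inter> M2"] exI[of _ N.tors] ballI Un_least)
        (rule st M3 MT NT eqT N.submodule_tors N.in_Tors_tors subset_refl | assumption)+
  qed
  have "s \<in> fracs n d lam M N \<and> t \<in> fracs n d lam M N" if "(s, t) \<in> frac_rel n d lam M N"
    using that unfolding frac_rel_def s t mem_Collect_eq prod.case by (elim conjE) (intro conjI)
  thus ?thesis using fwd bwd by blast
qed

end


context affine_pair
begin

text \<open>A \<open>D\<^sub>0\<close>-linear map \<open>\<theta>\<close> on degree zero parts extends to the relation
  \<open>{(x, y). \<forall>Q. (Q y)\<^sub>0 = \<theta> ((Q x)\<^sub>0)}\<close>, which is a map into \<open>N\<close> modulo torsion.\<close>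

lemma frac_map_surj:
  assumes \<theta>: "\<theta> \<in> lin_maps (twisted0 n d lam) (degree0 n d lam M) (degree0 n d lam N)"
  shows "\<exists>s\<in>fracs n d lam M N. frac_map n d lam M N s = \<theta>"
proof -
  have \<theta>E: "\<theta> \<in> eigen n d M lam \<rightarrow>\<^sub>E eigen n d N lam"
    and \<theta>add: "\<And>x y. x \<in> eigen n d M lam \<Longrightarrow> y \<in> eigen n d M lam \<Longrightarrow> \<theta> (x \<oplus>\<^bsub>M\<^esub> y) = \<theta> x \<oplus>\<^bsub>N\<^esub> \<theta> y"
    and \<theta>act: "\<And>P x. weyl_homog n d 0 P \<Longrightarrow> x \<in> eigen n d M lam \<Longrightarrow> \<theta> (P \<odot>\<^bsub>M\<^esub> x) = P \<odot>\<^bsub>N\<^esub> \<theta> x"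
    using \<theta> unfolding lin_maps_degree0_iff[OF M.weyl_module_axioms N.weyl_module_axioms] by blast+
  have \<theta>e: "\<theta> x \<in> eigen n d N lam" if "x \<in> eigen n d M lam" for x using \<theta>E that by blast
  have \<theta>0: "\<theta> \<zero>\<^bsub>M\<^esub> = \<zero>\<^bsub>N\<^esub>"
    using \<theta>act[OF weyl_homog.zero M.eigen_zero] M.act_zero_op N.act_zero_op N.eigen_carrier[OF \<theta>e[OF M.eigen_zero]]
    by simp
  define f where "f = (\<lambda>x. {y \<in> carrier N. \<forall>Q\<in>weyl_carrier n. N.pr (Q \<odot>\<^bsub>N\<^esub> y) = \<theta> (M.pr (Q \<odot>\<^bsub>M\<^esub> x))})"
  define M' where "M' = {x \<in> carrier M. f x \<noteq> {}}"
  interpret T: left_module_submodule "weyl n" N N.tors by (rule N.left_module_submodule[OF N.submodule_tors])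
  have fD: "y \<in> carrier N" "\<And>Q. Q \<in> weyl_carrier n \<Longrightarrow> N.pr (Q \<odot>\<^bsub>N\<^esub> y) = \<theta> (M.pr (Q \<odot>\<^bsub>M\<^esub> x))"
    if "y \<in> f x" for x y using that by (simp_all add: f_def)
  \<comment> \<open>For \<open>Q\<close> of nonzero degree both sides vanish, for \<open>Q\<close>
    of degree zero this is linearity of \<open>\<theta>\<close>, and both sides are additive in
    \<open>Q\<close>.\<close>
  have f_eigen: "\<theta> x \<in> f x" if x: "x \<in> eigen n d M lam" for x
  proof -
    have xC: "x \<in> carrier M" and \<theta>C: "\<theta> x \<in> carrier N"
      using x M.eigen_carrier \<theta>e N.eigen_carrier by blast+
    have "N.pr (Q \<odot>\<^bsub>N\<^esub> \<theta> x) = \<theta> (M.pr (Q \<odot>\<^bsub>M\<^esub> x))" if "Q \<in> weyl_carrier n" for Q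
      using that
    proof (induction rule: weyl_carrier_induct_homog[where d = d])
      case (homog k P)
      note e = M.eproj_on_eigen[OF M.eigen_homog[OF homog x]] N.eproj_on_eigen[OF N.eigen_homog[OF homog \<theta>e[OF x]]]
      show ?case
      proof (cases "k = 0")
        case True
        thus ?thesis using e \<theta>act[OF _ x] homog by simp
      next
        case False
        thus ?thesis using e \<theta>0 by simp
      qed
    next
      case (add P Q)
      have "\<theta> (M.pr (P \<odot>\<^bsub>M\<^esub> x) \<oplus>\<^bsub>M\<^esub> M.pr (Q \<odot>\<^bsub>M\<^esub> x)) = \<theta> (M.pr (P \<odot>\<^bsub>M\<^esub> x)) \<oplus>\<^bsub>N\<^esub> \<theta> (M.pr (Q \<odot>\<^bsub>M\<^esub> x))"
        by (intro \<theta>add M.eproj_eigen M.act_closed add xC)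
      thus ?case using add
        by (simp add: M.act_add_op N.act_add_op xC \<theta>C M.eproj_add N.eproj_add M.act_closed N.act_closed)
    qed
    thus ?thesis using \<theta>C by (simp add: f_def)
  qed
  \<comment> \<open>Two solutions \<open>y\<close> for the same \<open>x\<close> differ by an
    element of \<open>N.tors\<close>, so \<open>f\<close> is single-valued modulo torsion.\<close>
  have coset: "f x = N.tors +>\<^bsub>N\<^esub> y" if y: "y \<in> f x" for x y
  proof (rule Set.set_eqI)
    fix z
    note yD = fD[OF y]
    have "z \<in> f x \<longleftrightarrow> z \<ominus>\<^bsub>N\<^esub> y \<in> N.tors" if z: "z \<in> carrier N"
    proof -
      have "N.pr (Q \<odot>\<^bsub>N\<^esub> (z \<ominus>\<^bsub>N\<^esub> y)) = \<zero>\<^bsub>N\<^esub> \<longleftrightarrow> N.pr (Q \<odot>\<^bsub>N\<^esub> z) = \<theta> (M.pr (Q \<odot>\<^bsub>M\<^esub> x))"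
        if Q: "Q \<in> weyl_carrier n" for Q
        unfolding yD(2)[OF Q, symmetric] N.act_diff[OF Q z yD(1)]
          N.eproj_diff[OF N.act_closed[OF Q z] N.act_closed[OF Q yD(1)]]
        by (intro N.diff_eq_zero_iff N.eproj_closed N.act_closed Q z yD(1))
      thus ?thesis using z yD(1) by (simp add: f_def N.tors_def)
    qed
    thus "z \<in> f x \<longleftrightarrow> z \<in> N.tors +>\<^bsub>N\<^esub> y" using T.mem_coset_iff[OF yD(1)] fD(1) by blast
  qed
  have f_add: "y \<oplus>\<^bsub>N\<^esub> y' \<in> f (x \<oplus>\<^bsub>M\<^esub> x')"
    if y: "y \<in> f x" "y' \<in> f x'" and x: "x \<in> carrier M" "x' \<in> carrier M" for x x' y y'
  proof -
    note yD = fD[OF y(1)] and yD' = fD[OF y(2)]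
    have "N.pr (Q \<odot>\<^bsub>N\<^esub> (y \<oplus>\<^bsub>N\<^esub> y')) = \<theta> (M.pr (Q \<odot>\<^bsub>M\<^esub> (x \<oplus>\<^bsub>M\<^esub> x')))" if Q: "Q \<in> weyl_carrier n" for Q
    proof -
      have "\<theta> (M.pr (Q \<odot>\<^bsub>M\<^esub> x) \<oplus>\<^bsub>M\<^esub> M.pr (Q \<odot>\<^bsub>M\<^esub> x')) = \<theta> (M.pr (Q \<odot>\<^bsub>M\<^esub> x)) \<oplus>\<^bsub>N\<^esub> \<theta> (M.pr (Q \<odot>\<^bsub>M\<^esub> x'))"
        by (intro \<theta>add M.eproj_eigen M.act_closed Q x)
      thus ?thesis
        using yD yD' x Q by (simp add: M.act_add N.act_add M.eproj_add N.eproj_add M.act_closed N.act_closed)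
    qed
    thus ?thesis using yD(1) yD'(1) by (simp add: f_def)
  qed
  have f_act: "P \<odot>\<^bsub>N\<^esub> y \<in> f (P \<odot>\<^bsub>M\<^esub> x)"
    if y: "y \<in> f x" and x: "x \<in> carrier M" and P: "P \<in> weyl_carrier n" for P x y
  proof -
    note yD = fD[OF y]
    have "N.pr (Q \<odot>\<^bsub>N\<^esub> (P \<odot>\<^bsub>N\<^esub> y)) = \<theta> (M.pr (Q \<odot>\<^bsub>M\<^esub> (P \<odot>\<^bsub>M\<^esub> x)))" if Q: "Q \<in> weyl_carrier n" for Q
      using yD(2)[OF weyl_carrier.comp[OF Q P]] M.act_comp[OF Q P x] N.act_comp[OF Q P yD(1)] by simp
    thus ?thesis using N.act_closed[OF P yD(1)] by (simp add: f_def)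
  qed
  have M'D: "x \<in> carrier M" "\<exists>y. y \<in> f x" if "x \<in> M'" for x using that by (auto simp: M'_def)
  have M'I: "x \<in> M'" if "x \<in> carrier M" "y \<in> f x" for x y using that by (auto simp: M'_def)
  have sub: "submodule M' (weyl n) M"
  proof (rule M.submoduleI)
    show "M' \<subseteq> carrier M" using M'D by blast
    show "\<zero>\<^bsub>M\<^esub> \<in> M'" by (rule M'I[OF _ f_eigen[OF M.eigen_zero]]) simp
    fix a b assume ab: "a \<in> M'" "b \<in> M'"
    obtain y y' where "y \<in> f a" "y' \<in> f b" using M'D(2) ab by blast
    from M'I[OF _ f_add[OF this]] show "a \<oplus>\<^bsub>M\<^esub> b \<in> M'" using M'D(1) ab by simp
  next
    fix P :: "'k oper" and x assume Px: "P \<in> carrier (weyl n)" "x \<in> M'"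
    obtain y where "y \<in> f x" using M'D(2) Px by blast
    from M'I[OF _ f_act[OF this]] show "P \<odot>\<^bsub>M\<^esub> x \<in> M'" using M'D(1) Px M.act_closed by simp
  qed
  interpret M': left_module_submodule "weyl n" M M' by (rule M.left_module_submodule[OF sub])
  have lin: "restrict f M' \<in> lin_maps (weyl n) (sub_mod M M') (quot_mod N N.tors)"
  proof (rule lin_mapsI)
    fix x assume "x \<in> carrier (sub_mod M M')"
    hence x: "x \<in> M'" by simp
    then obtain y where y: "y \<in> f x" using M'D by blast
    note fx = coset[OF y] and yC = fD(1)[OF y]
    show "restrict f M' x \<in> carrier (quot_mod N N.tors)"
      using x fx T.coset_quot_mod[OF yC] by simp
    fix P :: "'k oper" assume "P \<in> carrier (weyl n)"
    hence P: "P \<in> weyl_carrier n" by simp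
    have "f (P \<odot>\<^bsub>M\<^esub> x) = N.tors +>\<^bsub>N\<^esub> (P \<odot>\<^bsub>N\<^esub> y)" by (rule coset[OF f_act[OF y M'D(1)[OF x] P]])
    thus "restrict f M' (P \<odot>\<^bsub>sub_mod M M'\<^esub> x) = P \<odot>\<^bsub>quot_mod N N.tors\<^esub> restrict f M' x"
      using x P fx yC M'.H_smult by (simp add: T.quot_mod_smult)
  next
    fix x x' assume "x \<in> carrier (sub_mod M M')" "x' \<in> carrier (sub_mod M M')"
    hence x: "x \<in> M'" "x' \<in> M'" by simp_all
    obtain y y' where y: "y \<in> f x" "y' \<in> f x'" using M'D(2)[OF x(1)] M'D(2)[OF x(2)] by blast
    have "f (x \<oplus>\<^bsub>M\<^esub> x') = N.tors +>\<^bsub>N\<^esub> (y \<oplus>\<^bsub>N\<^esub> y')"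
      by (rule coset[OF f_add[OF y M'D(1)[OF x(1)] M'D(1)[OF x(2)]]])
    thus "restrict f M' (x \<oplus>\<^bsub>sub_mod M M'\<^esub> x') = restrict f M' x \<oplus>\<^bsub>quot_mod N N.tors\<^esub> restrict f M' x'"
      using x M'.H_add coset[OF y(1)] coset[OF y(2)] fD(1)[OF y(1)] fD(1)[OF y(2)]
      by (simp add: T.coset_add)
  qed simp
  have "eigen n d M lam \<subseteq> M'" using M'I f_eigen M.eigen_carrier by blast
  hence "in_Tors n d lam (quot_mod M M')" using M.in_Tors_quot_iff[OF sub] by blast
  hence s: "(M', N.tors, restrict f M') \<in> fracs n d lam M N"
    unfolding fracs_iff using sub N.submodule_tors N.in_Tors_tors lin by blast
  have "frac_map n d lam M N (M', N.tors, restrict f M') x = \<theta> x" if x: "x \<in> eigen n d M lam" for x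
    by (rule frac_map_eqI[OF s x _ \<theta>e[OF x]])
      (use f_eigen[OF x] M'I[OF M.eigen_carrier[OF x] f_eigen[OF x]] in simp)
  hence "frac_map n d lam M N (M', N.tors, restrict f M') = \<theta>"
    using lin_maps_eqI[OF frac_map_lin_maps[OF s] \<theta>] by simp
  thus ?thesis using s by blast
qed

lemma frac_map_frac_of:
  assumes "frac_of M N h \<in> fracs n d lam M N" "h \<in> lin_maps (weyl n) M N" "x \<in> eigen n d M lam"
  shows "frac_map n d lam M N (frac_of M N h) x = h x"
proof -
  have xC: "x \<in> carrier M" using assms(3) by (rule M.eigen_carrier)
  have "h x \<in> eigen n d N lam"
    using assms(3) lin_mapsD(1)[OF assms(2) xC] lin_mapsD(3)[OF assms(2) _ xC, of "euler n d"]
      lin_mapsD(3)[OF assms(2) _ xC, of "scal lam"]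
    by (simp add: eigen_def euler_weyl_carrier weyl_carrier.scal)
  thus ?thesis using frac_map_eqI[OF assms(1)[unfolded frac_of_def] assms(3)] xC
    by (simp add: frac_of_def)
qed

end

text \<open>On arrows the chosen representative is immaterial, by \<open>qmap_eq\<close>.\<close>

definition qmap ::
  "nat \<Rightarrow> (nat \<Rightarrow> nat) \<Rightarrow> 'k::field \<Rightarrow> ('k oper, 'm) module \<Rightarrow> ('k oper, 'm) module \<Rightarrow> 'm frac set \<Rightarrow> 'm \<Rightarrow> 'm"
  where "qmap n d lam M N \<alpha> = frac_map n d lam M N (SOME s. s \<in> \<alpha>)"

lemma Qcoh_simps [simp]:
  "Obj (Qcoh n d lam) = {M. euler_module n d lam M}"
  "Hom (Qcoh n d lam) M N = fracs n d lam M N // frac_rel n d lam M N"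
  "Comp (Qcoh n d lam) M N P \<beta> \<alpha> = (\<Union>s\<in>\<alpha>. \<Union>t\<in>\<beta>. frac_rel n d lam M P `` {frac_comp t s})"
  by (simp_all add: Qcoh_def)

context affine_pair
begin

lemma quotient_class:
  assumes "\<alpha> \<in> fracs n d lam M N // frac_rel n d lam M N"
  obtains s where "s \<in> fracs n d lam M N"
    "\<alpha> = {t \<in> fracs n d lam M N. frac_map n d lam M N t = frac_map n d lam M N s}"
proof -
  obtain s where s: "s \<in> fracs n d lam M N" "\<alpha> = frac_rel n d lam M N `` {s}"
    using assms by (rule quotientE)
  have "frac_rel n d lam M N `` {s} = {t \<in> fracs n d lam M N. frac_map n d lam M N t = frac_map n d lam M N s}"
    by (rule Set.set_eqI, unfold Image_singleton_iff frac_rel_iff mem_Collect_eq) (metis s(1))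
  thus ?thesis using that s by simp
qed

lemma qmap_eq:
  assumes "\<alpha> \<in> fracs n d lam M N // frac_rel n d lam M N" "s \<in> \<alpha>"
  shows "s \<in> fracs n d lam M N" "qmap n d lam M N \<alpha> = frac_map n d lam M N s"
proof -
  obtain t where t: "t \<in> fracs n d lam M N"
    "\<alpha> = {u \<in> fracs n d lam M N. frac_map n d lam M N u = frac_map n d lam M N t}"
    using assms(1) by (rule quotient_class)
  show "s \<in> fracs n d lam M N" using assms(2) t by blast
  have "(SOME s. s \<in> \<alpha>) \<in> \<alpha>" using assms(2) by (rule someI)
  thus "qmap n d lam M N \<alpha> = frac_map n d lam M N s" unfolding qmap_def using assms(2) t by simp
qed

lemma class_nonempty:
  assumes "\<alpha> \<in> fracs n d lam M N // frac_rel n d lam M N"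
  obtains s where "s \<in> \<alpha>"
  using quotient_class[OF assms] by blast

text \<open>Full faithfulness of the degree zero functor on the quotient category: injectivity comes
  from \<open>frac_rel_iff\<close>, surjectivity from \<open>frac_map_surj\<close>.\<close>

lemma bij_betw_qmap:
  "bij_betw (qmap n d lam M N) (fracs n d lam M N // frac_rel n d lam M N)
     (lin_maps (twisted0 n d lam) (degree0 n d lam M) (degree0 n d lam N))"
proof (rule bij_betwI')
  fix \<alpha> \<beta>
  assume a: "\<alpha> \<in> fracs n d lam M N // frac_rel n d lam M N" and b: "\<beta> \<in> fracs n d lam M N // frac_rel n d lam M N"
  obtain s where s: "s \<in> fracs n d lam M N"
    "\<alpha> = {u \<in> fracs n d lam M N. frac_map n d lam M N u = frac_map n d lam M N s}"
    using a by (rule quotient_class)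
  obtain t where t: "t \<in> fracs n d lam M N"
    "\<beta> = {u \<in> fracs n d lam M N. frac_map n d lam M N u = frac_map n d lam M N t}"
    using b by (rule quotient_class)
  have "s \<in> \<alpha>" "t \<in> \<beta>" using s t by blast+
  thus "qmap n d lam M N \<alpha> = qmap n d lam M N \<beta> \<longleftrightarrow> \<alpha> = \<beta>"
    using qmap_eq(2)[OF a] qmap_eq(2)[OF b] s t by auto
next
  fix \<alpha> assume a: "\<alpha> \<in> fracs n d lam M N // frac_rel n d lam M N"
  then obtain s where s: "s \<in> \<alpha>" by (rule class_nonempty)
  show "qmap n d lam M N \<alpha> \<in> lin_maps (twisted0 n d lam) (degree0 n d lam M) (degree0 n d lam N)"
    using qmap_eq[OF a s] frac_map_lin_maps by (cases s) simp
next
  fix \<theta> assume "\<theta> \<in> lin_maps (twisted0 n d lam) (degree0 n d lam M) (degree0 n d lam N)"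
  from frac_map_surj[OF this] obtain s where s: "s \<in> fracs n d lam M N" "frac_map n d lam M N s = \<theta>" by blast
  have c: "frac_rel n d lam M N `` {s} \<in> fracs n d lam M N // frac_rel n d lam M N" by (rule quotientI[OF s(1)])
  have "s \<in> frac_rel n d lam M N `` {s}" using s(1) frac_rel_iff by simp
  from qmap_eq(2)[OF c this] have "\<theta> = qmap n d lam M N (frac_rel n d lam M N `` {s})" using s(2) by simp
  thus "\<exists>\<alpha>\<in>fracs n d lam M N // frac_rel n d lam M N. \<theta> = qmap n d lam M N \<alpha>"
    using c by (rule bexI)
qed

text \<open>That the image of \<open>h\<close> is an arrow is a premise, to be supplied by
  functoriality of the quotient functor. As arrows are nonempty classes, it also shows that
  \<open>frac_of M N h\<close> is a fraction.\<close>

lemma qmap_quot_func: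
  assumes "farr (quot_func n d lam) M N h \<in> fracs n d lam M N // frac_rel n d lam M N"
    and h: "h \<in> lin_maps (weyl n) M N" and x: "x \<in> eigen n d M lam"
  shows "qmap n d lam M N (farr (quot_func n d lam) M N h) x = h x"
proof -
  have a: "farr (quot_func n d lam) M N h = frac_rel n d lam M N `` {frac_of M N h}"
    by (simp add: quot_func_def)
  note A = assms(1)[unfolded a]
  obtain s where "s \<in> frac_rel n d lam M N `` {frac_of M N h}" using A by (rule class_nonempty)
  hence "frac_of M N h \<in> fracs n d lam M N" using frac_rel_iff by blast
  moreover from this have "frac_of M N h \<in> frac_rel n d lam M N `` {frac_of M N h}" using frac_rel_iff by simp
  ultimately show ?thesis using qmap_eq(2)[OF A] frac_map_frac_of[OF _ h x] unfolding a by simp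
qed

end

text \<open>Premise \<open>c\<close> will come from the category axioms contained in the adjunction.
  It makes the composite a nonempty class, so that one pair of representatives whose
  \<open>frac_comp\<close> is a fraction suffices; on elements of degree zero
  \<open>frac_comp\<close> is composition of maps.\<close>

lemma qmap_comp:
  assumes M: "affine_module n d lam M" and N: "affine_module n d lam N" and P: "affine_module n d lam P"
    and \<alpha>: "\<alpha> \<in> Hom (Qcoh n d lam) M N" and \<beta>: "\<beta> \<in> Hom (Qcoh n d lam) N P"
    and c: "Comp (Qcoh n d lam) M N P \<beta> \<alpha> \<in> Hom (Qcoh n d lam) M P" and x: "x \<in> eigen n d M lam"
  shows "qmap n d lam M P (Comp (Qcoh n d lam) M N P \<beta> \<alpha>) x = qmap n d lam N P \<beta> (qmap n d lam M N \<alpha> x)"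
proof -
  interpret MN: affine_pair n d lam M N by (intro affine_pair.intro M N)
  interpret NP: affine_pair n d lam N P by (intro affine_pair.intro N P)
  interpret MP: affine_pair n d lam M P by (intro affine_pair.intro M P)
  let ?\<gamma> = "Comp (Qcoh n d lam) M N P \<beta> \<alpha>"
  have c': "?\<gamma> \<in> fracs n d lam M P // frac_rel n d lam M P" using c by simp
  have \<alpha>': "\<alpha> \<in> fracs n d lam M N // frac_rel n d lam M N" using \<alpha> by simp
  have \<beta>': "\<beta> \<in> fracs n d lam N P // frac_rel n d lam N P" using \<beta> by simp
  obtain z where z: "z \<in> ?\<gamma>" using c' by (rule MP.class_nonempty)
  then obtain s t where st: "s \<in> \<alpha>" "t \<in> \<beta>" "(frac_comp t s, z) \<in> frac_rel n d lam M P" by auto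
  obtain M' N' f where s: "s = (M', N', f)" by (cases s)
  obtain N'' P' g where t: "t = (N'', P', g)" by (cases t)
  have sf: "(M', N', f) \<in> fracs n d lam M N" using MN.qmap_eq(1)[OF \<alpha>' st(1)] s by simp
  have tf: "(N'', P', g) \<in> fracs n d lam N P" using NP.qmap_eq(1)[OF \<beta>' st(2)] t by simp
  have q: "frac_comp t s \<in> fracs n d lam M P" "qmap n d lam M P ?\<gamma> = frac_map n d lam M P (frac_comp t s)"
    using st(3) MP.frac_rel_iff MP.qmap_eq(2)[OF c' z] by auto
  define y where "y = frac_map n d lam M N s x"
  define w where "w = frac_map n d lam N P t y"
  have y: "y \<in> eigen n d N lam" "y \<in> f x"
    unfolding y_def s using MN.frac_map_mem[OF sf x] by blast+
  have w: "w \<in> eigen n d P lam" "w \<in> g y"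
    unfolding w_def t using NP.frac_map_mem[OF tf y(1)] by blast+
  \<comment> \<open>Being of degree zero, \<open>y\<close> lies in the domain \<open>N''\<close>, so
    \<open>g y\<close> is among the cosets that \<open>frac_comp\<close> joins.\<close>
  have yN: "y \<in> N''" using NP.frac_eigen_subset[OF tf] y(1) by blast
  have xM: "x \<in> M'" using MN.frac_eigen_subset[OF sf] x by blast
  define K where "K = {m \<in> M'. f m \<inter> N'' \<noteq> {}}"
  have fc: "frac_comp t s = (K, \<Union>y\<in>N' \<inter> N''. g y, restrict (\<lambda>m. \<Union>y\<in>f m \<inter> N''. g y) K)"
    unfolding frac_comp_def s t K_def Let_def prod.case ..
  have "x \<in> K" unfolding K_def using xM y(2) yN by blast
  hence "w \<in> restrict (\<lambda>m. \<Union>y\<in>f m \<inter> N''. g y) K x" using y(2) yN w(2) by auto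
  hence "frac_map n d lam M P (frac_comp t s) x = w"
    unfolding fc by (intro MP.frac_map_eqI[OF q(1)[unfolded fc] x _ w(1)])
  thus ?thesis
    using q(2) MN.qmap_eq(2)[OF \<alpha>' st(1)] NP.qmap_eq(2)[OF \<beta>' st(2)] unfolding w_def y_def by simp
qed

section \<open>Equivalences of categories\<close>

lemma categoryD:
  assumes "category C"
  shows category_id: "X \<in> Obj C \<Longrightarrow> Id C X \<in> Hom C X X"
    and category_comp: "X \<in> Obj C \<Longrightarrow> Y \<in> Obj C \<Longrightarrow> Z \<in> Obj C \<Longrightarrow> f \<in> Hom C X Y \<Longrightarrow>
      g \<in> Hom C Y Z \<Longrightarrow> Comp C X Y Z g f \<in> Hom C X Z"
    and category_idr: "X \<in> Obj C \<Longrightarrow> Y \<in> Obj C \<Longrightarrow> f \<in> Hom C X Y \<Longrightarrow> Comp C X X Y f (Id C X) = f"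
    and category_idl: "X \<in> Obj C \<Longrightarrow> Y \<in> Obj C \<Longrightarrow> f \<in> Hom C X Y \<Longrightarrow> Comp C X Y Y (Id C Y) f = f"
    and category_assoc: "W \<in> Obj C \<Longrightarrow> X \<in> Obj C \<Longrightarrow> Y \<in> Obj C \<Longrightarrow> Z \<in> Obj C \<Longrightarrow>
      f \<in> Hom C W X \<Longrightarrow> g \<in> Hom C X Y \<Longrightarrow> h \<in> Hom C Y Z \<Longrightarrow>
      Comp C W Y Z h (Comp C W X Y g f) = Comp C W X Z (Comp C X Y Z h g) f"
  using assms unfolding category_def by simp_all

lemma functorD:
  assumes "is_functor C D F"
  shows functor_source: "category C" and functor_target: "category D"
    and functor_obj: "X \<in> Obj C \<Longrightarrow> fobj F X \<in> Obj D"
    and functor_arr: "X \<in> Obj C \<Longrightarrow> Y \<in> Obj C \<Longrightarrow> f \<in> Hom C X Y \<Longrightarrow>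
      farr F X Y f \<in> Hom D (fobj F X) (fobj F Y)"
    and functor_id: "X \<in> Obj C \<Longrightarrow> farr F X X (Id C X) = Id D (fobj F X)"
    and functor_comp: "X \<in> Obj C \<Longrightarrow> Y \<in> Obj C \<Longrightarrow> Z \<in> Obj C \<Longrightarrow> f \<in> Hom C X Y \<Longrightarrow>
      g \<in> Hom C Y Z \<Longrightarrow> farr F X Z (Comp C X Y Z g f) =
        Comp D (fobj F X) (fobj F Y) (fobj F Z) (farr F Y Z g) (farr F X Y f)"
  using assms unfolding is_functor_def by simp_all

lemma is_isoD:
  assumes "is_iso D X Y f"
  shows "f \<in> Hom D X Y"
    "\<exists>g\<in>Hom D Y X. Comp D X Y X g f = Id D X \<and> Comp D Y X Y f g = Id D Y"
  using assms unfolding is_iso_def by auto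

text \<open>Choose for each \<open>Y\<close> an object \<open>g Y\<close> and an isomorphism
  \<open>e Y\<close> from its image to \<open>Y\<close> with inverse \<open>i Y\<close>. The
  quasi-inverse sends \<open>f\<close> to the preimage of the conjugate \<open>i f e\<close>;
  fullness provides this preimage, faithfulness the functor laws.\<close>

lemma is_equivalenceI:
  assumes F: "is_functor C D F"
    and bij: "\<And>X Y. X \<in> Obj C \<Longrightarrow> Y \<in> Obj C \<Longrightarrow>
      bij_betw (farr F X Y) (Hom C X Y) (Hom D (fobj F X) (fobj F Y))"
    and ess: "\<And>Y. Y \<in> Obj D \<Longrightarrow> \<exists>X\<in>Obj C. \<exists>f. is_iso D (fobj F X) Y f"
  shows "is_equivalence C D F"
proof -
  note C = functor_source[OF F] and D = functor_target[OF F]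
  note Fo = functor_obj[OF F] and Fa = functor_arr[OF F] and Fid = functor_id[OF F]
    and Fc = functor_comp[OF F]
  note Cid = category_id[OF C] and Cc = category_comp[OF C]
  note Did = category_id[OF D] and Dc = category_comp[OF D] and Dl = category_idl[OF D]
    and Dr = category_idr[OF D] and Da = category_assoc[OF D]
  have faithful: "a = b" if "X \<in> Obj C" "Y \<in> Obj C" "a \<in> Hom C X Y" "b \<in> Hom C X Y"
      "farr F X Y a = farr F X Y b" for X Y a b
    using bij[OF that(1,2)] that(3-5) unfolding bij_betw_def inj_on_def by blast
  define lift where "lift X Y = inv_into (Hom C X Y) (farr F X Y)" for X Y
  have lift: "lift X Y \<phi> \<in> Hom C X Y" "farr F X Y (lift X Y \<phi>) = \<phi>"
    if "X \<in> Obj C" "Y \<in> Obj C" "\<phi> \<in> Hom D (fobj F X) (fobj F Y)" for X Y \<phi>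
    using bij_betw_imp_surj_on[OF bij[OF that(1,2)]] that(3) unfolding lift_def
    by (simp_all add: inv_into_into f_inv_into_f)
  have "\<forall>Y\<in>Obj D. \<exists>X e i. X \<in> Obj C \<and> e \<in> Hom D (fobj F X) Y \<and> i \<in> Hom D Y (fobj F X) \<and>
     Comp D (fobj F X) Y (fobj F X) i e = Id D (fobj F X) \<and> Comp D Y (fobj F X) Y e i = Id D Y"
    using ess is_isoD by metis
  then obtain g e i where ge: "\<And>Y. Y \<in> Obj D \<Longrightarrow> g Y \<in> Obj C"
    "\<And>Y. Y \<in> Obj D \<Longrightarrow> e Y \<in> Hom D (fobj F (g Y)) Y" "\<And>Y. Y \<in> Obj D \<Longrightarrow> i Y \<in> Hom D Y (fobj F (g Y))"
    and ie: "\<And>Y. Y \<in> Obj D \<Longrightarrow> Comp D (fobj F (g Y)) Y (fobj F (g Y)) (i Y) (e Y) = Id D (fobj F (g Y))"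
    and ei: "\<And>Y. Y \<in> Obj D \<Longrightarrow> Comp D Y (fobj F (g Y)) Y (e Y) (i Y) = Id D Y"
    by metis
  note FgO = Fo[OF ge(1)]
  define conj where "conj Y Z f = Comp D (fobj F (g Y)) Z (fobj F (g Z)) (i Z)
     (Comp D (fobj F (g Y)) Y Z f (e Y))" for Y Z f
  have conj: "conj Y Z f \<in> Hom D (fobj F (g Y)) (fobj F (g Z))"
    if "Y \<in> Obj D" "Z \<in> Obj D" "f \<in> Hom D Y Z" for Y Z f
    unfolding conj_def by (intro Dc ge FgO that)
  have e_conj: "Comp D (fobj F (g Y)) (fobj F (g Z)) Z (e Z) (conj Y Z f) =
      Comp D (fobj F (g Y)) Y Z f (e Y)" if "Y \<in> Obj D" "Z \<in> Obj D" "f \<in> Hom D Y Z" for Y Z f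
  proof -
    have fe: "Comp D (fobj F (g Y)) Y Z f (e Y) \<in> Hom D (fobj F (g Y)) Z"
      by (intro Dc ge FgO that)
    show ?thesis unfolding conj_def
      using Da[OF FgO[OF that(1)] that(2) FgO[OF that(2)] that(2) fe ge(3)[OF that(2)] ge(2)[OF that(2)]]
        ei[OF that(2)] Dl[OF FgO[OF that(1)] that(2) fe] by simp
  qed
  \<comment> \<open>\<open>i Y\<close> is a left inverse of \<open>e Y\<close>, so
    \<open>e Y\<close> can be cancelled. Together with \<open>e_conj\<close> this proves equations
    between conjugates without unfolding them.\<close>
  have e_mono: "a = b" if Y: "Y \<in> Obj D" and W: "W \<in> Obj D"
    and a: "a \<in> Hom D W (fobj F (g Y))" and b: "b \<in> Hom D W (fobj F (g Y))"
    and eq: "Comp D W (fobj F (g Y)) Y (e Y) a = Comp D W (fobj F (g Y)) Y (e Y) b" for W Y a b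
  proof -
    have *: "Comp D W Y (fobj F (g Y)) (i Y) (Comp D W (fobj F (g Y)) Y (e Y) c) = c"
      if c: "c \<in> Hom D W (fobj F (g Y))" for c
      unfolding Da[OF W FgO[OF Y] Y FgO[OF Y] c ge(2)[OF Y] ge(3)[OF Y]] ie[OF Y]
      by (rule Dl[OF W FgO[OF Y] c])
    show ?thesis using *[OF a] *[OF b] unfolding eq by (rule trans[OF sym])
  qed
  define G where "G = \<lparr>fobj = g, farr = (\<lambda>Y Z f. lift (g Y) (g Z) (conj Y Z f))\<rparr>"
  have Go: "fobj G = g" and Ga: "farr G Y Z f = lift (g Y) (g Z) (conj Y Z f)" for Y Z f
    by (simp_all add: G_def)
  have FG: "farr F (g Y) (g Z) (farr G Y Z f) = conj Y Z f"
    if "Y \<in> Obj D" "Z \<in> Obj D" "f \<in> Hom D Y Z" for Y Z f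
    unfolding Ga by (intro lift ge conj that)
  have Garr: "farr G Y Z f \<in> Hom C (g Y) (g Z)" if "Y \<in> Obj D" "Z \<in> Obj D" "f \<in> Hom D Y Z" for Y Z f
    unfolding Ga by (intro lift ge conj that)
  have G: "is_functor D C G"
    unfolding is_functor_def Go
  proof (intro conjI ballI C D ge(1) Garr)
    fix Y assume Y: "Y \<in> Obj D"
    show "farr G Y Y (Id D Y) = Id C (g Y)"
    proof (rule faithful[OF ge(1)[OF Y] ge(1)[OF Y] Garr[OF Y Y Did[OF Y]] Cid[OF ge(1)[OF Y]]])
      show "farr F (g Y) (g Y) (farr G Y Y (Id D Y)) = farr F (g Y) (g Y) (Id C (g Y))"
        unfolding FG[OF Y Y Did[OF Y]] Fid[OF ge(1)[OF Y]] conj_def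
          Dl[OF FgO[OF Y] Y ge(2)[OF Y]] by (rule ie[OF Y])
    qed
  next
    fix X Y Z f h assume X: "X \<in> Obj D" and Y: "Y \<in> Obj D" and Z: "Z \<in> Obj D"
      and f: "f \<in> Hom D X Y" and h: "h \<in> Hom D Y Z"
    note hf = Dc[OF X Y Z f h]
    note cf = conj[OF X Y f] and ch = conj[OF Y Z h] and chf = conj[OF X Z hf]
    have "conj X Z (Comp D X Y Z h f) =
      Comp D (fobj F (g X)) (fobj F (g Y)) (fobj F (g Z)) (conj Y Z h) (conj X Y f)"
    proof (rule e_mono[OF Z FgO[OF X] chf Dc[OF FgO[OF X] FgO[OF Y] FgO[OF Z] cf ch]])
      have "Comp D (fobj F (g X)) (fobj F (g Z)) Z (e Z)
          (Comp D (fobj F (g X)) (fobj F (g Y)) (fobj F (g Z)) (conj Y Z h) (conj X Y f)) =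
        Comp D (fobj F (g X)) (fobj F (g Y)) Z
          (Comp D (fobj F (g Y)) (fobj F (g Z)) Z (e Z) (conj Y Z h)) (conj X Y f)"
        by (rule Da[OF FgO[OF X] FgO[OF Y] FgO[OF Z] Z cf ch ge(2)[OF Z]])
      also have "\<dots> = Comp D (fobj F (g X)) (fobj F (g Y)) Z (Comp D (fobj F (g Y)) Y Z h (e Y)) (conj X Y f)"
        unfolding e_conj[OF Y Z h] ..
      also have "\<dots> = Comp D (fobj F (g X)) Y Z h (Comp D (fobj F (g X)) (fobj F (g Y)) Y (e Y) (conj X Y f))"
        by (rule Da[OF FgO[OF X] FgO[OF Y] Y Z cf ge(2)[OF Y] h, symmetric])
      also have "\<dots> = Comp D (fobj F (g X)) Y Z h (Comp D (fobj F (g X)) X Y f (e X))"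
        unfolding e_conj[OF X Y f] ..
      also have "\<dots> = Comp D (fobj F (g X)) X Z (Comp D X Y Z h f) (e X)"
        by (rule Da[OF FgO[OF X] X Y Z ge(2)[OF X] f h])
      finally show "Comp D (fobj F (g X)) (fobj F (g Z)) Z (e Z) (conj X Z (Comp D X Y Z h f)) =
        Comp D (fobj F (g X)) (fobj F (g Z)) Z (e Z)
          (Comp D (fobj F (g X)) (fobj F (g Y)) (fobj F (g Z)) (conj Y Z h) (conj X Y f))"
        unfolding e_conj[OF X Z hf] by simp
    qed
    hence "farr F (g X) (g Z) (farr G X Z (Comp D X Y Z h f)) =
      farr F (g X) (g Z) (Comp C (g X) (g Y) (g Z) (farr G Y Z h) (farr G X Y f))"
      using Fc[OF ge(1)[OF X] ge(1)[OF Y] ge(1)[OF Z] Garr[OF X Y f] Garr[OF Y Z h]]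
      by (simp add: FG X Y Z f h hf)
    thus "farr G X Z (Comp D X Y Z h f) = Comp C (g X) (g Y) (g Z) (farr G Y Z h) (farr G X Y f)"
      by (rule faithful[OF ge(1)[OF X] ge(1)[OF Z] Garr[OF X Z hf]
        Cc[OF ge(1)[OF X] ge(1)[OF Y] ge(1)[OF Z] Garr[OF X Y f] Garr[OF Y Z h]]])
  qed
  have "naturally_isomorphic D D (comp_func F G) id_func"
    unfolding naturally_isomorphic_def comp_func_def id_func_def Go func.simps
  proof (intro exI[of _ e] conjI ballI)
    fix Y assume "Y \<in> Obj D"
    thus "is_iso D (fobj F (g Y)) Y (e Y)" unfolding is_iso_def using ge ie ei by blast
  next
    fix Y Z f assume Y: "Y \<in> Obj D" and Z: "Z \<in> Obj D" and f: "f \<in> Hom D Y Z"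
    show "Comp D (fobj F (g Y)) (fobj F (g Z)) Z (e Z) (farr F (g Y) (g Z) (farr G Y Z f)) =
      Comp D (fobj F (g Y)) Y Z f (e Y)"
      unfolding FG[OF Y Z f] by (rule e_conj[OF Y Z f])
  qed
  moreover have "naturally_isomorphic C C id_func (comp_func G F)"
    unfolding naturally_isomorphic_def comp_func_def id_func_def Go func.simps
  \<comment> \<open>The unit at \<open>X\<close> is the lift of the inverse isomorphism
    \<open>i (fobj F X)\<close>.\<close>
  proof (intro exI[of _ "\<lambda>X. lift X (g (fobj F X)) (i (fobj F X))"] conjI ballI)
    fix X assume X: "X \<in> Obj C"
    note FX = Fo[OF X]
    note gX = ge(1)[OF FX]
    note l = lift[OF X gX ge(3)[OF FX]] and l' = lift[OF gX X ge(2)[OF FX]]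
    show "is_iso C X (g (fobj F X)) (lift X (g (fobj F X)) (i (fobj F X)))"
      unfolding is_iso_def
    proof (intro conjI l(1) bexI[OF _ l'(1)])
      show "Comp C X (g (fobj F X)) X (lift (g (fobj F X)) X (e (fobj F X))) (lift X (g (fobj F X)) (i (fobj F X))) = Id C X"
        by (rule faithful[OF X X Cc[OF X gX X l(1) l'(1)] Cid[OF X]])
          (simp add: Fc[OF X gX X l(1) l'(1)] l l' Fid X ei FX)
      show "Comp C (g (fobj F X)) X (g (fobj F X)) (lift X (g (fobj F X)) (i (fobj F X)))
          (lift (g (fobj F X)) X (e (fobj F X))) = Id C (g (fobj F X))"
        by (rule faithful[OF gX gX Cc[OF gX X gX l'(1) l(1)] Cid[OF gX]])
          (simp add: Fc[OF gX X gX l'(1) l(1)] l l' Fid gX ie FX)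
    qed
  next
    fix X Y f assume X: "X \<in> Obj C" and Y: "Y \<in> Obj C" and f: "f \<in> Hom C X Y"
    note FX = Fo[OF X] and FY = Fo[OF Y]
    note gX = ge(1)[OF FX] and gY = ge(1)[OF FY]
    note lX = lift[OF X gX ge(3)[OF FX]] and lY = lift[OF Y gY ge(3)[OF FY]]
    note Ff = Fa[OF X Y f]
    note GFf = Garr[OF FX FY Ff]
    show "Comp C X Y (g (fobj F Y)) (lift Y (g (fobj F Y)) (i (fobj F Y))) f =
      Comp C X (g (fobj F X)) (g (fobj F Y)) (farr G (fobj F X) (fobj F Y) (farr F X Y f))
        (lift X (g (fobj F X)) (i (fobj F X)))"
    proof (rule faithful[OF X gY Cc[OF X Y gY f lY(1)] Cc[OF X gX gY lX(1) GFf]])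
      have "Comp D (fobj F X) (fobj F (g (fobj F X))) (fobj F (g (fobj F Y)))
          (conj (fobj F X) (fobj F Y) (farr F X Y f)) (i (fobj F X)) =
        Comp D (fobj F X) (fobj F Y) (fobj F (g (fobj F Y))) (i (fobj F Y))
          (Comp D (fobj F X) (fobj F (g (fobj F X))) (fobj F Y)
            (Comp D (fobj F (g (fobj F X))) (fobj F X) (fobj F Y) (farr F X Y f) (e (fobj F X))) (i (fobj F X)))"
        unfolding conj_def
        by (rule Da[OF FX FgO[OF FX] FY FgO[OF FY] ge(3)[OF FX] Dc[OF FgO[OF FX] FX FY ge(2)[OF FX] Ff]
            ge(3)[OF FY], symmetric])
      also have "Comp D (fobj F X) (fobj F (g (fobj F X))) (fobj F Y)
            (Comp D (fobj F (g (fobj F X))) (fobj F X) (fobj F Y) (farr F X Y f) (e (fobj F X))) (i (fobj F X)) =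
         farr F X Y f"
        using Da[OF FX FgO[OF FX] FX FY ge(3)[OF FX] ge(2)[OF FX] Ff] ei[OF FX] Dr[OF FX FY Ff] by simp
      finally show "farr F X (g (fobj F Y)) (Comp C X Y (g (fobj F Y)) (lift Y (g (fobj F Y)) (i (fobj F Y))) f) =
        farr F X (g (fobj F Y)) (Comp C X (g (fobj F X)) (g (fobj F Y))
          (farr G (fobj F X) (fobj F Y) (farr F X Y f)) (lift X (g (fobj F X)) (i (fobj F X))))"
        unfolding Fc[OF X Y gY f lY(1)] Fc[OF X gX gY lX(1) GFf] lX(2) lY(2) FG[OF FX FY Ff] by simp
    qed
  qed
  ultimately show ?thesis unfolding is_equivalence_def using F G by blast
qed

text \<open>Closure of \<open>carrier N\<close> under the operations and linearity of the inverse
  are both read off from \<open>M\<close> through the bijection.\<close>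

lemma lin_maps_inverse:
  assumes "left_module R M" "f \<in> lin_maps R M N" "bij_betw f (carrier M) (carrier N)"
  shows "restrict (inv_into (carrier M) f) (carrier N) \<in> lin_maps R N M"
proof -
  interpret M: left_module R M by fact
  define g where "g = inv_into (carrier M) f"
  have gC: "g y \<in> carrier M" "f (g y) = y" if "y \<in> carrier N" for y
    unfolding g_def using bij_betw_imp_surj_on[OF assms(3)] that
    by (simp_all add: inv_into_into f_inv_into_f)
  have inj: "x = x'" if "x \<in> carrier M" "x' \<in> carrier M" "f x = f x'" for x x'
    using bij_betw_imp_inj_on[OF assms(3)] that by (simp add: inj_on_def)
  have cl: "f x \<in> carrier N" if "x \<in> carrier M" for x using lin_mapsD(1)[OF assms(2) that] .
  show ?thesis
    unfolding g_def[symmetric]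
  proof (rule lin_mapsI)
    fix x y assume xy: "x \<in> carrier N" "y \<in> carrier N"
    have e: "f (g x \<oplus>\<^bsub>M\<^esub> g y) = x \<oplus>\<^bsub>N\<^esub> y" using lin_mapsD(2)[OF assms(2)] gC xy by simp
    hence c: "x \<oplus>\<^bsub>N\<^esub> y \<in> carrier N" using cl[of "g x \<oplus>\<^bsub>M\<^esub> g y"] gC xy by simp
    have "g (x \<oplus>\<^bsub>N\<^esub> y) = g x \<oplus>\<^bsub>M\<^esub> g y" by (rule inj) (use e c gC xy in simp_all)
    thus "restrict g (carrier N) (x \<oplus>\<^bsub>N\<^esub> y) = restrict g (carrier N) x \<oplus>\<^bsub>M\<^esub> restrict g (carrier N) y"
      using xy c by simp
  next
    fix a y assume ay: "a \<in> carrier R" "y \<in> carrier N"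
    have e: "f (a \<odot>\<^bsub>M\<^esub> g y) = a \<odot>\<^bsub>N\<^esub> y" using lin_mapsD(3)[OF assms(2)] gC ay by simp
    hence c: "a \<odot>\<^bsub>N\<^esub> y \<in> carrier N" using cl[of "a \<odot>\<^bsub>M\<^esub> g y"] gC ay M.smult_closed by simp
    have "g (a \<odot>\<^bsub>N\<^esub> y) = a \<odot>\<^bsub>M\<^esub> g y" by (rule inj) (use e c gC ay M.smult_closed in simp_all)
    thus "restrict g (carrier N) (a \<odot>\<^bsub>N\<^esub> y) = a \<odot>\<^bsub>M\<^esub> restrict g (carrier N) y"
      using ay c by simp
  qed (use gC in auto)
qed

lemma Left_Mod_simps [simp]:
  "Obj (Left_Mod R) = {M. left_module R M}" "Hom (Left_Mod R) = lin_maps R"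
  "Id (Left_Mod R) M = restrict (\<lambda>x. x) (carrier M)"
  "Comp (Left_Mod R) M N P g f = compose (carrier M) g f"
  by (simp_all add: Left_Mod_def mod_cat_def)

lemma Grmod_simps [simp]:
  "Obj (Grmod n d lam) = {M. euler_module n d lam M}" "Hom (Grmod n d lam) = lin_maps (weyl n)"
  "Id (Grmod n d lam) M = restrict (\<lambda>x. x) (carrier M)"
  "Comp (Grmod n d lam) M N P g f = compose (carrier M) g f"
  by (simp_all add: Grmod_def mod_cat_def)

lemma Left_Mod_iso:
  assumes M: "left_module R M" and f: "f \<in> lin_maps R M N" and b: "bij_betw f (carrier M) (carrier N)"
  shows "is_iso (Left_Mod R) M N f"
proof -
  let ?g = "restrict (inv_into (carrier M) f) (carrier N)"
  have g: "?g \<in> lin_maps R N M" by (rule lin_maps_inverse[OF assms])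
  have "compose (carrier M) ?g f = restrict (\<lambda>x. x) (carrier M)"
    using lin_mapsD(1)[OF f] bij_betw_imp_inj_on[OF b] by (auto simp: compose_def fun_eq_iff)
  moreover have "compose (carrier N) f ?g = restrict (\<lambda>x. x) (carrier N)"
    using bij_betw_imp_surj_on[OF b] by (auto simp: compose_def fun_eq_iff f_inv_into_f)
  ultimately show ?thesis unfolding is_iso_def Left_Mod_simps using f g by blast
qed

lemma restrict_degree0_lin_maps:
  assumes "weyl_module n M" "weyl_module n N" "h \<in> lin_maps (weyl n) M N"
  shows "restrict h (eigen n d M lam) \<in> lin_maps (twisted0 n d lam) (degree0 n d lam M) (degree0 n d lam N)"
proof -
  interpret M: weyl_module n M d lam by fact
  interpret N: weyl_module n N d lam by fact
  note hD = lin_mapsD[OF assms(3)]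
  have he: "h x \<in> eigen n d N lam" if "x \<in> eigen n d M lam" for x
    using that hD(1)[of x] hD(3)[of "euler n d" x] hD(3)[of "scal lam" x]
    by (simp add: eigen_def euler_weyl_carrier weyl_carrier.scal)
  have "h (P \<odot>\<^bsub>M\<^esub> x) = P \<odot>\<^bsub>N\<^esub> h x" if "weyl_homog n d 0 P" "x \<in> eigen n d M lam" for P x
    using hD(3)[of P x] weyl_homog_weyl_carrier[OF that(1)] M.eigen_carrier[OF that(2)] by simp
  moreover have "h (x \<oplus>\<^bsub>M\<^esub> y) = h x \<oplus>\<^bsub>N\<^esub> h y" if "x \<in> eigen n d M lam" "y \<in> eigen n d M lam" for x y
    using hD(2) that M.eigen_carrier by blast
  ultimately show ?thesis
    unfolding lin_maps_degree0_iff[OF assms(1,2)]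
    using he M.eigen_add M.eigen_homog0 by simp
qed

section \<open>The counit and global sections\<close>

locale affine_adjunction = affine_weights n d lam for n d and lam :: "'k::field_char_0" +
  fixes \<omega> :: "(('k oper, 'm) module, 'm frac set, ('k oper, 'm) module, 'm \<Rightarrow> 'm) func"
  assumes adjoint: "right_adjoint (Grmod n d lam) (Qcoh n d lam) (quot_func n d lam) \<omega>"
begin

abbreviation "Gr \<equiv> Grmod n d lam :: (('k oper, 'm) module, 'm \<Rightarrow> 'm) cat"
abbreviation "Q \<equiv> Qcoh n d lam :: (('k oper, 'm) module, 'm frac set) cat"
abbreviation "\<Omega> \<equiv> fobj \<omega>"
abbreviation "\<pi> \<equiv> farr (quot_func n d lam) :: ('k oper, 'm) module \<Rightarrow> _ \<Rightarrow> ('m \<Rightarrow> 'm) \<Rightarrow> 'm frac set"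

lemma functor_quot: "is_functor Gr Q (quot_func n d lam)" and functor_\<omega>: "is_functor Q Gr \<omega>"
  using adjoint unfolding right_adjoint_def by blast+

lemma fobj_quot_func [simp]: "fobj (quot_func n d lam) M = M"
  by (simp add: quot_func_def)

lemma Obj_Q [simp]: "M \<in> Obj Q \<longleftrightarrow> M \<in> Obj Gr" for M :: "('k oper, 'm) module"
  by simp

lemma affine_module_Obj: "M \<in> Obj Gr \<Longrightarrow> affine_module n d lam M" for M :: "('k oper, 'm) module"
  by (intro affine_module.intro affine_weights_axioms) (simp add: euler_mod_iff)

lemma affine_pair_Obj: "M \<in> Obj Gr \<Longrightarrow> N \<in> Obj Gr \<Longrightarrow> affine_pair n d lam M N"
  for M N :: "('k oper, 'm) module"
  by (intro affine_pair.intro affine_module_Obj)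

lemma \<omega>_Obj: "M \<in> Obj Gr \<Longrightarrow> \<Omega> M \<in> Obj Gr"
  using functor_obj[OF functor_\<omega>, of M] by (simp only: Obj_Q)

lemma \<pi>_Hom: "M \<in> Obj Gr \<Longrightarrow> N \<in> Obj Gr \<Longrightarrow> h \<in> lin_maps (weyl n) M N \<Longrightarrow> \<pi> M N h \<in> Hom Q M N"
  using functor_arr[OF functor_quot, of M N h] by (simp only: fobj_quot_func Grmod_simps)

lemma \<omega>_arr: "M \<in> Obj Gr \<Longrightarrow> N \<in> Obj Gr \<Longrightarrow> \<alpha> \<in> Hom Q M N \<Longrightarrow>
    farr \<omega> M N \<alpha> \<in> lin_maps (weyl n) (\<Omega> M) (\<Omega> N)"
  using functor_arr[OF functor_\<omega>, of M N \<alpha>] by (simp only: Obj_Q Grmod_simps)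

abbreviation "qm \<equiv> qmap n d lam"

lemma qm_comp:
  assumes "M \<in> Obj Gr" "N \<in> Obj Gr" "P \<in> Obj Gr" "\<alpha> \<in> Hom Q M N" "\<beta> \<in> Hom Q N P"
    "x \<in> eigen n d M lam"
  shows "qm M P (Comp Q M N P \<beta> \<alpha>) x = qm N P \<beta> (qm M N \<alpha> x)"
  by (rule qmap_comp[OF affine_module_Obj affine_module_Obj affine_module_Obj assms(4,5) _ assms(6)])
    (use assms category_comp[OF functor_target[OF functor_quot], of M N P \<alpha> \<beta>] in \<open>simp_all only: Obj_Q\<close>)

lemma qm_\<pi>:
  assumes "M \<in> Obj Gr" "N \<in> Obj Gr" "h \<in> lin_maps (weyl n) M N" "x \<in> eigen n d M lam"
  shows "qm M N (\<pi> M N h) x = h x"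
  using affine_pair.qmap_quot_func[OF affine_pair_Obj[OF assms(1,2)] _ assms(3,4)] \<pi>_Hom[OF assms(1-3)]
  by (simp only: Qcoh_simps)

lemma qm_bij:
  assumes "M \<in> Obj Gr" "N \<in> Obj Gr"
  shows "bij_betw (qm M N) (Hom Q M N) (lin_maps (twisted0 n d lam) (degree0 n d lam M) (degree0 n d lam N))"
  using affine_pair.bij_betw_qmap[OF affine_pair_Obj[OF assms]] by (simp only: Qcoh_simps)

lemma degree0_linD:
  assumes "M \<in> Obj Gr" "N \<in> Obj Gr"
    and f: "f \<in> lin_maps (twisted0 n d lam) (degree0 n d lam M) (degree0 n d lam N)"
  shows "x \<in> eigen n d M lam \<Longrightarrow> f x \<in> eigen n d N lam"
    and "x \<in> eigen n d M lam \<Longrightarrow> y \<in> eigen n d M lam \<Longrightarrow> f (x \<oplus>\<^bsub>M\<^esub> y) = f x \<oplus>\<^bsub>N\<^esub> f y"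
    and "weyl_homog n d 0 P \<Longrightarrow> x \<in> eigen n d M lam \<Longrightarrow> f (P \<odot>\<^bsub>M\<^esub> x) = P \<odot>\<^bsub>N\<^esub> f x"
proof -
  interpret MN: affine_pair n d lam M N by (rule affine_pair_Obj[OF assms(1,2)])
  note D = f[unfolded lin_maps_degree0_iff[OF MN.M.weyl_module_axioms MN.N.weyl_module_axioms]]
  show "x \<in> eigen n d M lam \<Longrightarrow> f x \<in> eigen n d N lam" using D by blast
  show "x \<in> eigen n d M lam \<Longrightarrow> y \<in> eigen n d M lam \<Longrightarrow> f (x \<oplus>\<^bsub>M\<^esub> y) = f x \<oplus>\<^bsub>N\<^esub> f y" using D by blast
  show "weyl_homog n d 0 P \<Longrightarrow> x \<in> eigen n d M lam \<Longrightarrow> f (P \<odot>\<^bsub>M\<^esub> x) = P \<odot>\<^bsub>N\<^esub> f x" using D by blast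
qed

text \<open>With the counit as \<open>\<epsilon>\<close> this is the adjunction bijection, from maps
  \<open>M \<rightarrow> \<Omega> N\<close> to arrows \<open>M \<rightarrow> N\<close> of the
  quotient category.\<close>

abbreviation transpose :: "'m frac set \<Rightarrow> ('k oper, 'm) module \<Rightarrow> ('k oper, 'm) module \<Rightarrow> ('m \<Rightarrow> 'm) \<Rightarrow> 'm frac set"
  where "transpose \<epsilon> M N h \<equiv> Comp Q M (\<Omega> N) N \<epsilon> (\<pi> M (\<Omega> N) h)"

text \<open>The counit corresponds to the identity of \<open>\<Omega> N\<close> under the given
  bijections. Their naturality in the first argument makes \<open>transpose\<close> inverse to them;
  naturality in the second makes the counit natural.\<close>

lemma counit_ex:
  obtains \<epsilon> :: "('k oper, 'm) module \<Rightarrow> 'm frac set" where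
    "\<And>N. N \<in> Obj Gr \<Longrightarrow> \<epsilon> N \<in> Hom Q (\<Omega> N) N"
    "\<And>M N. M \<in> Obj Gr \<Longrightarrow> N \<in> Obj Gr \<Longrightarrow>
      bij_betw (transpose (\<epsilon> N) M N) (lin_maps (weyl n) M (\<Omega> N)) (Hom Q M N)"
    "\<And>M N \<alpha>. M \<in> Obj Gr \<Longrightarrow> N \<in> Obj Gr \<Longrightarrow> \<alpha> \<in> Hom Q M N \<Longrightarrow>
      transpose (\<epsilon> N) (\<Omega> M) N (farr \<omega> M N \<alpha>) = Comp Q (\<Omega> M) M N \<alpha> (\<epsilon> M)"
proof -
  note QC = functor_target[OF functor_quot] and GC = functor_source[OF functor_quot]
  obtain \<phi> :: "('k oper, 'm) module \<Rightarrow> ('k oper, 'm) module \<Rightarrow> 'm frac set \<Rightarrow> 'm \<Rightarrow> 'm" where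
    bij: "\<forall>X\<in>Obj Gr. \<forall>Y\<in>Obj Q. bij_betw (\<phi> X Y) (Hom Q (fobj (quot_func n d lam) X) Y) (Hom Gr X (\<Omega> Y))"
    and natX: "\<forall>X'\<in>Obj Gr. \<forall>X\<in>Obj Gr. \<forall>Y\<in>Obj Q. \<forall>u\<in>Hom Gr X' X. \<forall>f\<in>Hom Q (fobj (quot_func n d lam) X) Y.
       \<phi> X' Y (Comp Q (fobj (quot_func n d lam) X') (fobj (quot_func n d lam) X) Y f (\<pi> X' X u)) =
       Comp Gr X' X (\<Omega> Y) (\<phi> X Y f) u"
    and natY: "\<forall>X\<in>Obj Gr. \<forall>Y\<in>Obj Q. \<forall>Y'\<in>Obj Q. \<forall>v\<in>Hom Q Y Y'. \<forall>f\<in>Hom Q (fobj (quot_func n d lam) X) Y.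
       \<phi> X Y' (Comp Q (fobj (quot_func n d lam) X) Y Y' v f) =
       Comp Gr X (\<Omega> Y) (\<Omega> Y') (farr \<omega> Y Y' v) (\<phi> X Y f)"
    using adjoint unfolding right_adjoint_def by (elim conjE exE) (rule that)
  define \<epsilon> where "\<epsilon> N = inv_into (Hom Q (\<Omega> N) N) (\<phi> (\<Omega> N) N) (Id Gr (\<Omega> N))" for N
  have bij': "bij_betw (\<phi> M N) (Hom Q M N) (Hom Gr M (\<Omega> N))" if "M \<in> Obj Gr" "N \<in> Obj Gr" for M N
    using bij that by (simp only: fobj_quot_func Obj_Q)
  have \<epsilon>: "\<epsilon> N \<in> Hom Q (\<Omega> N) N" "\<phi> (\<Omega> N) N (\<epsilon> N) = Id Gr (\<Omega> N)" if N: "N \<in> Obj Gr" for N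
  proof -
    have "Id Gr (\<Omega> N) \<in> \<phi> (\<Omega> N) N ` Hom Q (\<Omega> N) N"
      using bij_betw_imp_surj_on[OF bij'[OF \<omega>_Obj[OF N] N]] category_id[OF GC \<omega>_Obj[OF N]] by blast
    thus "\<epsilon> N \<in> Hom Q (\<Omega> N) N" "\<phi> (\<Omega> N) N (\<epsilon> N) = Id Gr (\<Omega> N)"
      unfolding \<epsilon>_def by (rule inv_into_into, rule f_inv_into_f)
  qed
  have \<phi>\<epsilon>: "\<phi> M N (transpose (\<epsilon> N) M N h) = h"
    if M: "M \<in> Obj Gr" and N: "N \<in> Obj Gr" and h: "h \<in> Hom Gr M (\<Omega> N)" for M N h
  proof -
    have "\<phi> M N (transpose (\<epsilon> N) M N h) =
      Comp Gr M (\<Omega> N) (\<Omega> N) (\<phi> (\<Omega> N) N (\<epsilon> N)) h"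
      using natX[rule_format, OF M \<omega>_Obj[OF N], of N h "\<epsilon> N"] N h \<epsilon>(1)[OF N]
      by (simp only: fobj_quot_func Obj_Q)
    also have "\<dots> = h" unfolding \<epsilon>(2)[OF N] by (rule category_idl[OF GC M \<omega>_Obj[OF N] h])
    finally show ?thesis .
  qed
  have in_Hom: "transpose (\<epsilon> N) M N h \<in> Hom Q M N"
    if M: "M \<in> Obj Gr" and N: "N \<in> Obj Gr" and h: "h \<in> Hom Gr M (\<Omega> N)" for M N h
    by (rule category_comp[OF QC]) (use M N h \<epsilon>(1)[OF N] \<omega>_Obj[OF N] \<pi>_Hom in \<open>simp_all only: Obj_Q Grmod_simps\<close>)
  have uniq: "transpose (\<epsilon> N) M N (\<phi> M N \<alpha>) = \<alpha>"
    if M: "M \<in> Obj Gr" and N: "N \<in> Obj Gr" and \<alpha>: "\<alpha> \<in> Hom Q M N" for M N \<alpha>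
  proof -
    have h: "\<phi> M N \<alpha> \<in> Hom Gr M (\<Omega> N)" using bij_betw_imp_surj_on[OF bij'[OF M N]] \<alpha> by blast
    show ?thesis
      by (rule inj_onD[OF bij_betw_imp_inj_on[OF bij'[OF M N]] \<phi>\<epsilon>[OF M N h] in_Hom[OF M N h] \<alpha>])
  qed
  show thesis
  proof (rule that[of \<epsilon>])
    show "\<epsilon> N \<in> Hom Q (\<Omega> N) N" if "N \<in> Obj Gr" for N by (rule \<epsilon>(1)[OF that])
    fix M N assume M: "M \<in> Obj Gr" and N: "N \<in> Obj Gr"
    show "bij_betw (transpose (\<epsilon> N) M N) (lin_maps (weyl n) M (\<Omega> N)) (Hom Q M N)"
    proof (rule bij_betwI[where g = "\<phi> M N"])
      show "transpose (\<epsilon> N) M N \<in> lin_maps (weyl n) M (\<Omega> N) \<rightarrow> Hom Q M N"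
        using in_Hom[OF M N] by (intro Pi_I) (simp only: Grmod_simps)
      show "\<phi> M N \<in> Hom Q M N \<rightarrow> lin_maps (weyl n) M (\<Omega> N)"
        using bij_betwE[OF bij'[OF M N]] by (intro Pi_I) (simp only: Grmod_simps)
      show "\<phi> M N (transpose (\<epsilon> N) M N h) = h" if "h \<in> lin_maps (weyl n) M (\<Omega> N)" for h
        using \<phi>\<epsilon>[OF M N, of h] that by (simp only: Grmod_simps)
      show "transpose (\<epsilon> N) M N (\<phi> M N \<alpha>) = \<alpha>" if "\<alpha> \<in> Hom Q M N" for \<alpha>
        by (rule uniq[OF M N that])
    qed
  next
    show "transpose (\<epsilon> N) (\<Omega> M) N (farr \<omega> M N \<alpha>) =
        Comp Q (\<Omega> M) M N \<alpha> (\<epsilon> M)"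
      if M: "M \<in> Obj Gr" and N: "N \<in> Obj Gr" and \<alpha>: "\<alpha> \<in> Hom Q M N" for M N \<alpha>
    proof -
      note W = \<omega>_Obj[OF M]
      have c: "Comp Q (\<Omega> M) M N \<alpha> (\<epsilon> M) \<in> Hom Q (\<Omega> M) N"
        by (rule category_comp[OF QC]) (use M N W \<alpha> \<epsilon>(1)[OF M] in \<open>simp_all only: Obj_Q\<close>)
      have "\<phi> (\<Omega> M) N (Comp Q (\<Omega> M) M N \<alpha> (\<epsilon> M)) =
        Comp Gr (\<Omega> M) (\<Omega> M) (\<Omega> N) (farr \<omega> M N \<alpha>) (\<phi> (\<Omega> M) M (\<epsilon> M))"
        using natY[rule_format, OF W, of M N \<alpha> "\<epsilon> M"] M N \<alpha> \<epsilon>(1)[OF M] by (simp only: fobj_quot_func Obj_Q)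
      also have "\<dots> = farr \<omega> M N \<alpha>"
        unfolding \<epsilon>(2)[OF M] by (rule category_idr[OF GC W \<omega>_Obj[OF N]])
          (use \<omega>_arr[OF M N \<alpha>] in \<open>simp only: Grmod_simps\<close>)
      finally show ?thesis using uniq[OF W N c] by simp
    qed
  qed
qed

text \<open>Injectivity: if the counit kills the degree zero part of a submodule of
  \<open>\<Omega> N\<close>, the inclusion and the zero map of this submodule have the same
  transpose, so the submodule is zero. Surjectivity: the identity of \<open>N\<close> is the
  transpose of some \<open>h\<close>, and \<open>h\<close> is then a section of the counit in degree
  zero.\<close>

lemma counit_bij:
  assumes N: "N \<in> Obj Gr" and \<epsilon>: "\<epsilon> \<in> Hom Q (\<Omega> N) N"
    and bij: "\<And>M. M \<in> Obj Gr \<Longrightarrow>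
      bij_betw (transpose \<epsilon> M N) (lin_maps (weyl n) M (\<Omega> N)) (Hom Q M N)"
  shows "bij_betw (qm (\<Omega> N) N \<epsilon>) (eigen n d (\<Omega> N) lam) (eigen n d N lam)"
proof -
  define W where "W = \<Omega> N"
  have W: "W \<in> Obj Gr" unfolding W_def by (rule \<omega>_Obj[OF N])
  note \<epsilon> = \<epsilon>[folded W_def] and bij = bij[folded W_def]
  interpret WN: affine_pair n d lam W N by (rule affine_pair_Obj[OF W N])
  let ?e = "qm W N \<epsilon>"
  have e: "?e \<in> lin_maps (twisted0 n d lam) (degree0 n d lam W) (degree0 n d lam N)"
    using bij_betw_imp_surj_on[OF qm_bij[OF W N]] \<epsilon> by blast
  note eD = degree0_linD[OF W N e]
  have e0: "?e \<zero>\<^bsub>W\<^esub> = \<zero>\<^bsub>N\<^esub>"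
    using lin_maps_zero[OF e WN.M.left_module_degree0 WN.N.left_module_degree0] by simp
  have kernel: "w = \<zero>\<^bsub>W\<^esub>" if w: "w \<in> eigen n d W lam" "?e w = \<zero>\<^bsub>N\<^esub>" for w
  proof -
    \<comment> \<open>The largest submodule with degree zero part in the kernel. It will be shown to
      contain \<open>w\<close> and to be zero.\<close>
    define X where "X = {x \<in> carrier W. \<forall>Q\<in>weyl_carrier n. ?e (WN.M.pr (Q \<odot>\<^bsub>W\<^esub> x)) = \<zero>\<^bsub>N\<^esub>}"
    have X: "submodule X (weyl n) W"
      unfolding X_def
      by (rule WN.M.submodule_preimage_kernel[OF WN.N.M.abelian_group_axioms])
        (use eD(1) WN.N.eigen_carrier eD(2) in blast)+
    interpret X: left_module_submodule "weyl n" W X by (rule WN.M.left_module_submodule[OF X])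
    have SX: "sub_mod W X \<in> Obj Gr"
      using euler_mod.euler_module[OF WN.M.euler_mod_sub[OF X]] by simp
    have i: "restrict (\<lambda>x. x) X \<in> lin_maps (weyl n) (sub_mod W X) W"
      by (rule lin_mapsI) (auto simp: X.H_closed X.H_add X.H_smult)
    have z: "restrict (\<lambda>x. \<zero>\<^bsub>W\<^esub>) X \<in> lin_maps (weyl n) (sub_mod W X) W"
      by (rule lin_mapsI) (auto simp: X.H_closed X.H_add X.H_smult WN.M.act_zero)
    have eX: "?e x = \<zero>\<^bsub>N\<^esub>" if "x \<in> X" "x \<in> eigen n d W lam" for x
    proof -
      have "?e (WN.M.pr ((\<lambda>p. p) \<odot>\<^bsub>W\<^esub> x)) = \<zero>\<^bsub>N\<^esub>" using that(1) weyl_carrier_id unfolding X_def by blast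
      thus ?thesis using WN.M.act_id[OF WN.M.eigen_carrier[OF that(2)]] WN.M.eproj_eq_self[OF that(2)] by simp
    qed
    have comp: "qm (sub_mod W X) N (Comp Q (sub_mod W X) W N \<epsilon> (\<pi> (sub_mod W X) W h)) x = ?e (h x)"
      if h: "h \<in> lin_maps (weyl n) (sub_mod W X) W" and x: "x \<in> eigen n d (sub_mod W X) lam" for h x
      using qm_comp[OF SX W N \<pi>_Hom[OF SX W h] \<epsilon> x] qm_\<pi>[OF SX W h x] by simp
    have Hm: "Comp Q (sub_mod W X) W N \<epsilon> (\<pi> (sub_mod W X) W h) \<in> Hom Q (sub_mod W X) N"
      if h: "h \<in> lin_maps (weyl n) (sub_mod W X) W" for h
      by (rule category_comp[OF functor_target[OF functor_quot]])
        (use SX W N \<epsilon> \<pi>_Hom[OF SX W h] in \<open>simp_all only: Obj_Q\<close>)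
    have qlin: "qm (sub_mod W X) N (Comp Q (sub_mod W X) W N \<epsilon> (\<pi> (sub_mod W X) W h)) \<in>
        lin_maps (twisted0 n d lam) (degree0 n d lam (sub_mod W X)) (degree0 n d lam N)"
      if h: "h \<in> lin_maps (weyl n) (sub_mod W X) W" for h
      using bij_betw_imp_surj_on[OF qm_bij[OF SX N]] Hm[OF h] by blast
    have SXe: "eigen n d (sub_mod W X) lam = X \<inter> eigen n d W lam"
      by (rule WN.M.eigen_sub_mod[OF WN.M.submodule_subset[OF X]])
    have "qm (sub_mod W X) N (Comp Q (sub_mod W X) W N \<epsilon> (\<pi> (sub_mod W X) W (restrict (\<lambda>x. x) X))) =
      qm (sub_mod W X) N (Comp Q (sub_mod W X) W N \<epsilon> (\<pi> (sub_mod W X) W (restrict (\<lambda>x. \<zero>\<^bsub>W\<^esub>) X)))"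
    proof (rule lin_maps_eqI[OF qlin[OF i] qlin[OF z]])
      fix x assume "x \<in> carrier (degree0 n d lam (sub_mod W X))"
      hence x: "x \<in> eigen n d (sub_mod W X) lam" by (simp add: degree0_def)
      show "qm (sub_mod W X) N (Comp Q (sub_mod W X) W N \<epsilon> (\<pi> (sub_mod W X) W (restrict (\<lambda>x. x) X))) x =
        qm (sub_mod W X) N (Comp Q (sub_mod W X) W N \<epsilon> (\<pi> (sub_mod W X) W (restrict (\<lambda>x. \<zero>\<^bsub>W\<^esub>) X))) x"
        unfolding comp[OF i x] comp[OF z x] using x SXe eX e0 by simp
    qed
    hence "Comp Q (sub_mod W X) W N \<epsilon> (\<pi> (sub_mod W X) W (restrict (\<lambda>x. x) X)) =
      Comp Q (sub_mod W X) W N \<epsilon> (\<pi> (sub_mod W X) W (restrict (\<lambda>x. \<zero>\<^bsub>W\<^esub>) X))"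
      by (rule inj_onD[OF bij_betw_imp_inj_on[OF qm_bij[OF SX N]] _ Hm[OF i] Hm[OF z]])
    from inj_onD[OF bij_betw_imp_inj_on[OF bij[OF SX]] this i z]
    have iz: "restrict (\<lambda>x. x) X = restrict (\<lambda>x. \<zero>\<^bsub>W\<^esub>) X" .
    have wC: "w \<in> carrier W" using w(1) by (rule WN.M.eigen_carrier)
    \<comment> \<open>The submodule generated by \<open>w\<close> stays in the kernel in degree
      zero: operators of degree zero commute with \<open>?e\<close>, and the others contribute
      nothing to the projection.\<close>
    have "?e (WN.M.pr (Q \<odot>\<^bsub>W\<^esub> w)) = \<zero>\<^bsub>N\<^esub>" if "Q \<in> weyl_carrier n" for Q
      using that
    proof (induction rule: weyl_carrier_induct_homog[where d = d])
      case (homog k P)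
      show ?case
      proof (cases "k = 0")
        case True
        hence P: "weyl_homog n d 0 P" using homog by simp
        have "?e (P \<odot>\<^bsub>W\<^esub> w) = P \<odot>\<^bsub>N\<^esub> \<zero>\<^bsub>N\<^esub>" using eD(3)[OF P w(1)] w(2) by simp
        thus ?thesis
          using WN.M.eproj_eq_self[OF WN.M.eigen_homog0[OF P w(1)]]
            WN.N.act_zero[OF weyl_homog_weyl_carrier[OF P]] by simp
      next
        case False
        thus ?thesis using WN.M.eproj_on_eigen[OF WN.M.eigen_homog[OF homog w(1)]] e0 by simp
      qed
    next
      case (add A B)
      have "?e (WN.M.pr (A \<odot>\<^bsub>W\<^esub> w) \<oplus>\<^bsub>W\<^esub> WN.M.pr (B \<odot>\<^bsub>W\<^esub> w)) =
        ?e (WN.M.pr (A \<odot>\<^bsub>W\<^esub> w)) \<oplus>\<^bsub>N\<^esub> ?e (WN.M.pr (B \<odot>\<^bsub>W\<^esub> w))"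
        by (intro eD(2) WN.M.eproj_eigen WN.M.act_closed add wC)
      thus ?case using add
        by (simp add: WN.M.act_add_op wC WN.M.eproj_add WN.M.act_closed)
    qed
    hence "w \<in> X" using wC by (simp add: X_def)
    thus ?thesis using fun_cong[OF iz, of w] by simp
  qed
  have "inj_on ?e (eigen n d W lam)"
  proof (rule inj_onI)
    fix x y assume xy: "x \<in> eigen n d W lam" "y \<in> eigen n d W lam" "?e x = ?e y"
    have d: "x \<ominus>\<^bsub>W\<^esub> y \<in> eigen n d W lam" using xy WN.M.eigen_diff by blast
    have C: "x \<in> carrier W" "y \<in> carrier W" using xy WN.M.eigen_carrier by blast+
    have "?e ((x \<ominus>\<^bsub>W\<^esub> y) \<oplus>\<^bsub>W\<^esub> y) = ?e (x \<ominus>\<^bsub>W\<^esub> y) \<oplus>\<^bsub>N\<^esub> ?e y" by (rule eD(2)[OF d xy(2)])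
    hence "?e (x \<ominus>\<^bsub>W\<^esub> y) \<oplus>\<^bsub>N\<^esub> ?e y = ?e y" using WN.M.diff_add_cancel[OF C] xy(3) by simp
    moreover have "?e (x \<ominus>\<^bsub>W\<^esub> y) \<in> carrier N" "?e y \<in> carrier N"
      using eD(1) d xy(2) WN.N.eigen_carrier by blast+
    ultimately have "?e (x \<ominus>\<^bsub>W\<^esub> y) = \<zero>\<^bsub>N\<^esub>" by (rule WN.N.add_eq_self_zero)
    from kernel[OF d this] show "x = y" using WN.M.diff_eq_zero_iff[OF C] by simp
  qed
  moreover have "?e ` eigen n d W lam = eigen n d N lam"
  proof
    show "?e ` eigen n d W lam \<subseteq> eigen n d N lam" using eD(1) by blast
    show "eigen n d N lam \<subseteq> ?e ` eigen n d W lam"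
    proof
      fix y assume y: "y \<in> eigen n d N lam"
      have idl: "restrict (\<lambda>x. x) (carrier N) \<in> lin_maps (weyl n) N N"
        by (rule lin_maps_id[OF WN.N.left_module_axioms])
      obtain h where h: "h \<in> lin_maps (weyl n) N W"
        "Comp Q N W N \<epsilon> (\<pi> N W h) = \<pi> N N (restrict (\<lambda>x. x) (carrier N))"
        using \<pi>_Hom[OF N N idl] unfolding bij_betw_imp_surj_on[OF bij[OF N], symmetric]
        by (elim imageE) (rule that, simp_all only:)
      have hy: "h y \<in> eigen n d W lam"
        using lin_mapsD(1)[OF restrict_degree0_lin_maps[OF WN.N.weyl_module_axioms WN.M.weyl_module_axioms h(1)], of y]
          y by (simp add: degree0_def)
      have "?e (h y) = qm N N (\<pi> N N (restrict (\<lambda>x. x) (carrier N))) y"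
        using qm_comp[OF N W N \<pi>_Hom[OF N W h(1)] \<epsilon> y] qm_\<pi>[OF N W h(1) y] h(2) by simp
      also have "\<dots> = y" using qm_\<pi>[OF N N idl y] WN.N.eigen_carrier[OF y] by simp
      finally show "y \<in> ?e ` eigen n d W lam" using hy by force
    qed
  qed
  ultimately show ?thesis unfolding bij_betw_def W_def by blast
qed

lemma is_functor_global_sections:
  "is_functor Q (Left_Mod (twisted0 n d lam)) (global_sections n d lam \<omega>)"
  unfolding is_functor_def global_sections_def func.simps
proof (intro conjI ballI)
  show "category Q" by (rule functor_target[OF functor_quot])
  show "category (Left_Mod (twisted0 n d lam) :: (('k oper set, 'm) module, 'm \<Rightarrow> 'm) cat)"
    unfolding Left_Mod_def by (rule category_mod_cat) simp
next
  fix M assume "M \<in> Obj Q"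
  hence M: "M \<in> Obj Gr" by (simp only: Obj_Q)
  interpret W: affine_module n d lam "\<Omega> M" by (rule affine_module_Obj[OF \<omega>_Obj[OF M]])
  show "degree0 n d lam (\<Omega> M) \<in> Obj (Left_Mod (twisted0 n d lam))"
    using W.left_module_degree0 by simp
  have "farr \<omega> M M (Id Q M) = restrict (\<lambda>x. x) (carrier (\<Omega> M))"
    using functor_id[OF functor_\<omega>, of M] M by (simp only: Obj_Q Grmod_simps)
  thus "restrict (farr \<omega> M M (Id Q M)) (eigen n d (\<Omega> M) lam) =
    Id (Left_Mod (twisted0 n d lam)) (degree0 n d lam (\<Omega> M))"
    using W.eigen_carrier by (auto simp: restrict_def fun_eq_iff)
next
  fix M N \<alpha> assume "M \<in> Obj Q" "N \<in> Obj Q" and \<alpha>: "\<alpha> \<in> Hom Q M N"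
  hence M: "M \<in> Obj Gr" and N: "N \<in> Obj Gr" by (simp_all only: Obj_Q)
  interpret MN: affine_pair n d lam "\<Omega> M" "\<Omega> N"
    by (rule affine_pair_Obj[OF \<omega>_Obj[OF M] \<omega>_Obj[OF N]])
  show "restrict (farr \<omega> M N \<alpha>) (eigen n d (\<Omega> M) lam) \<in>
    Hom (Left_Mod (twisted0 n d lam)) (degree0 n d lam (\<Omega> M)) (degree0 n d lam (\<Omega> N))"
    unfolding Left_Mod_simps
    by (rule restrict_degree0_lin_maps[OF MN.M.weyl_module_axioms MN.N.weyl_module_axioms \<omega>_arr[OF M N \<alpha>]])
next
  fix M N P \<alpha> \<beta> assume "M \<in> Obj Q" "N \<in> Obj Q" "P \<in> Obj Q" and \<alpha>: "\<alpha> \<in> Hom Q M N" and \<beta>: "\<beta> \<in> Hom Q N P"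
  hence M: "M \<in> Obj Gr" and N: "N \<in> Obj Gr" and P: "P \<in> Obj Gr" by (simp_all only: Obj_Q)
  interpret MN: affine_pair n d lam "\<Omega> M" "\<Omega> N"
    by (rule affine_pair_Obj[OF \<omega>_Obj[OF M] \<omega>_Obj[OF N]])
  have c: "farr \<omega> M P (Comp Q M N P \<beta> \<alpha>) = compose (carrier (\<Omega> M)) (farr \<omega> N P \<beta>) (farr \<omega> M N \<alpha>)"
    using functor_comp[OF functor_\<omega>, of M N P \<alpha> \<beta>] M N P \<alpha> \<beta> by (simp only: Obj_Q Grmod_simps)
  have e: "farr \<omega> M N \<alpha> x \<in> eigen n d (\<Omega> N) lam" if "x \<in> eigen n d (\<Omega> M) lam" for x
    using lin_mapsD(1)[OF restrict_degree0_lin_maps[OF MN.M.weyl_module_axioms MN.N.weyl_module_axioms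
      \<omega>_arr[OF M N \<alpha>], where d = d and lam = lam], of x] that by (simp add: degree0_def)
  show "restrict (farr \<omega> M P (Comp Q M N P \<beta> \<alpha>)) (eigen n d (\<Omega> M) lam) =
    Comp (Left_Mod (twisted0 n d lam)) (degree0 n d lam (\<Omega> M)) (degree0 n d lam (\<Omega> N))
      (degree0 n d lam (\<Omega> P)) (restrict (farr \<omega> N P \<beta>) (eigen n d (\<Omega> N) lam))
      (restrict (farr \<omega> M N \<alpha>) (eigen n d (\<Omega> M) lam))"
    unfolding c using e MN.M.eigen_carrier
    by (intro ext) (simp add: compose_def restrict_def)
qed

text \<open>The counit identifies global sections with the functor
  \<open>M \<mapsto> M\<^sub>0\<close>, which is fully faithful by \<open>qm_bij\<close>. Essential
  surjectivity is a matter of this simpler functor, hence the form of the premise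
  \<open>ess\<close>.\<close>

lemma global_sections_equivalence:
  assumes ess: "\<And>V :: ('k oper set, 'm) module. left_module (twisted0 n d lam) V \<Longrightarrow>
    \<exists>L :: ('k oper, 'm) module. \<exists>\<psi>. euler_module n d lam L \<and>
      \<psi> \<in> lin_maps (twisted0 n d lam) (degree0 n d lam L) V \<and>
      bij_betw \<psi> (carrier (degree0 n d lam L)) (carrier V)"
  shows "is_equivalence Q (Left_Mod (twisted0 n d lam)) (global_sections n d lam \<omega>)"
proof -
  obtain \<epsilon> :: "('k oper, 'm) module \<Rightarrow> 'm frac set" where
    \<epsilon>: "\<And>N. N \<in> Obj Gr \<Longrightarrow> \<epsilon> N \<in> Hom Q (\<Omega> N) N"
    and \<epsilon>bij: "\<And>M N. M \<in> Obj Gr \<Longrightarrow> N \<in> Obj Gr \<Longrightarrow>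
      bij_betw (transpose (\<epsilon> N) M N) (lin_maps (weyl n) M (\<Omega> N)) (Hom Q M N)"
    and \<epsilon>nat: "\<And>M N \<alpha>. M \<in> Obj Gr \<Longrightarrow> N \<in> Obj Gr \<Longrightarrow> \<alpha> \<in> Hom Q M N \<Longrightarrow>
      transpose (\<epsilon> N) (\<Omega> M) N (farr \<omega> M N \<alpha>) = Comp Q (\<Omega> M) M N \<alpha> (\<epsilon> M)"
    by (rule counit_ex) (rule that)
  let ?R = "twisted0 n d lam"
  define e where "e N = qm (\<Omega> N) N (\<epsilon> N)" for N
  have e_bij: "bij_betw (e N) (eigen n d (\<Omega> N) lam) (eigen n d N lam)" if N: "N \<in> Obj Gr" for N
    unfolding e_def by (rule counit_bij[OF N \<epsilon>[OF N] \<epsilon>bij[OF _ N]])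
  have e_lin: "e N \<in> lin_maps ?R (degree0 n d lam (\<Omega> N)) (degree0 n d lam N)" if N: "N \<in> Obj Gr" for N
    unfolding e_def using bij_betw_imp_surj_on[OF qm_bij[OF \<omega>_Obj[OF N] N]] \<epsilon>[OF N] by blast
  have ld: "left_module ?R (degree0 n d lam M)" if "M \<in> Obj Gr" for M :: "('k oper, 'm) module"
  proof -
    interpret affine_module n d lam M by (rule affine_module_Obj[OF that])
    show ?thesis by (rule left_module_degree0)
  qed
  \<comment> \<open>Naturality of the counit read in degree zero: conjugating
    \<open>farr \<omega> M N \<alpha>\<close> with the bijections \<open>e\<close> gives the map
    that \<open>\<alpha>\<close> induces on degree zero parts.\<close>
  have nat: "e N (farr \<omega> M N \<alpha> x) = qm M N \<alpha> (e M x)"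
    if M: "M \<in> Obj Gr" and N: "N \<in> Obj Gr" and \<alpha>: "\<alpha> \<in> Hom Q M N" and x: "x \<in> eigen n d (\<Omega> M) lam" for M N \<alpha> x
    using \<epsilon>nat[OF M N \<alpha>] qm_comp[OF \<omega>_Obj[OF M] \<omega>_Obj[OF N] N \<pi>_Hom[OF \<omega>_Obj[OF M] \<omega>_Obj[OF N] \<omega>_arr[OF M N \<alpha>]] \<epsilon>[OF N] x]
      qm_comp[OF \<omega>_Obj[OF M] M N \<epsilon>[OF M] \<alpha> x] qm_\<pi>[OF \<omega>_Obj[OF M] \<omega>_Obj[OF N] \<omega>_arr[OF M N \<alpha>] x]
    unfolding e_def by simp
  have dc [simp]: "carrier (degree0 n d lam M) = eigen n d M lam" for M :: "('k oper, 'm) module"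
    by (simp add: degree0_def)
  show ?thesis
  proof (rule is_equivalenceI[OF is_functor_global_sections])
    fix M N assume "M \<in> Obj Q" "N \<in> Obj Q"
    hence M: "M \<in> Obj Gr" and N: "N \<in> Obj Gr" by (simp_all only: Obj_Q)
    have \<Gamma>: "farr (global_sections n d lam \<omega>) M N \<alpha> = restrict (farr \<omega> M N \<alpha>) (eigen n d (\<Omega> M) lam)" for \<alpha>
      by (simp add: global_sections_def)
    have \<Gamma>lin: "farr (global_sections n d lam \<omega>) M N \<alpha> \<in>
        lin_maps ?R (degree0 n d lam (\<Omega> M)) (degree0 n d lam (\<Omega> N))" if "\<alpha> \<in> Hom Q M N" for \<alpha>
      using functor_arr[OF is_functor_global_sections, of M N \<alpha>] M N that
      by (simp only: Obj_Q Left_Mod_simps) (simp add: global_sections_def)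
    have key: "e N (farr (global_sections n d lam \<omega>) M N \<alpha> x) = qm M N \<alpha> (e M x)"
      if "\<alpha> \<in> Hom Q M N" "x \<in> eigen n d (\<Omega> M) lam" for \<alpha> x
      unfolding \<Gamma> using nat[OF M N that] that(2) by simp
    have "bij_betw (farr (global_sections n d lam \<omega>) M N) (Hom Q M N)
       (lin_maps ?R (degree0 n d lam (\<Omega> M)) (degree0 n d lam (\<Omega> N)))"
    proof (rule bij_betwI')
      fix \<alpha> \<beta> assume \<alpha>: "\<alpha> \<in> Hom Q M N" and \<beta>: "\<beta> \<in> Hom Q M N"
      show "farr (global_sections n d lam \<omega>) M N \<alpha> = farr (global_sections n d lam \<omega>) M N \<beta> \<longleftrightarrow> \<alpha> = \<beta>"
      proof
        assume eq: "farr (global_sections n d lam \<omega>) M N \<alpha> = farr (global_sections n d lam \<omega>) M N \<beta>"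
        have l: "qm M N \<gamma> \<in> lin_maps ?R (degree0 n d lam M) (degree0 n d lam N)" if "\<gamma> \<in> Hom Q M N" for \<gamma>
          using bij_betw_imp_surj_on[OF qm_bij[OF M N]] that by blast
        have "qm M N \<alpha> = qm M N \<beta>"
        proof (rule lin_maps_eqI[OF l[OF \<alpha>] l[OF \<beta>]])
          fix y assume "y \<in> carrier (degree0 n d lam M)"
          then obtain x where x: "x \<in> eigen n d (\<Omega> M) lam" "y = e M x"
            using bij_betw_imp_surj_on[OF e_bij[OF M]] dc by blast
          show "qm M N \<alpha> y = qm M N \<beta> y" unfolding x(2) using key[OF \<alpha> x(1)] key[OF \<beta> x(1)] eq by simp
        qed
        thus "\<alpha> = \<beta>" by (rule inj_onD[OF bij_betw_imp_inj_on[OF qm_bij[OF M N]] _ \<alpha> \<beta>])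
      qed simp
    next
      fix \<alpha> assume "\<alpha> \<in> Hom Q M N"
      thus "farr (global_sections n d lam \<omega>) M N \<alpha> \<in>
        lin_maps ?R (degree0 n d lam (\<Omega> M)) (degree0 n d lam (\<Omega> N))" by (rule \<Gamma>lin)
    next
      fix \<theta> assume \<theta>: "\<theta> \<in> lin_maps ?R (degree0 n d lam (\<Omega> M)) (degree0 n d lam (\<Omega> N))"
      define i where "i = restrict (inv_into (eigen n d (\<Omega> M) lam) (e M)) (eigen n d M lam)"
      have i: "i \<in> lin_maps ?R (degree0 n d lam M) (degree0 n d lam (\<Omega> M))"
        using lin_maps_inverse[OF ld[OF \<omega>_Obj[OF M]] e_lin[OF M]] e_bij[OF M] unfolding i_def by simp
      \<comment> \<open>The conjugate of \<open>\<theta>\<close> by the two counits; its preimage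
        under \<open>qm\<close> is the arrow sought.\<close>
      define \<theta>' where "\<theta>' = compose (eigen n d M lam) (e N) (compose (eigen n d M lam) \<theta> i)"
      have "compose (eigen n d M lam) \<theta> i \<in> lin_maps ?R (degree0 n d lam M) (degree0 n d lam (\<Omega> N))"
        using lin_maps_compose[OF i \<theta> ld[OF M]] by simp
      from lin_maps_compose[OF this e_lin[OF N] ld[OF M]]
      have "\<theta>' \<in> lin_maps ?R (degree0 n d lam M) (degree0 n d lam N)" unfolding \<theta>'_def by simp
      hence "\<theta>' \<in> qm M N ` Hom Q M N" unfolding bij_betw_imp_surj_on[OF qm_bij[OF M N]] .
      then obtain \<alpha> where \<alpha>: "\<alpha> \<in> Hom Q M N" "qm M N \<alpha> = \<theta>'" by (elim imageE) (rule that, simp_all only:)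
      have "\<theta> = farr (global_sections n d lam \<omega>) M N \<alpha>"
      proof (rule lin_maps_eqI[OF \<theta> \<Gamma>lin[OF \<alpha>(1)]])
        fix x assume "x \<in> carrier (degree0 n d lam (\<Omega> M))"
        hence x: "x \<in> eigen n d (\<Omega> M) lam" by simp
        have ex: "e M x \<in> eigen n d M lam" using bij_betwE[OF e_bij[OF M]] x by blast
        have "i (e M x) = x" unfolding i_def using ex bij_betw_imp_inj_on[OF e_bij[OF M]] x by simp
        hence "\<theta>' (e M x) = e N (\<theta> x)" unfolding \<theta>'_def using ex by (simp add: compose_def)
        hence "e N (\<theta> x) = e N (farr (global_sections n d lam \<omega>) M N \<alpha> x)" using key[OF \<alpha>(1) x] \<alpha>(2) by simp
        moreover have "\<theta> x \<in> eigen n d (\<Omega> N) lam" using lin_mapsD(1)[OF \<theta>, of x] x by simp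
        moreover have "farr (global_sections n d lam \<omega>) M N \<alpha> x \<in> eigen n d (\<Omega> N) lam"
          using lin_mapsD(1)[OF \<Gamma>lin[OF \<alpha>(1)], of x] x by simp
        ultimately show "\<theta> x = farr (global_sections n d lam \<omega>) M N \<alpha> x"
          by (rule inj_onD[OF bij_betw_imp_inj_on[OF e_bij[OF N]]])
      qed
      thus "\<exists>\<alpha>\<in>Hom Q M N. \<theta> = farr (global_sections n d lam \<omega>) M N \<alpha>" using \<alpha>(1) by (rule bexI)
    qed
    thus "bij_betw (farr (global_sections n d lam \<omega>) M N) (Hom Q M N)
      (Hom (Left_Mod ?R) (fobj (global_sections n d lam \<omega>) M) (fobj (global_sections n d lam \<omega>) N))"
      by (simp only: Left_Mod_simps) (simp add: global_sections_def)
  next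
    fix V :: "('k oper set, 'm) module" assume "V \<in> Obj (Left_Mod ?R)"
    hence "left_module ?R V" by simp
    from ess[OF this] obtain L :: "('k oper, 'm) module" and \<psi> where L: "euler_module n d lam L"
      "\<psi> \<in> lin_maps ?R (degree0 n d lam L) V" "bij_betw \<psi> (carrier (degree0 n d lam L)) (carrier V)" by blast
    have LO: "L \<in> Obj Gr" using L(1) by simp
    have lin: "compose (eigen n d (\<Omega> L) lam) \<psi> (e L) \<in> lin_maps ?R (degree0 n d lam (\<Omega> L)) V"
      using lin_maps_compose[OF e_lin[OF LO] L(2) ld[OF \<omega>_Obj[OF LO]]] by simp
    have "bij_betw (\<psi> \<circ> e L) (eigen n d (\<Omega> L) lam) (carrier V)"
      by (rule bij_betw_trans[OF e_bij[OF LO]]) (use L(3) in simp)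
    hence "bij_betw (compose (eigen n d (\<Omega> L) lam) \<psi> (e L)) (eigen n d (\<Omega> L) lam) (carrier V)"
      by (rule bij_betw_cong[THEN iffD1, rotated]) (simp add: compose_def)
    hence "is_iso (Left_Mod ?R) (degree0 n d lam (\<Omega> L)) V (compose (eigen n d (\<Omega> L) lam) \<psi> (e L))"
      by (intro Left_Mod_iso ld \<omega>_Obj LO lin) simp
    thus "\<exists>M\<in>Obj Q. \<exists>f. is_iso (Left_Mod ?R) (fobj (global_sections n d lam \<omega>) M) V f"
      using LO by (intro bexI[of _ L]) (auto simp: global_sections_def)
  qed
qed

end

section \<open>Essential surjectivity\<close>

context includes cardinal_syntax
begin

text \<open>Lists are a countable union, over the length, of finite powers of \<open>A\<close>, and
  each power is bounded by \<open>B\<close> because an infinite set absorbs products.\<close>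

lemma card_of_lists_ordLeq:
  assumes inf: "infinite B" and le: "|A| \<le>o |B|"
  shows "|lists A| \<le>o |B|"
proof -
  have len: "|{xs \<in> lists A. length xs = k}| \<le>o |B|" for k
  proof (induction k)
    case 0
    have "{xs \<in> lists A. length xs = 0} = {[]}" by auto
    thus ?case using card_of_singl_ordLeq[of B "[]"] inf by auto
  next
    case (Suc k)
    have "{xs \<in> lists A. length xs = Suc k} \<subseteq>
        (\<lambda>(x, xs). x # xs) ` (A \<times> {xs \<in> lists A. length xs = k})"
      by (auto simp: length_Suc_conv)
    hence "|{xs \<in> lists A. length xs = Suc k}| \<le>o |A \<times> {xs \<in> lists A. length xs = k}|"
      by (rule surj_imp_ordLeq)
    also have "|A \<times> {xs \<in> lists A. length xs = k}| \<le>o |B|"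
      by (rule card_of_Sigma_ordLeq_infinite[OF inf le]) (use Suc in simp)
    finally show ?case .
  qed
  have "lists A = (\<Union>k\<in>(UNIV :: nat set). {xs \<in> lists A. length xs = k})" by auto
  moreover have "|\<Union>k\<in>(UNIV :: nat set). {xs \<in> lists A. length xs = k}| \<le>o |B|"
    by (rule card_of_UNION_ordLeq_infinite[OF inf inf[unfolded infinite_iff_card_of_nat]])
      (use len in simp)
  ultimately show ?thesis by simp
qed

text \<open>Made for a module whose elements are sums over lists of pairs of a word and a vector;
  countability of the words keeps the pairs within the size of \<open>B\<close>.\<close>

lemma ex_inj_on_image_lists:
  fixes f :: "('w::countable \<times> 'v) list \<Rightarrow> 'x" and B :: "'v set"
  assumes "infinite B"
  shows "\<exists>i :: 'x \<Rightarrow> 'v. inj_on i (f ` lists (W \<times> B))"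
proof -
  have "|W| \<le>o |UNIV :: nat set|"
    unfolding card_of_ordLeq[symmetric] by (intro exI[of _ to_nat]) (simp add: inj_on_def)
  hence "|W| \<le>o |B|" using assms ordLeq_transitive infinite_iff_card_of_nat by blast
  hence "|W \<times> B| \<le>o |B|"
    by (rule card_of_Sigma_ordLeq_infinite[OF assms]) (simp add: card_of_mono1)
  hence "|lists (W \<times> B)| \<le>o |B|" by (rule card_of_lists_ordLeq[OF assms])
  hence "|f ` lists (W \<times> B)| \<le>o |B|" using card_of_image ordLeq_transitive by blast
  thus ?thesis unfolding card_of_ordLeq[symmetric] by blast
qed

end

section \<open>Transport of structure along an injection\<close>

definition transport_module :: "('m \<Rightarrow> 'p) \<Rightarrow> ('r, 'm) module \<Rightarrow> ('r, 'p) module" where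
  "transport_module i M = (let g = inv_into (carrier M) i in
     \<lparr>carrier = i ` carrier M, monoid.mult = undefined, one = undefined, zero = i \<zero>\<^bsub>M\<^esub>,
      add = (\<lambda>x y. i (g x \<oplus>\<^bsub>M\<^esub> g y)), module.smult = (\<lambda>a x. i (a \<odot>\<^bsub>M\<^esub> g x))\<rparr>)"

lemma transport_module:
  assumes "left_module R M" and i: "inj_on i (carrier M)"
  shows left_module_transport: "left_module R (transport_module i M)"
    and transport_lin_maps: "restrict i (carrier M) \<in> lin_maps R M (transport_module i M)"
    and transport_bij: "bij_betw (restrict i (carrier M)) (carrier M) (carrier (transport_module i M))"
proof -
  interpret M: left_module R M by fact
  define T where "T = transport_module i M"
  have T [simp]: "carrier T = i ` carrier M" "\<zero>\<^bsub>T\<^esub> = i \<zero>\<^bsub>M\<^esub>"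
    by (simp_all add: T_def transport_module_def Let_def)
  have add [simp]: "i x \<oplus>\<^bsub>T\<^esub> i y = i (x \<oplus>\<^bsub>M\<^esub> y)" if "x \<in> carrier M" "y \<in> carrier M" for x y
    using that i by (simp add: T_def transport_module_def Let_def)
  have smult [simp]: "a \<odot>\<^bsub>T\<^esub> i x = i (a \<odot>\<^bsub>M\<^esub> x)" if "x \<in> carrier M" for a x
    using that i by (simp add: T_def transport_module_def Let_def)
  have "abelian_group T"
  proof (rule abelian_groupI)
    fix x assume "x \<in> carrier T"
    then obtain u where u: "u \<in> carrier M" "x = i u" by auto
    show "\<exists>y\<in>carrier T. y \<oplus>\<^bsub>T\<^esub> x = \<zero>\<^bsub>T\<^esub>"
      by (rule bexI[of _ "i (\<ominus>\<^bsub>M\<^esub> u)"]) (simp_all add: u M.l_neg)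
  qed (auto simp: M.a_ac)
  moreover have "left_module_axioms R T"
    by (rule left_module_axioms.intro)
      (auto simp: M.smult_closed M.smult_l_distr M.smult_r_distr M.smult_assoc M.smult_one)
  ultimately show "left_module R (transport_module i M)"
    unfolding T_def[symmetric] by (intro left_module.intro M.R.ring_axioms)
  show "restrict i (carrier M) \<in> lin_maps R M (transport_module i M)"
    unfolding T_def[symmetric] by (rule lin_mapsI) (simp_all add: M.smult_closed)
  show "bij_betw (restrict i (carrier M)) (carrier M) (carrier (transport_module i M))"
    unfolding T_def[symmetric] bij_betw_def using i by (auto simp: inj_on_def)
qed

text \<open>Linear maps take eigenvectors to eigenvectors, so the image is again spanned by
  them.\<close>

lemma euler_module_lin_image:
  assumes M: "euler_mod n M d lam" and N: "left_module (weyl n) N"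
    and f: "f \<in> lin_maps (weyl n) M N" "f ` carrier M = carrier N"
  shows "euler_mod n N d lam"
proof -
  interpret M: euler_mod n M d lam by fact
  interpret N: weyl_module n N d lam by (intro weyl_module.intro N)
  note fD = lin_mapsD[OF f(1)]
  have "f x \<in> eigen_span n d lam N UNIV" if "x \<in> carrier M" for x
    using that
  proof (induction rule: M.carrier_induct)
    case (eigen k x)
    hence "x \<in> carrier M" "euler n d \<odot>\<^bsub>M\<^esub> x = scal (lam + of_int k) \<odot>\<^bsub>M\<^esub> x" by (simp_all add: M.eigen_iff)
    hence "f x \<in> eigen n d N (lam + of_int k)"
      using fD(1)[of x] fD(3)[of "euler n d" x] fD(3)[of "scal (lam + of_int k)" x]
      by (simp add: eigen_def euler_weyl_carrier weyl_carrier.scal)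
    thus ?case by (intro eigen_span.eigen) auto
  next
    case (add x y)
    from eigen_span.add[OF add(3,4)] fD(2)[OF add(1,2)] show ?case by simp
  qed
  hence "f ` carrier M \<subseteq> eigen_span n d lam N UNIV" by (rule image_subsetI)
  hence "carrier N \<subseteq> eigen_span n d lam N UNIV" unfolding f(2) .
  thus ?thesis by (intro euler_mod.intro N.weyl_module_axioms euler_mod_axioms.intro)
qed

section \<open>An Euler module with prescribed degree zero part\<close>

locale twisted_module = left_module "twisted0 n d lam" V
  for n :: nat and d :: "nat \<Rightarrow> nat" and lam :: "'k::field_char_0"
    and V :: "('k oper set, 'm) module" (structure)
begin

definition act0 :: "'k oper \<Rightarrow> 'm \<Rightarrow> 'm" where
  "act0 P v = tcoset n d lam P \<odot> v"

lemma act0_closed: "weyl_homog n d 0 P \<Longrightarrow> v \<in> carrier V \<Longrightarrow> act0 P v \<in> carrier V"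
  unfolding act0_def by (intro smult_closed tcoset_carrier)

lemma act0_add_op:
  "weyl_homog n d 0 P \<Longrightarrow> weyl_homog n d 0 Q \<Longrightarrow> v \<in> carrier V \<Longrightarrow>
   act0 (\<lambda>p. P p + Q p) v = act0 P v \<oplus> act0 Q v"
  unfolding act0_def by (simp add: smult_l_distr[OF tcoset_carrier tcoset_carrier, symmetric] tcoset_add)

lemma act0_add:
  "weyl_homog n d 0 P \<Longrightarrow> v \<in> carrier V \<Longrightarrow> w \<in> carrier V \<Longrightarrow> act0 P (v \<oplus> w) = act0 P v \<oplus> act0 P w"
  unfolding act0_def by (intro smult_r_distr tcoset_carrier)

lemma act0_comp:
  "weyl_homog n d 0 P \<Longrightarrow> weyl_homog n d 0 Q \<Longrightarrow> v \<in> carrier V \<Longrightarrow> act0 (P \<circ> Q) v = act0 P (act0 Q v)"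
  unfolding act0_def by (simp add: smult_assoc[OF tcoset_carrier tcoset_carrier, symmetric] tcoset_mult)

lemma act0_id: "v \<in> carrier V \<Longrightarrow> act0 (\<lambda>p. p) v = v"
  unfolding act0_def twisted0_one[symmetric] by (rule smult_one)

lemma act0_euler: "act0 (euler n d) v = act0 (scal lam) v"
  unfolding act0_def tcoset_euler ..

lemma act0_zero: "weyl_homog n d 0 P \<Longrightarrow> act0 P \<zero> = \<zero>"
  unfolding act0_def by (intro smult_r_null tcoset_carrier)

text \<open>The scalar multiples of a nonzero vector form a copy of the field, which is infinite in
  characteristic zero. Over a finite carrier the lists of vectors would outnumber the
  vectors.\<close>

lemma infinite_carrier:
  assumes "v \<in> carrier V" "v \<noteq> \<zero>"
  shows "infinite (carrier V)"
proof -
  have "inj (\<lambda>c. act0 (scal c) v)"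
  proof (rule injI, rule ccontr)
    fix a b :: 'k assume eq: "act0 (scal a) v = act0 (scal b) v" and "a \<noteq> b"
    have C: "act0 (scal c) v \<in> carrier V" for c by (intro act0_closed weyl_homog.scal assms)
    have "act0 (scal (a - b)) v \<oplus> act0 (scal b) v = act0 (scal a) v"
      using act0_add_op[OF weyl_homog.scal weyl_homog.scal assms(1), of "a - b" b]
      by (simp add: scal_plus)
    hence "act0 (scal (a - b)) v = \<zero>" using M.add_eq_self_zero C eq by simp
    hence "act0 (scal (1 / (a - b)) \<circ> scal (a - b)) v = \<zero>"
      using act0_comp[OF weyl_homog.scal weyl_homog.scal assms(1)] act0_zero[OF weyl_homog.scal] by simp
    moreover have "scal (1 / (a - b)) \<circ> scal (a - b) = (\<lambda>p. p :: 'k pol)"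
      using \<open>a \<noteq> b\<close> by (simp add: scal_comp scal_one)
    ultimately show False using act0_id assms by simp
  qed
  moreover have "infinite (UNIV :: 'k set)"
    by (rule infinite_UNIV_char_0)
  ultimately have "infinite (range (\<lambda>c. act0 (scal c) v))" using finite_imageD by blast
  moreover have "range (\<lambda>c. act0 (scal c) v) \<subseteq> carrier V"
    using act0_closed weyl_homog.scal assms(1) by blast
  ultimately show ?thesis using finite_subset by blast
qed

text \<open>Operators act by \<open>(P h) Q = h (Q P)\<close>; the distributive law for sums of
  operators forces the functions to be additive. Restriction to \<open>weyl_carrier n\<close> makes
  equality of functions equality on the algebra. This is only an ambient module: the part that
  matters is generated by the functions \<open>gen P v\<close>.\<close>

definition coind :: "('k oper, 'k oper \<Rightarrow> 'm) module" where
  "coind = \<lparr>carrier = {h \<in> weyl_carrier n \<rightarrow>\<^sub>E carrier V. \<forall>P\<in>weyl_carrier n. \<forall>Q\<in>weyl_carrier n.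
       h (\<lambda>p. P p + Q p) = h P \<oplus> h Q},
     monoid.mult = undefined, one = undefined, zero = restrict (\<lambda>Q. \<zero>) (weyl_carrier n),
     add = (\<lambda>h h'. restrict (\<lambda>Q. h Q \<oplus> h' Q) (weyl_carrier n)),
     module.smult = (\<lambda>P h. restrict (\<lambda>Q. h (Q \<circ> P)) (weyl_carrier n))\<rparr>"

lemma coind_carrier:
  "h \<in> carrier coind \<longleftrightarrow> (\<forall>Q. Q \<in> weyl_carrier n \<longrightarrow> h Q \<in> carrier V) \<and>
     (\<forall>Q. Q \<notin> weyl_carrier n \<longrightarrow> h Q = undefined) \<and>
     (\<forall>P\<in>weyl_carrier n. \<forall>Q\<in>weyl_carrier n. h (\<lambda>p. P p + Q p) = h P \<oplus> h Q)"
  by (simp add: coind_def PiE_iff extensional_def Ball_def)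

lemma coind_simps [simp]:
  "\<zero>\<^bsub>coind\<^esub> = restrict (\<lambda>Q. \<zero>) (weyl_carrier n)"
  "h \<oplus>\<^bsub>coind\<^esub> h' = restrict (\<lambda>Q. h Q \<oplus> h' Q) (weyl_carrier n)"
  "P \<odot>\<^bsub>coind\<^esub> h = restrict (\<lambda>Q. h (Q \<circ> P)) (weyl_carrier n)"
  by (simp_all add: coind_def)

lemma coind_eqI:
  "h \<in> carrier coind \<Longrightarrow> h' \<in> carrier coind \<Longrightarrow> (\<And>Q. Q \<in> weyl_carrier n \<Longrightarrow> h Q = h' Q) \<Longrightarrow> h = h'"
  unfolding coind_carrier by (intro ext) metis

lemma coindD:
  assumes "h \<in> carrier coind"
  shows "Q \<in> weyl_carrier n \<Longrightarrow> h Q \<in> carrier V"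
    "Q \<notin> weyl_carrier n \<Longrightarrow> h Q = undefined"
    "P \<in> weyl_carrier n \<Longrightarrow> Q \<in> weyl_carrier n \<Longrightarrow> h (\<lambda>p. P p + Q p) = h P \<oplus> h Q"
  using assms unfolding coind_carrier by simp_all

lemma coind_zero_closed: "\<zero>\<^bsub>coind\<^esub> \<in> carrier coind"
  unfolding coind_carrier by (simp add: weyl_carrier.add)

lemma coind_add_closed:
  assumes "h \<in> carrier coind" "h' \<in> carrier coind"
  shows "h \<oplus>\<^bsub>coind\<^esub> h' \<in> carrier coind"
  unfolding coind_carrier[of "h \<oplus>\<^bsub>coind\<^esub> h'"] using coindD[OF assms(1)] coindD[OF assms(2)]
  by (simp add: weyl_carrier.add M.a_ac)

lemma coind_smult_closed:
  assumes "P \<in> weyl_carrier n" "h \<in> carrier coind"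
  shows "P \<odot>\<^bsub>coind\<^esub> h \<in> carrier coind"
proof -
  have "h ((\<lambda>p. A p + B p) \<circ> P) = h (A \<circ> P) \<oplus> h (B \<circ> P)"
    if "A \<in> weyl_carrier n" "B \<in> weyl_carrier n" for A B
    using coindD(3)[OF assms(2) weyl_carrier.comp[OF that(1) assms(1)] weyl_carrier.comp[OF that(2) assms(1)]]
    by (simp add: comp_def)
  thus ?thesis
    unfolding coind_carrier[of "P \<odot>\<^bsub>coind\<^esub> h"] using coindD(1)[OF assms(2)] assms(1)
    by (simp add: weyl_carrier.add weyl_carrier.comp)
qed

lemma left_module_coind: "left_module (weyl n) coind"
proof -
  have "abelian_group coind"
  proof (rule abelian_groupI)
    fix h assume h: "h \<in> carrier coind"
    note hD = coindD[OF h]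
    have m: "restrict (\<lambda>Q. \<ominus> (h Q)) (weyl_carrier n) \<in> carrier coind"
      unfolding coind_carrier using hD by (simp add: weyl_carrier.add M.minus_add)
    show "\<exists>h'\<in>carrier coind. h' \<oplus>\<^bsub>coind\<^esub> h = \<zero>\<^bsub>coind\<^esub>"
      by (rule bexI[OF _ m], rule coind_eqI[OF coind_add_closed[OF m h] coind_zero_closed])
        (simp add: hD M.l_neg)
    show "\<zero>\<^bsub>coind\<^esub> \<oplus>\<^bsub>coind\<^esub> h = h"
      by (rule coind_eqI[OF coind_add_closed[OF coind_zero_closed h] h]) (simp add: hD)
    fix h' assume h': "h' \<in> carrier coind"
    note hD' = coindD[OF h']
    show "h \<oplus>\<^bsub>coind\<^esub> h' \<in> carrier coind" by (rule coind_add_closed[OF h h'])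
    show "h \<oplus>\<^bsub>coind\<^esub> h' = h' \<oplus>\<^bsub>coind\<^esub> h"
      by (rule coind_eqI[OF coind_add_closed[OF h h'] coind_add_closed[OF h' h]]) (simp add: hD hD' M.a_comm)
    fix h'' assume h'': "h'' \<in> carrier coind"
    note hD'' = coindD[OF h'']
    show "h \<oplus>\<^bsub>coind\<^esub> h' \<oplus>\<^bsub>coind\<^esub> h'' = h \<oplus>\<^bsub>coind\<^esub> (h' \<oplus>\<^bsub>coind\<^esub> h'')"
      by (rule coind_eqI[OF coind_add_closed[OF coind_add_closed[OF h h'] h'']
          coind_add_closed[OF h coind_add_closed[OF h' h'']]]) (simp add: hD hD' hD'' M.a_assoc)
  qed (rule coind_zero_closed)
  moreover have "left_module_axioms (weyl n) coind"
  proof (rule left_module_axioms.intro)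
    fix P :: "'k oper" and h assume "P \<in> carrier (weyl n)" and h: "h \<in> carrier coind"
    hence P: "P \<in> weyl_carrier n" by simp
    note hD = coindD[OF h]
    show "P \<odot>\<^bsub>coind\<^esub> h \<in> carrier coind" by (rule coind_smult_closed[OF P h])
    fix P' :: "'k oper" assume "P' \<in> carrier (weyl n)"
    hence P': "P' \<in> weyl_carrier n" by simp
    have "h (Q \<circ> (\<lambda>p. P p + P' p)) = h (Q \<circ> P) \<oplus> h (Q \<circ> P')" if Q: "Q \<in> weyl_carrier n" for Q
      using hD(3)[OF weyl_carrier.comp[OF Q P] weyl_carrier.comp[OF Q P']]
      by (simp add: comp_def weyl_carrier_add[OF Q])
    thus "(P \<oplus>\<^bsub>weyl n\<^esub> P') \<odot>\<^bsub>coind\<^esub> h = P \<odot>\<^bsub>coind\<^esub> h \<oplus>\<^bsub>coind\<^esub> P' \<odot>\<^bsub>coind\<^esub> h"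
      by (intro coind_eqI coind_smult_closed coind_add_closed h P P')
        (simp_all add: weyl_carrier.add P P')
    show "(P \<otimes>\<^bsub>weyl n\<^esub> P') \<odot>\<^bsub>coind\<^esub> h = P \<odot>\<^bsub>coind\<^esub> (P' \<odot>\<^bsub>coind\<^esub> h)"
      unfolding weyl_simps
      by (intro coind_eqI coind_smult_closed weyl_carrier.comp h P P')
        (simp add: weyl_carrier.comp P P' comp_assoc)
  next
    fix P :: "'k oper" and h h' assume "P \<in> carrier (weyl n)" and h: "h \<in> carrier coind" and h': "h' \<in> carrier coind"
    hence P: "P \<in> weyl_carrier n" by simp
    show "P \<odot>\<^bsub>coind\<^esub> (h \<oplus>\<^bsub>coind\<^esub> h') = P \<odot>\<^bsub>coind\<^esub> h \<oplus>\<^bsub>coind\<^esub> P \<odot>\<^bsub>coind\<^esub> h'"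
      by (intro coind_eqI coind_smult_closed coind_add_closed h h' P)
        (simp add: weyl_carrier.comp P)
  next
    fix h assume h: "h \<in> carrier coind"
    have "(\<lambda>p. p) \<odot>\<^bsub>coind\<^esub> h = h"
      by (intro coind_eqI coind_smult_closed weyl_carrier_id h) (simp add: comp_def)
    thus "\<one>\<^bsub>weyl n\<^esub> \<odot>\<^bsub>coind\<^esub> h = h" by simp
  qed
  ultimately show ?thesis by (intro left_module.intro ring_weyl)
qed

text \<open>This function stands for \<open>P \<otimes> v\<close>. For \<open>P\<close> the identity
  its value at the identity is \<open>v\<close>, by which \<open>V\<close> is recovered from the
  module.\<close>

definition gen :: "'k oper \<Rightarrow> 'm \<Rightarrow> 'k oper \<Rightarrow> 'm" where
  "gen P v = restrict (\<lambda>Q. act0 (deg0 n d (Q \<circ> P)) v) (weyl_carrier n)"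

lemma gen_carrier:
  assumes P: "P \<in> weyl_carrier n" and v: "v \<in> carrier V"
  shows "gen P v \<in> carrier coind"
proof -
  have "act0 (deg0 n d ((\<lambda>p. A p + B p) \<circ> P)) v = act0 (deg0 n d (A \<circ> P)) v \<oplus> act0 (deg0 n d (B \<circ> P)) v"
    if "A \<in> weyl_carrier n" "B \<in> weyl_carrier n" for A B
  proof -
    note c = weyl_carrier.comp[OF that(1) P] weyl_carrier.comp[OF that(2) P]
    have "deg0 n d ((\<lambda>p. A p + B p) \<circ> P) = (\<lambda>p. deg0 n d (A \<circ> P) p + deg0 n d (B \<circ> P) p)"
      using deg0_add[OF c, of d] by (simp add: comp_def)
    thus ?thesis using act0_add_op[OF weyl_homog_deg0[OF c(1)] weyl_homog_deg0[OF c(2)] v] by simp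
  qed
  thus ?thesis unfolding coind_carrier gen_def
    by (simp add: weyl_carrier.add weyl_carrier.comp P act0_closed weyl_homog_deg0 v)
qed

lemma gen_smult:
  assumes "P \<in> weyl_carrier n" "Q \<in> weyl_carrier n" "v \<in> carrier V"
  shows "P \<odot>\<^bsub>coind\<^esub> gen Q v = gen (P \<circ> Q) v"
  by (intro coind_eqI coind_smult_closed gen_carrier weyl_carrier.comp assms)
    (simp add: gen_def weyl_carrier.comp assms comp_assoc)

lemma gen_add_op:
  assumes P: "P \<in> weyl_carrier n" and P': "P' \<in> weyl_carrier n" and v: "v \<in> carrier V"
  shows "gen (\<lambda>p. P p + P' p) v = gen P v \<oplus>\<^bsub>coind\<^esub> gen P' v"
proof (intro coind_eqI coind_add_closed gen_carrier weyl_carrier.add P P' v)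
  fix Q :: "'k oper" assume Q: "Q \<in> weyl_carrier n"
  note c = weyl_carrier.comp[OF Q P] weyl_carrier.comp[OF Q P']
  have "deg0 n d (Q \<circ> (\<lambda>p. P p + P' p)) = (\<lambda>p. deg0 n d (Q \<circ> P) p + deg0 n d (Q \<circ> P') p)"
    using deg0_add[OF c, of d] by (simp add: comp_def weyl_carrier_add[OF Q])
  thus "gen (\<lambda>p. P p + P' p) v Q = (gen P v \<oplus>\<^bsub>coind\<^esub> gen P' v) Q"
    using act0_add_op[OF weyl_homog_deg0[OF c(1)] weyl_homog_deg0[OF c(2)] v] Q by (simp add: gen_def)
qed

lemma gen_add:
  assumes P: "P \<in> weyl_carrier n" and v: "v \<in> carrier V" "w \<in> carrier V"
  shows "gen P (v \<oplus> w) = gen P v \<oplus>\<^bsub>coind\<^esub> gen P w"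
  by (intro coind_eqI coind_add_closed gen_carrier M.a_closed P v)
    (simp add: gen_def act0_add weyl_homog_deg0 weyl_carrier.comp P v)

text \<open>The balancing relation \<open>P R \<otimes> v = P \<otimes> R v\<close>. It rests on
  right linearity of the degree zero projection over \<open>D\<^sub>0\<close>.\<close>

lemma gen_comp_right:
  assumes P: "P \<in> weyl_carrier n" and R: "weyl_homog n d 0 R" and v: "v \<in> carrier V"
  shows "gen (P \<circ> R) v = gen P (act0 R v)"
proof (intro coind_eqI gen_carrier weyl_carrier.comp P weyl_homog_weyl_carrier[OF R] v act0_closed[OF R])
  fix Q :: "'k oper" assume Q: "Q \<in> weyl_carrier n"
  have "deg0 n d (Q \<circ> (P \<circ> R)) = deg0 n d (Q \<circ> P) \<circ> R"
    using deg0_comp_right[OF R weyl_carrier.comp[OF Q P]] by (simp only: comp_assoc)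
  thus "gen (P \<circ> R) v Q = gen P (act0 R v) Q"
    using Q act0_comp[OF weyl_homog_deg0[OF weyl_carrier.comp[OF Q P]] R v] by (simp add: gen_def)
qed

lemma gen_zero: "P \<in> weyl_carrier n \<Longrightarrow> gen P \<zero> = \<zero>\<^bsub>coind\<^esub>"
  by (intro coind_eqI gen_carrier coind_zero_closed)
    (simp_all add: gen_def act0_zero weyl_homog_deg0 weyl_carrier.comp)

text \<open>Combine \<open>[E, P] = k P\<close> with the balancing relation: \<open>E\<close>, moved
  past \<open>P\<close>, acts on \<open>V\<close> as \<open>lam\<close>.\<close>

lemma gen_eigen:
  assumes P: "weyl_homog n d k P" and v: "v \<in> carrier V"
  shows "gen P v \<in> eigen n d coind (lam + of_int k)"
proof -
  interpret C: weyl_module n coind d lam by (intro weyl_module.intro left_module_coind)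
  have PW: "P \<in> weyl_carrier n" using P by (rule weyl_homog_weyl_carrier)
  have gC: "gen P v \<in> carrier coind" by (rule gen_carrier[OF PW v])
  have sc: "gen (scal c \<circ> P) v = scal c \<odot>\<^bsub>coind\<^esub> gen P v" for c
    by (rule gen_smult[OF weyl_carrier.scal PW v, symmetric])
  have "euler n d \<odot>\<^bsub>coind\<^esub> gen P v = gen (euler n d \<circ> P) v"
    by (rule gen_smult[OF euler_weyl_carrier PW v])
  also have "\<dots> = gen (\<lambda>p. (P \<circ> euler n d) p + (scal (of_int k) \<circ> P) p) v"
    unfolding euler_comp[OF P] by simp
  also have "\<dots> = gen (P \<circ> euler n d) v \<oplus>\<^bsub>coind\<^esub> gen (scal (of_int k) \<circ> P) v"
    by (intro gen_add_op weyl_carrier.comp PW euler_weyl_carrier weyl_carrier.scal v)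
  also have "gen (P \<circ> euler n d) v = gen (P \<circ> scal lam) v"
    unfolding gen_comp_right[OF PW weyl_homog_euler v] gen_comp_right[OF PW weyl_homog.scal v] act0_euler ..
  also have "\<dots> = scal lam \<odot>\<^bsub>coind\<^esub> gen P v" unfolding scal_commute[OF PW] by (rule sc)
  also have "scal lam \<odot>\<^bsub>coind\<^esub> gen P v \<oplus>\<^bsub>coind\<^esub> gen (scal (of_int k) \<circ> P) v =
    scal (lam + of_int k) \<odot>\<^bsub>coind\<^esub> gen P v"
    unfolding sc by (rule C.act_scal_add[OF gC, symmetric])
  finally show ?thesis unfolding C.eigen_iff using gC by blast
qed

text \<open>Sums are indexed by lists of words and vectors rather than of operators and vectors, so
  that the span is at once the image of a set of bounded cardinality.\<close>

definition gen_sum :: "((bool \<times> nat) list \<times> 'm) list \<Rightarrow> 'k oper \<Rightarrow> 'm" where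
  "gen_sum xs = foldr (\<lambda>(w, v) h. gen (weyl_word w) v \<oplus>\<^bsub>coind\<^esub> h) xs \<zero>\<^bsub>coind\<^esub>"

abbreviation words :: "(bool \<times> nat) list set" where
  "words \<equiv> {w. snd ` set w \<subseteq> {..n}}"

definition gen_span :: "('k oper \<Rightarrow> 'm) set" where
  "gen_span = gen_sum ` lists (words \<times> carrier V)"

lemma gen_sum_Nil: "gen_sum [] = \<zero>\<^bsub>coind\<^esub>"
  by (simp add: gen_sum_def)

lemma gen_sum_Cons: "gen_sum ((w, v) # xs) = gen (weyl_word w) v \<oplus>\<^bsub>coind\<^esub> gen_sum xs"
  by (simp add: gen_sum_def)

lemma gen_span_induct [consumes 1, case_names zero add]:
  assumes "h \<in> gen_span"
    and zero: "T \<zero>\<^bsub>coind\<^esub>"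
    and add: "\<And>w v h. w \<in> words \<Longrightarrow> v \<in> carrier V \<Longrightarrow> h \<in> gen_span \<Longrightarrow> h \<in> carrier coind \<Longrightarrow> T h \<Longrightarrow>
      T (gen (weyl_word w) v \<oplus>\<^bsub>coind\<^esub> h)"
  shows "T h"
proof -
  have "T (gen_sum xs) \<and> gen_sum xs \<in> carrier coind" if "xs \<in> lists (words \<times> carrier V)" for xs
    using that
  proof (induction rule: lists.induct)
    case Nil
    show ?case unfolding gen_sum_Nil using zero coind_zero_closed by blast
  next
    case (Cons x xs)
    then obtain w v where x: "x = (w, v)" "w \<in> words" "v \<in> carrier V" by auto
    have W: "(weyl_word w :: 'k oper) \<in> weyl_carrier n" using x(2) weyl_word_weyl_carrier by blast
    have S: "gen_sum xs \<in> gen_span" unfolding gen_span_def using Cons by blast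
    show ?case unfolding x(1) gen_sum_Cons
      using add[OF x(2,3) S] Cons coind_add_closed[OF gen_carrier[OF W x(3)]] by blast
  qed
  thus ?thesis using assms(1) unfolding gen_span_def by blast
qed

lemma gen_span_carrier: "h \<in> gen_span \<Longrightarrow> h \<in> carrier coind"
proof (induction rule: gen_span_induct)
  case zero
  show ?case by (rule coind_zero_closed)
next
  case (add w v h)
  have "(weyl_word w :: 'k oper) \<in> weyl_carrier n" using add(1) weyl_word_weyl_carrier by blast
  thus ?case using add by (intro coind_add_closed gen_carrier)
qed

lemma gen_span_zero: "\<zero>\<^bsub>coind\<^esub> \<in> gen_span"
  unfolding gen_span_def using gen_sum_Nil by (intro image_eqI[of _ _ "[]"]) simp_all

lemma gen_span_step:
  assumes "w \<in> words" "v \<in> carrier V" "h \<in> gen_span"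
  shows "gen (weyl_word w) v \<oplus>\<^bsub>coind\<^esub> h \<in> gen_span"
proof -
  obtain xs where xs: "xs \<in> lists (words \<times> carrier V)" "h = gen_sum xs"
    using assms(3) unfolding gen_span_def by blast
  show ?thesis unfolding gen_span_def xs(2) gen_sum_Cons[symmetric]
    by (rule imageI) (use assms xs in simp)
qed

lemma gen_span_add:
  assumes "h \<in> gen_span" "h' \<in> gen_span"
  shows "h \<oplus>\<^bsub>coind\<^esub> h' \<in> gen_span"
proof -
  interpret C: left_module "weyl n" coind by (rule left_module_coind)
  show ?thesis using assms(1)
  proof (induction rule: gen_span_induct)
    case zero
    show ?case using assms(2) C.M.l_zero[OF gen_span_carrier[OF assms(2)]] by (simp only:)
  next
    case (add w v h)
    have W: "(weyl_word w :: 'k oper) \<in> weyl_carrier n" using add(1) weyl_word_weyl_carrier by blast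
    show ?case
      using gen_span_step[OF add(1,2,5)]
        C.M.a_assoc[OF gen_carrier[OF W add(2)] add(4) gen_span_carrier[OF assms(2)]] by (simp only:)
  qed
qed

text \<open>Every operator is a sum of words with a scalar on the right, and the balancing relation
  moves the scalar into the vector.\<close>

lemma gen_mem_gen_span:
  assumes "P \<in> weyl_carrier n" "v \<in> carrier V"
  shows "gen P v \<in> gen_span"
proof -
  interpret C: left_module "weyl n" coind by (rule left_module_coind)
  from weyl_carrier_word_span[OF assms(1)] show ?thesis
  proof (induction rule: word_span.induct)
    case (word w c)
    have W: "(weyl_word w :: 'k oper) \<in> weyl_carrier n" using word by (rule weyl_word_weyl_carrier)
    have a: "act0 (scal c) v \<in> carrier V" by (intro act0_closed weyl_homog.scal assms)
    have "gen (weyl_word w) (act0 (scal c) v) \<oplus>\<^bsub>coind\<^esub> \<zero>\<^bsub>coind\<^esub> \<in> gen_span"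
      by (rule gen_span_step[OF _ a gen_span_zero]) (use word in simp)
    thus ?case unfolding gen_comp_right[OF W weyl_homog.scal assms(2)]
      using C.M.r_zero[OF gen_carrier[OF W a]] by (simp only:)
  next
    case (add P Q)
    thus ?case using gen_span_add
      by (simp only: gen_add_op[OF word_span_weyl_carrier[OF add(1)] word_span_weyl_carrier[OF add(2)] assms(2)])
  qed
qed

lemma submodule_gen_span: "submodule gen_span (weyl n) coind"
proof -
  interpret C: left_module "weyl n" coind by (rule left_module_coind)
  show ?thesis
  proof (rule C.submoduleI)
    show "gen_span \<subseteq> carrier coind" using gen_span_carrier by blast
    show "\<zero>\<^bsub>coind\<^esub> \<in> gen_span" by (rule gen_span_zero)
    show "a \<oplus>\<^bsub>coind\<^esub> b \<in> gen_span" if "a \<in> gen_span" "b \<in> gen_span" for a b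
      by (rule gen_span_add[OF that])
    fix P :: "'k oper" and h assume "P \<in> carrier (weyl n)" and h: "h \<in> gen_span"
    hence P: "P \<in> weyl_carrier n" by simp
    from h show "P \<odot>\<^bsub>coind\<^esub> h \<in> gen_span"
    proof (induction rule: gen_span_induct)
      case zero
      show ?case using C.smult_r_null[of P] P gen_span_zero by (simp only: weyl_simps)
    next
      case (add w v h)
      have W: "(weyl_word w :: 'k oper) \<in> weyl_carrier n" using add(1) weyl_word_weyl_carrier by blast
      have "P \<odot>\<^bsub>coind\<^esub> (gen (weyl_word w) v \<oplus>\<^bsub>coind\<^esub> h) = gen (P \<circ> weyl_word w) v \<oplus>\<^bsub>coind\<^esub> P \<odot>\<^bsub>coind\<^esub> h"
        using C.smult_r_distr[of P "gen (weyl_word w) v" h] P gen_carrier[OF W add(2)] add(4)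
        by (simp only: gen_smult[OF P W add(2)] weyl_simps)
      thus ?case using gen_span_add[OF gen_mem_gen_span[OF weyl_carrier.comp[OF P W] add(2)] add(5)]
        by (simp only:)
    qed
  qed
qed

definition gen_mod :: "('k oper, 'k oper \<Rightarrow> 'm) module" where
  "gen_mod = sub_mod coind gen_span"

lemma gen_mod_simps:
  "carrier gen_mod = gen_span" "\<zero>\<^bsub>gen_mod\<^esub> = \<zero>\<^bsub>coind\<^esub>"
  "h \<oplus>\<^bsub>gen_mod\<^esub> h' = h \<oplus>\<^bsub>coind\<^esub> h'" "P \<odot>\<^bsub>gen_mod\<^esub> h = P \<odot>\<^bsub>coind\<^esub> h"
  by (simp_all add: gen_mod_def sub_mod_def)

lemma eigen_gen_mod: "eigen n d gen_mod \<mu> = gen_span \<inter> eigen n d coind \<mu>"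
  using gen_span_carrier by (auto simp: eigen_def gen_mod_simps simp del: coind_simps)

lemma euler_mod_gen_mod: "euler_mod n gen_mod d lam"
proof -
  interpret C: left_module_submodule "weyl n" coind gen_span
    by (intro left_module_submodule.intro left_module_coind submodule_gen_span)
  have "h \<in> eigen_span n d lam gen_mod UNIV" if "h \<in> gen_span" for h
    using that
  proof (induction rule: gen_span_induct)
    case zero
    show ?case using eigen_span.zero[of gen_mod n d lam UNIV] by (simp only: gen_mod_simps)
  next
    case (add w v h)
    obtain k where k: "weyl_homog n d k (weyl_word w :: 'k oper)"
      using weyl_word_homog[of w n d] add(1) by blast
    have "gen (weyl_word w) v \<in> eigen n d gen_mod (lam + of_int k)"
      unfolding eigen_gen_mod
      using gen_eigen[OF k add(2)] gen_mem_gen_span[OF weyl_homog_weyl_carrier[OF k] add(2)] by blast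
    from eigen_span.add[OF eigen_span.eigen[OF UNIV_I this] add(5)]
    show ?case by (simp only: gen_mod_simps)
  qed
  moreover have "left_module (weyl n) gen_mod" unfolding gen_mod_def by (rule C.left_module_sub_mod)
  ultimately show ?thesis
    by (intro euler_mod.intro weyl_module.intro euler_mod_axioms.intro) (auto simp only: gen_mod_simps)
qed

text \<open>The projection to degree zero is evaluated on one generator at a time: a word of degree
  zero moves into the vector by the balancing relation, and any other word projects to zero.\<close>

lemma eigen_gen_mod_lam: "eigen n d gen_mod lam = gen (\<lambda>p. p) ` carrier V"
proof
  interpret G: euler_mod n gen_mod d lam by (rule euler_mod_gen_mod)
  show "gen (\<lambda>p. p) ` carrier V \<subseteq> eigen n d gen_mod lam"
    using gen_eigen[OF weyl_homog_id] gen_mem_gen_span[OF weyl_carrier_id] unfolding eigen_gen_mod by auto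
  have "G.pr h \<in> gen (\<lambda>p. p) ` carrier V" if "h \<in> gen_span" for h
    using that
  proof (induction rule: gen_span_induct)
    case zero
    have "\<zero>\<^bsub>coind\<^esub> = gen (\<lambda>p. p) \<zero>" by (rule gen_zero[OF weyl_carrier_id, symmetric])
    thus ?case using G.eproj_zero M.zero_closed unfolding gen_mod_simps by (simp only: image_eqI)
  next
    case (add w v h)
    obtain k where k: "weyl_homog n d k (weyl_word w :: 'k oper)"
      using weyl_word_homog[of w n d] add(1) by blast
    have W: "(weyl_word w :: 'k oper) \<in> weyl_carrier n" using k by (rule weyl_homog_weyl_carrier)
    have g: "gen (weyl_word w) v \<in> gen_span" by (rule gen_mem_gen_span[OF W add(2)])
    have e: "gen (weyl_word w) v \<in> eigen n d gen_mod (lam + of_int k)"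
      unfolding eigen_gen_mod using gen_eigen[OF k add(2)] g by blast
    have "G.pr (gen (weyl_word w) v) \<in> gen (\<lambda>p. p) ` carrier V"
    proof (cases "k = 0")
      case True
      hence k0: "weyl_homog n d 0 (weyl_word w :: 'k oper)" using k by simp
      have "gen (weyl_word w) v = gen ((\<lambda>p. p) \<circ> weyl_word w) v" by (simp add: comp_def)
      also have "\<dots> = gen (\<lambda>p. p) (act0 (weyl_word w) v)"
        by (rule gen_comp_right[OF weyl_carrier_id k0 add(2)])
      finally have "gen (weyl_word w) v \<in> gen (\<lambda>p. p) ` carrier V" using act0_closed[OF k0 add(2)] by blast
      thus ?thesis using G.eproj_on_eigen[OF e] True by simp
    next
      case False
      have "G.pr (gen (weyl_word w) v) = gen (\<lambda>p. p) \<zero>"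
        using G.eproj_on_eigen[OF e] False gen_zero[OF weyl_carrier_id] by (simp only: gen_mod_simps if_False)
      thus ?thesis using M.zero_closed by blast
    qed
    then obtain u where u: "u \<in> carrier V" "G.pr (gen (weyl_word w) v) = gen (\<lambda>p. p) u" by blast
    obtain u' where u': "u' \<in> carrier V" "G.pr h = gen (\<lambda>p. p) u'" using add(5) by blast
    have "G.pr (gen (weyl_word w) v \<oplus>\<^bsub>gen_mod\<^esub> h) = gen (\<lambda>p. p) u \<oplus>\<^bsub>gen_mod\<^esub> gen (\<lambda>p. p) u'"
      using G.eproj_add[of "gen (weyl_word w) v" h] g add(3) unfolding gen_mod_simps(1) u(2) u'(2) by blast
    also have "\<dots> = gen (\<lambda>p. p) (u \<oplus> u')"
      unfolding gen_mod_simps by (rule gen_add[OF weyl_carrier_id u(1) u'(1), symmetric])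
    finally show ?case unfolding gen_mod_simps using u u' by blast
  qed
  thus "eigen n d gen_mod lam \<subseteq> gen (\<lambda>p. p) ` carrier V"
    using G.eproj_eq_self by (auto simp: eigen_gen_mod simp del: coind_simps) (metis IntI eigen_gen_mod)
qed

lemma gen_id_apply: "v \<in> carrier V \<Longrightarrow> gen (\<lambda>p. p) v (\<lambda>p. p) = v"
proof -
  assume v: "v \<in> carrier V"
  have "deg0 n d ((\<lambda>p. p) \<circ> (\<lambda>p. p)) = (\<lambda>p. p :: 'k pol)"
    using deg0_homog[OF weyl_homog_id, of n d] by (simp add: comp_def)
  moreover have "gen (\<lambda>p. p) v (\<lambda>p. p) = act0 (deg0 n d ((\<lambda>p. p) \<circ> (\<lambda>p. p))) v"
    unfolding gen_def by (rule restrict_apply'[OF weyl_carrier_id])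
  ultimately show ?thesis by (simp only: act0_id[OF v])
qed

text \<open>Evaluation at the identity operator is inverse to \<open>gen (\<lambda>p. p)\<close>,
  and the balancing relation makes it linear over \<open>D\<^sub>0\<close>.\<close>

lemma degree0_gen_mod:
  defines "\<psi> \<equiv> restrict (\<lambda>h. h (\<lambda>p. p)) (eigen n d gen_mod lam)"
  shows "\<psi> \<in> lin_maps (twisted0 n d lam) (degree0 n d lam gen_mod) V"
    and "bij_betw \<psi> (carrier (degree0 n d lam gen_mod)) (carrier V)"
proof -
  interpret G: euler_mod n gen_mod d lam by (rule euler_mod_gen_mod)
  have \<psi>: "\<psi> (gen (\<lambda>p. p) v) = v" if "v \<in> carrier V" for v
    unfolding \<psi>_def eigen_gen_mod_lam using gen_id_apply[OF that] that by simp
  show "\<psi> \<in> lin_maps (twisted0 n d lam) (degree0 n d lam gen_mod) V"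
  proof (rule lin_mapsI)
    fix h assume "h \<in> carrier (degree0 n d lam gen_mod)"
    then obtain v where v: "v \<in> carrier V" "h = gen (\<lambda>p. p) v" unfolding G.degree0_simps eigen_gen_mod_lam by blast
    have he: "h \<in> eigen n d gen_mod lam" unfolding eigen_gen_mod_lam v(2) using v(1) by blast
    show "\<psi> h \<in> carrier V" using \<psi> v by simp
    fix a assume "a \<in> carrier (twisted0 n d lam)"
    then obtain P where P: "weyl_homog n d 0 P" "a = tcoset n d lam P" by (rule twisted0_carrierE)
    have "a \<odot>\<^bsub>degree0 n d lam gen_mod\<^esub> h = P \<odot>\<^bsub>gen_mod\<^esub> h" unfolding P(2) by (rule G.degree0_smult[OF P(1) he])
    also have "\<dots> = gen (P \<circ> (\<lambda>p. p)) v"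
      unfolding gen_mod_simps v(2) by (rule gen_smult[OF weyl_homog_weyl_carrier[OF P(1)] weyl_carrier_id v(1)])
    also have "P \<circ> (\<lambda>p. p) = (\<lambda>p. p) \<circ> P" by (simp add: comp_def)
    also have "gen ((\<lambda>p. p) \<circ> P) v = gen (\<lambda>p. p) (act0 P v)"
      by (rule gen_comp_right[OF weyl_carrier_id P(1) v(1)])
    finally show "\<psi> (a \<odot>\<^bsub>degree0 n d lam gen_mod\<^esub> h) = a \<odot> \<psi> h"
      using \<psi>[OF act0_closed[OF P(1) v(1)]] \<psi>[OF v(1)] unfolding v(2) P(2) act0_def by simp
  next
    fix h h' assume "h \<in> carrier (degree0 n d lam gen_mod)" "h' \<in> carrier (degree0 n d lam gen_mod)"
    then obtain v v' where v: "v \<in> carrier V" "h = gen (\<lambda>p. p) v" "v' \<in> carrier V" "h' = gen (\<lambda>p. p) v'"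
      unfolding G.degree0_simps eigen_gen_mod_lam by blast
    have "h \<oplus>\<^bsub>degree0 n d lam gen_mod\<^esub> h' = gen (\<lambda>p. p) (v \<oplus> v')"
      unfolding G.degree0_simps gen_mod_simps v(2,4) by (rule gen_add[OF weyl_carrier_id v(1,3), symmetric])
    thus "\<psi> (h \<oplus>\<^bsub>degree0 n d lam gen_mod\<^esub> h') = \<psi> h \<oplus> \<psi> h'"
      using \<psi>[OF M.a_closed[OF v(1,3)]] \<psi>[OF v(1)] \<psi>[OF v(3)] unfolding v(2,4) by simp
  next
    fix h assume "h \<notin> carrier (degree0 n d lam gen_mod)"
    thus "\<psi> h = undefined" unfolding \<psi>_def G.degree0_simps by simp
  qed
  show "bij_betw \<psi> (carrier (degree0 n d lam gen_mod)) (carrier V)"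
    unfolding G.degree0_simps eigen_gen_mod_lam
    by (rule bij_betwI[where g = "gen (\<lambda>p. p)"]) (use \<psi> in auto)
qed

text \<open>The zero module is set apart because its carrier is finite; there the span is zero and a
  constant map is injective on it.\<close>

lemma ex_inj_on_gen_span: "\<exists>i :: ('k oper \<Rightarrow> 'm) \<Rightarrow> 'm. inj_on i gen_span"
proof (cases "carrier V = {\<zero>}")
  case True
  have "h = \<zero>\<^bsub>coind\<^esub>" if "h \<in> gen_span" for h
    using coindD(1)[OF gen_span_carrier[OF that]] True
    by (intro coind_eqI[OF gen_span_carrier[OF that] coind_zero_closed]) simp
  hence "inj_on (\<lambda>_. \<zero>) gen_span" unfolding inj_on_def by metis
  thus ?thesis by (intro exI[of _ "\<lambda>_. \<zero>"])
next
  case False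
  then obtain v where "v \<in> carrier V" "v \<noteq> \<zero>" using M.zero_closed by blast
  hence "infinite (carrier V)" by (rule infinite_carrier)
  thus ?thesis unfolding gen_span_def by (rule ex_inj_on_image_lists)
qed

text \<open>The elements of \<open>gen_mod\<close> are functions; an injection carries its structure
  over to the type of \<open>V\<close>, and the resulting isomorphism restricts to the degree zero
  parts.\<close>

lemma ex_euler_module_degree0:
  "\<exists>L :: ('k oper, 'm) module. \<exists>\<psi>. euler_module n d lam L \<and>
     \<psi> \<in> lin_maps (twisted0 n d lam) (degree0 n d lam L) V \<and>
     bij_betw \<psi> (carrier (degree0 n d lam L)) (carrier V)"
proof -
  interpret G: euler_mod n gen_mod d lam by (rule euler_mod_gen_mod)
  obtain i :: "('k oper \<Rightarrow> 'm) \<Rightarrow> 'm" where "inj_on i gen_span" using ex_inj_on_gen_span by blast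
  hence i: "inj_on i (carrier gen_mod)" unfolding gen_mod_simps .
  define L where "L = transport_module i gen_mod"
  define f where "f = restrict i (carrier gen_mod)"
  note T = transport_module[OF G.left_module_axioms i, folded L_def f_def]
  have fe: "f ` carrier gen_mod = carrier L" using T(3) by (rule bij_betw_imp_surj_on)
  interpret L: euler_mod n L d lam
    by (rule euler_module_lin_image[OF G.euler_mod_axioms T(1,2) fe])
  define g where "g = restrict (inv_into (carrier gen_mod) f) (carrier L)"
  have g: "g \<in> lin_maps (weyl n) L gen_mod"
    unfolding g_def by (rule lin_maps_inverse[OF G.left_module_axioms T(2,3)])
  have gf: "g (f x) = x" if "x \<in> carrier gen_mod" for x
    unfolding g_def using that fe bij_betw_imp_inj_on[OF T(3)] by auto
  have fg: "f (g y) = y" if "y \<in> carrier L" for y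
    using that gf unfolding fe[symmetric] by auto
  note g0 = restrict_degree0_lin_maps[OF L.weyl_module_axioms G.weyl_module_axioms g, of d lam]
  note f0 = restrict_degree0_lin_maps[OF G.weyl_module_axioms L.weyl_module_axioms T(2), of d lam]
  define \<psi> where "\<psi> = restrict (\<lambda>h. h (\<lambda>p. p)) (eigen n d gen_mod lam)"
  note P = degree0_gen_mod[folded \<psi>_def]
  have b: "bij_betw (restrict g (eigen n d L lam)) (carrier (degree0 n d lam L)) (carrier (degree0 n d lam gen_mod))"
  proof (rule bij_betwI[where g = "restrict f (eigen n d gen_mod lam)"])
    show "restrict g (eigen n d L lam) \<in> carrier (degree0 n d lam L) \<rightarrow> carrier (degree0 n d lam gen_mod)"
      using lin_mapsD(1)[OF g0] by blast
    show "restrict f (eigen n d gen_mod lam) \<in> carrier (degree0 n d lam gen_mod) \<rightarrow> carrier (degree0 n d lam L)"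
      using lin_mapsD(1)[OF f0] by blast
    fix x assume x: "x \<in> carrier (degree0 n d lam L)"
    hence x': "x \<in> eigen n d L lam" by simp
    have "g x \<in> eigen n d gen_mod lam" using lin_mapsD(1)[OF g0 x] x' by simp
    thus "restrict f (eigen n d gen_mod lam) (restrict g (eigen n d L lam) x) = x"
      using x' fg[OF L.eigen_carrier[OF x']] by simp
  next
    fix y assume y: "y \<in> carrier (degree0 n d lam gen_mod)"
    hence y': "y \<in> eigen n d gen_mod lam" by simp
    have "f y \<in> eigen n d L lam" using lin_mapsD(1)[OF f0 y] y' by simp
    thus "restrict g (eigen n d L lam) (restrict f (eigen n d gen_mod lam) y) = y"
      using y' gf[OF G.eigen_carrier[OF y']] by simp
  qed
  have "compose (carrier (degree0 n d lam L)) \<psi> (restrict g (eigen n d L lam)) \<in>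
     lin_maps (twisted0 n d lam) (degree0 n d lam L) V"
    by (rule lin_maps_compose[OF g0 P(1) L.left_module_degree0])
  moreover have "bij_betw (compose (carrier (degree0 n d lam L)) \<psi> (restrict g (eigen n d L lam)))
     (carrier (degree0 n d lam L)) (carrier V)"
    by (rule bij_betw_cong[THEN iffD1, OF _ bij_betw_trans[OF b P(2)]]) (simp add: compose_def)
  ultimately show ?thesis using L.euler_module by blast
qed

end

theorem corollary17:
  fixes n :: nat and d :: "nat \<Rightarrow> nat"
    and lam :: "'k :: {alg_closed_field, field_char_0}"
    and \<omega> :: "(('k oper, 'm) module, 'm frac set, ('k oper, 'm) module, 'm \<Rightarrow> 'm) func"
  assumes "1 \<le> n"
    and "0 < d 0"
    and "\<And>i. i < n \<Longrightarrow> d i \<le> d (Suc i)"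
    and "lam \<notin> \<int> \<or> lam \<in> {of_nat (\<Sum>i\<le>n. b i * d i) | b :: nat \<Rightarrow> nat. True}"
    and "Gcd (d ` {..n}) = 1"
    and "right_adjoint (Grmod n d lam) (Qcoh n d lam) (quot_func n d lam) \<omega>"
  shows "is_equivalence (Qcoh n d lam) (Left_Mod (twisted0 n d lam)) (global_sections n d lam \<omega>)"
proof -
  have "0 < d i" if "i \<le> n" for i
    using that
  proof (induction i)
    case 0
    show ?case by (rule assms(2))
  next
    case (Suc i)
    thus ?case using assms(3)[of i] by simp
  qed
  moreover have "lam \<notin> \<int> \<or> (\<exists>b. lam = of_nat (\<Sum>i\<le>n. b i * d i))" using assms(4) by auto
  ultimately interpret affine_adjunction n d lam \<omega>
    using assms(5,6)
    by (intro affine_adjunction.intro affine_weights.intro affine_adjunction_axioms.intro)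
  show ?thesis
    by (rule global_sections_equivalence)
      (rule twisted_module.ex_euler_module_degree0[OF twisted_module.intro])
qed

end
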